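(* Let $\gamma>0$, let $B=(A^T\Gamma^{-1}A+\Gamma_0^{-1})^{-1}$ and $c=A^T\Gamma^{-1}y$, and consider the mean-field equation $$\dot q=p,\qquad \dot p=-\mathcal{C}_q(\rho)(B^{-1}q-c)-\gamma p+\sqrt{2\gamma\,\mathcal{C}_q(\rho)}\,\dot W$$ on $\mathbb{R}^{2N}$, where $\rho$ is the law of $z=(q,p)$. Write the mean and covariance of $\rho$ in block form $$m(\rho)=\begin{pmatrix}m_q\\ m_p\end{pmatrix},\qquad \mathcal{C}(\rho)=\begin{pmatrix}\mathcal{C}_q&\mathcal{C}_{q,p}\\ \mathcal{C}_{q,p}^T&\mathcal{C}_p\end{pmatrix}.$$ (i) The evolution of the mean and covariance is prescribed by the system of ODEs $$\begin{aligned}\dot m_q&=m_p,\\ \dot m_p&=-\mathcal{C}_q(B^{-1}m_q-c)-\gamma m_p,\\ \dot{\mathcal{C}}_q&=\mathcal{C}_{q,p}+\mathcal{C}_{q,p}^T,\\ \dot{\mathcal{C}}_p&=-\mathcal{C}_qB^{-1}\mathcal{C}_{q,p}-(\mathcal{C}_qB^{-1}\mathcal{C}_{q,p})^T-2\gamma\,\mathcal{C}_p+2\gamma\,\mathcal{C}_q,\\ \dot{\mathcal{C}}_{q,p}&=-\gamma\,\mathcal{C}_{q,p}-\mathcal{C}_qB^{-1}\mathcal{C}_q+\mathcal{C}_p.\end{aligned}$$ (ii) The unique steady solution with positive definite covariance is the Gibbs measure $m_q=Bc$, $m_p=0$, $\mathcal{C}_{q,p}=0$, $\mathcal{C}_q=\mathcal{C}_p=B$;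 the marginal on $q$ gives the solution of the linear Gaussian Bayesian inverse problem. (iii) All other steady state solutions have degenerate covariance, are unstable, and take the form $m_q=B(c+m)$, $m_p=0$, $\mathcal{C}_{q,p}=0$, $\mathcal{C}_q=\mathcal{C}_p=B^{1/2}XB^{1/2}$ for a projection matrix $X$ and $m$ in the nullspace of $\mathcal{C}_q$. (iv) The equilibrium point with positive definite covariance is hyperbolic and linearly stable, and hence its basin of attraction is an open set, containing the equilibrium point itself, in the set of all mean vectors and positive definite covariances. (v) Furthermore, the mean and covariance converge to this equilibrium, from all points in its basin of attraction, with a speed independent of $B$ and $c$.
   Context: The linear inverse problem is to find $q\in\mathbb{R}^N$ from $y=Aq+\eta$ with $A\in\mathbb{R}^{J\times N}$, $y\in\mathbb{R}^J$, noise $\eta\sim\mathsf{N}(0,\Gamma)$ independent of $q$, and prior $q\sim\mathsf{N}(0,\Gamma_0)$, where $\Gamma,\Gamma_0$ are symmetric positive definite; hence $B$ is well defined and symmetric positive definite. The potential is $\Phi(q)=\frac12\|\Gamma^{-1/2}(y-Aq)\|^2+\frac12\|\Gamma_0^{-1/2}q\|^2$, with gradient $D\Phi(q)=B^{-1}q-c$, and the solution of the Bayesian inverse problem is the posterior $\mathsf{N}(Bc,B)$, with density proportional to $\exp(-\Phi(q))$. The Gibbs measure is the probability measure on $\mathbb{R}^{2N}$ with density proportional to $\exp(-\frac12\langle p,\mathcal{M}^{-1}p\rangle-\Phi(q))$, where the mass matrix is $\mathcal{M}=\mathcal{C}_q$ (equal to $B$ at this equilibrium); it is Gaussian and is identified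 in (ii) with its mean and covariance. $W$ is a standard Brownian motion in $\mathbb{R}^N$, and $\gamma$ is a scalar damping parameter. The blocks are $\mathcal{C}_q=\mathbb{E}[(q-m_q)(q-m_q)^T]$, $\mathcal{C}_p=\mathbb{E}[(p-m_p)(p-m_p)^T]$, $\mathcal{C}_{q,p}=\mathbb{E}[(q-m_q)(p-m_p)^T]$, and $\mathcal{C}_q(\rho)$ in the equation is this $q$-block. A projection matrix is a matrix $X$ with $X^2=X$ (here it is also symmetric, since $\mathcal{C}_q$ is). "Degenerate" means not positive definite. "Steady", "unstable", "hyperbolic", "linearly stable" and "basin of attraction" refer to the ODE system in (i). *)

theory Defs
  imports "HOL-Probability.Probability"
begin

definition sym_mat :: "real^'n^'n \<Rightarrow> bool" where
  "sym_mat C \<longleftrightarrow> transpose C = C"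

definition psd_mat :: "real^'n^'n \<Rightarrow> bool" where
  "psd_mat C \<longleftrightarrow> sym_mat C \<and> (\<forall>x. 0 \<le> x \<bullet> (C *v x))"

definition pd_mat :: "real^'n^'n \<Rightarrow> bool" where
  "pd_mat C \<longleftrightarrow> sym_mat C \<and> (\<forall>x. x \<noteq> 0 \<longrightarrow> 0 < x \<bullet> (C *v x))"

text \<open>Only meaningful for positive semidefinite \<open>C\<close>, where the square root is unique.\<close>

definition msqrt :: "real^'n^'n \<Rightarrow> real^'n^'n" where
  "msqrt C = (THE S. psd_mat S \<and> S ** S = C)"

definition outer :: "real^'n \<Rightarrow> real^'m \<Rightarrow> real^'m^'n" where
  "outer u v = (\<chi> i j. u $ i * v $ j)"

definition post_cov :: "real^'n^'j \<Rightarrow> real^'j^'j \<Rightarrow> real^'n^'n \<Rightarrow> real^'n^'n" where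
  "post_cov A \<Gamma> \<Gamma>0 = matrix_inv (transpose A ** matrix_inv \<Gamma> ** A + matrix_inv \<Gamma>0)"

definition data_vec :: "real^'n^'j \<Rightarrow> real^'j^'j \<Rightarrow> real^'j \<Rightarrow> real^'n" where
  "data_vec A \<Gamma> y = (transpose A ** matrix_inv \<Gamma>) *v y"

definition potential ::
    "real^'n^'j \<Rightarrow> real^'j^'j \<Rightarrow> real^'n^'n \<Rightarrow> real^'j \<Rightarrow> real^'n \<Rightarrow> real" where
  "potential A \<Gamma> \<Gamma>0 y q =
     (1/2) * (norm (matrix_inv (msqrt \<Gamma>) *v (y - A *v q)))\<^sup>2
   + (1/2) * (norm (matrix_inv (msqrt \<Gamma>0) *v q))\<^sup>2"

definition gaussian :: "real^'n \<Rightarrow> real^'n^'n \<Rightarrow> (real^'n) measure" where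
  "gaussian m C = density lborel (\<lambda>x. ennreal
     (exp (- (1/2) * ((x - m) \<bullet> (matrix_inv C *v (x - m))))
        / sqrt ((2 * pi) ^ CARD('n) * det C)))"

definition normalized_density :: "('a::euclidean_space \<Rightarrow> real) \<Rightarrow> 'a measure" where
  "normalized_density f = density lborel (\<lambda>x. ennreal (f x / (\<integral>u. f u \<partial>lborel)))"

definition gibbs :: "real^'n^'j \<Rightarrow> real^'j^'j \<Rightarrow> real^'n^'n \<Rightarrow> real^'j \<Rightarrow> real^'n^'n
    \<Rightarrow> ((real^'n) \<times> (real^'n)) measure" where
  "gibbs A \<Gamma> \<Gamma>0 y Mass = normalized_density
     (\<lambda>(q, p). exp (- (1/2) * (p \<bullet> (matrix_inv Mass *v p)) - potential A \<Gamma> \<Gamma>0 y q))"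

text \<open>Joint law of the unknown and the data, \<open>(q, A q + \<eta>)\<close>, with \<open>q\<close> and \<open>\<eta>\<close> independent.\<close>

definition bayes_joint :: "real^'n^'j \<Rightarrow> real^'j^'j \<Rightarrow> real^'n^'n
    \<Rightarrow> ((real^'n) \<times> (real^'j)) measure" where
  "bayes_joint A \<Gamma> \<Gamma>0 =
     distr (gaussian 0 \<Gamma>0 \<Otimes>\<^sub>M gaussian 0 \<Gamma>) borel (\<lambda>(q, \<eta>). (q, A *v q + \<eta>))"

text \<open>\<open>\<kappa>\<close> is a regular conditional distribution of the first component given the second.\<close>

definition conditional_law ::
    "('a::euclidean_space \<times> 'b::euclidean_space) measure \<Rightarrow> ('b \<Rightarrow> 'a measure) \<Rightarrow> bool" where
  "conditional_law J \<kappa> \<longleftrightarrow> \<kappa> \<in> measurable borel (prob_algebra borel) \<and>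
     (\<forall>U \<in> sets borel. \<forall>V \<in> sets borel.
        emeasure J (U \<times> V) = (\<integral>\<^sup>+ y. emeasure (\<kappa> y) U * indicator V y \<partial>(distr J borel snd)))"

text \<open>A state is a tuple \<open>(m\<^sub>q, m\<^sub>p, C\<^sub>q, C\<^sub>p, C\<^sub>q\<^sub>p)\<close>, and \<open>(real^'n) \<times> (real^'n)\<close> is the phase
  space of \<open>z = (q, p)\<close>.\<close>

type_synonym 'n state =
  "(real^'n) \<times> (real^'n) \<times> (real^'n^'n) \<times> (real^'n^'n) \<times> (real^'n^'n)"

definition cov_block :: "real^'n^'n \<Rightarrow> real^'n^'n \<Rightarrow> real^'n^'n \<Rightarrow> real^('n + 'n)^('n + 'n)" where
  "cov_block Cq Cp Cqp = (\<chi> a b.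
     case a of
       Inl i \<Rightarrow> (case b of Inl j \<Rightarrow> Cq $ i $ j | Inr j \<Rightarrow> Cqp $ i $ j)
     | Inr i \<Rightarrow> (case b of Inl j \<Rightarrow> transpose Cqp $ i $ j | Inr j \<Rightarrow> Cp $ i $ j))"

text \<open>\<open>sym_states\<close> is the tangent space of the manifold of admissible states: \<open>C\<^sub>q\<close> and \<open>C\<^sub>p\<close>
  are symmetric, \<open>C\<^sub>q\<^sub>p\<close> is arbitrary.\<close>

definition sym_states :: "('n::finite) state set" where
  "sym_states = {(mq, mp, Cq, Cp, Cqp). sym_mat (cov_block Cq Cp Cqp)}"

definition psd_states :: "('n::finite) state set" where
  "psd_states = {(mq, mp, Cq, Cp, Cqp). psd_mat (cov_block Cq Cp Cqp)}"

definition pd_states :: "('n::finite) state set" where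
  "pd_states = {(mq, mp, Cq, Cp, Cqp). pd_mat (cov_block Cq Cp Cqp)}"

definition mean_q :: "((real^'n) \<times> (real^'n)) measure \<Rightarrow> real^'n" where
  "mean_q \<rho> = (\<integral>z. fst z \<partial>\<rho>)"

definition mean_p :: "((real^'n) \<times> (real^'n)) measure \<Rightarrow> real^'n" where
  "mean_p \<rho> = (\<integral>z. snd z \<partial>\<rho>)"

definition cov_q :: "((real^'n) \<times> (real^'n)) measure \<Rightarrow> real^'n^'n" where
  "cov_q \<rho> = (\<integral>z. outer (fst z - mean_q \<rho>) (fst z - mean_q \<rho>) \<partial>\<rho>)"

definition cov_p :: "((real^'n) \<times> (real^'n)) measure \<Rightarrow> real^'n^'n" where
  "cov_p \<rho> = (\<integral>z. outer (snd z - mean_p \<rho>) (snd z - mean_p \<rho>) \<partial>\<rho>)"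

definition cov_qp :: "((real^'n) \<times> (real^'n)) measure \<Rightarrow> real^'n^'n" where
  "cov_qp \<rho> = (\<integral>z. outer (fst z - mean_q \<rho>) (snd z - mean_p \<rho>) \<partial>\<rho>)"

definition moments :: "((real^'n) \<times> (real^'n)) measure \<Rightarrow> ('n::finite) state" where
  "moments \<rho> = (mean_q \<rho>, mean_p \<rho>, cov_q \<rho>, cov_p \<rho>, cov_qp \<rho>)"

definition brownian_motion ::
    "'w measure \<Rightarrow> (real \<Rightarrow> 'w measure) \<Rightarrow> (real \<Rightarrow> 'w \<Rightarrow> real^'n) \<Rightarrow> bool" where
  "brownian_motion M F W \<longleftrightarrow>
     prob_space M \<and>
     (\<forall>t\<ge>0. subalgebra M (F t)) \<and>
     (\<forall>s t. 0 \<le> s \<and> s \<le> t \<longrightarrow> sets (F s) \<subseteq> sets (F t)) \<and>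
     (\<forall>t\<ge>0. W t \<in> borel_measurable (F t)) \<and>
     (AE \<omega> in M. W 0 \<omega> = 0) \<and>
     (AE \<omega> in M. continuous_on {0..} (\<lambda>t. W t \<omega>)) \<and>
     (\<forall>s t. 0 \<le> s \<and> s < t \<longrightarrow>
        distr M borel (\<lambda>\<omega>. W t \<omega> - W s \<omega>) = gaussian 0 ((t - s) *\<^sub>R mat 1) \<and>
        prob_space.indep_set M (sets (F s))
          (sets (vimage_algebra (space M) (\<lambda>\<omega>. W t \<omega> - W s \<omega>) borel)))"

definition grid :: "real \<Rightarrow> real \<Rightarrow> nat \<Rightarrow> nat \<Rightarrow> real" where
  "grid a b n k = a + real k * (b - a) / real n"

text \<open>\<open>J\<close> is (a version of) the Ito integral over \<open>[a, b]\<close> of a deterministic matrix-valued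
  integrand \<open>\<sigma>\<close>: step functions with values \<open>H n k\<close> on uniform grids approximate \<open>\<sigma>\<close> in
  \<open>L\<^sup>2([a, b])\<close> and their elementary integrals converge to \<open>J\<close> in mean square. Deterministic
  integrands suffice, because the diffusion coefficient of the mean-field equation depends on
  time only, through the law of the solution. Non-negative integrals are used so that no
  integrability is presupposed.\<close>

definition wiener_integral :: "'w measure \<Rightarrow> (real \<Rightarrow> 'w \<Rightarrow> real^'n) \<Rightarrow>
    (real \<Rightarrow> real^'n^'n) \<Rightarrow> real \<Rightarrow> real \<Rightarrow> ('w \<Rightarrow> real^'n) \<Rightarrow> bool" where
  "wiener_integral M W \<sigma> a b J \<longleftrightarrow>
     J \<in> borel_measurable M \<and>
     set_borel_measurable lborel {a..b} \<sigma> \<and>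
     (\<exists>H :: nat \<Rightarrow> nat \<Rightarrow> real^'n^'n.
        (\<lambda>n. \<Sum>k<n. \<integral>\<^sup>+ r. ennreal ((norm (\<sigma> r - H n k))\<^sup>2)
               * indicator {grid a b n k..grid a b n (Suc k)} r \<partial>lborel) \<longlonglongrightarrow> 0 \<and>
        (\<lambda>n. \<integral>\<^sup>+ \<omega>. ennreal ((norm (J \<omega> -
               (\<Sum>k<n. H n k *v (W (grid a b n (Suc k)) \<omega> - W (grid a b n k) \<omega>))))\<^sup>2) \<partial>M)
          \<longlonglongrightarrow> 0)"

definition law :: "'w measure \<Rightarrow> (real \<Rightarrow> 'w \<Rightarrow> real^'n) \<Rightarrow> (real \<Rightarrow> 'w \<Rightarrow> real^'n) \<Rightarrow> real
    \<Rightarrow> ((real^'n) \<times> (real^'n)) measure" where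
  "law M q p t = distr M borel (\<lambda>\<omega>. (q t \<omega>, p t \<omega>))"

text \<open>Solutions on \<open>[0, T]\<close>: continuous adapted processes with bounded second moments
  (so that the mean and covariance of the law make sense) satisfying the equation in integrated
  form on every subinterval.\<close>

definition mean_field_solution :: "real \<Rightarrow> real^'n^'n \<Rightarrow> real^'n \<Rightarrow> real \<Rightarrow> 'w measure
    \<Rightarrow> (real \<Rightarrow> 'w measure) \<Rightarrow> (real \<Rightarrow> 'w \<Rightarrow> real^'n) \<Rightarrow> (real \<Rightarrow> 'w \<Rightarrow> real^'n)
    \<Rightarrow> (real \<Rightarrow> 'w \<Rightarrow> real^'n) \<Rightarrow> bool" where
  "mean_field_solution \<gamma> B c T M F W q p \<longleftrightarrow>
     0 < T \<and>
     brownian_motion M F W \<and>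
     (\<forall>t\<in>{0..T}. q t \<in> borel_measurable (F t) \<and> p t \<in> borel_measurable (F t)) \<and>
     (AE \<omega> in M. continuous_on {0..T} (\<lambda>t. q t \<omega>) \<and> continuous_on {0..T} (\<lambda>t. p t \<omega>)) \<and>
     (\<exists>K::real. \<forall>t\<in>{0..T}.
        (\<integral>\<^sup>+ \<omega>. ennreal ((norm (q t \<omega>))\<^sup>2 + (norm (p t \<omega>))\<^sup>2) \<partial>M) \<le> ennreal K) \<and>
     (\<forall>s t. 0 \<le> s \<and> s < t \<and> t \<le> T \<longrightarrow>
        (AE \<omega> in M. ((\<lambda>r. p r \<omega>) has_integral (q t \<omega> - q s \<omega>)) {s..t}) \<and>
        (\<exists>J. wiener_integral M W (\<lambda>r. msqrt ((2 * \<gamma>) *\<^sub>R cov_q (law M q p r))) s t J \<and>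
           (AE \<omega> in M.
              ((\<lambda>r. - (cov_q (law M q p r) *v (matrix_inv B *v q r \<omega> - c)) - \<gamma> *\<^sub>R p r \<omega>)
                 has_integral (p t \<omega> - p s \<omega> - J \<omega>)) {s..t})))"

definition moment_field :: "real \<Rightarrow> real^'n^'n \<Rightarrow> real^'n \<Rightarrow> 'n state \<Rightarrow> ('n::finite) state" where
  "moment_field \<gamma> B c = (\<lambda>(mq, mp, Cq, Cp, Cqp).
     (mp,
      - (Cq *v (matrix_inv B *v mq - c)) - \<gamma> *\<^sub>R mp,
      Cqp + transpose Cqp,
      - (Cq ** matrix_inv B ** Cqp) - transpose (Cq ** matrix_inv B ** Cqp)
        - (2 * \<gamma>) *\<^sub>R Cp + (2 * \<gamma>) *\<^sub>R Cq,
      - (\<gamma> *\<^sub>R Cqp) - Cq ** matrix_inv B ** Cq + Cp))"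

definition ode_solution ::
    "('a::real_normed_vector \<Rightarrow> 'a) \<Rightarrow> real set \<Rightarrow> (real \<Rightarrow> 'a) \<Rightarrow> bool" where
  "ode_solution f I \<phi> \<longleftrightarrow> (\<forall>t\<in>I. (\<phi> has_vector_derivative f (\<phi> t)) (at t within I))"

definition steady :: "('a::real_normed_vector \<Rightarrow> 'a) \<Rightarrow> 'a \<Rightarrow> bool" where
  "steady f e \<longleftrightarrow> f e = 0"

text \<open>Lyapunov stability with respect to perturbations of the initial value inside \<open>S\<close>.\<close>

definition lyapunov_stable ::
    "('a::real_normed_vector \<Rightarrow> 'a) \<Rightarrow> 'a set \<Rightarrow> 'a \<Rightarrow> bool" where
  "lyapunov_stable f S e \<longleftrightarrow>
     (\<forall>\<epsilon>>0. \<exists>\<delta>>0. \<forall>T>0. \<forall>\<phi>. ode_solution f {0..T} \<phi> \<and> \<phi> 0 \<in> S \<and> dist (\<phi> 0) e < \<delta> \<longrightarrow>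
        (\<forall>t\<in>{0..T}. dist (\<phi> t) e < \<epsilon>))"

definition unstable :: "('a::real_normed_vector \<Rightarrow> 'a) \<Rightarrow> 'a set \<Rightarrow> 'a \<Rightarrow> bool" where
  "unstable f S e \<longleftrightarrow> \<not> lyapunov_stable f S e"

text \<open>\<open>z\<close> is an eigenvalue of the complexification of \<open>L\<close> on the invariant subspace \<open>V\<close>;
  the equations are the real and imaginary parts of \<open>L (u + \<i> v) = z (u + \<i> v)\<close>.\<close>

definition eigenvalue_on ::
    "'a::real_vector set \<Rightarrow> ('a \<Rightarrow> 'a) \<Rightarrow> complex \<Rightarrow> bool" where
  "eigenvalue_on V L z \<longleftrightarrow> (\<exists>u\<in>V. \<exists>v\<in>V. \<not> (u = 0 \<and> v = 0) \<and>
     L u = Re z *\<^sub>R u - Im z *\<^sub>R v \<and> L v = Im z *\<^sub>R u + Re z *\<^sub>R v)"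

definition hyperbolic_on ::
    "'a::real_normed_vector set \<Rightarrow> ('a \<Rightarrow> 'a) \<Rightarrow> 'a \<Rightarrow> bool" where
  "hyperbolic_on V f e \<longleftrightarrow> f differentiable (at e) \<and>
     (\<forall>z. eigenvalue_on V (frechet_derivative f (at e)) z \<longrightarrow> Re z \<noteq> 0)"

definition linearly_stable_on ::
    "'a::real_normed_vector set \<Rightarrow> ('a \<Rightarrow> 'a) \<Rightarrow> 'a \<Rightarrow> bool" where
  "linearly_stable_on V f e \<longleftrightarrow> f differentiable (at e) \<and>
     (\<forall>z. eigenvalue_on V (frechet_derivative f (at e)) z \<longrightarrow> Re z < 0)"

definition basin :: "('a::real_normed_vector \<Rightarrow> 'a) \<Rightarrow> 'a set \<Rightarrow> 'a \<Rightarrow> 'a set" where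
  "basin f S e =
     {x \<in> S. \<exists>\<phi>. ode_solution f {0..} \<phi> \<and> \<phi> 0 = x \<and> (\<phi> \<longlongrightarrow> e) at_top}"

definition equilibrium :: "real^'n^'n \<Rightarrow> real^'n \<Rightarrow> ('n::finite) state" where
  "equilibrium B c = (B *v c, 0, B, B, 0)"

end

theory Submission
  imports Defs
begin

text \<open>
  The diffusion coefficient depends on time only, so the noise is a Wiener integral of a deterministic
  integrand: over \<open>[s, t]\<close> it is orthogonal to the past and has covariance \<open>\<integral> 2 \<gamma> C\<^sub>q\<close>. Expanding the
  increments of \<open>q\<close> and \<open>p\<close> in mean square up to \<open>O((t - s)\<^sup>3\<^sup>/\<^sup>2)\<close> gives the derivatives of the means
  and covariances without Ito's formula.

  At a steady state \<open>m\<^sub>p = 0\<close>, \<open>C\<^sub>q\<^sub>p = 0\<close> and \<open>C\<^sub>p = C\<^sub>q = C\<^sub>q B\<^sup>-\<^sup>1 C\<^sub>q\<close>, so that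
  \<open>B\<^sup>-\<^sup>1\<^sup>/\<^sup>2 C\<^sub>q B\<^sup>-\<^sup>1\<^sup>/\<^sup>2\<close> is a projection. If it is not the identity, perturbing the covariance by multiples
  of \<open>w w\<^sup>T\<close> with \<open>w\<close> in the kernel of \<open>C\<^sub>q B\<^sup>-\<^sup>1\<close> leads to a system of five scalar equations whose
  solutions leave a fixed ball, however small the perturbation.

  Centred at the Gibbs equilibrium, the moment equations are a linear field plus a quadratic one, and the
  linear field depends on \<open>\<gamma>\<close> alone. A quadratic energy decreases along it at a rate that depends on
  \<open>\<gamma>\<close> only; the quadratic part is negligible near the equilibrium, which yields the eigenvalue bound,
  the openness of the basin and a rate of convergence independent of \<open>B\<close> and \<open>c\<close>.
\<close>

section \<open>Positive definite matrices\<close>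

text \<open>The linearized equations are damped oscillators whose energy is dissipated directly only
  through the momentum, \<open>C\<^sub>q\<^sub>p\<close> and \<open>C\<^sub>p - C\<^sub>q\<close>; a
  small cross term spreads the decay to the remaining directions. The conservative terms are
  cancelled using the symmetry of the blocks, so eigenvalues and decay are considered on
  \<open>sym_states\<close>.

  The field is quadratic, and solutions from nearby states might blow up. They are therefore built
  for the field composed with a projection onto a large ball and then shown not to reach its
  boundary; this is what openness of the basin needs.

  For instability an unstable eigenvalue alone would not be enough: the perturbed initial state must
  again be a covariance. The multiples of \<open>w w\<^sup>T\<close> respect this and belong to an
  invariant family, on which an exponentially growing combination replaces invariant manifold
  theory.

  In (i) the diffusion coefficient is a matrix square root, whose regularity in time is not obvious
  where the covariance degenerates. The noise is used only through its covariance, in which the root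
  occurs squared, so regularity of \<open>C\<^sub>q\<close> suffices.\<close>

declare transpose_matrix_vector [simp del]

lemma sym_mat_inner: "sym_mat C \<longleftrightarrow> (\<forall>x y. x \<bullet> (C *v y) = (C *v x) \<bullet> y)"
proof
  show "\<forall>x y. x \<bullet> (C *v y) = (C *v x) \<bullet> y" if "sym_mat C"
    using that by (metis dot_lmul_matrix sym_mat_def vector_transpose_matrix)
  show "sym_mat C" if *: "\<forall>x y. x \<bullet> (C *v y) = (C *v x) \<bullet> y"
  proof -
    have "C $ i $ j = C $ j $ i" for i j
      using *[rule_format, of "axis i 1" "axis j 1"]
      by (simp add: matrix_vector_mul_component inner_axis inner_axis' inner_commute row_def
          matrix_vector_mult_basis column_def)
    then show ?thesis by (simp add: sym_mat_def transpose_def vec_eq_iff)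
  qed
qed

lemma transpose_diff: "transpose (A - B) = transpose A - transpose (B :: real^'n^'m)"
  and transpose_add: "transpose (A + B) = transpose A + transpose (B :: real^'n^'m)"
  and transpose_uminus: "transpose (- A) = - transpose (A :: real^'n^'m)"
  by (simp_all add: transpose_def vec_eq_iff)

lemma mat_eqI: "(\<And>x. A *v x = B *v x) \<Longrightarrow> A = (B :: real^'n^'m)"
  by (metis matrix_eq)

lemma pd_imp_psd: "pd_mat C \<Longrightarrow> psd_mat C"
  unfolding pd_mat_def psd_mat_def by (metis inner_zero_left less_eq_real_def)

lemma pd_sym: "pd_mat C \<Longrightarrow> sym_mat C" and psd_sym: "psd_mat C \<Longrightarrow> sym_mat C"
  by (simp_all add: pd_mat_def psd_mat_def)

lemma matrix_inv_unique:
  assumes "A ** B = mat 1" "B ** A = (mat 1 :: real^'n^'n)"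
  shows "matrix_inv A = B"
proof -
  have "A ** matrix_inv A = mat 1"
    using someI_ex[of "\<lambda>A'. A ** A' = mat 1 \<and> A' ** A = mat 1"] assms
    unfolding matrix_inv_def by blast
  then have "B ** A ** matrix_inv A = B" by (simp flip: matrix_mul_assoc)
  then show ?thesis by (simp add: assms)
qed

lemma invertible_matrix_inv:
  assumes "invertible (A :: real^'n^'n)"
  shows "A ** matrix_inv A = mat 1" "matrix_inv A ** A = mat 1"
  using someI_ex[OF assms[unfolded invertible_def]] unfolding matrix_inv_def by blast+

lemma pd_invertible: assumes "pd_mat C" shows "invertible C"
proof -
  have "x = 0" if "C *v x = 0" for x
    using assms that by (metis inner_zero_right less_irrefl pd_mat_def)
  then show ?thesis
    using matrix_left_invertible_ker invertible_left_inverse by blast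
qed

lemmas pd_inv = invertible_matrix_inv[OF pd_invertible]

lemma pd_inv_mult:
  assumes "pd_mat C"
  shows "C *v (matrix_inv C *v x) = x" "matrix_inv C *v (C *v x) = x"
    "C ** (matrix_inv C ** X) = X" "matrix_inv C ** (C ** X) = X"
  using pd_inv[OF assms] by (simp_all add: matrix_vector_mul_assoc matrix_mul_assoc)

lemma pd_matrix_inv: assumes "pd_mat C" shows "pd_mat (matrix_inv C)"
proof -
  let ?D = "matrix_inv C"
  have "x \<bullet> (?D *v y) = (?D *v x) \<bullet> y" for x y
    using pd_sym[OF assms, unfolded sym_mat_inner, rule_format, of "?D *v x" "?D *v y"]
    by (simp add: pd_inv_mult[OF assms])
  moreover have "0 < x \<bullet> (?D *v x)" if "x \<noteq> 0" for x
  proof -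
    have "?D *v x \<noteq> 0" using that pd_inv_mult(1)[OF assms, of x] by (metis matrix_vector_mult_0_right)
    then have "0 < (?D *v x) \<bullet> (C *v (?D *v x))" using assms by (simp add: pd_mat_def)
    then show ?thesis by (simp add: pd_inv_mult[OF assms] inner_commute)
  qed
  ultimately show ?thesis by (simp add: pd_mat_def sym_mat_inner)
qed

lemma matrix_inv_matrix_inv: "pd_mat C \<Longrightarrow> matrix_inv (matrix_inv C) = C"
  by (intro matrix_inv_unique pd_inv)

text \<open>The expression is maximal at \<open>t = 0\<close>, so its derivative
  \<open>2 * a\<close> vanishes there. This one-variable first-order condition serves both for the
  Rayleigh quotient and for null vectors of semidefinite forms.\<close>

lemma quadratic_nonpos_imp_linear_zero:
  fixes a b :: real
  assumes "\<And>t. 2 * t * a + t\<^sup>2 * b \<le> 0"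
  shows "a = 0"
proof (rule ccontr)
  assume "a \<noteq> 0"
  \<comment> \<open>A step with the sign of \<open>a\<close>, short enough that
    \<open>t\<^sup>2 * \<bar>b\<bar> \<le> t * a\<close>; the linear term \<open>2 * t * a\<close>
    then wins.\<close>
  define t where "t = a / (1 + \<bar>b\<bar>)"
  have *: "0 < 1 + \<bar>b\<bar>" by linarith
  have "t\<^sup>2 * \<bar>b\<bar> \<le> t * a"
  proof -
    have "t * \<bar>b\<bar> * t = t * a * (\<bar>b\<bar> / (1 + \<bar>b\<bar>))" by (simp add: t_def)
    also have "\<dots> \<le> t * a * 1"
      using * by (intro mult_left_mono) (auto simp: t_def)
    finally show ?thesis by (simp add: power2_eq_square mult_ac)
  qed
  moreover have "- (t\<^sup>2 * \<bar>b\<bar>) \<le> t\<^sup>2 * b"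
    by (smt (verit) mult_left_mono mult_minus_right zero_le_power2)
  moreover have "t * a > 0" using \<open>a \<noteq> 0\<close> * by (auto simp: t_def zero_less_mult_iff zero_less_divide_iff)
  ultimately show False using assms[of t] by (simp add: algebra_simps)
qed

text \<open>The Rayleigh quotient attains its maximum over the unit sphere of \<open>V\<close> at an
  eigenvector: by the first-order condition \<open>C *v u\<close> is orthogonal to every vector of
  \<open>V\<close> orthogonal to \<open>u\<close>, and by invariance its component off
  \<open>u\<close> lies in \<open>V\<close>, hence is zero.\<close>

lemma symmetric_eigenvector:
  fixes C :: "real^'n^'n"
  assumes C: "sym_mat C" and V: "subspace V" "\<And>x. x \<in> V \<Longrightarrow> C *v x \<in> V" and "V \<noteq> {0}"
  obtains u where "u \<in> V" "norm u = 1" "C *v u = (u \<bullet> (C *v u)) *\<^sub>R u"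
proof -
  let ?S = "V \<inter> sphere 0 1"
  obtain x where x: "x \<in> V" "x \<noteq> 0" using \<open>V \<noteq> {0}\<close> V(1) subspace_0 by blast
  have "(1 / norm x) *\<^sub>R x \<in> ?S" using x V(1) by (simp add: subspace_scale)
  then have ne: "?S \<noteq> {}" by blast
  have cpt: "compact ?S" using V(1) by (simp add: closed_Int_compact closed_subspace)
  have cont: "continuous_on ?S (\<lambda>x. x \<bullet> (C *v x))"
    by (intro continuous_intros matrix_vector_mult_linear_continuous_on)
  obtain u where u: "u \<in> ?S" and max: "\<And>y. y \<in> ?S \<Longrightarrow> y \<bullet> (C *v y) \<le> u \<bullet> (C *v u)"
    using continuous_attains_sup[OF cpt ne cont] by blast
  let ?l = "u \<bullet> (C *v u)"
  have le: "y \<bullet> (C *v y) \<le> ?l * (y \<bullet> y)" if "y \<in> V" for y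
  proof (cases "y = 0")
    case False
    let ?y = "(1 / norm y) *\<^sub>R y"
    have "?y \<in> ?S" using that False V(1) by (simp add: subspace_scale)
    from max[OF this] have "(y \<bullet> (C *v y)) / (norm y)\<^sup>2 \<le> ?l"
      by (simp add: matrix_vector_mult_scaleR power2_eq_square)
    then show ?thesis using False by (simp add: divide_le_eq dot_square_norm)
  qed simp
  have u1: "u \<bullet> u = 1" using u by (simp add: dot_square_norm)
  have orth: "w \<bullet> (C *v u) = 0" if w: "w \<in> V" "w \<bullet> u = 0" for w
  proof (rule quadratic_nonpos_imp_linear_zero)
    fix t
    have "u + t *\<^sub>R w \<in> V" using w u V(1) by (auto intro!: subspace_add subspace_scale)
    from le[OF this] show "2 * t * (w \<bullet> (C *v u)) + t\<^sup>2 * (w \<bullet> (C *v w) - ?l * (w \<bullet> w)) \<le> 0"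
      using w(2) u1 C[unfolded sym_mat_inner, rule_format, of u w]
      by (simp add: inner_simps matrix_vector_right_distrib matrix_vector_mult_scaleR
          algebra_simps power2_eq_square inner_commute)
  qed
  let ?d = "C *v u - ?l *\<^sub>R u"
  have "?d \<in> V" using u V by (auto intro!: subspace_diff subspace_scale)
  moreover have du: "?d \<bullet> u = 0" using u1 by (simp add: inner_simps inner_commute)
  ultimately have "?d \<bullet> (C *v u) = 0" by (rule orth)
  then have "?d \<bullet> ?d = 0" using du by (simp add: inner_diff_right)
  then have "C *v u = ?l *\<^sub>R u" by simp
  then show thesis using that u by auto
qed

text \<open>Induction on the dimension: the vectors of \<open>V\<close> orthogonal to an eigenvector
  form an invariant subspace because \<open>C\<close> is symmetric. For a unit eigenvector the
  eigenvalue is \<open>b \<bullet> (C *v b)\<close>, which saves a separate eigenvalue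
  function.\<close>

lemma symmetric_eigenbasis_subspace:
  fixes C :: "real^'n^'n"
  assumes C: "sym_mat C"
  shows "subspace V \<Longrightarrow> (\<And>x. x \<in> V \<Longrightarrow> C *v x \<in> V) \<Longrightarrow>
    \<exists>E. finite E \<and> E \<subseteq> V \<and> pairwise orthogonal E \<and> (\<forall>b\<in>E. norm b = 1) \<and> V \<subseteq> span E \<and>
        (\<forall>b\<in>E. C *v b = (b \<bullet> (C *v b)) *\<^sub>R b)"
proof (induction "dim V" arbitrary: V rule: less_induct)
  case less
  show ?case
  proof (cases "V = {0}")
    case True
    then show ?thesis by (intro exI[of _ "{}"]) (auto simp: pairwise_def)
  next
    case False
    obtain u where u: "u \<in> V" "norm u = 1" "C *v u = (u \<bullet> (C *v u)) *\<^sub>R u"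
      using symmetric_eigenvector[OF C less.prems False] by blast
    define W where "W = {x \<in> V. u \<bullet> x = 0}"
    have W: "subspace W" using less.prems(1) unfolding W_def subspace_def by (auto simp: inner_simps)
    have CW: "C *v x \<in> W" if "x \<in> W" for x
    proof -
      have "u \<bullet> (C *v x) = (C *v u) \<bullet> x" using C by (simp add: sym_mat_inner)
      also have "\<dots> = 0" using that by (subst u(3)) (simp add: W_def)
      finally show ?thesis using that less.prems(2) by (simp add: W_def)
    qed
    have "u \<notin> W" using u(2) by (simp add: W_def norm_eq_1)
    then have "W \<noteq> V" using u(1) by blast
    moreover have "W \<subseteq> V" by (auto simp: W_def)
    ultimately have "W \<subset> V" by blast
    then have "dim W < dim V"
      using W less.prems(1) by (metis dim_psubset span_eq_iff)
    then obtain E where E: "finite E" "E \<subseteq> W" "pairwise orthogonal E" "\<forall>b\<in>E. norm b = 1" "W \<subseteq> span E"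
      "\<forall>b\<in>E. C *v b = (b \<bullet> (C *v b)) *\<^sub>R b"
      using less.hyps[OF _ W CW] by auto
    have "V \<subseteq> span (insert u E)"
    proof
      fix x assume x: "x \<in> V"
      have "x - (u \<bullet> x) *\<^sub>R u \<in> W"
        using x u less.prems(1) by (auto simp: W_def inner_diff_right dot_square_norm
          intro!: subspace_diff subspace_scale)
      then show "x \<in> span (insert u E)" using E(5) by (auto simp: span_insert)
    qed
    moreover have "pairwise orthogonal (insert u E)"
      using E(2,3) by (auto simp: pairwise_insert W_def orthogonal_def inner_commute)
    moreover have "insert u E \<subseteq> V" using E(2) u by (auto simp: W_def)
    moreover have "\<forall>b\<in>insert u E. norm b = 1" using E(4) u(2) by simp
    moreover have "\<forall>b\<in>insert u E. C *v b = (b \<bullet> (C *v b)) *\<^sub>R b" using E(6) u(3) by simp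
    moreover have "finite (insert u E)" using E(1) by simp
    ultimately show ?thesis by blast
  qed
qed

lemma symmetric_eigenbasis:
  fixes C :: "real^'n^'n"
  assumes "sym_mat C"
  obtains E where "finite E" "pairwise orthogonal E" "\<And>b. b \<in> E \<Longrightarrow> norm b = 1" "span E = UNIV"
    "\<And>b. b \<in> E \<Longrightarrow> C *v b = (b \<bullet> (C *v b)) *\<^sub>R b"
  using symmetric_eigenbasis_subspace[OF assms, of UNIV] by auto

section \<open>Square roots of positive semidefinite matrices\<close>

lemma psd_sqrt_exists:
  fixes C :: "real^'n^'n"
  assumes C: "psd_mat C"
  shows "\<exists>S. psd_mat S \<and> S ** S = C"
proof -
  obtain E where E: "finite E" "pairwise orthogonal E" "\<And>b. b \<in> E \<Longrightarrow> norm b = 1" "span E = UNIV"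
    "\<And>b. b \<in> E \<Longrightarrow> C *v b = (b \<bullet> (C *v b)) *\<^sub>R b"
    using symmetric_eigenbasis[OF psd_sym[OF C]] by blast
  let ?l = "\<lambda>b. sqrt (b \<bullet> (C *v b))"
  \<comment> \<open>The map that multiplies each basis vector by the root of its eigenvalue.\<close>
  define f where "f x = (\<Sum>b\<in>E. (?l b * (b \<bullet> x)) *\<^sub>R b)" for x
  have lin: "linear f" unfolding f_def
    by (intro linear_compose_sum ballI linearI) (simp_all add: inner_simps algebra_simps)
  define S where "S = matrix f"
  have Sf: "S *v x = f x" for x using lin by (simp add: S_def)
  have fE: "f b = ?l b *\<^sub>R b" if "b \<in> E" for b
  proof -
    have "f b = (\<Sum>b'\<in>E. if b' = b then ?l b *\<^sub>R b else 0)"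
      unfolding f_def using E(2,3) that
      by (intro sum.cong) (auto simp: pairwise_def orthogonal_def dot_square_norm)
    then show ?thesis using E(1) that by simp
  qed
  have ff: "f (f x) = C *v x" for x
  proof -
    have "f (f b) = C *v b" if "b \<in> E" for b
    proof -
      have "0 \<le> b \<bullet> (C *v b)" using C by (simp add: psd_mat_def)
      then show ?thesis
        by (subst E(5)[OF that]) (simp add: fE that linear_scale[OF lin])
    qed
    then have "(f \<circ> f) x = C *v x"
      using linear_eq_on[of "f \<circ> f" "(*v) C" x E] lin E(4) by (simp add: linear_compose)
    then show ?thesis by simp
  qed
  have "psd_mat S"
    unfolding psd_mat_def sym_mat_inner Sf
  proof (intro conjI allI)
    fix x y
    show "x \<bullet> f y = f x \<bullet> y"
      unfolding f_def by (simp add: inner_sum_left inner_sum_right mult_ac inner_commute)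
    have "0 \<le> (\<Sum>b\<in>E. ?l b * (b \<bullet> x)\<^sup>2)" using C by (intro sum_nonneg) (auto simp: psd_mat_def)
    then show "0 \<le> x \<bullet> f x"
      unfolding f_def by (simp add: inner_sum_right inner_commute power2_eq_square mult_ac)
  qed
  moreover have "S ** S = C"
    by (rule mat_eqI) (simp add: Sf ff flip: matrix_vector_mul_assoc)
  ultimately show ?thesis by blast
qed

text \<open>Such an \<open>x\<close> minimizes the form, so the first variation
  \<open>y \<bullet> (C *v x)\<close> vanishes for every \<open>y\<close>.\<close>

lemma psd_zero_imp_kernel:
  assumes C: "psd_mat C" and x: "x \<bullet> (C *v x) = 0"
  shows "C *v x = 0"
proof -
  have "- (y \<bullet> (C *v x)) = 0" for y
  proof (rule quadratic_nonpos_imp_linear_zero)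
    fix t
    have "0 \<le> (x + t *\<^sub>R y) \<bullet> (C *v (x + t *\<^sub>R y))" using C by (simp add: psd_mat_def)
    then show "2 * t * - (y \<bullet> (C *v x)) + t\<^sup>2 * - (y \<bullet> (C *v y)) \<le> 0"
      using x psd_sym[OF C, unfolded sym_mat_inner, rule_format, of x y]
      by (simp add: inner_simps matrix_vector_right_distrib matrix_vector_mult_scaleR
          algebra_simps power2_eq_square inner_commute)
  qed
  from this[of "C *v x"] show ?thesis by simp
qed

text \<open>\<open>S\<close> and \<open>T\<close> are not known to commute, so they are compared on
  an eigenbasis of \<open>S - T\<close>. If \<open>b\<close> has eigenvalue \<open>m\<close> there,
  equality of the squares gives
  \<open>m * (b \<bullet> (S *v b) + b \<bullet> (T *v b)) = 0\<close>; either \<open>m = 0\<close>,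
  or both forms vanish at \<open>b\<close> and so do \<open>S *v b\<close> and
  \<open>T *v b\<close>.\<close>

lemma psd_sqrt_unique:
  fixes S T :: "real^'n^'n"
  assumes S: "psd_mat S" and T: "psd_mat T" and eq: "S ** S = T ** T"
  shows "S = T"
proof -
  let ?D = "S - T"
  have "transpose ?D = ?D" using S T by (simp add: psd_mat_def sym_mat_def transpose_diff)
  then have "sym_mat ?D" by (simp add: sym_mat_def)
  then obtain E where E: "finite E" "pairwise orthogonal E" "\<And>b. b \<in> E \<Longrightarrow> norm b = 1" "span E = UNIV"
    "\<And>b. b \<in> E \<Longrightarrow> ?D *v b = (b \<bullet> (?D *v b)) *\<^sub>R b"
    using symmetric_eigenbasis by blast
  have "S *v b = T *v b" if b: "b \<in> E" for b
  proof -
    define m where "m = b \<bullet> (?D *v b)"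
    have D: "S *v b = T *v b + m *\<^sub>R b" using E(5)[OF b] by (simp add: m_def matrix_vector_mult_diff_rdistrib algebra_simps)
    have s: "b \<bullet> (S *v x) = (S *v b) \<bullet> x" "b \<bullet> (T *v x) = (T *v b) \<bullet> x" for x
      using S T by (auto simp: psd_mat_def sym_mat_inner)
    have "b \<bullet> (S *v (S *v b)) = b \<bullet> (T *v (T *v b))" by (simp add: matrix_vector_mul_assoc eq)
    then have "(S *v b) \<bullet> (S *v b) = (T *v b) \<bullet> (T *v b)" by (simp add: s)
    then have "m * (b \<bullet> (S *v b) + b \<bullet> (T *v b)) = 0"
      unfolding D by (simp add: inner_simps algebra_simps inner_commute)
    then have "m = 0 \<or> (b \<bullet> (S *v b) = 0 \<and> b \<bullet> (T *v b) = 0)"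
      using S T unfolding psd_mat_def
      by (metis add_nonneg_eq_0_iff mult_eq_0_iff)
    then show ?thesis using D psd_zero_imp_kernel[OF S, of b] psd_zero_imp_kernel[OF T, of b] by fastforce
  qed
  then have "S *v x = T *v x" for x
    using linear_eq_on[of "(*v) S" "(*v) T" x E] E(4) by auto
  then show ?thesis by (rule mat_eqI)
qed

lemma msqrt:
  assumes "psd_mat C"
  shows "psd_mat (msqrt C)" "msqrt C ** msqrt C = C"
proof -
  have "\<exists>!S. psd_mat S \<and> S ** S = C" using psd_sqrt_exists[OF assms] psd_sqrt_unique by blast
  from theI'[OF this] show "psd_mat (msqrt C)" "msqrt C ** msqrt C = C" by (simp_all add: msqrt_def)
qed

lemma pd_msqrt: assumes "pd_mat C" shows "pd_mat (msqrt C)"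
proof -
  note S = msqrt[OF pd_imp_psd[OF assms]]
  have "0 < x \<bullet> (msqrt C *v x)" if "x \<noteq> 0" for x
  proof (rule ccontr)
    assume "\<not> 0 < x \<bullet> (msqrt C *v x)"
    then have "x \<bullet> (msqrt C *v x) = 0" using S(1) unfolding psd_mat_def by (metis order_le_less)
    then have "msqrt C *v x = 0" using S(1) psd_zero_imp_kernel by blast
    then have "C *v x = 0" by (metis S(2) matrix_vector_mul_assoc matrix_vector_mult_0_right)
    then show False using assms that by (metis inner_zero_right less_irrefl pd_mat_def)
  qed
  then show ?thesis using S(1) by (simp add: pd_mat_def psd_mat_def)
qed

lemma det_pd: assumes "pd_mat C" shows "0 < det C" "\<bar>det (msqrt C)\<bar> = sqrt (det C)"
proof -
  have eq: "det C = (det (msqrt C))\<^sup>2"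
    using msqrt(2)[OF pd_imp_psd[OF assms]] by (metis det_mul power2_eq_square)
  moreover have "det (msqrt C) \<noteq> 0"
    using pd_invertible[OF pd_msqrt[OF assms]] by (simp add: invertible_det_nz)
  ultimately show "0 < det C" by simp
  show "\<bar>det (msqrt C)\<bar> = sqrt (det C)" using eq by simp
qed

text \<open>Removes the square roots from \<open>potential\<close>: the weighted norms become
  quadratic forms of inverse covariances.\<close>

lemma norm_inv_msqrt:
  assumes "pd_mat C"
  shows "(norm (matrix_inv (msqrt C) *v x))\<^sup>2 = x \<bullet> (matrix_inv C *v x)"
proof -
  let ?S = "msqrt C" and ?R = "matrix_inv (msqrt C)"
  note R = pd_inv[OF pd_msqrt[OF assms]]
  have S: "?S ** ?S = C" by (rule msqrt(2)[OF pd_imp_psd[OF assms]])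
  have "matrix_inv C = ?R ** ?R"
    by (rule matrix_inv_unique) (metis R S matrix_mul_assoc matrix_mul_lid)+
  moreover have "x \<bullet> (?R *v (?R *v x)) = (?R *v x) \<bullet> (?R *v x)"
    using pd_sym[OF pd_matrix_inv[OF pd_msqrt[OF assms]]] by (simp add: sym_mat_inner)
  ultimately show ?thesis by (simp add: dot_square_norm matrix_vector_mul_assoc flip: matrix_vector_mul_assoc)
qed

section \<open>Gaussian measures\<close>

lemma inner_matrix_transpose: "(A *v x) \<bullet> y = x \<bullet> (transpose A *v (y :: real^'m))"
  by (metis dot_lmul_matrix inner_commute vector_transpose_matrix transpose_transpose)

lemma symmetric_diagonalization:
  fixes C :: "real^'n^'n"
  assumes "sym_mat C"
  obtains Q :: "real^'n^'n" and d :: "'n \<Rightarrow> real"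
  where "orthogonal_matrix Q" "C = Q ** (\<chi> i j. if i = j then d i else 0) ** transpose Q"
proof -
  obtain E where E: "finite E" "pairwise orthogonal E" "\<And>b. b \<in> E \<Longrightarrow> norm b = 1" "span E = UNIV"
    "\<And>b. b \<in> E \<Longrightarrow> C *v b = (b \<bullet> (C *v b)) *\<^sub>R b"
    using symmetric_eigenbasis[OF assms] by blast
  have "0 \<notin> E" using E(3) by force
  then have "independent E" using E(2) pairwise_orthogonal_independent by blast
  then have "card E = CARD('n)" using E(4) dim_eq_card[of E UNIV] by simp
  then obtain b :: "'n \<Rightarrow> real^'n" where b: "bij_betw b UNIV E"
    using E(1) by (metis bij_betw_iff_card finite_code)
  then have bE: "b i \<in> E" for i by (auto simp: bij_betw_def)
  have bb: "b i \<bullet> b j = (if i = j then 1 else 0)" for i j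
  proof (cases "i = j")
    case False
    then have "b i \<noteq> b j" using b by (auto simp: bij_betw_def inj_on_def)
    then show ?thesis using E(2) bE False by (simp add: pairwise_def orthogonal_def)
  qed (use E(3) bE in \<open>simp add: norm_eq_1\<close>)
  define Q :: "real^'n^'n" where "Q = (\<chi> i j. b j $ i)"
  define d where "d i = b i \<bullet> (C *v b i)" for i
  let ?D = "(\<chi> i j. if i = j then d i else 0) :: real^'n^'n"
  have "transpose Q ** Q = mat 1"
    using bb by (simp add: Q_def matrix_matrix_mult_def transpose_def mat_def vec_eq_iff inner_vec_def)
  then have orth: "orthogonal_matrix Q" by (simp add: orthogonal_matrix)
  have "(C ** Q) $ i $ j = (Q ** ?D) $ i $ j" for i j
  proof -
    have "(C ** Q) $ i $ j = (C *v b j) $ i"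
      by (simp add: Q_def matrix_matrix_mult_def matrix_vector_mult_def)
    also have "\<dots> = d j * b j $ i" by (subst E(5)[OF bE]) (simp add: d_def)
    also have "\<dots> = (\<Sum>k\<in>UNIV. b k $ i * (if k = j then d k else 0))"
      by (simp add: if_distrib sum.delta cong: if_cong)
    finally show ?thesis by (simp add: Q_def matrix_matrix_mult_def)
  qed
  then have "C ** Q = Q ** ?D" by (simp add: vec_eq_iff)
  then have "C ** Q ** transpose Q = Q ** ?D ** transpose Q" by simp
  then have "C = Q ** ?D ** transpose Q"
    using orth by (simp add: orthogonal_matrix_def flip: matrix_mul_assoc)
  with orth that show thesis by blast
qed

text \<open>Uniqueness of Haar measure. A double integral over \<open>?B\<close> and
  \<open>A\<close> is rewritten with Fubini while translating in \<open>y\<close>, then in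
  \<open>x\<close>, then in \<open>y\<close> again. It equals
  \<open>emeasure \<mu> ?B * emeasure lborel A\<close> and also
  \<open>emeasure lborel ?B * emeasure \<mu> A\<close>, and the common factor is finite and
  positive.\<close>

lemma translation_invariant_eq_lborel:
  fixes \<mu> :: "'a::euclidean_space measure"
  assumes s: "sets \<mu> = sets borel" and sf: "sigma_finite_measure \<mu>"
    and inv: "\<And>a. distr \<mu> borel (\<lambda>x. a + x) = \<mu>"
    and ball: "emeasure \<mu> (ball 0 1) = emeasure lborel (ball 0 1 :: 'a set)"
  shows "\<mu> = lborel"
proof (rule measure_eqI)
  fix A assume "A \<in> sets \<mu>"
  then have [measurable]: "A \<in> sets borel" by (simp add: s)
  interpret \<mu>: sigma_finite_measure \<mu> by (rule sf)
  interpret P: pair_sigma_finite \<mu> "lborel :: 'a measure" ..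
  note s[measurable_cong]
  let ?B = "ball 0 1 :: 'a set"
  have Bm: "?B \<in> sets \<mu>" by (simp add: s)
  have [measurable]: "?B \<in> sets borel" by simp
  have [measurable]: "(\<lambda>z. indicator A (fst z + snd z) :: ennreal) \<in> borel_measurable (\<mu> \<Otimes>\<^sub>M lborel)"
    by (rule measurable_compose[of "\<lambda>z. fst z + snd z" _ borel]) measurable
  have [measurable]: "(\<lambda>z. indicator ?B (fst z) :: ennreal) \<in> borel_measurable (\<mu> \<Otimes>\<^sub>M lborel)"
    "(\<lambda>z. indicator ?B (- snd z + fst z) :: ennreal) \<in> borel_measurable (\<mu> \<Otimes>\<^sub>M lborel)"
    "(\<lambda>z. indicator A (fst z) :: ennreal) \<in> borel_measurable (\<mu> \<Otimes>\<^sub>M lborel)"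
    by (rule measurable_compose[of _ _ borel], measurable)+
  have shift: "(\<integral>\<^sup>+x. f x \<partial>\<mu>) = (\<integral>\<^sup>+x. f (a + x) \<partial>\<mu>)" if [measurable]: "f \<in> borel_measurable borel" for f a
    by (subst inv[of a, symmetric]) (simp add: nn_integral_distr)
  have lshift: "(\<integral>\<^sup>+x. f x \<partial>lborel) = (\<integral>\<^sup>+x. f (a + x) \<partial>lborel)" if [measurable]: "f \<in> borel_measurable borel" for f and a :: 'a
    by (subst lborel_distr_plus[of a, symmetric]) (simp add: nn_integral_distr)
  have "emeasure \<mu> ?B * emeasure lborel A
      = (\<integral>\<^sup>+x. (\<integral>\<^sup>+y. indicator ?B x * indicator A y \<partial>lborel) \<partial>\<mu>)"
    using Bm by (simp add: nn_integral_cmult nn_integral_multc[OF borel_measurable_indicator[OF Bm]])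
  also have "\<dots> = (\<integral>\<^sup>+x. (\<integral>\<^sup>+y. indicator ?B x * indicator A (x + y) \<partial>lborel) \<partial>\<mu>)"
    by (intro nn_integral_cong lshift) simp
  also have "\<dots> = (\<integral>\<^sup>+y. (\<integral>\<^sup>+x. indicator ?B x * indicator A (x + y) \<partial>\<mu>) \<partial>lborel)"
    by (rule P.Fubini'[symmetric]) measurable
  also have "\<dots> = (\<integral>\<^sup>+y. (\<integral>\<^sup>+x. indicator ?B (- y + x) * indicator A ((- y + x) + y) \<partial>\<mu>) \<partial>lborel)"
    by (intro nn_integral_cong shift) simp
  also have "\<dots> = (\<integral>\<^sup>+y. (\<integral>\<^sup>+x. indicator ?B (- y + x) * indicator A x \<partial>\<mu>) \<partial>lborel)"
    by simp
  also have "\<dots> = (\<integral>\<^sup>+x. (\<integral>\<^sup>+y. indicator ?B (- y + x) * indicator A x \<partial>lborel) \<partial>\<mu>)"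
    by (rule P.Fubini') measurable
  also have "\<dots> = (\<integral>\<^sup>+x. (\<integral>\<^sup>+y. indicator ?B (- (x + y) + x) * indicator A x \<partial>lborel) \<partial>\<mu>)"
    by (intro nn_integral_cong lshift) simp
  also have "\<dots> = (\<integral>\<^sup>+x. (\<integral>\<^sup>+y. indicator ?B y * indicator A x \<partial>lborel) \<partial>\<mu>)"
    by (intro nn_integral_cong) (simp add: indicator_def)
  also have "\<dots> = emeasure lborel ?B * emeasure \<mu> A"
    by (simp add: nn_integral_multc nn_integral_cmult s)
  finally have "emeasure lborel ?B * emeasure lborel A = emeasure lborel ?B * emeasure \<mu> A"
    by (simp add: ball)
  moreover have "emeasure lborel ?B \<noteq> 0" "emeasure lborel ?B \<noteq> \<top>"
    using emeasure_lborel_ball_finite[of "0::'a" 1] content_ball_pos[of 1 "0::'a"]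
    by (auto simp: measure_def)
  ultimately show "emeasure \<mu> A = emeasure lborel A"
    by (simp add: ennreal_mult_cancel_left)
qed (simp add: s)

text \<open>An orthogonal map carries translations to translations and preserves the unit ball, so
  the image measure meets the characterization by translation invariance.\<close>

lemma lborel_orthogonal_image:
  fixes Q :: "real^'n^'n"
  assumes "orthogonal_matrix Q"
  shows "distr lborel borel (\<lambda>x. Q *v x) = lborel"
proof (rule translation_invariant_eq_lborel)
  have [measurable]: "(\<lambda>x. Q *v x) \<in> borel_measurable borel"
    by (intro borel_measurable_continuous_onI matrix_vector_mult_linear_continuous_on)
  have Q: "Q *v (transpose Q *v x) = x" "transpose Q *v (Q *v x) = x" for x
    using assms by (simp_all add: matrix_vector_mul_assoc orthogonal_matrix_def)
  have [measurable]: "(\<lambda>x. transpose Q *v x) \<in> borel_measurable borel"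
    by (intro borel_measurable_continuous_onI matrix_vector_mult_linear_continuous_on)
  show "sigma_finite_measure (distr lborel borel (\<lambda>x. Q *v x))"
    by (rule sigma_finite_measure_distr[where N = borel and f = "\<lambda>x. transpose Q *v x"])
      (simp_all add: distr_distr o_def Q distr_id2 lborel.sigma_finite_measure_axioms)
  have *: "(\<lambda>x. Q *v x) -` ball 0 1 = ball 0 1"
    using assms orthogonal_transformation_matrix[of "(*v) Q"] by (auto simp: orthogonal_transformation norm_minus_cancel dist_norm)
  show "emeasure (distr lborel borel (\<lambda>x. Q *v x)) (ball 0 1) = emeasure lborel (ball 0 1 :: (real^'n) set)"
    by (simp add: emeasure_distr *)
  fix a
  have "distr (distr lborel borel (\<lambda>x. Q *v x)) borel (\<lambda>x. a + x)
      = distr (distr lborel borel (\<lambda>x. transpose Q *v a + x)) borel (\<lambda>x. Q *v x)"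
    by (simp add: distr_distr o_def matrix_vector_right_distrib Q)
  then show "distr (distr lborel borel (\<lambda>x. Q *v x)) borel (\<lambda>x. a + x) = distr lborel borel (\<lambda>x. Q *v x)"
    by (simp add: lborel_distr_plus)
qed simp

text \<open>The factor is \<open>R = Q ** ?E\<close> with orthogonal \<open>Q\<close> and the
  diagonal matrix \<open>?E\<close> of square roots of eigenvalues: coordinatewise scaling accounts
  for the determinant, and \<open>Q\<close> preserves \<open>lborel\<close>. The change of variables
  is thus reduced to these two cases.\<close>

lemma pd_factor_lborel:
  fixes C :: "real^'n^'n"
  assumes C: "pd_mat C"
  obtains R :: "real^'n^'n" where "R ** transpose R = C" "\<bar>det R\<bar> = sqrt (det C)"
    "\<And>m. lborel = density (distr lborel borel (\<lambda>x. m + R *v x)) (\<lambda>_. ennreal \<bar>det R\<bar>)"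
proof -
  obtain Q d where Q: "orthogonal_matrix Q" and CQ: "C = Q ** (\<chi> i j. if i = j then d i else 0) ** transpose Q"
    using symmetric_diagonalization[OF pd_sym[OF C]] by blast
  let ?D = "(\<chi> i j. if i = j then d i else 0) :: real^'n^'n"
  let ?E = "(\<chi> i j. if i = j then sqrt (d i) else 0) :: real^'n^'n"
  have QQ: "transpose Q ** Q = mat 1" using Q by (simp add: orthogonal_matrix_def)
  have dpos: "d i > 0" for i
  proof -
    have "transpose Q *v (Q *v axis i 1) = axis i 1" by (simp add: matrix_vector_mul_assoc QQ)
    then have ne: "Q *v axis i 1 \<noteq> 0" by (metis axis_eq_0_iff matrix_vector_mult_0_right zero_neq_one)
    have "(Q *v axis i 1) \<bullet> (C *v (Q *v axis i 1)) = (Q *v axis i 1) \<bullet> (Q *v (?D *v axis i 1))"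
      by (simp add: CQ matrix_vector_mul_assoc QQ flip: matrix_mul_assoc)
    also have "\<dots> = axis i 1 \<bullet> (?D *v axis i 1)"
      by (simp add: inner_matrix_transpose matrix_vector_mul_assoc matrix_mul_assoc QQ)
    also have "\<dots> = d i"
      by (simp add: inner_axis' matrix_vector_mult_basis column_def)
    finally show ?thesis using C ne by (metis pd_mat_def)
  qed
  define R where "R = Q ** ?E"
  have tE: "transpose ?E = ?E" by (auto simp: transpose_def vec_eq_iff)
  have EE: "?E ** ?E = ?D"
  proof -
    have "(\<Sum>k\<in>UNIV. (if i = k then sqrt (d i) else 0) * (if k = j then sqrt (d k) else 0))
        = (\<Sum>k\<in>UNIV. if k = i then if i = j then d i else 0 else 0)" for i j
      using dpos by (intro sum.cong) (auto simp: less_imp_le)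
    then show ?thesis by (simp add: matrix_matrix_mult_def vec_eq_iff)
  qed
  have 1: "R ** transpose R = C"
    by (simp add: R_def CQ matrix_transpose_mul tE EE[symmetric] matrix_mul_assoc)
  have "det C = (det R)\<^sup>2"
    by (simp add: 1[symmetric] det_mul power2_eq_square)
  then have 2: "\<bar>det R\<bar> = sqrt (det C)" by simp
  have "\<bar>det Q\<bar> = 1" using det_orthogonal_matrix[OF Q] by auto
  then have detR: "\<bar>det R\<bar> = (\<Prod>i\<in>UNIV. sqrt (d i))"
    using dpos by (simp add: R_def det_mul abs_mult det_diagonal prod_nonneg less_imp_le)
  have [measurable]: "(\<lambda>x. X *v x) \<in> borel_measurable borel" for X :: "real^'n^'n"
    by (intro borel_measurable_continuous_onI matrix_vector_mult_linear_continuous_on)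
  \<comment> \<open>\<open>g\<close> recovers the index of a standard basis vector, to match
    products and sums over \<open>Basis\<close> with those over the index type.\<close>
  have "inj (\<lambda>i. axis i 1 :: real^'n)" by (auto simp: inj_on_def axis_eq_axis)
  then obtain g :: "real^'n \<Rightarrow> 'n" where g: "\<And>i. g (axis i 1) = i" by (metis inv_f_f)
  have Basis: "(Basis :: (real^'n) set) = range (\<lambda>i. axis i 1)" by (auto simp: Basis_vec_def)
  have prodB: "(\<Prod>j\<in>Basis. f (g j)) = (\<Prod>i\<in>UNIV. f i)" for f :: "'n \<Rightarrow> real"
    unfolding Basis using \<open>inj _\<close> by (subst prod.reindex) (auto simp: g)
  have sumB: "(\<Sum>j\<in>Basis. (sqrt (d (g j)) * (x \<bullet> j)) *\<^sub>R j) = ?E *v x" for x :: "real^'n"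
    unfolding Basis using \<open>inj _\<close>
    by (subst sum.reindex, simp, auto simp: g inner_axis vec_eq_iff matrix_vector_mult_def if_distrib if_distribR
        sum.delta cong: if_cong, simp add: axis_def sum.delta if_distrib if_distribR cong: if_cong)
  have L: "lborel = density (distr lborel borel (\<lambda>x. ?E *v x)) (\<lambda>_. ennreal \<bar>det R\<bar>)"
    using lborel_affine_euclidean[of "\<lambda>j. sqrt (d (g j))" "0 :: real^'n"] dpos
    by (simp add: sumB detR prodB[symmetric] less_imp_neq[THEN not_sym] less_imp_le)
  have 3: "lborel = density (distr lborel borel (\<lambda>x. m + R *v x)) (\<lambda>_. ennreal \<bar>det R\<bar>)" for m
  proof -
    have "lborel = distr (distr lborel borel (\<lambda>x. Q *v x)) borel (\<lambda>x. m + x)"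
      by (simp add: lborel_orthogonal_image[OF Q] lborel_distr_plus)
    also have "\<dots> = distr (distr (density (distr lborel borel (\<lambda>x. ?E *v x)) (\<lambda>_. ennreal \<bar>det R\<bar>)) borel (\<lambda>x. Q *v x)) borel (\<lambda>x. m + x)"
      using L by simp
    also have "\<dots> = density (distr lborel borel (\<lambda>x. m + R *v x)) (\<lambda>_. ennreal \<bar>det R\<bar>)"
      by (subst density_distr[symmetric], simp, simp)+
        (simp add: distr_distr o_def R_def matrix_vector_mul_assoc)
    finally show ?thesis .
  qed
  from that 1 2 3 show thesis by blast
qed

lemma integral_lborel_prod:
  fixes f :: "'a::euclidean_space \<Rightarrow> real \<Rightarrow> real"
  assumes "\<And>b. b \<in> Basis \<Longrightarrow> integrable lborel (f b)"
  shows "has_bochner_integral lborel (\<lambda>x. \<Prod>b\<in>Basis. f b (x \<bullet> b)) (\<Prod>b\<in>Basis. \<integral>x. f b x \<partial>lborel)"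
proof -
  interpret product_sigma_finite "\<lambda>_::'a. lborel :: real measure" ..
  have [measurable]: "f b \<in> borel_measurable borel" if "b \<in> Basis" for b
    using assms[OF that] by (simp add: borel_measurable_integrable)
  have m: "(\<lambda>x::'a. \<Prod>b\<in>Basis. f b (x \<bullet> b)) \<in> borel_measurable borel" by measurable
  have s: "(\<lambda>f. \<Sum>b\<in>Basis. f b *\<^sub>R b) \<in> (\<Pi>\<^sub>M b\<in>Basis. lborel :: real measure) \<rightarrow>\<^sub>M (borel :: 'a measure)"
    by measurable
  have *: "(\<Prod>b\<in>Basis. f b ((\<Sum>b\<in>Basis. x b *\<^sub>R b) \<bullet> b)) = (\<Prod>b\<in>Basis. f b (x b))" for x :: "'a \<Rightarrow> real"
    by (intro prod.cong refl) simp
  show ?thesis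
    unfolding has_bochner_integral_iff lborel_eq[where 'a='a]
    using product_integrable_prod[of Basis f] product_integral_prod[of Basis f] assms m s
    by (simp add: integrable_distr_eq integral_distr *)
qed

section \<open>Densities and moments of Gaussian measures\<close>

abbreviation gauss_dens :: "real^'n \<Rightarrow> real^'n^'n \<Rightarrow> real^'n \<Rightarrow> real" where
  "gauss_dens m C x \<equiv> exp (- (1/2) * ((x - m) \<bullet> (matrix_inv C *v (x - m)))) / sqrt ((2 * pi) ^ CARD('n) * det C)"

lemma measurable_matrix_vector_mult[measurable]: "(\<lambda>x. X *v x) \<in> borel_measurable borel" for X :: "real^'n^'m"
  by (intro borel_measurable_continuous_onI matrix_vector_mult_linear_continuous_on)

lemma sets_gaussian[simp, measurable_cong]: "sets (gaussian m C) = sets borel"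
  and space_gaussian[simp]: "space (gaussian m C) = UNIV"
  by (simp_all add: gaussian_def)

lemma matrix_inv_mat_1[simp]: "matrix_inv (mat 1 :: real^'n^'n) = mat 1"
  by (intro matrix_inv_unique) simp_all

lemma gauss_dens_std:
  "gauss_dens 0 (mat 1) x = (\<Prod>b\<in>Basis. std_normal_density (x \<bullet> b))" for x :: "real^'n"
proof -
  have "(\<Prod>b\<in>(Basis :: (real^'n) set). std_normal_density (x \<bullet> b))
      = (1 / sqrt (2 * pi)) ^ CARD('n) * exp (\<Sum>b\<in>Basis. - (x \<bullet> b)\<^sup>2 / 2)"
    by (simp add: std_normal_density_def prod_dividef exp_sum power_divide)
  also have "(\<Sum>b\<in>Basis. - (x \<bullet> b)\<^sup>2 / 2) = - (1/2) * (x \<bullet> x)"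
    by (subst euclidean_inner) (simp add: sum_distrib_left sum_negf power2_eq_square sum_divide_distrib)
  finally show ?thesis
    using real_sqrt_power[of "2 * pi" "CARD('n)"] by (simp add: power_divide power_mult_distrib)
qed

text \<open>Every nondegenerate Gaussian is an affine image of the standard one, to which the moment
  computations are thereby reduced. With \<open>x = m + R *v u\<close> the quadratic form becomes
  \<open>u \<bullet> u\<close>, and the Jacobian \<open>\<bar>det R\<bar>\<close> cancels the
  normalizing \<open>sqrt (det C)\<close>.\<close>

lemma gaussian_affine:
  fixes C :: "real^'n^'n"
  assumes C: "pd_mat C"
  obtains R :: "real^'n^'n" where "R ** transpose R = C"
    "\<And>m. gaussian m C = distr (gaussian 0 (mat 1)) borel (\<lambda>x. m + R *v x)"
proof -
  obtain R :: "real^'n^'n" where R: "R ** transpose R = C" "\<bar>det R\<bar> = sqrt (det C)"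
    "\<And>m. lborel = density (distr lborel borel (\<lambda>x. m + R *v x)) (\<lambda>_. ennreal \<bar>det R\<bar>)"
    using pd_factor_lborel[OF C] by blast
  have "det C \<noteq> 0" using det_pd(1)[OF C] by simp
  then have "det R \<noteq> 0" using R(2) by auto
  then have inv: "invertible R" by (simp add: invertible_det_nz)
  note RI = invertible_matrix_inv[OF inv]
  let ?I = "matrix_inv R"
  have "matrix_inv C = transpose ?I ** ?I"
    by (rule matrix_inv_unique)
      (metis R(1) RI matrix_mul_assoc matrix_mul_lid matrix_mul_rid matrix_transpose_mul transpose_mat)+
  moreover have tR: "transpose R ** transpose ?I = mat 1"
    by (simp add: RI flip: matrix_transpose_mul)
  ultimately have q: "(R *v x) \<bullet> (matrix_inv C *v (R *v x)) = x \<bullet> x" for x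
    by (simp add: inner_matrix_transpose matrix_vector_mul_assoc matrix_mul_assoc tR)
      (simp add: RI flip: matrix_mul_assoc)
  have *: "\<bar>det R\<bar> * gauss_dens m C (m + R *v x) = gauss_dens 0 (mat 1) x" for m x
    using R(2) det_pd(1)[OF C] by (simp add: q real_sqrt_mult)
  have "gaussian m C = distr (gaussian 0 (mat 1)) borel (\<lambda>x. m + R *v x)" for m
  proof -
    have "gaussian m C = density (density (distr lborel borel (\<lambda>x. m + R *v x)) (\<lambda>_. ennreal \<bar>det R\<bar>)) (\<lambda>x. ennreal (gauss_dens m C x))"
      unfolding gaussian_def by (subst R(3)[of m]) simp
    also have "\<dots> = density (distr lborel borel (\<lambda>x. m + R *v x)) (\<lambda>x. ennreal (\<bar>det R\<bar> * gauss_dens m C x))"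
      using det_pd(1)[OF C] by (subst density_density_eq) (auto simp: ennreal_mult[symmetric] divide_nonneg_nonneg intro!: arg_cong2[where f=density])
    also have "\<dots> = distr (gaussian 0 (mat 1)) borel (\<lambda>x. m + R *v x)"
    proof (subst density_distr)
      show "(\<lambda>x. ennreal (\<bar>det R\<bar> * gauss_dens m C x)) \<in> borel_measurable borel" by measurable
      show "(\<lambda>x. m + R *v x) \<in> lborel \<rightarrow>\<^sub>M borel" by measurable
    qed (simp only: gaussian_def *)
    finally show ?thesis .
  qed
  with that R(1) show thesis by blast
qed

lemma std_gaussian_moments:
  fixes b c :: "real^'n"
  assumes "b \<in> Basis" "c \<in> Basis"
  shows "prob_space (gaussian 0 (mat 1 :: real^'n^'n))"
    "has_bochner_integral (gaussian 0 (mat 1)) (\<lambda>x. x \<bullet> b) 0"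
    "has_bochner_integral (gaussian 0 (mat 1)) (\<lambda>x. (x \<bullet> b) * (x \<bullet> c)) (if b = c then 1 else 0)"
proof -
  define mom where "mom k = (\<integral>x. std_normal_density x * x ^ k \<partial>lborel)" for k
  have mom: "mom 0 = 1" "mom 1 = 0" "mom 2 = 1"
    using integral_std_normal_moment_even[of 0] integral_std_normal_moment_odd[of 0] integral_std_normal_moment_even[of 1]
    by (simp_all add: mom_def)
  \<comment> \<open>All mixed monomial moments at once: exponent \<open>0\<close> everywhere gives
    the total mass, a single \<open>1\<close> the mean, and a sum of two unit exponents, which is
    \<open>2\<close> where they coincide, the covariance.\<close>
  have key: "has_bochner_integral (gaussian 0 (mat 1)) (\<lambda>x::real^'n. \<Prod>d\<in>Basis. (x \<bullet> d) ^ k d) (\<Prod>d\<in>Basis. mom (k d))" for k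
  proof -
    have "has_bochner_integral lborel (\<lambda>x::real^'n. \<Prod>d\<in>Basis. std_normal_density (x \<bullet> d) * (x \<bullet> d) ^ k d) (\<Prod>d\<in>Basis. mom (k d))"
      unfolding mom_def by (rule integral_lborel_prod) (rule integrable_std_normal_moment)
    then have "has_bochner_integral lborel (\<lambda>x::real^'n. gauss_dens 0 (mat 1) x *\<^sub>R (\<Prod>d\<in>Basis. (x \<bullet> d) ^ k d)) (\<Prod>d\<in>Basis. mom (k d))"
      unfolding gauss_dens_std by (simp add: prod.distrib)
    then show ?thesis unfolding gaussian_def
      by (subst has_bochner_integral_density) auto
  qed
  have p: "(\<Prod>d\<in>Basis. if d = b then f d else (1::real)) = f b" if "b \<in> Basis" for f :: "real^'n \<Rightarrow> real" and b
    using that by (simp add: prod.delta)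
  have "has_bochner_integral (gaussian 0 (mat 1)) (\<lambda>x::real^'n. 1::real) 1"
    using key[of "\<lambda>_. 0"] by (simp add: mom)
  then have i: "integrable (gaussian 0 (mat 1)) (\<lambda>x::real^'n. 1::real)"
    and 1: "(\<integral>x. (1::real) \<partial>(gaussian 0 (mat 1 :: real^'n^'n))) = 1"
    by (auto simp: has_bochner_integral_iff)
  from i interpret finite_measure "gaussian 0 (mat 1 :: real^'n^'n)"
    by (intro finite_measureI) (auto simp: integrable_iff_bounded)
  show "prob_space (gaussian 0 (mat 1 :: real^'n^'n))"
    using 1 by (intro prob_spaceI) (simp add: emeasure_eq_measure)
  have "(x \<bullet> d) ^ (if d = b then 1 else 0) = (if d = b then x \<bullet> d else 1)" for x d :: "real^'n" by simp
  then show "has_bochner_integral (gaussian 0 (mat 1)) (\<lambda>x. x \<bullet> b) 0"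
    using key[of "\<lambda>d. if d = b then 1 else 0"] p[OF assms(1), of "\<lambda>_. mom 1"] p[OF assms(1), of "\<lambda>d. _ \<bullet> d"] assms(1)
    by (simp add: if_distrib mom[unfolded One_nat_def] cong: if_cong)
  show "has_bochner_integral (gaussian 0 (mat 1)) (\<lambda>x. (x \<bullet> b) * (x \<bullet> c)) (if b = c then 1 else 0)"
  proof -
    let ?k = "\<lambda>d. (if d = b then 1 else 0) + (if d = c then 1 else 0) :: nat"
    have "(x \<bullet> d) ^ ?k d = (if d = b then x \<bullet> d else 1) * (if d = c then x \<bullet> d else 1)" for x d :: "real^'n" by simp
    then have L: "(\<Prod>d\<in>Basis. (x \<bullet> d) ^ ?k d) = (x \<bullet> b) * (x \<bullet> c)" for x :: "real^'n"
      using p[OF assms(1)] p[OF assms(2)] by (simp add: prod.distrib)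
    have R: "(\<Prod>d\<in>Basis. mom (?k d)) = (if b = c then 1 else 0)"
    proof (cases "b = c")
      case True
      then have "mom (?k d) = 1" for d using mom by (simp add: numeral_2_eq_2)
      then show ?thesis using True by simp
    next
      case False
      then have "mom (?k b) = 0" using mom by simp
      then have "(\<Prod>d\<in>Basis. mom (?k d)) = 0" using assms(1) by (intro prod_zero) auto
      then show ?thesis using False by simp
    qed
    show ?thesis using key[of ?k] unfolding L R .
  qed
qed

lemma has_bochner_integral_vec:
  fixes f :: "'a \<Rightarrow> ('b::euclidean_space)^'n"
  assumes "\<And>i. has_bochner_integral M (\<lambda>x. f x $ i) (I $ i)"
  shows "has_bochner_integral M f I"
proof -
  have ax: "v = (\<Sum>i\<in>UNIV. axis i (v $ i))" for v :: "'b^'n"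
    by (simp add: vec_eq_iff axis_def if_distrib if_distribR cong: if_cong)
  have "has_bochner_integral M (\<lambda>x. \<Sum>i\<in>UNIV. axis i (f x $ i)) (\<Sum>i\<in>UNIV. axis i (I $ i))"
  proof (intro has_bochner_integral_sum)
    fix i :: 'n
    have "linear (axis i :: 'b \<Rightarrow> 'b^'n)" by (rule linearI) (auto simp: axis_def vec_eq_iff)
    then have "bounded_linear (axis i :: 'b \<Rightarrow> 'b^'n)" by (simp add: linear_conv_bounded_linear)
    from has_bochner_integral_bounded_linear[OF this assms]
    show "has_bochner_integral M (\<lambda>x. axis i (f x $ i)) (axis i (I $ i))" .
  qed
  then show ?thesis using ax by simp
qed

lemma gaussian_moments:
  fixes C :: "real^'n^'n"
  assumes C: "pd_mat C"
  shows "prob_space (gaussian m C)"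
    "has_bochner_integral (gaussian m C) (\<lambda>x. x) m"
    "has_bochner_integral (gaussian m C) (\<lambda>x. outer (x - m) (x - m)) C"
proof -
  obtain R :: "real^'n^'n" where R: "R ** transpose R = C"
    "\<And>m. gaussian m C = distr (gaussian 0 (mat 1)) borel (\<lambda>x. m + R *v x)"
    using gaussian_affine[OF C] by blast
  interpret G: prob_space "gaussian 0 (mat 1 :: real^'n^'n)"
    using std_gaussian_moments(1)[OF SOME_Basis SOME_Basis] .
  show "prob_space (gaussian m C)" unfolding R(2) by (rule G.prob_space_distr) simp
  have e1: "has_bochner_integral (gaussian 0 (mat 1)) (\<lambda>x::real^'n. x $ i) 0" for i
    using std_gaussian_moments(2)[of "axis i 1" "axis i 1"] by (simp add: inner_axis)
  have e2: "has_bochner_integral (gaussian 0 (mat 1)) (\<lambda>x::real^'n. x $ i * x $ j) (if i = j then 1 else 0)" for i j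
    using std_gaussian_moments(3)[of "axis i 1" "axis j 1"] by (simp add: inner_axis axis_eq_axis)
  have "has_bochner_integral (gaussian 0 (mat 1)) (\<lambda>x. (m + R *v x) $ i) (m $ i)" for i
  proof -
    have "has_bochner_integral (gaussian 0 (mat 1)) (\<lambda>x. m $ i + (\<Sum>k\<in>UNIV. R $ i $ k * x $ k)) (m $ i + (\<Sum>k\<in>UNIV. R $ i $ k * 0))"
      by (intro has_bochner_integral_add has_bochner_integral_sum has_bochner_integral_mult_right e1)
        (simp add: has_bochner_integral_iff G.prob_space[simplified])
    then show ?thesis by (simp add: matrix_vector_mult_def)
  qed
  then have "has_bochner_integral (gaussian 0 (mat 1)) (\<lambda>x. m + R *v x) m"
    by (rule has_bochner_integral_vec)
  then show "has_bochner_integral (gaussian m C) (\<lambda>x. x) m"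
    unfolding R(2) by (subst has_bochner_integral_distr) auto
  have "has_bochner_integral (gaussian 0 (mat 1)) (\<lambda>x. outer (R *v x) (R *v x) $ i $ j) (C $ i $ j)" for i j
  proof -
    have "has_bochner_integral (gaussian 0 (mat 1)) (\<lambda>x. \<Sum>k\<in>UNIV. \<Sum>l\<in>UNIV. (R $ i $ k * R $ j $ l) * (x $ k * x $ l))
      (\<Sum>k\<in>UNIV. \<Sum>l\<in>UNIV. (R $ i $ k * R $ j $ l) * (if k = l then 1 else 0))"
      by (intro has_bochner_integral_sum has_bochner_integral_mult_right e2)
    moreover have "(\<Sum>k\<in>UNIV. \<Sum>l\<in>UNIV. (R $ i $ k * R $ j $ l) * (if k = l then 1 else 0)) = C $ i $ j"
      by (simp add: R(1)[symmetric] matrix_matrix_mult_def transpose_def if_distrib cong: if_cong)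
    moreover have "(\<Sum>k\<in>UNIV. \<Sum>l\<in>UNIV. (R $ i $ k * R $ j $ l) * (x $ k * x $ l)) = outer (R *v x) (R *v x) $ i $ j" for x
      by (simp add: outer_def matrix_vector_mult_def sum_product mult_ac)
    ultimately show ?thesis by simp
  qed
  then have "has_bochner_integral (gaussian 0 (mat 1)) (\<lambda>x. outer (R *v x) (R *v x)) C"
    by (intro has_bochner_integral_vec)
  moreover have "(\<lambda>x. outer (x - m) (x - m)) \<in> borel_measurable borel"
    unfolding outer_def by (intro borel_measurable_continuous_onI continuous_intros)
  ultimately show "has_bochner_integral (gaussian m C) (\<lambda>x. outer (x - m) (x - m)) C"
    unfolding R(2) by (subst has_bochner_integral_distr) auto
qed

section \<open>The posterior and the Gibbs measure\<close>

lemma post_cov_pd: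
  fixes A :: "real^'n^'j"
  assumes "pd_mat \<Gamma>" "pd_mat \<Gamma>0"
  shows "pd_mat (post_cov A \<Gamma> \<Gamma>0)"
    "matrix_inv (post_cov A \<Gamma> \<Gamma>0) = transpose A ** matrix_inv \<Gamma> ** A + matrix_inv \<Gamma>0"
proof -
  let ?P = "transpose A ** matrix_inv \<Gamma> ** A + matrix_inv \<Gamma>0"
  note G = pd_matrix_inv[OF assms(1)] and G0 = pd_matrix_inv[OF assms(2)]
  have q: "x \<bullet> (?P *v y) = (A *v x) \<bullet> (matrix_inv \<Gamma> *v (A *v y)) + x \<bullet> (matrix_inv \<Gamma>0 *v y)" for x y
    by (simp add: matrix_vector_mult_add_rdistrib inner_add_right inner_matrix_transpose matrix_vector_mul_assoc matrix_mul_assoc)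
  have "0 < x \<bullet> (?P *v x)" if "x \<noteq> 0" for x
    unfolding q using G0 that pd_imp_psd[OF G]
    by (intro add_nonneg_pos) (auto simp: pd_mat_def psd_mat_def)
  moreover have "sym_mat ?P"
    using pd_sym[OF G] pd_sym[OF G0]
    by (simp add: sym_mat_def transpose_add matrix_transpose_mul matrix_mul_assoc)
  ultimately have "pd_mat ?P" by (simp add: pd_mat_def)
  then show "pd_mat (post_cov A \<Gamma> \<Gamma>0)" "matrix_inv (post_cov A \<Gamma> \<Gamma>0) = ?P"
    unfolding post_cov_def by (auto intro: pd_matrix_inv matrix_inv_matrix_inv)
qed

text \<open>The gradient of the potential vanishes at \<open>B *v c\<close> and its Hessian is the
  inverse of \<open>B\<close>, so the potential is a centred quadratic form plus a term free of
  \<open>q\<close>. That term depends on \<open>y\<close> and reappears as the exponent of the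
  evidence in \<open>bayes_conditional_law\<close>.\<close>

lemma potential_complete_square:
  fixes A :: "real^'n^'j"
  assumes G: "pd_mat \<Gamma>" "pd_mat \<Gamma>0"
    and B: "B = post_cov A \<Gamma> \<Gamma>0" and c: "c = data_vec A \<Gamma> y"
  shows "potential A \<Gamma> \<Gamma>0 y q = (1/2) * ((q - B *v c) \<bullet> (matrix_inv B *v (q - B *v c)))
    + (1/2) * (y \<bullet> (matrix_inv \<Gamma> *v y) - c \<bullet> (B *v c))"
proof -
  have B': "pd_mat B" "matrix_inv B = transpose A ** matrix_inv \<Gamma> ** A + matrix_inv \<Gamma>0"
    using post_cov_pd[OF G] B by auto
  have sG: "x \<bullet> (matrix_inv \<Gamma> *v z) = (matrix_inv \<Gamma> *v x) \<bullet> z" for x z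
    using pd_sym[OF pd_matrix_inv[OF G(1)]] by (simp add: sym_mat_inner)
  have c': "c = transpose A *v (matrix_inv \<Gamma> *v y)"
    by (simp add: c data_vec_def matrix_vector_mul_assoc)
  have qc: "(A *v q) \<bullet> (matrix_inv \<Gamma> *v y) = q \<bullet> c"
    by (simp add: c' inner_matrix_transpose)
  have qq: "q \<bullet> (matrix_inv B *v q) = (A *v q) \<bullet> (matrix_inv \<Gamma> *v (A *v q)) + q \<bullet> (matrix_inv \<Gamma>0 *v q)"
    by (simp add: B'(2) matrix_vector_mult_add_rdistrib inner_add_right inner_matrix_transpose matrix_vector_mul_assoc matrix_mul_assoc)
  have "(y - A *v q) \<bullet> (matrix_inv \<Gamma> *v (y - A *v q))
      = y \<bullet> (matrix_inv \<Gamma> *v y) - 2 * (q \<bullet> c) + (A *v q) \<bullet> (matrix_inv \<Gamma> *v (A *v q))"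
  proof -
    have "y \<bullet> (matrix_inv \<Gamma> *v (A *v q)) = q \<bullet> c"
      by (subst sG) (metis qc inner_commute)
    then show ?thesis
      by (simp add: matrix_vector_mult_diff_distrib inner_diff_left inner_diff_right qc)
  qed
  moreover have "(q - B *v c) \<bullet> (matrix_inv B *v (q - B *v c)) = q \<bullet> (matrix_inv B *v q) - 2 * (q \<bullet> c) + c \<bullet> (B *v c)"
  proof -
    have "(B *v c) \<bullet> (matrix_inv B *v q) = (matrix_inv B *v (B *v c)) \<bullet> q"
      using pd_sym[OF pd_matrix_inv[OF B'(1)]] by (simp add: sym_mat_inner)
    then show ?thesis
      by (simp add: matrix_vector_mult_diff_distrib inner_diff_left inner_diff_right pd_inv_mult[OF B'(1)] inner_commute)
  qed
  ultimately show ?thesis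
    unfolding potential_def norm_inv_msqrt[OF G(1)] norm_inv_msqrt[OF G(2)] qq by argo
qed

section \<open>Normalized densities and the Gibbs measure\<close>

lemma integral_prob_density:
  fixes g :: "'a::euclidean_space \<Rightarrow> real"
  assumes [measurable]: "g \<in> borel_measurable borel" and "\<And>x. 0 \<le> g x"
    and p: "prob_space (density lborel (\<lambda>x. ennreal (g x)))"
  shows "(\<integral>x. g x \<partial>lborel) = 1"
proof -
  have "(\<integral>\<^sup>+x. ennreal (g x) \<partial>lborel) = 1"
    using prob_space.emeasure_space_1[OF p] by (simp add: emeasure_density)
  then show ?thesis using assms(2) by (subst integral_eq_nn_integral) auto
qed

text \<open>A function proportional to a probability density normalizes to it; this replaces the
  computation of the normalizing integrals.\<close>

lemma normalized_density_eq:
  fixes g :: "'a::euclidean_space \<Rightarrow> real"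
  assumes g: "g \<in> borel_measurable borel" "\<And>x. 0 \<le> g x" "prob_space (density lborel (\<lambda>x. ennreal (g x)))"
    and f: "f = (\<lambda>x. K * g x)" and K: "K > 0"
  shows "normalized_density f = density lborel (\<lambda>x. ennreal (g x))"
  using integral_prob_density[OF g] K by (simp add: normalized_density_def f)

lemma gauss_dens_nonneg: "pd_mat C \<Longrightarrow> 0 \<le> gauss_dens m C x"
  using det_pd(1)[of C] by (intro divide_nonneg_nonneg) auto

lemma gaussian_pair_eq_density:
  fixes C1 :: "real^'n^'n" and C2 :: "real^'m^'m"
  assumes "pd_mat C1" "pd_mat C2"
  shows "gaussian m1 C1 \<Otimes>\<^sub>M gaussian m2 C2
    = density lborel (\<lambda>z. ennreal (gauss_dens m1 C1 (fst z) * gauss_dens m2 C2 (snd z)))"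
proof -
  interpret G2: prob_space "gaussian m2 C2" by (rule gaussian_moments(1)[OF assms(2)])
  have "gaussian m1 C1 \<Otimes>\<^sub>M gaussian m2 C2
      = density (lborel \<Otimes>\<^sub>M lborel) (\<lambda>(x, y). ennreal (gauss_dens m1 C1 x) * ennreal (gauss_dens m2 C2 y))"
    using G2.sigma_finite_measure_axioms unfolding gaussian_def
    by (intro pair_measure_density) (auto simp: lborel.sigma_finite_measure_axioms)
  also have "\<dots> = density lborel (\<lambda>z. ennreal (gauss_dens m1 C1 (fst z) * gauss_dens m2 C2 (snd z)))"
    using gauss_dens_nonneg[OF assms(1)] gauss_dens_nonneg[OF assms(2)]
    by (simp only: lborel_prod ennreal_mult case_prod_unfold)
  finally show ?thesis .
qed

lemma gaussian_pair_moments: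
  fixes C1 C2 :: "real^'n^'n" and m1 m2 :: "real^'n"
  assumes "pd_mat C1" "pd_mat C2"
  defines "P \<equiv> gaussian m1 C1 \<Otimes>\<^sub>M gaussian m2 C2"
  shows "prob_space P" "distr P borel fst = gaussian m1 C1" "moments P = (m1, m2, C1, C2, 0)"
proof -
  let ?G1 = "gaussian m1 C1" and ?G2 = "gaussian m2 C2"
  interpret G1: prob_space ?G1 by (rule gaussian_moments(1)[OF assms(1)])
  interpret G2: prob_space ?G2 by (rule gaussian_moments(1)[OF assms(2)])
  interpret P: pair_prob_space ?G1 ?G2 ..
  show "prob_space P" unfolding P_def by (rule P.prob_space_axioms)
  have d1: "distr P borel fst = ?G1"
    using G2.distr_pair_fst[of ?G1] unfolding P_def by (simp cong: distr_cong)
  then show "distr P borel fst = ?G1" .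
  have d2: "distr P borel snd = ?G2"
  proof (rule measure_eqI)
    fix V assume "V \<in> sets (distr P borel snd)"
    then have [measurable]: "V \<in> sets borel" by simp
    have "snd -` V \<inter> space P = UNIV \<times> V" by (auto simp: P_def space_pair_measure)
    then show "emeasure (distr P borel snd) V = emeasure ?G2 V"
      using G1.emeasure_space_1 unfolding P_def
      by (subst emeasure_distr) (auto simp: G2.emeasure_pair_measure_Times)
  qed simp
  have mq: "mean_q P = m1"
    using gaussian_moments(2)[OF assms(1), of m1] unfolding mean_q_def
    by (subst (asm) d1[symmetric]) (simp add: has_bochner_integral_iff integral_distr P_def)
  have mp: "mean_p P = m2"
    using gaussian_moments(2)[OF assms(2), of m2] unfolding mean_p_def
    by (subst (asm) d2[symmetric]) (simp add: has_bochner_integral_iff integral_distr P_def)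
  have [measurable]: "(\<lambda>x. outer (x - m) (x - m)) \<in> borel_measurable borel" for m :: "real^'n"
    unfolding outer_def by (intro borel_measurable_continuous_onI continuous_intros)
  have cq: "cov_q P = C1"
    using gaussian_moments(3)[OF assms(1), of m1] unfolding cov_q_def mq
    by (subst (asm) d1[symmetric]) (simp add: has_bochner_integral_iff integral_distr P_def)
  have cp: "cov_p P = C2"
    using gaussian_moments(3)[OF assms(2), of m2] unfolding cov_p_def mp
    by (subst (asm) d2[symmetric]) (simp add: has_bochner_integral_iff integral_distr P_def)
  \<comment> \<open>Under the product measure the centred coordinates are independent with mean
    zero, so the integral of each product factors and vanishes.\<close>
  have "has_bochner_integral P (\<lambda>z. outer (fst z - m1) (snd z - m2)) 0"
  proof (intro has_bochner_integral_vec)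
    fix i j
    have i1: "has_bochner_integral ?G1 (\<lambda>x. (x - m1) $ i) 0" and i2: "has_bochner_integral ?G2 (\<lambda>x. (x - m2) $ j) 0"
    proof -
      have "has_bochner_integral ?G1 (\<lambda>x. x - m1) (m1 - m1)"
        by (intro has_bochner_integral_diff gaussian_moments assms) (simp add: has_bochner_integral_iff G1.prob_space[simplified])
      then show "has_bochner_integral ?G1 (\<lambda>x. (x - m1) $ i) 0"
        using has_bochner_integral_bounded_linear[OF bounded_linear_vec_nth, of ?G1 _ _ i] by fastforce
      have "has_bochner_integral ?G2 (\<lambda>x. x - m2) (m2 - m2)"
        by (intro has_bochner_integral_diff gaussian_moments assms) (simp add: has_bochner_integral_iff G2.prob_space[simplified])
      then show "has_bochner_integral ?G2 (\<lambda>x. (x - m2) $ j) 0"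
        using has_bochner_integral_bounded_linear[OF bounded_linear_vec_nth, of ?G2 _ _ j] by fastforce
    qed
    have int: "integrable P (\<lambda>z. (fst z - m1) $ i * (snd z - m2) $ j)"
      unfolding P_def using i1 i2
      by (intro P.Fubini_integrable) (auto simp: has_bochner_integral_iff abs_mult)
    moreover have "(\<integral>z. (fst z - m1) $ i * (snd z - m2) $ j \<partial>P) = 0"
      using P.integral_fst'[OF int[unfolded P_def]] i2 unfolding P_def by (simp add: has_bochner_integral_iff)
    ultimately show "has_bochner_integral P (\<lambda>z. outer (fst z - m1) (snd z - m2) $ i $ j) (0 $ i $ j)"
      by (simp add: outer_def has_bochner_integral_iff)
  qed
  then have "cov_qp P = 0" by (simp add: cov_qp_def mq mp has_bochner_integral_iff)
  then show "moments P = (m1, m2, C1, C2, 0)" by (simp add: moments_def mq mp cq cp)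
qed

text \<open>With the mass matrix fixed at \<open>B\<close> the exponent is a quadratic form in
  \<open>p\<close> plus the completed square in \<open>q\<close>, so the Gibbs density is, up to a
  factor, a product of two Gaussian densities. The second identity is the same computation for
  \<open>q\<close> alone.\<close>

lemma gibbs_eq_gaussian:
  fixes A :: "real^'n^'j"
  assumes G: "pd_mat \<Gamma>" "pd_mat \<Gamma>0"
    and B: "B = post_cov A \<Gamma> \<Gamma>0" and c: "c = data_vec A \<Gamma> y"
  shows "gibbs A \<Gamma> \<Gamma>0 y B = gaussian (B *v c) B \<Otimes>\<^sub>M gaussian 0 B"
    "normalized_density (\<lambda>q. exp (- potential A \<Gamma> \<Gamma>0 y q)) = gaussian (B *v c) B"
proof -
  have pB: "pd_mat B" using post_cov_pd[OF G] B by auto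
  define k where "k = (1/2) * (y \<bullet> (matrix_inv \<Gamma> *v y) - c \<bullet> (B *v c))"
  define Z where "Z = sqrt ((2 * pi) ^ CARD('n) * det B)"
  have Z: "Z > 0" using det_pd(1)[OF pB] by (simp add: Z_def)
  have pot: "exp (- potential A \<Gamma> \<Gamma>0 y q) = (exp (- k) * Z) * gauss_dens (B *v c) B q" for q
  proof -
    define a where "a = (q - B *v c) \<bullet> (matrix_inv B *v (q - B *v c))"
    have "potential A \<Gamma> \<Gamma>0 y q = (1/2) * a + k"
      unfolding a_def k_def by (rule potential_complete_square[OF G B c])
    then have "exp (- potential A \<Gamma> \<Gamma>0 y q) = exp (- k) * exp (- (1/2) * a)"
      by (simp flip: exp_add)
    also have "\<dots> = exp (- k) * Z * (exp (- (1/2) * a) / Z)" using Z by simp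
    finally show ?thesis unfolding a_def Z_def .
  qed
  show "normalized_density (\<lambda>q. exp (- potential A \<Gamma> \<Gamma>0 y q)) = gaussian (B *v c) B"
    unfolding gaussian_def pot using Z gaussian_moments(1)[OF pB, of "B *v c"] gauss_dens_nonneg[OF pB]
    by (intro normalized_density_eq[OF _ _ _ refl]) (auto simp: gaussian_def)
  have e: "(\<lambda>(q, p). exp (- (1/2) * (p \<bullet> (matrix_inv B *v p)) - potential A \<Gamma> \<Gamma>0 y q))
      = (\<lambda>z. (exp (- k) * Z * Z) * (gauss_dens (B *v c) B (fst z) * gauss_dens 0 B (snd z)))"
  proof (rule ext)
    fix z :: "(real^'n) \<times> (real^'n)"
    obtain q p where z: "z = (q, p)" by fastforce
    have "exp (- (1/2) * (p \<bullet> (matrix_inv B *v p)) - potential A \<Gamma> \<Gamma>0 y q)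
        = exp (- (1/2) * (p \<bullet> (matrix_inv B *v p))) * exp (- potential A \<Gamma> \<Gamma>0 y q)"
      by (simp flip: exp_add)
    also have "exp (- (1/2) * (p \<bullet> (matrix_inv B *v p))) = Z * gauss_dens 0 B p"
      using Z det_pd(1)[OF pB] unfolding Z_def by simp
    finally show "(case z of (q, p) \<Rightarrow> exp (- (1/2) * (p \<bullet> (matrix_inv B *v p)) - potential A \<Gamma> \<Gamma>0 y q))
        = (exp (- k) * Z * Z) * (gauss_dens (B *v c) B (fst z) * gauss_dens 0 B (snd z))"
      unfolding z pot prod.case fst_conv snd_conv by (simp only: mult_ac)
  qed
  show "gibbs A \<Gamma> \<Gamma>0 y B = gaussian (B *v c) B \<Otimes>\<^sub>M gaussian 0 B"
    unfolding gibbs_def gaussian_pair_eq_density[OF pB pB]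
  proof (rule normalized_density_eq[OF _ _ _ e])
    show "prob_space (density lborel (\<lambda>z. ennreal (gauss_dens (B *v c) B (fst z) * gauss_dens 0 B (snd z))))"
      using gaussian_pair_moments(1)[OF pB pB] unfolding gaussian_pair_eq_density[OF pB pB] .
    show "0 \<le> gauss_dens (B *v c) B (fst z) * gauss_dens 0 B (snd z)" for z
      by (intro mult_nonneg_nonneg gauss_dens_nonneg pB)
    show "(\<lambda>z. gauss_dens (B *v c) B (fst z) * gauss_dens 0 B (snd z)) \<in> borel_measurable borel"
      by (intro borel_measurable_continuous_onI continuous_intros matrix_vector_mult_linear_continuous_on
          continuous_on_compose2[OF matrix_vector_mult_linear_continuous_on])
        (use det_pd(1)[OF pB] in auto)
  qed (use Z in simp)
qed

section \<open>The posterior as a conditional law\<close>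

lemma gaussian_kernel_measurable:
  fixes B :: "real^'n^'n" and X :: "real^'j^'n"
  assumes "pd_mat B"
  shows "(\<lambda>y. gaussian (X *v y) B) \<in> borel \<rightarrow>\<^sub>M prob_algebra borel"
proof (rule measurable_prob_algebraI)
  show "prob_space (gaussian (X *v y) B)" for y by (rule gaussian_moments(1)[OF assms])
  then have sub: "subprob_space (gaussian (X *v y) B)" for y by (simp add: prob_space_imp_subprob_space)
  show "(\<lambda>y. gaussian (X *v y) B) \<in> borel \<rightarrow>\<^sub>M subprob_algebra borel"
  proof (rule measurable_subprob_algebra[OF sub])
    fix U :: "(real^'n) set" assume [measurable]: "U \<in> sets borel"
    have "emeasure (gaussian (X *v y) B) U = (\<integral>\<^sup>+q. ennreal (gauss_dens (X *v y) B q) * indicator U q \<partial>lborel)" for y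
      unfolding gaussian_def by (subst emeasure_density) auto
    then show "(\<lambda>y. emeasure (gaussian (X *v y) B) U) \<in> borel_measurable borel" by simp
  qed simp
qed

text \<open>Completing the square factors the joint density: prior times likelihood equals
  \<open>Z y\<close> times the posterior density at \<open>q\<close>. Integrating out
  \<open>q\<close> shows that \<open>Z\<close> is the density of the data, and Fubini turns the
  factorization into the disintegration required by \<open>conditional_law\<close>.\<close>

lemma bayes_conditional_law:
  fixes A :: "real^'n^'j"
  assumes G: "pd_mat \<Gamma>" "pd_mat \<Gamma>0" and B: "B = post_cov A \<Gamma> \<Gamma>0"
  shows "conditional_law (bayes_joint A \<Gamma> \<Gamma>0) (\<lambda>y. gaussian (B *v data_vec A \<Gamma> y) B)"
proof -
  let ?\<kappa> = "\<lambda>y. gaussian (B *v data_vec A \<Gamma> y) B"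
  have pB: "pd_mat B" using post_cov_pd[OF G] B by auto
  interpret G0: prob_space "gaussian 0 \<Gamma>0" by (rule gaussian_moments(1)[OF G(2)])
  interpret G1: prob_space "gaussian 0 \<Gamma>" by (rule gaussian_moments(1)[OF G(1)])
  have bc: "B *v data_vec A \<Gamma> y = (B ** (transpose A ** matrix_inv \<Gamma>)) *v y" for y
    by (simp add: data_vec_def matrix_vector_mul_assoc)
  have K: "?\<kappa> \<in> borel \<rightarrow>\<^sub>M prob_algebra borel"
    unfolding bc by (rule gaussian_kernel_measurable[OF pB])
  \<comment> \<open>The evidence: the factor left by the completed square together with the ratio of
    the three normalizing constants.\<close>
  define Z where "Z y = exp (- (1/2) * (y \<bullet> (matrix_inv \<Gamma> *v y) - data_vec A \<Gamma> y \<bullet> (B *v data_vec A \<Gamma> y)))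
    * sqrt ((2 * pi) ^ CARD('n) * det B) / (sqrt ((2 * pi) ^ CARD('n) * det \<Gamma>0) * sqrt ((2 * pi) ^ CARD('j) * det \<Gamma>))" for y
  have Z0: "0 \<le> Z y" for y
    unfolding Z_def using det_pd(1)[OF pB] det_pd(1)[OF G(1)] det_pd(1)[OF G(2)] by simp
  have [measurable]: "(\<lambda>y. data_vec A \<Gamma> y) \<in> borel_measurable borel"
    unfolding data_vec_def by measurable
  have [measurable]: "Z \<in> borel_measurable borel" unfolding Z_def by measurable
  have fac: "gauss_dens 0 \<Gamma>0 q * gauss_dens 0 \<Gamma> (y - A *v q) = Z y * gauss_dens (B *v data_vec A \<Gamma> y) B q" for q y
  proof -
    have "exp (- (1/2) * ((q - 0) \<bullet> (matrix_inv \<Gamma>0 *v (q - 0)))) * exp (- (1/2) * ((y - A *v q - 0) \<bullet> (matrix_inv \<Gamma> *v (y - A *v q - 0))))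
      = exp (- potential A \<Gamma> \<Gamma>0 y q)"
      unfolding potential_def norm_inv_msqrt[OF G(1)] norm_inv_msqrt[OF G(2)] by (simp flip: exp_add add: algebra_simps)
    also have "\<dots> = exp (- (1/2) * (y \<bullet> (matrix_inv \<Gamma> *v y) - data_vec A \<Gamma> y \<bullet> (B *v data_vec A \<Gamma> y)))
        * exp (- (1/2) * ((q - B *v data_vec A \<Gamma> y) \<bullet> (matrix_inv B *v (q - B *v data_vec A \<Gamma> y))))"
      unfolding potential_complete_square[OF G B refl] by (simp flip: exp_add add: algebra_simps)
    finally show ?thesis
      using det_pd(1)[OF pB] unfolding Z_def by (simp add: field_simps)
  qed
  have J: "emeasure (bayes_joint A \<Gamma> \<Gamma>0) (U \<times> V) = (\<integral>\<^sup>+y. ennreal (Z y) * (emeasure (?\<kappa> y) U * indicator V y) \<partial>lborel)"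
    if [measurable]: "U \<in> sets borel" "V \<in> sets borel" for U V
  proof -
    have [measurable]: "U \<times> V \<in> sets borel" by (metis that borel_prod pair_measureI)
    have [measurable]: "(\<lambda>(q, \<eta>). (q, A *v q + \<eta>)) \<in> gaussian 0 \<Gamma>0 \<Otimes>\<^sub>M gaussian 0 \<Gamma> \<rightarrow>\<^sub>M borel"
      unfolding borel_prod[symmetric] by measurable
    have "emeasure (bayes_joint A \<Gamma> \<Gamma>0) (U \<times> V)
        = (\<integral>\<^sup>+z. indicator U (fst z) * indicator V (A *v fst z + snd z) \<partial>(gaussian 0 \<Gamma>0 \<Otimes>\<^sub>M gaussian 0 \<Gamma>))"
    proof -
      have "emeasure (bayes_joint A \<Gamma> \<Gamma>0) (U \<times> V) = (\<integral>\<^sup>+z. indicator (U \<times> V) z \<partial>bayes_joint A \<Gamma> \<Gamma>0)"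
        by (simp add: bayes_joint_def)
      also have "\<dots> = (\<integral>\<^sup>+z. indicator (U \<times> V) (fst z, A *v fst z + snd z) \<partial>(gaussian 0 \<Gamma>0 \<Otimes>\<^sub>M gaussian 0 \<Gamma>))"
        unfolding bayes_joint_def by (subst nn_integral_distr) (auto simp: case_prod_beta)
      finally show ?thesis by (simp add: indicator_times)
    qed
    also have "\<dots> = (\<integral>\<^sup>+q. \<integral>\<^sup>+\<eta>. indicator U q * indicator V (A *v q + \<eta>) \<partial>gaussian 0 \<Gamma> \<partial>gaussian 0 \<Gamma>0)"
      by (subst G1.nn_integral_fst[symmetric]) auto
    also have "\<dots> = (\<integral>\<^sup>+q. ennreal (gauss_dens 0 \<Gamma>0 q) * (\<integral>\<^sup>+\<eta>. ennreal (gauss_dens 0 \<Gamma> \<eta>) * (indicator U q * indicator V (A *v q + \<eta>)) \<partial>lborel) \<partial>lborel)"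
      unfolding gaussian_def by (subst nn_integral_density; measurable)+
    also have "\<dots> = (\<integral>\<^sup>+q. ennreal (gauss_dens 0 \<Gamma>0 q) * (\<integral>\<^sup>+y. ennreal (gauss_dens 0 \<Gamma> (y - A *v q)) * (indicator U q * indicator V y) \<partial>lborel) \<partial>lborel)"
    proof (rule nn_integral_cong, rule arg_cong2[where f="(*)", OF refl])
      \<comment> \<open>For fixed \<open>q\<close> the data \<open>y = A *v q + \<eta>\<close> is a
        translate of the noise.\<close>
      fix q
      show "(\<integral>\<^sup>+\<eta>. ennreal (gauss_dens 0 \<Gamma> \<eta>) * (indicator U q * indicator V (A *v q + \<eta>)) \<partial>lborel)
        = (\<integral>\<^sup>+y. ennreal (gauss_dens 0 \<Gamma> (y - A *v q)) * (indicator U q * indicator V y) \<partial>lborel)"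
        by (subst (2) lborel_distr_plus[of "A *v q", symmetric]) (subst nn_integral_distr; simp)
    qed
    also have "\<dots> = (\<integral>\<^sup>+q. (\<integral>\<^sup>+y. ennreal (Z y) * ennreal (gauss_dens (B *v data_vec A \<Gamma> y) B q) * (indicator U q * indicator V y) \<partial>lborel) \<partial>lborel)"
      by (subst nn_integral_cmult[symmetric])
        (simp_all only: mult.assoc[symmetric] ennreal_mult[symmetric] gauss_dens_nonneg[OF pB] gauss_dens_nonneg[OF G(1)] gauss_dens_nonneg[OF G(2)] fac Z0, measurable)
    also have "\<dots> = (\<integral>\<^sup>+y. (\<integral>\<^sup>+q. ennreal (Z y) * ennreal (gauss_dens (B *v data_vec A \<Gamma> y) B q) * (indicator U q * indicator V y) \<partial>lborel) \<partial>lborel)"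
      by (rule lborel_pair.Fubini'[symmetric]) measurable
    also have "\<dots> = (\<integral>\<^sup>+y. ennreal (Z y) * (emeasure (?\<kappa> y) U * indicator V y) \<partial>lborel)"
    proof (rule nn_integral_cong)
      fix y
      have "emeasure (?\<kappa> y) U = (\<integral>\<^sup>+q. ennreal (gauss_dens (B *v data_vec A \<Gamma> y) B q) * indicator U q \<partial>lborel)"
        unfolding gaussian_def by (subst emeasure_density) auto
      then show "(\<integral>\<^sup>+q. ennreal (Z y) * ennreal (gauss_dens (B *v data_vec A \<Gamma> y) B q) * (indicator U q * indicator V y) \<partial>lborel)
        = ennreal (Z y) * (emeasure (?\<kappa> y) U * indicator V y)"
        by (simp add: nn_integral_cmult nn_integral_multc mult.assoc[symmetric])
          (simp add: nn_integral_cmult nn_integral_multc mult.assoc)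
    qed
    finally show ?thesis .
  qed
  have sJ: "sets (bayes_joint A \<Gamma> \<Gamma>0) = sets borel" by (simp add: bayes_joint_def)
  have snd_m: "snd \<in> bayes_joint A \<Gamma> \<Gamma>0 \<rightarrow>\<^sub>M borel"
    unfolding measurable_cong_sets[OF sJ refl] by (intro borel_measurable_continuous_onI continuous_intros)
  have marg: "distr (bayes_joint A \<Gamma> \<Gamma>0) borel snd = density lborel (\<lambda>y. ennreal (Z y))"
  proof (rule measure_eqI)
    fix V assume "V \<in> sets (distr (bayes_joint A \<Gamma> \<Gamma>0) borel snd)"
    then have [measurable]: "V \<in> sets borel" by simp
    have "snd -` V \<inter> space (bayes_joint A \<Gamma> \<Gamma>0) = UNIV \<times> V" by (auto simp: bayes_joint_def)
    moreover have "emeasure (?\<kappa> y) UNIV = 1" for y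
      using prob_space.emeasure_space_1[OF gaussian_moments(1)[OF pB]] by simp
    ultimately show "emeasure (distr (bayes_joint A \<Gamma> \<Gamma>0) borel snd) V = emeasure (density lborel (\<lambda>y. ennreal (Z y))) V"
      using J[of UNIV V] by (simp add: emeasure_distr[OF snd_m] emeasure_density)
  qed simp
  have "(\<lambda>y. emeasure (?\<kappa> y) U) \<in> borel_measurable borel" if "U \<in> sets borel" for U
    using measurable_compose[OF measurable_prob_algebraD[OF K] measurable_emeasure_subprob_algebra[OF that]] .
  then show ?thesis
    unfolding conditional_law_def marg using K by (auto simp: J nn_integral_density)
qed

section \<open>Lipschitz differential equations\<close>

text \<open>Continuous induction: the times with \<open>u \<le> 0\<close> form a closed set, and
  \<open>step\<close> is contradicted at the earliest of them. Estimates that are only available as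
  long as a bound holds can thus be used to maintain that bound.\<close>

lemma positive_propagation:
  fixes u :: "real \<Rightarrow> real"
  assumes cont: "continuous_on {a..b} u" and "u a > 0"
    and step: "\<And>t. a < t \<Longrightarrow> t \<le> b \<Longrightarrow> (\<And>s. a \<le> s \<Longrightarrow> s < t \<Longrightarrow> u s > 0) \<Longrightarrow> u t > 0"
    and t: "a \<le> t" "t \<le> b"
  shows "u t > 0"
proof (rule ccontr)
  assume "\<not> u t > 0"
  define N where "N = {s \<in> {a..b}. u s \<le> 0}"
  have "t \<in> N" using t \<open>\<not> u t > 0\<close> by (simp add: N_def)
  have "N = {a..b} \<inter> u -` {..0}" by (auto simp: N_def)
  then have "closed N"
    using continuous_closed_preimage[OF cont closed_atLeastAtMost closed_atMost, of 0] by simp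
  moreover have bdd: "bdd_below N" by (auto simp: N_def)
  ultimately have inf: "Inf N \<in> N" using \<open>t \<in> N\<close> closed_contains_Inf by blast
  have "u s > 0" if "a \<le> s" "s < Inf N" for s
    using that cInf_lower[OF _ bdd, of s] inf by (force simp: N_def)
  moreover have "a < Inf N" using inf \<open>u a > 0\<close> by (auto simp: N_def less_le)
  ultimately show False using step[of "Inf N"] inf by (auto simp: N_def)
qed

text \<open>\<open>V\<close> times \<open>exp (- k * (t - a))\<close> is nonincreasing. Negative
  \<open>k\<close> gives decay, and negated functions give the lower bounds in
  \<open>escape\<close>.\<close>

lemma gronwall:
  fixes V V' :: "real \<Rightarrow> real"
  assumes "a \<le> b" "continuous_on {a..b} V"
    and V: "\<And>t. a < t \<Longrightarrow> t < b \<Longrightarrow> (V has_real_derivative V' t) (at t)"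
    and le: "\<And>t. a < t \<Longrightarrow> t < b \<Longrightarrow> V' t \<le> k * V t"
  shows "V b \<le> V a * exp (k * (b - a))"
proof (cases "a < b")
  case True
  define W where "W t = V t * exp (- k * (t - a))" for t
  have "W b \<le> W a"
  proof (rule DERIV_nonpos_imp_decreasing_open[OF \<open>a \<le> b\<close>])
    show "continuous_on {a..b} W" unfolding W_def by (intro continuous_intros assms)
    fix t assume t: "a < t" "t < b"
    have "(W has_real_derivative (V' t - k * V t) * exp (- k * (t - a))) (at t)"
      unfolding W_def by (rule derivative_eq_intros V t refl | simp add: algebra_simps)+
    moreover have "(V' t - k * V t) * exp (- k * (t - a)) \<le> 0"
      using le[OF t] by (simp add: mult_nonpos_nonneg)
    ultimately show "\<exists>y. (W has_real_derivative y) (at t) \<and> y \<le> 0" by blast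
  qed
  then have "V b * exp (- k * (b - a)) * exp (k * (b - a)) \<le> V a * exp (k * (b - a))"
    by (intro mult_right_mono) (simp_all add: W_def)
  then show ?thesis by (simp add: mult.assoc flip: exp_add)
qed (use assms in simp)

section \<open>Solutions of differential equations\<close>

lemma ode_solution_subset: "ode_solution f I \<phi> \<Longrightarrow> J \<subseteq> I \<Longrightarrow> ode_solution f J \<phi>"
  unfolding ode_solution_def by (meson has_vector_derivative_within_subset subsetD)

lemma ode_solution_continuous: "ode_solution f I \<phi> \<Longrightarrow> continuous_on I \<phi>"
  unfolding ode_solution_def continuous_on_eq_continuous_within
  by (blast intro: has_vector_derivative_continuous)

lemma ode_solution_at:
  "ode_solution f {a..b} \<phi> \<Longrightarrow> a < t \<Longrightarrow> t < b \<Longrightarrow> (\<phi> has_vector_derivative f (\<phi> t)) (at t)"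
  unfolding ode_solution_def by (metis at_within_Icc_at atLeastAtMost_iff less_imp_le)

lemma ode_solution_half_line:
  assumes "\<And>T. T > 0 \<Longrightarrow> ode_solution f {0..T} \<phi>"
  shows "ode_solution f {0..} \<phi>"
  unfolding ode_solution_def
proof
  fix t :: real assume t: "t \<in> {0..}"
  have "(\<phi> has_vector_derivative f (\<phi> t)) (at t within {0..t+1})"
    using assms[of "t + 1"] t unfolding ode_solution_def by auto
  moreover have "at t within {0..} = at t within {0..t+1}"
    by (rule at_within_nhd[of t "{..<t+1}"]) auto
  ultimately show "(\<phi> has_vector_derivative f (\<phi> t)) (at t within {0..})" by simp
qed

lemma ode_solution_cong:
  assumes "ode_solution f I \<phi>" "\<And>t. t \<in> I \<Longrightarrow> f (\<phi> t) = g (\<phi> t)"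
  shows "ode_solution g I \<phi>"
  using assms by (simp add: ode_solution_def)

text \<open>Gronwall for the squared distance, which is differentiable also where the two solutions
  meet. The Lipschitz bound is asked for along the two trajectories only, which suits locally
  Lipschitz fields.\<close>

lemma ode_gronwall:
  fixes \<phi> \<psi> :: "real \<Rightarrow> 'a::euclidean_space"
  assumes "a \<le> b" and \<phi>: "ode_solution f {a..b} \<phi>" and \<psi>: "ode_solution g {a..b} \<psi>"
    and lip: "\<And>t. a \<le> t \<Longrightarrow> t \<le> b \<Longrightarrow> norm (f (\<phi> t) - g (\<psi> t)) \<le> L * norm (\<phi> t - \<psi> t)"
  shows "norm (\<phi> b - \<psi> b) \<le> norm (\<phi> a - \<psi> a) * exp (L * (b - a))"
proof -
  let ?d = "\<lambda>t. \<phi> t - \<psi> t"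
  have "?d b \<bullet> ?d b \<le> ?d a \<bullet> ?d a * exp (2 * L * (b - a))"
  proof (rule gronwall[where V' = "\<lambda>t. 2 * (?d t \<bullet> (f (\<phi> t) - g (\<psi> t)))"])
    show "continuous_on {a..b} (\<lambda>t. ?d t \<bullet> ?d t)"
      by (intro continuous_intros ode_solution_continuous[OF \<phi>] ode_solution_continuous[OF \<psi>])
    fix t assume t: "a < t" "t < b"
    have "(?d has_vector_derivative (f (\<phi> t) - g (\<psi> t))) (at t)"
      by (intro has_vector_derivative_diff ode_solution_at[OF \<phi>] ode_solution_at[OF \<psi>] t)
    from bounded_bilinear.has_vector_derivative[OF bounded_bilinear_inner this this]
    show "((\<lambda>t. ?d t \<bullet> ?d t) has_real_derivative 2 * (?d t \<bullet> (f (\<phi> t) - g (\<psi> t)))) (at t)"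
      by (simp add: has_real_derivative_iff_has_vector_derivative inner_commute)
    have "?d t \<bullet> (f (\<phi> t) - g (\<psi> t)) \<le> norm (?d t) * norm (f (\<phi> t) - g (\<psi> t))"
      by (rule norm_cauchy_schwarz)
    also have "\<dots> \<le> norm (?d t) * (L * norm (?d t))"
      using lip t by (intro mult_left_mono) auto
    finally show "2 * (?d t \<bullet> (f (\<phi> t) - g (\<psi> t))) \<le> 2 * L * (?d t \<bullet> ?d t)"
      by (simp add: dot_square_norm power2_eq_square mult_ac)
  qed fact
  also have "exp (2 * L * (b - a)) = (exp (L * (b - a)))\<^sup>2"
    by (simp add: power2_eq_square flip: exp_add)
  finally have "(norm (?d b))\<^sup>2 \<le> (norm (?d a) * exp (L * (b - a)))\<^sup>2"
    by (simp add: dot_square_norm power_mult_distrib)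
  then show ?thesis by (rule power2_le_imp_le) simp
qed

text \<open>Picard iteration. Measured with the weight \<open>exp (- 2 * L * t)\<close> the integral
  operator contracts by the factor \<open>1/2\<close>, so the iterates converge on all of
  \<open>{0..T}\<close> at once, for every \<open>T\<close>, without continuation from short
  intervals.\<close>

lemma picard_lindelof:
  fixes g :: "'a::euclidean_space \<Rightarrow> 'a"
  assumes L: "L > 0" and lip: "\<And>x y. norm (g x - g y) \<le> L * norm (x - y)"
  obtains \<phi> where "\<phi> 0 = x0" "ode_solution g {0..} \<phi>"
proof -
  define X where "X n = ((\<lambda>\<psi> (t::real). x0 + integral {0..t} (\<lambda>s. g (\<psi> s))) ^^ n) (\<lambda>_. x0)" for n
  have X0: "X 0 t = x0" and XS: "X (Suc n) t = x0 + integral {0..t} (\<lambda>s. g (X n s))" for n t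
    by (simp_all add: X_def)
  have gc: "continuous_on UNIV g"
    by (rule lipschitz_on_continuous_on[of L], rule lipschitz_onI) (use lip L in \<open>auto simp: dist_norm\<close>)
  have gcomp: "continuous_on A (\<lambda>s. g (\<psi> s))" if "continuous_on A \<psi>" for A and \<psi> :: "real \<Rightarrow> 'a"
    using continuous_on_compose2[OF gc that] by simp
  have Xc: "continuous_on {0..T} (X n)" for n T
  proof (induction n)
    case (Suc n)
    have "continuous_on {0..T} (\<lambda>t. integral {0..t} (\<lambda>s. g (X n s)))"
      by (rule indefinite_integral_continuous_1[OF integrable_continuous_real[OF gcomp[OF Suc]]])
    then show ?case by (subst XS[abs_def]) (intro continuous_intros)
  qed (simp add: X0)
  \<comment> \<open>Bounds the first increment \<open>t *\<^sub>R g x0\<close>, since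
    \<open>L * t \<le> exp (2 * L * t)\<close>.\<close>
  define K where "K = norm (g x0) / L + 1"
  have bound: "norm (X (Suc n) t - X n t) \<le> K * (1/2) ^ n * exp (2 * L * t)" if "t \<ge> 0" for n t
    using that
  proof (induction n arbitrary: t)
    case 0
    have "X (Suc 0) t - X 0 t = t *\<^sub>R g x0" using 0 by (simp add: XS X0)
    moreover have "L * t \<le> exp (2 * L * t)"
    proof -
      have "0 \<le> L * t" using 0 L by simp
      then show ?thesis using exp_ge_add_one_self[of "2 * (L * t)"] unfolding mult.assoc by linarith
    qed
    then have "norm (g x0) / L * (L * t) \<le> K * exp (2 * L * t)"
      using 0 L by (intro mult_mono) (auto simp: K_def)
    ultimately show ?case using 0 L by (simp add: mult.commute)
  next
    case (Suc n)
    have c: "continuous_on {0..t} (\<lambda>s. g (X m s))" for m by (intro gcomp Xc)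
    have e: "((\<lambda>s. L * (K * (1/2) ^ n * exp (2 * L * s))) has_integral
        (K * (1/2) ^ Suc n * exp (2 * L * t) - K * (1/2) ^ Suc n * exp (2 * L * 0))) {0..t}"
      using Suc.prems L by (intro fundamental_theorem_of_calculus)
        (auto intro!: derivative_eq_intros simp flip: has_real_derivative_iff_has_vector_derivative)
    have "X (Suc (Suc n)) t - X (Suc n) t = integral {0..t} (\<lambda>s. g (X (Suc n) s) - g (X n s))"
      by (subst (1 2) XS) (simp add: Henstock_Kurzweil_Integration.integral_diff integrable_continuous_real c)
    also have "norm \<dots> \<le> integral {0..t} (\<lambda>s. L * (K * (1/2) ^ n * exp (2 * L * s)))"
    proof (rule Henstock_Kurzweil_Integration.integral_norm_bound_integral)
      show "(\<lambda>s. g (X (Suc n) s) - g (X n s)) integrable_on {0..t}"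
        by (intro integrable_continuous_real continuous_intros c)
      show "norm (g (X (Suc n) s) - g (X n s)) \<le> L * (K * (1/2) ^ n * exp (2 * L * s))" if "s \<in> {0..t}" for s
        by (rule order_trans[OF lip mult_left_mono]) (use Suc.IH[of s] L that in auto)
    qed (use e in blast)
    also have "\<dots> = K * (1/2) ^ Suc n * exp (2 * L * t) - K * (1/2) ^ Suc n"
      using integral_unique[OF e] by simp
    also have "\<dots> \<le> K * (1/2) ^ Suc n * exp (2 * L * t)" using L by (simp add: K_def)
    finally show ?case .
  qed
  define \<phi> where "\<phi> t = x0 + (\<Sum>n. X (Suc n) t - X n t)" for t
  have K0: "K \<ge> 0" using L by (simp add: K_def)
  have ul: "uniform_limit {0..T} X \<phi> sequentially" for T
  proof -
    have "uniform_limit {0..T} (\<lambda>n t. \<Sum>i<n. X (Suc i) t - X i t) (\<lambda>t. \<Sum>i. X (Suc i) t - X i t) sequentially"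
    proof (rule Weierstrass_m_test)
      show "norm (X (Suc n) t - X n t) \<le> K * exp (2 * L * T) * (1/2) ^ n" if "t \<in> {0..T}" for n t
      proof -
        have "K * (1/2) ^ n * exp (2 * L * t) \<le> K * (1/2) ^ n * exp (2 * L * T)"
          using that L K0 by (intro mult_left_mono) auto
        then show ?thesis using bound[of t n] that by (simp add: mult_ac)
      qed
      show "summable (\<lambda>n. K * exp (2 * L * T) * (1/2) ^ n :: real)"
        by (intro summable_mult summable_geometric) simp
    qed
    then have "uniform_limit {0..T} (\<lambda>n t. x0 + (\<Sum>i<n. X (Suc i) t - X i t)) \<phi> sequentially"
      unfolding \<phi>_def by (intro uniform_limit_intros)
    moreover have "x0 + (\<Sum>i<n. X (Suc i) t - X i t) = X n t" for n t
      using sum_lessThan_telescope[of "\<lambda>i. X i t" n] by (simp add: X0)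
    ultimately show ?thesis by simp
  qed
  have \<phi>c: "continuous_on {0..T} \<phi>" for T
    by (rule uniform_limit_theorem[OF _ ul]) (use Xc in auto)
  have eq: "\<phi> t = x0 + integral {0..t} (\<lambda>s. g (\<phi> s))" if "t \<ge> 0" for t
  proof (rule LIMSEQ_unique)
    show "(\<lambda>n. X (Suc n) t) \<longlonglongrightarrow> \<phi> t"
      using tendsto_uniform_limitI[OF ul[of t]] that by (intro LIMSEQ_Suc) auto
    have "uniform_limit {0..t} (\<lambda>n s. g (X n s)) (\<lambda>s. g (\<phi> s)) sequentially"
    proof (rule uniform_limitI)
      fix e :: real assume "e > 0"
      then have "\<forall>\<^sub>F n in sequentially. \<forall>s\<in>{0..t}. dist (X n s) (\<phi> s) < e / L"
        using uniform_limitD[OF ul] L by simp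
      then show "\<forall>\<^sub>F n in sequentially. \<forall>s\<in>{0..t}. dist (g (X n s)) (g (\<phi> s)) < e"
      proof (rule eventually_mono, intro ballI)
        fix n s assume "\<forall>s\<in>{0..t}. dist (X n s) (\<phi> s) < e / L" "s \<in> {0..t}"
        then have "L * dist (X n s) (\<phi> s) < e" using L by (simp add: field_simps)
        then show "dist (g (X n s)) (g (\<phi> s)) < e" using lip[of "X n s" "\<phi> s"] by (simp add: dist_norm)
      qed
    qed
    from uniform_limit_integral[OF this]
    obtain I J where IJ: "\<And>n. ((\<lambda>s. g (X n s)) has_integral I n) {0..t}" "((\<lambda>s. g (\<phi> s)) has_integral J) {0..t}" "I \<longlonglongrightarrow> J"
      using gcomp[OF Xc] by auto
    show "(\<lambda>n. X (Suc n) t) \<longlonglongrightarrow> x0 + integral {0..t} (\<lambda>s. g (\<phi> s))"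
      unfolding XS integral_unique[OF IJ(1)] integral_unique[OF IJ(2)] by (intro tendsto_intros IJ(3))
  qed
  have "ode_solution g {0..T} \<phi>" if "T > 0" for T
    unfolding ode_solution_def
  proof
    fix t assume t: "t \<in> {0..T}"
    have "((\<lambda>t. x0 + integral {0..t} (\<lambda>s. g (\<phi> s))) has_vector_derivative g (\<phi> t)) (at t within {0..T})"
      using integral_has_vector_derivative[OF gcomp[OF \<phi>c] t] by (auto intro!: derivative_eq_intros)
    then show "(\<phi> has_vector_derivative g (\<phi> t)) (at t within {0..T})"
      by (rule has_vector_derivative_transform[OF t, rotated]) (use eq in auto)
  qed
  moreover have "\<phi> 0 = x0" using eq[of 0] by simp
  ultimately show thesis using that ode_solution_half_line by blast
qed

section \<open>Quadratic vector fields\<close>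

text \<open>Covers both the centred moment equations, with \<open>S\<close> the states with
  symmetric covariance blocks, and the five-dimensional system of \<open>escape\<close>. A quadratic
  field is Lipschitz on balls only, so global existence has to be earned from bounds.\<close>

locale quadratic_ode =
  fixes L :: "'a::euclidean_space \<Rightarrow> 'a" and \<beta> :: "'a \<Rightarrow> 'a \<Rightarrow> 'a" and S :: "'a set"
  assumes L: "linear L" and \<beta>: "bounded_bilinear \<beta>" and S: "subspace S"
    and invariant: "h \<in> S \<Longrightarrow> L h + \<beta> h h \<in> S"
begin

definition F :: "'a \<Rightarrow> 'a" where "F h = L h + \<beta> h h"

lemma F_lipschitz:
  obtains K where "K > 0" "\<And>x y. norm x \<le> R \<Longrightarrow> norm y \<le> R \<Longrightarrow> norm (F x - F y) \<le> K * norm (x - y)"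
proof -
  interpret \<beta>: bounded_bilinear \<beta> by (rule \<beta>)
  obtain A where A: "A > 0" "\<And>x. norm (L x) \<le> A * norm x"
    using linear_bounded_pos[OF L] by blast
  obtain B where B: "B > 0" "\<And>x y. norm (\<beta> x y) \<le> norm x * norm y * B"
    using \<beta>.pos_bounded by blast
  have "norm (F x - F y) \<le> (A + 2 * B * \<bar>R\<bar>) * norm (x - y)" if "norm x \<le> R" "norm y \<le> R" for x y
  proof -
    have "F x - F y = L (x - y) + (\<beta> x (x - y) + \<beta> (x - y) y)"
      by (simp add: F_def linear_diff[OF L] \<beta>.diff_left \<beta>.diff_right)
    also have "norm \<dots> \<le> A * norm (x - y) + (norm x * norm (x - y) * B + norm (x - y) * norm y * B)"
      by (intro norm_triangle_le add_mono A B)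
    also have "\<dots> \<le> A * norm (x - y) + (\<bar>R\<bar> * norm (x - y) * B + norm (x - y) * \<bar>R\<bar> * B)"
      using that B(1) by (intro add_mono mult_right_mono mult_left_mono) auto
    finally show ?thesis by (simp add: algebra_simps)
  qed
  moreover have "A + 2 * B * \<bar>R\<bar> > 0" using A(1) B(1) by (simp add: add_pos_nonneg)
  ultimately show thesis using that by blast
qed

lemma bounded_solution:
  assumes "ode_solution F {a..b} \<phi>"
  obtains R where "R > 0" "\<And>t. a \<le> t \<Longrightarrow> t \<le> b \<Longrightarrow> norm (\<phi> t) < R"
proof -
  have "bounded (\<phi> ` {a..b})"
    by (intro compact_imp_bounded compact_continuous_image ode_solution_continuous[OF assms]) simp
  then obtain R where "R > 0" "\<forall>x\<in>\<phi> ` {a..b}. norm x \<le> R" using bounded_pos by blast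
  then show thesis using that[of "R + 1"] by force
qed

lemma close_solutions:
  assumes K: "\<And>x y. norm x \<le> R \<Longrightarrow> norm y \<le> R \<Longrightarrow> norm (F x - F y) \<le> K * norm (x - y)"
    and "a \<le> b" and sol: "ode_solution F {a..b} \<phi>" "ode_solution F {a..b} \<psi>"
    and bd: "\<And>t. a \<le> t \<Longrightarrow> t \<le> b \<Longrightarrow> norm (\<phi> t) \<le> R" "\<And>t. a \<le> t \<Longrightarrow> t \<le> b \<Longrightarrow> norm (\<psi> t) \<le> R"
  shows "norm (\<phi> b - \<psi> b) \<le> norm (\<phi> a - \<psi> a) * exp (K * (b - a))"
  by (rule ode_gronwall[OF \<open>a \<le> b\<close> sol]) (intro K bd; simp)

lemma unique_solution:
  assumes sol: "ode_solution F {a..b} \<phi>" "ode_solution F {a..b} \<psi>" and eq: "\<phi> a = \<psi> a"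
    and t: "a \<le> t" "t \<le> b"
  shows "\<phi> t = \<psi> t"
proof -
  obtain R1 where R1: "R1 > 0" "\<And>t. a \<le> t \<Longrightarrow> t \<le> b \<Longrightarrow> norm (\<phi> t) < R1" using bounded_solution[OF sol(1)] by blast
  obtain R2 where R2: "R2 > 0" "\<And>t. a \<le> t \<Longrightarrow> t \<le> b \<Longrightarrow> norm (\<psi> t) < R2" using bounded_solution[OF sol(2)] by blast
  obtain K where "K > 0"
    and K: "\<And>x y. norm x \<le> max R1 R2 \<Longrightarrow> norm y \<le> max R1 R2 \<Longrightarrow> norm (F x - F y) \<le> K * norm (x - y)"
    using F_lipschitz by blast
  have sub: "{a..t} \<subseteq> {a..b}" using t by auto
  have "norm (\<phi> t - \<psi> t) \<le> norm (\<phi> a - \<psi> a) * exp (K * (t - a))"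
    using R1(2) R2(2) t
    by (intro close_solutions[where R = "max R1 R2"] K ode_solution_subset[OF sol(1) sub] ode_solution_subset[OF sol(2) sub])
      (force intro: less_imp_le simp: less_max_iff_disj le_max_iff_disj)+
  then show ?thesis by (simp add: eq)
qed

text \<open>The component of \<open>z\<close> orthogonal to \<open>S\<close> has zero derivative and
  starts at zero.\<close>

lemma orthogonal_derivative_stays:
  assumes z: "\<And>t. 0 \<le> t \<Longrightarrow> (z has_vector_derivative z' t) (at t within {0..})" "\<And>t. z' t \<in> S"
    and "z 0 \<in> S" "0 \<le> t"
  shows "z t \<in> S"
proof -
  have "w \<bullet> z t = 0" if w: "w \<in> orthogonal_comp S" for w
  proof -
    have w0: "w \<bullet> x = 0" if "x \<in> S" for x
      using w that by (auto simp: orthogonal_comp_def orthogonal_def inner_commute)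
    have "\<exists>c. \<forall>t\<in>{0..}. w \<bullet> z t = c"
    proof (rule has_derivative_zero_constant)
      fix t :: real assume t: "t \<in> {0..}"
      have "((\<lambda>t. w \<bullet> z t) has_vector_derivative w \<bullet> z' t) (at t within {0..})"
        using bounded_linear.has_vector_derivative[OF bounded_linear_inner_right z(1)] t by auto
      then show "((\<lambda>t. w \<bullet> z t) has_derivative (\<lambda>h. 0)) (at t within {0..})"
        using z(2) w0 by (simp add: has_vector_derivative_def)
    qed simp
    then show ?thesis using w0[OF \<open>z 0 \<in> S\<close>] \<open>0 \<le> t\<close> by force
  qed
  then have "z t \<in> orthogonal_comp (orthogonal_comp S)"
    by (auto simp: orthogonal_comp_def[of "orthogonal_comp S"] orthogonal_def)
  then show ?thesis using orthogonal_comp_self[OF S] by simp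
qed

text \<open>\<open>z\<close> solves the equation with the field composed with the nearest-point projection
  onto the part of \<open>S\<close> in a ball, which is globally Lipschitz.\<close>

lemma solution_in_ball:
  assumes x0: "x0 \<in> S" "norm x0 < R"
  obtains z where "z 0 = x0"
    "\<And>T. \<lbrakk>\<And>t h. \<lbrakk>0 < t; t \<le> T; ode_solution F {0..t} h; h 0 = x0;
        \<And>s. 0 \<le> s \<Longrightarrow> s \<le> t \<Longrightarrow> h s \<in> S \<and> norm (h s) \<le> R\<rbrakk> \<Longrightarrow> norm (h t) < R\<rbrakk>
      \<Longrightarrow> ode_solution F {0..T} z \<and> (\<forall>t\<in>{0..T}. z t \<in> S \<and> norm (z t) < R)"
proof -
  define C where "C = S \<inter> cball 0 R"
  have C: "convex C" "closed C" "C \<noteq> {}"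
    using x0 S by (auto simp: C_def closed_subspace subspace_imp_convex intro!: convex_Int closed_Int)
  obtain K where K: "K > 0" "\<And>x y. norm x \<le> R \<Longrightarrow> norm y \<le> R \<Longrightarrow> norm (F x - F y) \<le> K * norm (x - y)"
    using F_lipschitz by blast
  let ?P = "closest_point C"
  have P: "?P x \<in> C" for x using closest_point_in_set[OF C(2,3)] .
  have "norm (F (?P x) - F (?P y)) \<le> K * norm (x - y)" for x y
  proof -
    have "norm (F (?P x) - F (?P y)) \<le> K * norm (?P x - ?P y)"
      using P[of x] P[of y] by (intro K(2)) (auto simp: C_def)
    also have "\<dots> \<le> K * norm (x - y)"
      using closest_point_lipschitz[OF C, of x y] K(1) by (simp add: dist_norm)
    finally show ?thesis .
  qed
  then obtain z where z: "z 0 = x0" "ode_solution (\<lambda>x. F (?P x)) {0..} z"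
    using picard_lindelof[OF K(1), of "\<lambda>x. F (?P x)" x0] by blast
  have zS: "z t \<in> S" if "0 \<le> t" for t
  proof (rule orthogonal_derivative_stays[where z' = "\<lambda>t. F (?P (z t))", OF _ _ _ that])
    show "F (?P (z t)) \<in> S" for t using P[of "z t"] invariant by (auto simp: C_def F_def)
  qed (use z x0 in \<open>auto simp: ode_solution_def\<close>)
  \<comment> \<open>As long as \<open>z\<close> stays in the ball the projection leaves it fixed, so
    \<open>z\<close> solves the original equation.\<close>
  have sol: "ode_solution F {0..t} z" if "\<And>s. 0 \<le> s \<Longrightarrow> s \<le> t \<Longrightarrow> norm (z s) \<le> R" for t
  proof (rule ode_solution_cong)
    show "ode_solution (\<lambda>x. F (?P x)) {0..t} z" by (rule ode_solution_subset[OF z(2)]) auto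
    show "F (?P (z s)) = F (z s)" if "s \<in> {0..t}" for s
      using that zS \<open>\<And>s. 0 \<le> s \<Longrightarrow> s \<le> t \<Longrightarrow> norm (z s) \<le> R\<close> by (subst closest_point_self) (auto simp: C_def)
  qed
  have zc: "continuous_on {0..T} z" for T
    by (rule continuous_on_subset[OF ode_solution_continuous[OF z(2)]]) auto
  \<comment> \<open>The a priori bound concerns arbitrary solutions; it is applied to
    \<open>z\<close>, which is one up to the time reached so far. The same \<open>z\<close> serves
    every \<open>T\<close>, which later gives solutions on the half line.\<close>
  have "ode_solution F {0..T} z \<and> (\<forall>t\<in>{0..T}. z t \<in> S \<and> norm (z t) < R)"
    if hyp: "\<And>t h. \<lbrakk>0 < t; t \<le> T; ode_solution F {0..t} h; h 0 = x0;
        \<And>s. 0 \<le> s \<Longrightarrow> s \<le> t \<Longrightarrow> h s \<in> S \<and> norm (h s) \<le> R\<rbrakk> \<Longrightarrow> norm (h t) < R" for T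
  proof -
    have lt: "norm (z t) < R" if "0 \<le> t" "t \<le> T" for t
    proof -
      have "R - norm (z t) > 0"
      proof (rule positive_propagation[OF _ _ _ that])
        show "continuous_on {0..T} (\<lambda>t. R - norm (z t))" by (intro continuous_intros zc)
        fix t assume t: "0 < t" "t \<le> T" and pos: "\<And>s. 0 \<le> s \<Longrightarrow> s < t \<Longrightarrow> R - norm (z s) > 0"
        have "norm (z t) \<le> R"
        proof (rule continuous_le_on_closure[where f = "\<lambda>t. norm (z t)" and S = "{0..<t}"])
          show "continuous_on (closure {0..<t}) (\<lambda>t. norm (z t))"
            using t by (intro continuous_intros continuous_on_subset[OF zc[of t]]) auto
        qed (use t pos in \<open>auto simp: less_imp_le\<close>)
        then have "norm (z s) \<le> R" if "0 \<le> s" "s \<le> t" for s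
          using that pos[of s] by (cases "s = t") auto
        then show "R - norm (z t) > 0"
          using hyp[OF t sol z(1)] zS by auto
      qed (use z x0 in auto)
      then show ?thesis by simp
    qed
    then show ?thesis using sol[of T] zS by (auto simp: less_imp_le)
  qed
  with z(1) that show thesis by blast
qed

text \<open>Invariance is clear only for solutions constructed inside \<open>S\<close>.
  \<open>solution_in_ball\<close> provides one with the same initial value, with a radius taken from
  a bound on \<open>h\<close>, and uniqueness identifies the two.\<close>

lemma solution_stays_in_subspace:
  assumes sol: "ode_solution F {0..T} h" and "h 0 \<in> S" and t: "0 \<le> t" "t \<le> T"
  shows "h t \<in> S"
proof -
  obtain R where "R > 0" and R: "\<And>t. 0 \<le> t \<Longrightarrow> t \<le> T \<Longrightarrow> norm (h t) < R" using bounded_solution[OF sol] by blast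
  have "norm (h 0) < R" using R[of 0] t by auto
  then obtain z where z: "z 0 = h 0"
    "\<And>T. \<lbrakk>\<And>t k. \<lbrakk>0 < t; t \<le> T; ode_solution F {0..t} k; k 0 = h 0;
        \<And>s. 0 \<le> s \<Longrightarrow> s \<le> t \<Longrightarrow> k s \<in> S \<and> norm (k s) \<le> R\<rbrakk> \<Longrightarrow> norm (k t) < R\<rbrakk>
      \<Longrightarrow> ode_solution F {0..T} z \<and> (\<forall>t\<in>{0..T}. z t \<in> S \<and> norm (z t) < R)"
    using solution_in_ball[OF \<open>h 0 \<in> S\<close>] by blast
  have "ode_solution F {0..T} z \<and> (\<forall>t\<in>{0..T}. z t \<in> S \<and> norm (z t) < R)"
  proof (rule z(2))
    fix u k assume u: "0 < u" "u \<le> T" and k: "ode_solution F {0..u} k" "k 0 = h 0"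
    have "ode_solution F {0..u} h" by (rule ode_solution_subset[OF sol]) (use u in auto)
    from unique_solution[OF k(1) this k(2), of u] R[of u] u show "norm (k u) < R" by simp
  qed
  then have "ode_solution F {0..T} z" "z t \<in> S" using t by auto
  then show ?thesis using unique_solution[OF sol, of z t] z(1) t by simp
qed

end

text \<open>\<open>Q\<close> is a Lyapunov form for the linear part. The derivative of
  \<open>Q h h\<close> along \<open>L\<close> is at most \<open>- 4 * \<omega> * Q h h\<close>; half
  of this pays for the quadratic term near the equilibrium, and the remaining
  \<open>- 2 * \<omega> * Q h h\<close> makes the norm decay at rate
  \<open>\<omega>\<close>.\<close>

locale stable_quadratic_ode = quadratic_ode +
  fixes Q :: "'a \<Rightarrow> 'a \<Rightarrow> real" and c \<omega> :: real
  assumes Q: "bounded_bilinear Q" and Q_sym: "Q x y = Q y x"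
    and c: "c > 0" "\<And>h. c * (norm h)\<^sup>2 \<le> Q h h"
    and \<omega>: "\<omega> > 0" "\<And>h. h \<in> S \<Longrightarrow> Q h (L h) \<le> - 2 * \<omega> * Q h h"
begin

text \<open>For the real and imaginary parts \<open>u\<close>, \<open>v\<close> of an eigenvector
  the terms with \<open>Im z\<close> cancel by symmetry of \<open>Q\<close>. What is left is
  \<open>Re z * (Q u u + Q v v)\<close>, which dissipation bounds by a negative number.\<close>

lemma eigenvalue_neg:
  assumes "eigenvalue_on S L z"
  shows "Re z < 0"
proof -
  interpret Q: bounded_bilinear Q by (rule Q)
  obtain u v where uv: "u \<in> S" "v \<in> S" "\<not> (u = 0 \<and> v = 0)"
    "L u = Re z *\<^sub>R u - Im z *\<^sub>R v" "L v = Im z *\<^sub>R u + Re z *\<^sub>R v"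
    using assms by (auto simp: eigenvalue_on_def)
  have "Q u (L u) + Q v (L v) = Re z * (Q u u + Q v v)"
    unfolding uv(4,5) by (simp add: Q.diff_right Q.add_right Q.scaleR_right Q_sym[of v u] algebra_simps)
  then have "Re z * (Q u u + Q v v) \<le> - 2 * \<omega> * (Q u u + Q v v)"
    using \<omega>(2)[OF uv(1)] \<omega>(2)[OF uv(2)] by (simp add: algebra_simps)
  moreover have "Q u u + Q v v > 0"
  proof -
    have "c * (norm u)\<^sup>2 + c * (norm v)\<^sup>2 > 0"
      using uv(3) c(1) by (auto simp: add_pos_nonneg add_nonneg_pos)
    then show ?thesis using c(2)[of u] c(2)[of v] by linarith
  qed
  ultimately have "Re z + 2 * \<omega> \<le> 0"
    using mult_pos_pos[of "Re z + 2 * \<omega>" "Q u u + Q v v"] by (force simp: distrib_right not_le[symmetric])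
  then show ?thesis using \<omega>(1) by simp
qed

text \<open>The constants precede the interval and the solution, so the decay can be started at any
  time and for any neighbouring solution. Both the rate of convergence and the openness of the basin
  rest on that.\<close>

lemma local_decay:
  obtains r \<rho> D where "r > 0" "\<rho> > 0"
    "\<And>a b h t. \<lbrakk>ode_solution F {a..b} h; \<And>s. a \<le> s \<Longrightarrow> s \<le> b \<Longrightarrow> h s \<in> S; norm (h a) < \<rho>; a \<le> t; t \<le> b\<rbrakk>
      \<Longrightarrow> norm (h t) < r \<and> norm (h t) \<le> D * norm (h a) * exp (- \<omega> * (t - a))"
proof -
  interpret Q: bounded_bilinear Q by (rule Q)
  interpret \<beta>: bounded_bilinear \<beta> by (rule \<beta>)
  obtain B where B: "B > 0" "\<And>x y. norm (\<beta> x y) \<le> norm x * norm y * B" using \<beta>.pos_bounded by blast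
  obtain C where C: "C > 0" "\<And>x y. norm (Q x y) \<le> norm x * norm y * C" using Q.pos_bounded by blast
  \<comment> \<open>In the ball of radius \<open>r\<close> the quadratic term consumes at most half
    of the dissipation. \<open>Q\<close> is comparable with the squared norm up to the factors
    \<open>c\<close> and \<open>C\<close>; \<open>\<rho>\<close> and \<open>D\<close> account for
    their ratio, so that a solution starting within \<open>\<rho>\<close> stays in that
    ball.\<close>
  define r where "r = \<omega> * c / (B * C)"
  define \<rho> where "\<rho> = r * sqrt (c / C)"
  define D where "D = sqrt (C / c)"
  have pos: "r > 0" "\<rho> > 0" "D > 0" using \<omega>(1) c(1) B(1) C(1) by (auto simp: r_def \<rho>_def D_def)
  have field: "Q h (F h) \<le> - \<omega> * Q h h" if "h \<in> S" "norm h \<le> r" for h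
  proof -
    have "Q h (\<beta> h h) \<le> norm h * norm (\<beta> h h) * C" using C(2)[of h "\<beta> h h"] by simp
    also have "\<dots> \<le> norm h * (norm h * norm h * B) * C"
      using B C by (intro mult_right_mono mult_left_mono) auto
    also have "\<dots> = norm h * ((norm h)\<^sup>2 * (B * C))" by (simp add: power2_eq_square)
    also have "\<dots> \<le> r * ((norm h)\<^sup>2 * (B * C))"
      using that B C by (intro mult_right_mono) auto
    also have "\<dots> = \<omega> * (c * (norm h)\<^sup>2)" using B C by (simp add: r_def)
    also have "\<dots> \<le> \<omega> * Q h h" using c \<omega>(1) by simp
    finally show ?thesis using \<omega>(2)[OF that(1)] by (simp add: F_def Q.add_right)
  qed
  have main: "norm (h t) < r \<and> norm (h t) \<le> D * norm (h a) * exp (- \<omega> * (t - a))"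
    if sol: "ode_solution F {a..b} h" and hS: "\<And>s. a \<le> s \<Longrightarrow> s \<le> b \<Longrightarrow> h s \<in> S"
      and ha: "norm (h a) < \<rho>" and t: "a \<le> t" "t \<le> b" for a b h t
  proof -
    have hc: "continuous_on {a..b} h" by (rule ode_solution_continuous[OF sol])
    have decay: "norm (h t) \<le> D * norm (h a) * exp (- \<omega> * (t - a))"
      if t: "a \<le> t" "t \<le> b" and small: "\<And>s. a \<le> s \<Longrightarrow> s < t \<Longrightarrow> norm (h s) \<le> r" for t
    proof -
      have "Q (h t) (h t) \<le> Q (h a) (h a) * exp ((- 2 * \<omega>) * (t - a))"
      proof (rule gronwall[where V = "\<lambda>t. Q (h t) (h t)" and V' = "\<lambda>t. 2 * Q (h t) (F (h t))", OF t(1)])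
        show "continuous_on {a..t} (\<lambda>t. Q (h t) (h t))"
          using t by (intro Q.continuous_on continuous_on_subset[OF hc]) auto
        fix s assume s: "a < s" "s < t"
        have "(h has_vector_derivative F (h s)) (at s)" using ode_solution_at[OF sol, of s] s t by simp
        from Q.has_vector_derivative[OF this this]
        show "((\<lambda>t. Q (h t) (h t)) has_real_derivative 2 * Q (h s) (F (h s))) (at s)"
          by (simp add: has_real_derivative_iff_has_vector_derivative Q_sym)
        show "2 * Q (h s) (F (h s)) \<le> (- 2 * \<omega>) * Q (h s) (h s)"
          using field[OF hS small, of s] s t by simp
      qed
      moreover have "Q (h a) (h a) \<le> C * (norm (h a))\<^sup>2"
        using C(2)[of "h a" "h a"] by (simp add: power2_eq_square mult_ac)
      then have "Q (h a) (h a) * exp ((- 2 * \<omega>) * (t - a)) \<le> C * (norm (h a))\<^sup>2 * exp ((- 2 * \<omega>) * (t - a))"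
        by (intro mult_right_mono) auto
      moreover have "exp ((- 2 * \<omega>) * (t - a)) = (exp (- \<omega> * (t - a)))\<^sup>2"
        by (simp add: power2_eq_square flip: exp_add)
      ultimately have "Q (h t) (h t) \<le> C * (norm (h a))\<^sup>2 * (exp (- \<omega> * (t - a)))\<^sup>2"
        by (metis order_trans)
      then have "c * (norm (h t))\<^sup>2 \<le> C * (norm (h a))\<^sup>2 * (exp (- \<omega> * (t - a)))\<^sup>2"
        using c(2)[of "h t"] by linarith
      then have "(norm (h t))\<^sup>2 \<le> (C * (norm (h a))\<^sup>2 * (exp (- \<omega> * (t - a)))\<^sup>2) / c"
        using c(1) by (simp only: pos_le_divide_eq mult.commute[of c])
      also have "\<dots> = (C / c) * (norm (h a))\<^sup>2 * (exp (- \<omega> * (t - a)))\<^sup>2"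
        by simp
      also have "\<dots> = (D * norm (h a) * exp (- \<omega> * (t - a)))\<^sup>2"
        using c(1) C(1) by (simp add: D_def power_mult_distrib)
      finally show ?thesis by (rule power2_le_imp_le) (use pos in simp)
    qed
    have small: "D * norm (h a) * exp (- \<omega> * (t - a)) < r" if "a \<le> t" for t
    proof -
      have "D * norm (h a) * exp (- \<omega> * (t - a)) \<le> D * norm (h a) * 1"
        using pos that \<omega>(1) by (intro mult_left_mono) auto
      also have "\<dots> < D * \<rho>" using ha pos by simp
      also have "\<dots> = r * (sqrt (C / c) * sqrt (c / C))" by (simp add: D_def \<rho>_def)
      also have "\<dots> = r" using c(1) C(1) by (simp flip: real_sqrt_mult)
      finally show ?thesis .
    qed
    \<comment> \<open>Both bounds on \<open>Q\<close> at a unit vector; it gives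
      \<open>\<rho> \<le> r\<close>, which is the initial case of the propagation below.\<close>
    have "c \<le> C"
    proof -
      obtain x :: 'a where "norm x = 1" using SOME_Basis norm_Basis by blast
      then show ?thesis using c(2)[of x] C(2)[of x x] by simp
    qed
    then have "\<rho> \<le> r" using pos(1) c(1) C(1) by (simp add: \<rho>_def)
    have lt: "norm (h t) < r" if "a \<le> t" "t \<le> b" for t
    proof -
      have "r - norm (h t) > 0"
      proof (rule positive_propagation[OF _ _ _ that])
        show "continuous_on {a..b} (\<lambda>t. r - norm (h t))" by (intro continuous_intros hc)
        show "0 < r - norm (h a)" using ha \<open>\<rho> \<le> r\<close> by simp
        show "0 < r - norm (h t)" if "a < t" "t \<le> b" "\<And>s. a \<le> s \<Longrightarrow> s < t \<Longrightarrow> 0 < r - norm (h s)" for t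
          using decay[of t] small[of t] that by force
      qed
      then show ?thesis by simp
    qed
    show ?thesis using decay[OF t] lt t by (simp add: less_imp_le)
  qed
  from that[OF pos(1,2) main] show thesis .
qed

text \<open>Coordinates shifted to the equilibrium \<open>e\<close>. \<open>P\<close> will be the
  set of positive definite states, which is not a subspace; only the differences
  \<open>x - e\<close> lie in \<open>S\<close>.\<close>

context
  fixes f :: "'a \<Rightarrow> 'a" and e :: 'a and P :: "'a set"
  assumes f: "\<And>h. f (e + h) = F h" and P: "\<And>x. x \<in> P \<Longrightarrow> x - e \<in> S"
begin

lemma ode_solution_shift: "ode_solution f I \<phi> \<longleftrightarrow> ode_solution F I (\<lambda>t. \<phi> t - e)"
proof -
  have "f x = F (x - e)" for x using f[of "x - e"] by simp
  moreover have "((\<lambda>t. \<phi> t - e) has_vector_derivative y) (at t within I) \<longleftrightarrow> (\<phi> has_vector_derivative y) (at t within I)" for t y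
    using has_vector_derivative_diff_const[of \<phi> e y "at t within I"] by simp
  ultimately show ?thesis by (simp add: ode_solution_def)
qed

lemma equilibrium_in_basin: "e \<in> P \<Longrightarrow> e \<in> basin f P e"
proof -
  interpret \<beta>: bounded_bilinear \<beta> by (rule \<beta>)
  have "f e = 0" using f[of 0] by (simp add: F_def linear_0[OF L] \<beta>.zero_left)
  then show "e \<in> P \<Longrightarrow> e \<in> basin f P e"
    unfolding basin_def ode_solution_def by (auto intro!: exI[of _ "\<lambda>_. e"])
qed

text \<open>\<open>basin\<close> provides some convergent solution; by uniqueness every solution
  with that initial value is the same one.\<close>

lemma basin_solution:
  assumes x: "x \<in> basin f P e" and \<phi>: "ode_solution f {0..} \<phi>" "\<phi> 0 = x"
  shows "(\<phi> \<longlongrightarrow> e) at_top" "\<And>t. 0 \<le> t \<Longrightarrow> \<phi> t - e \<in> S"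
proof -
  obtain \<psi> where \<psi>: "ode_solution f {0..} \<psi>" "\<psi> 0 = x" "(\<psi> \<longlongrightarrow> e) at_top" and "x \<in> P"
    using x by (auto simp: basin_def)
  have sol: "ode_solution F {0..t} (\<lambda>t. \<phi> t - e)" "ode_solution F {0..t} (\<lambda>t. \<psi> t - e)" for t
    using \<phi>(1) \<psi>(1) unfolding ode_solution_shift by (auto intro: ode_solution_subset)
  have "\<psi> t = \<phi> t" if "0 \<le> t" for t
    using unique_solution[OF sol, of t t] \<phi>(2) \<psi>(2) that by simp
  then have "eventually (\<lambda>t. \<psi> t = \<phi> t) at_top"
    by (rule eventually_mono[OF eventually_ge_at_top])
  then show "(\<phi> \<longlongrightarrow> e) at_top" using \<psi>(3) by (rule Lim_transform_eventually[rotated])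
  show "\<phi> t - e \<in> S" if "0 \<le> t" for t
    using solution_stays_in_subspace[OF sol(1), of t t] P[OF \<open>x \<in> P\<close>] \<phi>(2) that by simp
qed

text \<open>The solution enters the ball of \<open>local_decay\<close> at some time \<open>T\<close>
  and decays at rate \<open>\<omega>\<close> from there on. The bounded initial phase only enlarges
  \<open>K\<close>.\<close>

lemma basin_rate:
  assumes x: "x \<in> basin f P e" and \<phi>: "ode_solution f {0..} \<phi>" "\<phi> 0 = x"
  shows "\<exists>K. \<forall>t\<ge>0. dist (\<phi> t) e \<le> K * exp (- \<omega> * t)"
proof -
  obtain r \<rho> D where rD: "r > 0" "\<rho> > 0"
    "\<And>a b h t. \<lbrakk>ode_solution F {a..b} h; \<And>s. a \<le> s \<Longrightarrow> s \<le> b \<Longrightarrow> h s \<in> S; norm (h a) < \<rho>; a \<le> t; t \<le> b\<rbrakk>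
      \<Longrightarrow> norm (h t) < r \<and> norm (h t) \<le> D * norm (h a) * exp (- \<omega> * (t - a))"
    using local_decay by blast
  note lim = basin_solution[OF x \<phi>]
  let ?h = "\<lambda>t. \<phi> t - e"
  have sol: "ode_solution F {a..b} ?h" if "0 \<le> a" for a b
    using \<phi>(1) that unfolding ode_solution_shift by (auto intro: ode_solution_subset)
  have "\<forall>\<^sub>F t in at_top. dist (\<phi> t) e < \<rho>" using lim(1) rD(2) by (rule tendstoD)
  then obtain T0 where "\<And>t. t \<ge> T0 \<Longrightarrow> dist (\<phi> t) e < \<rho>" by (auto simp: eventually_at_top_linorder)
  then obtain T where T: "T \<ge> 0" "norm (?h T) < \<rho>" by (metis dist_norm max.cobounded1 max.cobounded2)
  obtain R where R: "R > 0" "\<And>t. 0 \<le> t \<Longrightarrow> t \<le> T \<Longrightarrow> norm (?h t) < R"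
    using bounded_solution[OF sol[of 0 T]] by auto
  define K where "K = max (R * exp (\<omega> * T)) (D * norm (?h T) * exp (\<omega> * T))"
  have "dist (\<phi> t) e \<le> K * exp (- \<omega> * t)" if "t \<ge> 0" for t
  proof (cases "t \<le> T")
    case True
    have "norm (?h t) \<le> R * 1" using R(2)[OF that True] by simp
    also have "\<dots> \<le> R * exp (\<omega> * T - \<omega> * t)" using R(1) \<omega>(1) True by (intro mult_left_mono) auto
    also have "\<dots> = (R * exp (\<omega> * T)) * exp (- \<omega> * t)" by (simp flip: exp_add)
    also have "\<dots> \<le> K * exp (- \<omega> * t)" by (intro mult_right_mono) (auto simp: K_def)
    finally show ?thesis by (simp add: dist_norm)
  next
    case False
    have "norm (?h t) \<le> D * norm (?h T) * exp (- \<omega> * (t - T))"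
      using rD(3)[OF sol[of T t] _ T(2), of t] False T(1) lim(2) by simp
    also have "exp (- \<omega> * (t - T)) = exp (\<omega> * T) * exp (- \<omega> * t)" by (simp add: algebra_simps flip: exp_add)
    also have "D * norm (?h T) * (exp (\<omega> * T) * exp (- \<omega> * t)) \<le> K * exp (- \<omega> * t)"
      unfolding mult.assoc[symmetric] by (intro mult_right_mono) (auto simp: K_def)
    finally show ?thesis by (simp add: dist_norm)
  qed
  then show ?thesis by blast
qed

text \<open>The reference solution is within \<open>\<rho> / 2\<close> of \<open>e\<close> at time
  \<open>T\<close>. Continuous dependence keeps nearby solutions within \<open>\<rho> / 2\<close> of
  it until then, so they enter the ball of \<open>local_decay\<close>. That they exist so long is
  not given beforehand and comes from \<open>solution_in_ball\<close>.\<close>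

lemma basin_open: "openin (top_of_set P) (basin f P e)"
  unfolding openin_contains_ball
proof (intro conjI ballI)
  show "basin f P e \<subseteq> P" by (auto simp: basin_def)
  fix x assume x: "x \<in> basin f P e"
  then obtain \<phi> where \<phi>: "ode_solution f {0..} \<phi>" "\<phi> 0 = x" by (auto simp: basin_def)
  obtain r \<rho> D where rD: "r > 0" "\<rho> > 0"
    "\<And>a b h t. \<lbrakk>ode_solution F {a..b} h; \<And>s. a \<le> s \<Longrightarrow> s \<le> b \<Longrightarrow> h s \<in> S; norm (h a) < \<rho>; a \<le> t; t \<le> b\<rbrakk>
      \<Longrightarrow> norm (h t) < r \<and> norm (h t) \<le> D * norm (h a) * exp (- \<omega> * (t - a))"
    using local_decay by blast
  note lim = basin_solution[OF x \<phi>]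
  let ?h = "\<lambda>t. \<phi> t - e"
  have sol: "ode_solution F {0..b} ?h" for b
    using \<phi>(1) unfolding ode_solution_shift by (auto intro: ode_solution_subset)
  have "\<forall>\<^sub>F t in at_top. dist (\<phi> t) e < \<rho> / 2" using lim(1) rD(2) by (intro tendstoD) auto
  then obtain T0 where "\<And>t. t \<ge> T0 \<Longrightarrow> dist (\<phi> t) e < \<rho> / 2" by (auto simp: eventually_at_top_linorder)
  then obtain T where T: "T \<ge> 0" "norm (?h T) < \<rho> / 2" by (metis dist_norm max.cobounded1 max.cobounded2)
  obtain R0 where R0: "R0 > 0" "\<And>t. 0 \<le> t \<Longrightarrow> t \<le> T \<Longrightarrow> norm (?h t) < R0"
    using bounded_solution[OF sol[of T]] by auto
  \<comment> \<open>Beyond what nearby solutions can reach: less than \<open>R0 + \<rho> / 2\<close>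
    up to time \<open>T\<close>, and less than \<open>r\<close> afterwards.\<close>
  define R where "R = R0 + r + \<rho>"
  obtain K where K: "K > 0" "\<And>x y. norm x \<le> R \<Longrightarrow> norm y \<le> R \<Longrightarrow> norm (F x - F y) \<le> K * norm (x - y)"
    using F_lipschitz by blast
  \<comment> \<open>Compensates the Gronwall factor \<open>exp (K * T)\<close>.\<close>
  define \<delta> where "\<delta> = \<rho> / 2 * exp (- K * T)"
  have "\<delta> > 0" using rD(2) by (simp add: \<delta>_def)
  have "\<delta> \<le> \<rho> / 2 * 1" unfolding \<delta>_def using rD(2) K(1) T(1) by (intro mult_left_mono) auto
  have "y \<in> basin f P e" if y: "y \<in> P" "dist x y < \<delta>" for y
  proof -
    let ?y0 = "y - e"
    have hR: "norm (?h t) < R" if "0 \<le> t" "t \<le> T" for t using R0 rD that by (force simp: R_def)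
    have d0: "norm (?y0 - ?h 0) < \<delta>" using y(2) \<phi>(2) by (simp add: dist_norm norm_minus_commute)
    have y0R: "norm ?y0 < R"
    proof -
      have "norm ?y0 \<le> norm (?h 0) + norm (?y0 - ?h 0)" using norm_triangle_sub by blast
      then show ?thesis using d0 R0(2)[of 0] T(1) \<open>\<delta> \<le> \<rho> / 2 * 1\<close> rD by (simp add: R_def)
    qed
    have near: "norm (k t - ?h t) < \<rho> / 2"
      if k: "ode_solution F {0..t} k" "k 0 = ?y0" "\<And>s. 0 \<le> s \<Longrightarrow> s \<le> t \<Longrightarrow> norm (k s) \<le> R" and t: "0 \<le> t" "t \<le> T" for k t
    proof -
      have "norm (k t - ?h t) \<le> norm (k 0 - ?h 0) * exp (K * (t - 0))"
        using hR t by (intro close_solutions[OF K(2) t(1) k(1) sol k(3)]) (auto simp: less_imp_le)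
      also have "\<dots> \<le> norm (k 0 - ?h 0) * exp (K * T)"
        using K(1) t by (intro mult_left_mono) auto
      also have "\<dots> < \<delta> * exp (K * T)" using d0 k(2) by simp
      also have "\<dots> = \<rho> / 2" by (simp add: \<delta>_def mult.assoc flip: exp_add)
      finally show ?thesis .
    qed
    have tail: "norm (k t) < r \<and> norm (k t) \<le> D * norm (k T) * exp (- \<omega> * (t - T))"
      if k: "ode_solution F {0..t} k" "k 0 = ?y0" "\<And>s. 0 \<le> s \<Longrightarrow> s \<le> t \<Longrightarrow> k s \<in> S \<and> norm (k s) \<le> R" and t: "T \<le> t" for k t
    proof (rule rD(3)[where b = t])
      show "ode_solution F {T..t} k" by (rule ode_solution_subset[OF k(1)]) (use T in auto)
      have "ode_solution F {0..T} k" by (rule ode_solution_subset[OF k(1)]) (use t in auto)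
      then have "norm (k T - ?h T) < \<rho> / 2" using k T t by (intro near) auto
      moreover have "norm (k T) \<le> norm (?h T) + norm (k T - ?h T)" using norm_triangle_sub by blast
      ultimately show "norm (k T) < \<rho>" using T(2) by linarith
    qed (use t T k in auto)
    obtain z where z: "z 0 = ?y0"
      "\<And>T. \<lbrakk>\<And>t k. \<lbrakk>0 < t; t \<le> T; ode_solution F {0..t} k; k 0 = ?y0;
        \<And>s. 0 \<le> s \<Longrightarrow> s \<le> t \<Longrightarrow> k s \<in> S \<and> norm (k s) \<le> R\<rbrakk> \<Longrightarrow> norm (k t) < R\<rbrakk>
      \<Longrightarrow> ode_solution F {0..T} z \<and> (\<forall>t\<in>{0..T}. z t \<in> S \<and> norm (z t) < R)"
      using solution_in_ball[OF P[OF y(1)] y0R] by blast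
    have zsol: "ode_solution F {0..T'} z \<and> (\<forall>t\<in>{0..T'}. z t \<in> S \<and> norm (z t) < R)" for T'
    proof (rule z(2))
      fix t k assume t: "0 < t" "t \<le> T'" and k: "ode_solution F {0..t} k" "k 0 = ?y0"
        "\<And>s. 0 \<le> s \<Longrightarrow> s \<le> t \<Longrightarrow> k s \<in> S \<and> norm (k s) \<le> R"
      show "norm (k t) < R"
      proof (cases "t \<le> T")
        case True
        have "norm (k t) \<le> norm (?h t) + norm (k t - ?h t)" using norm_triangle_sub by blast
        then show ?thesis using near[OF k(1,2) _ _ True] k(3) t R0(2)[of t] True rD by (force simp: R_def)
      next
        case False
        then show ?thesis using tail[OF k] R0(1) rD by (force simp: R_def)
      qed
    qed
    let ?\<psi> = "\<lambda>t. z t + e"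
    have "ode_solution f {0..} ?\<psi>"
      unfolding ode_solution_shift using zsol by (intro ode_solution_half_line) auto
    moreover have "(?\<psi> \<longlongrightarrow> e) at_top"
    proof -
      have "((\<lambda>t. norm (z t)) \<longlongrightarrow> 0) at_top"
      proof (rule tendsto_sandwich[where f = "\<lambda>_. 0" and h = "\<lambda>t. D * norm (z T) * exp (- \<omega> * (t - T))"])
        have "norm (z t) \<le> D * norm (z T) * exp (- \<omega> * (t - T))" if "t \<ge> T" for t
          using tail[of t z] zsol[of t] z(1) that by (auto simp: less_imp_le)
        then show "\<forall>\<^sub>F t in at_top. norm (z t) \<le> D * norm (z T) * exp (- \<omega> * (t - T))"
          by (rule eventually_mono[OF eventually_ge_at_top])
        have "((\<lambda>t. exp (- \<omega> * (t - T))) \<longlongrightarrow> 0) at_top"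
        proof (rule filterlim_compose[OF exp_at_bot], unfold filterlim_at_bot, intro allI)
          fix Z
          show "\<forall>\<^sub>F t in at_top. - \<omega> * (t - T) \<le> Z"
            using eventually_ge_at_top[of "T - Z / \<omega>"]
            by (rule eventually_mono) (use \<omega>(1) in \<open>simp add: field_simps\<close>)
        qed
        from tendsto_mult_right_zero[OF this]
        show "((\<lambda>t. D * norm (z T) * exp (- \<omega> * (t - T))) \<longlongrightarrow> 0) at_top" .
      qed auto
      then have "(z \<longlongrightarrow> 0) at_top" by (simp add: tendsto_norm_zero_iff)
      from tendsto_add[OF this tendsto_const[of e]] show ?thesis by simp
    qed
    ultimately show ?thesis using y(1) z(1) unfolding basin_def
      by (auto intro!: exI[of _ ?\<psi>])
  qed
  then show "\<exists>\<delta>>0. ball x \<delta> \<inter> P \<subseteq> basin f P e" using \<open>\<delta> > 0\<close> by (intro exI[of _ \<delta>]) auto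
qed

end

end

section \<open>Linear stability of the moment equations\<close>

lemma (in stable_quadratic_ode) linearization:
  assumes f: "\<And>h. f (e + h) = F h"
  shows "(f has_derivative L) (at e)"
proof -
  interpret \<beta>: bounded_bilinear \<beta> by (rule \<beta>)
  have "f = (\<lambda>x. L (x - e) + \<beta> (x - e) (x - e))"
  proof
    show "f x = L (x - e) + \<beta> (x - e) (x - e)" for x using f[of "x - e"] by (simp add: F_def)
  qed
  moreover have "bounded_linear L" using L by (simp add: linear_conv_bounded_linear)
  then have "((\<lambda>x. L (x - e) + \<beta> (x - e) (x - e)) has_derivative L) (at e)"
    by (auto intro!: derivative_eq_intros bounded_linear.has_derivative[of L] \<beta>.FDERIV
        simp: \<beta>.zero_left \<beta>.zero_right)
  ultimately show ?thesis by simp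
qed

section \<open>Covariance matrices in block form\<close>

lemma sum_sum_type: "(\<Sum>a\<in>UNIV. f a) = (\<Sum>i\<in>UNIV. f (Inl i)) + (\<Sum>i\<in>UNIV. f (Inr i))"
  for f :: "'n::finite + 'm::finite \<Rightarrow> real"
  using sum.Plus[of UNIV UNIV f] by (simp add: UNIV_Plus_UNIV)

lemma sym_cov_block: "sym_mat (cov_block Cq Cp Cqp) \<longleftrightarrow> sym_mat Cq \<and> sym_mat Cp"
proof
  show "sym_mat (cov_block Cq Cp Cqp)" if "sym_mat Cq \<and> sym_mat Cp"
    using that by (auto simp: sym_mat_def transpose_def cov_block_def vec_eq_iff split: sum.splits)
next
  assume *: "sym_mat (cov_block Cq Cp Cqp)"
  have "cov_block Cq Cp Cqp $ a $ b = cov_block Cq Cp Cqp $ b $ a" for a b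
    using *[unfolded sym_mat_def] by (metis (no_types, lifting) transpose_def vec_lambda_beta)
  from this[of "Inl _" "Inl _"] this[of "Inr _" "Inr _"]
  show "sym_mat Cq \<and> sym_mat Cp"
    by (simp add: cov_block_def sym_mat_def transpose_def vec_eq_iff)
qed

lemma cov_block_quadratic_form:
  fixes z :: "real^('n::finite + 'n)" and Cqp :: "real^'n^'n"
  defines "u \<equiv> \<chi> i. z $ Inl i" and "v \<equiv> \<chi> i. z $ Inr i"
  shows "z \<bullet> (cov_block Cq Cp Cqp *v z) = u \<bullet> (Cq *v u) + 2 * (u \<bullet> (Cqp *v v)) + v \<bullet> (Cp *v v)"
proof -
  have "z \<bullet> (cov_block Cq Cp Cqp *v z) = u \<bullet> (Cq *v u) + u \<bullet> (Cqp *v v) + (v \<bullet> (transpose Cqp *v u) + v \<bullet> (Cp *v v))"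
    by (simp add: inner_vec_def sum_sum_type matrix_vector_mult_def cov_block_def u_def v_def
        distrib_left sum.distrib)
  also have "v \<bullet> (transpose Cqp *v u) = u \<bullet> (Cqp *v v)"
    by (simp add: inner_commute inner_matrix_transpose[symmetric])
  finally show ?thesis by simp
qed

text \<open>Tests the block matrix on vectors supported in the first block.\<close>

lemma cov_block_component:
  shows "psd_mat (cov_block Cq Cp Cqp) \<Longrightarrow> psd_mat Cq" "pd_mat (cov_block Cq Cp Cqp) \<Longrightarrow> pd_mat Cq"
proof -
  define z :: "real^'a \<Rightarrow> real^('a::finite + 'a)" where "z u = (\<chi> a. case a of Inl i \<Rightarrow> u $ i | Inr i \<Rightarrow> 0)" for u
  have q: "z u \<bullet> (cov_block Cq Cp Cqp *v z u) = u \<bullet> (Cq *v u)" for u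
    unfolding cov_block_quadratic_form by (simp add: z_def) (simp add: zero_vec_def[symmetric])
  have z0: "z u \<noteq> 0" if u: "u \<noteq> 0" for u
  proof -
    obtain i where "u $ i \<noteq> 0" using u by (metis vec_eq_iff zero_index)
    then have "z u $ Inl i \<noteq> 0" by (simp add: z_def)
    then show ?thesis by (metis zero_index)
  qed
  show "psd_mat (cov_block Cq Cp Cqp) \<Longrightarrow> psd_mat Cq"
    unfolding psd_mat_def sym_cov_block using q by metis
  show "pd_mat (cov_block Cq Cp Cqp) \<Longrightarrow> pd_mat Cq"
    unfolding pd_mat_def sym_cov_block using q z0 by metis
qed

lemma pd_cov_block_diagonal: "pd_mat B \<Longrightarrow> pd_mat (cov_block B B 0)"
  unfolding pd_mat_def sym_cov_block
proof (intro conjI allI impI; (elim conjE)?)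
  fix z :: "real^('a::finite + 'a)"
  assume z: "z \<noteq> 0" and B: "\<forall>x. x \<noteq> 0 \<longrightarrow> 0 < x \<bullet> (B *v x)"
  let ?u = "\<chi> i. z $ Inl i" and ?v = "\<chi> i. z $ Inr i"
  have B0: "0 \<le> x \<bullet> (B *v x)" for x using B by (cases "x = 0") (auto simp: less_imp_le)
  obtain a where "z $ a \<noteq> 0" using z by (auto simp: vec_eq_iff)
  then have "?u \<noteq> 0 \<or> ?v \<noteq> 0" by (cases a) (auto simp: vec_eq_iff)
  then show "0 < z \<bullet> (cov_block B B 0 *v z)"
    unfolding cov_block_quadratic_form using B B0[of ?u] B0[of ?v]
    by (auto simp: add_pos_nonneg add_nonneg_pos)
qed auto

section \<open>The moment equations centred at the equilibrium, and their energy\<close>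

definition lin_field :: "real \<Rightarrow> 'n state \<Rightarrow> ('n::finite) state" where
  "lin_field \<gamma> = (\<lambda>(x, p, U, V, K). (p, - x - \<gamma> *\<^sub>R p, K + transpose K,
     - (K + transpose K) - (2 * \<gamma>) *\<^sub>R V + (2 * \<gamma>) *\<^sub>R U, - (\<gamma> *\<^sub>R K) - 2 *\<^sub>R U + V))"

definition quad_field :: "real^'n^'n \<Rightarrow> 'n state \<Rightarrow> 'n state \<Rightarrow> ('n::finite) state" where
  "quad_field D = (\<lambda>(x, p, U, V, K) (x', p', U', V', K').
     (0, - (U *v (D *v x')), 0, - (U ** D ** K') - transpose (U ** D ** K'), - (U ** D ** U')))"

text \<open>The energy of the oscillators \<open>x'' = -x - \<gamma> x'\<close> and of the linearized covariance system,
  with a small cross term that makes it strictly decreasing.\<close>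

definition energy :: "real \<Rightarrow> 'n state \<Rightarrow> ('n::finite) state \<Rightarrow> real" where
  "energy \<epsilon> = (\<lambda>(x, p, U, V, K) (x', p', U', V', K').
     x \<bullet> x' + p \<bullet> p' + \<epsilon> * (x \<bullet> p' + p \<bullet> x')
     + (U \<bullet> U' + 2 * (K \<bullet> K') + (1/2) * ((V - U) \<bullet> (V' - U')) + \<epsilon> * (U \<bullet> K' + K \<bullet> U')))"

lemma matrix_add_rdistrib: "(A + B) ** C = A ** C + B ** (C :: real^'k^'n)"
  by (simp add: vec_eq_iff matrix_matrix_mult_def algebra_simps sum.distrib)

text \<open>In every term linear in \<open>h\<close> the factor \<open>matrix_inv B\<close> meets a
  factor \<open>B\<close> and cancels, which is why \<open>\<gamma>\<close> is the only parameter of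
  \<open>lin_field\<close>. The quadratic terms keep the inverse.\<close>

lemma moment_field_expand:
  assumes B: "pd_mat B"
  shows "moment_field \<gamma> B c (equilibrium B c + h) = lin_field \<gamma> h + quad_field (matrix_inv B) h h"
proof -
  obtain x p U V K where h: "h = (x, p, U, V, K)" by (metis surj_pair)
  let ?D = "matrix_inv B"
  have D: "B ** ?D = mat 1" "?D ** B = mat 1" using pd_inv[OF B] by auto
  have DB: "X ** ?D ** B = X" for X :: "real^'a^'a" by (simp add: D flip: matrix_mul_assoc)
  show ?thesis
    unfolding h moment_field_def equilibrium_def lin_field_def quad_field_def
    by (simp add: matrix_vector_right_distrib matrix_vector_mult_add_rdistrib pd_inv_mult[OF B]
        matrix_add_ldistrib matrix_add_rdistrib D DB transpose_add algebra_simps scaleR_2)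
qed

lemma inner_transpose_symmetric: "sym_mat U \<Longrightarrow> U \<bullet> transpose K = U \<bullet> K"
proof -
  have "transpose U \<bullet> transpose K = U \<bullet> K"
    unfolding inner_vec_def transpose_def by simp (rule sum.swap)
  then show "sym_mat U \<Longrightarrow> U \<bullet> transpose K = U \<bullet> K" by (simp add: sym_mat_def)
qed

lemma inner_transpose_self_le: "K \<bullet> transpose K \<le> K \<bullet> (K :: real^'n^'n)"
proof -
  have "transpose K \<bullet> transpose K = K \<bullet> K"
    unfolding inner_vec_def transpose_def by simp (rule sum.swap)
  moreover have "0 \<le> (K - transpose K) \<bullet> (K - transpose K)" by simp
  ultimately show ?thesis by (simp add: inner_diff_left inner_diff_right inner_commute)
qed

text \<open>Young's inequality with weight \<open>k\<close>.\<close>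

lemma inner_weighted_bound:
  fixes a b :: "'a::real_inner"
  assumes "k > 0"
  shows "a \<bullet> b \<le> k * (a \<bullet> a) + (b \<bullet> b) / (4 * k)"
proof -
  have "0 \<le> ((2 * k) *\<^sub>R a - b) \<bullet> ((2 * k) *\<^sub>R a - b)" by simp
  also have "\<dots> = 4 * k * (k * (a \<bullet> a) + (b \<bullet> b) / (4 * k) - a \<bullet> b)"
    using assms by (simp add: inner_diff_left inner_diff_right inner_commute algebra_simps)
  finally show ?thesis using assms by (simp add: zero_le_mult_iff)
qed

context
  fixes \<gamma> \<epsilon> :: real
  assumes \<gamma>: "\<gamma> > 0" and \<epsilon>_def: "\<epsilon> = \<gamma> / (4 + 4 * \<gamma>\<^sup>2)"
begin

text \<open>The two demands on the cross term: \<open>\<epsilon> \<le> 1/4\<close> keeps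
  \<open>energy\<close> positive definite, and
  \<open>\<epsilon> * (1 + \<gamma>\<^sup>2) = \<gamma> / 4\<close> lets the damping absorb what
  differentiating the cross term produces.\<close>

lemma \<epsilon>_bounds: "\<epsilon> > 0" "\<epsilon> * (4 + 4 * \<gamma>\<^sup>2) = \<gamma>" "\<epsilon> \<le> \<gamma> / 4" "\<epsilon> \<le> 1/4"
proof -
  have pos: "4 + 4 * \<gamma>\<^sup>2 > 0" by (simp add: add_pos_nonneg)
  show "\<epsilon> > 0" using \<gamma> pos by (simp add: \<epsilon>_def)
  show eq: "\<epsilon> * (4 + 4 * \<gamma>\<^sup>2) = \<gamma>" using pos by (simp add: \<epsilon>_def)
  have "\<epsilon> * (4 * \<gamma>\<^sup>2) \<ge> 0" using \<open>\<epsilon> > 0\<close> by simp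
  then show "\<epsilon> \<le> \<gamma> / 4" using eq by (simp add: algebra_simps)
  have "0 \<le> (2 * \<gamma> - 1)\<^sup>2" by simp
  then have "4 * \<gamma> \<le> 4 + 4 * \<gamma>\<^sup>2" by (simp add: power2_diff algebra_simps)
  then show "\<epsilon> \<le> 1/4" using pos by (simp add: \<epsilon>_def field_simps)
qed

text \<open>The cross terms cost at most a quarter of the squares, and \<open>V\<close> is recovered
  from \<open>V - U\<close> and \<open>U\<close>; the factor \<open>1/6\<close> leaves room for the
  doubling in that step.\<close>

lemma energy_lower: "(1/6) * (norm h)\<^sup>2 \<le> energy \<epsilon> h h"
proof -
  obtain x p U V K where h: "h = (x, p, U, V, K)" by (metis surj_pair)
  note \<epsilon> = \<epsilon>_bounds
  have b: "- (\<epsilon> * (a \<bullet> b + b \<bullet> a)) \<le> (1/4) * (a \<bullet> a + b \<bullet> b)" for a b :: "'b::real_inner"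
  proof -
    have "- (a \<bullet> b + b \<bullet> a) \<le> a \<bullet> a + b \<bullet> b"
      using inner_ge_zero[of "a + b"] by (simp add: inner_add_left inner_add_right inner_commute)
    then have "\<epsilon> * - (a \<bullet> b + b \<bullet> a) \<le> \<epsilon> * (a \<bullet> a + b \<bullet> b)" using \<epsilon>(1) by (intro mult_left_mono) auto
    also have "\<dots> \<le> (1/4) * (a \<bullet> a + b \<bullet> b)" using \<epsilon>(4) by (intro mult_right_mono) auto
    finally show ?thesis by (simp only: mult_minus_right)
  qed
  have V: "V \<bullet> V \<le> 2 * ((V - U) \<bullet> (V - U)) + 2 * (U \<bullet> U)"
    using inner_ge_zero[of "V - 2 *\<^sub>R U"] by (simp add: inner_diff_left inner_diff_right inner_commute algebra_simps)
  have pos: "0 \<le> x \<bullet> x" "0 \<le> p \<bullet> p" "0 \<le> U \<bullet> U" "0 \<le> K \<bullet> K" "0 \<le> (V - U) \<bullet> (V - U)" by auto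
  have "(norm h)\<^sup>2 = x \<bullet> x + p \<bullet> p + U \<bullet> U + V \<bullet> V + K \<bullet> K"
    by (simp add: h power2_norm_eq_inner)
  then show ?thesis
    unfolding h energy_def prod.case using b[of x p] b[of U K] V pos by argo
qed

text \<open>In terms of \<open>D = V - U\<close> the covariance part reads
  \<open>U' = K + transpose K\<close>, \<open>K' = - \<gamma> K - U + D\<close>,
  \<open>D' = - 2 (K + transpose K) - 2 \<gamma> D\<close>. The weights \<open>1\<close>,
  \<open>2\<close>, \<open>1/2\<close> make the exchange terms cancel for symmetric \<open>U\<close>
  and \<open>D\<close>, which leaves dissipation in \<open>p\<close>, \<open>K\<close> and
  \<open>D\<close>. The cross terms supply the missing dissipation in \<open>x\<close> and
  \<open>U\<close>.\<close>

lemma energy_decrease: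
  assumes "h \<in> sym_states"
  shows "energy \<epsilon> h (lin_field \<gamma> h) \<le> - 2 * (\<epsilon> / 12) * energy \<epsilon> h h"
proof -
  obtain x p U V K where h: "h = (x, p, U, V, K)" by (metis surj_pair)
  note \<epsilon> = \<epsilon>_bounds
  have sym: "sym_mat U" "sym_mat V" using assms by (simp_all add: h sym_states_def sym_cov_block)
  define D where "D = V - U"
  have "sym_mat D" using sym by (simp add: D_def sym_mat_def transpose_diff)
  note tr = inner_transpose_symmetric[OF sym(1), of K] inner_transpose_symmetric[OF \<open>sym_mat D\<close>, of K]
  have V: "V = U + D" by (simp add: D_def)
  have Q: "energy \<epsilon> h (lin_field \<gamma> h) = - \<gamma> * (p \<bullet> p) + \<epsilon> * (- (x \<bullet> x) - \<gamma> * (x \<bullet> p) + p \<bullet> p)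
     - 2 * \<gamma> * (K \<bullet> K) - \<gamma> * (D \<bullet> D) + \<epsilon> * (- \<gamma> * (U \<bullet> K) - U \<bullet> U + U \<bullet> D + K \<bullet> K + K \<bullet> transpose K)"
  proof -
    have tr': "D \<bullet> transpose K = D \<bullet> K" "U \<bullet> transpose K = U \<bullet> K" using tr by auto
    have D': "- (K + transpose K) - (2 * \<gamma>) *\<^sub>R V + (2 * \<gamma>) *\<^sub>R U - (K + transpose K)
        = - (2 *\<^sub>R K) - 2 *\<^sub>R transpose K - (2 * \<gamma>) *\<^sub>R D"
      and K': "- (\<gamma> *\<^sub>R K) - 2 *\<^sub>R U + V = - (\<gamma> *\<^sub>R K) - U + D"
      by (simp_all add: D_def scaleR_2 scaleR_diff_right)
    show ?thesis
      unfolding h energy_def lin_field_def prod.case D' K' D_def[symmetric]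
      by (simp add: inner_add_right inner_diff_right inner_add_left inner_diff_left tr'
          inner_commute[of K D] inner_commute[of p x] inner_commute[of K U] inner_commute[of D U])
        (simp add: algebra_simps add_divide_distrib diff_divide_distrib)
  qed
  \<comment> \<open>The weights in Young's inequality are such that \<open>x \<bullet> x\<close> and
    \<open>U \<bullet> U\<close> each keep half of their coefficient
    \<open>\<epsilon>\<close>.\<close>
  have xp: "- (\<epsilon> * \<gamma> * (x \<bullet> p)) \<le> \<epsilon> * ((1/2) * (x \<bullet> x) + (\<gamma>\<^sup>2 / 2) * (p \<bullet> p))"
    and UK: "- (\<epsilon> * \<gamma> * (U \<bullet> K)) \<le> \<epsilon> * ((1/4) * (U \<bullet> U) + \<gamma>\<^sup>2 * (K \<bullet> K))"
    and UD: "\<epsilon> * (U \<bullet> D) \<le> \<epsilon> * ((1/4) * (U \<bullet> U) + D \<bullet> D)"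
  proof -
    have "x \<bullet> (- \<gamma> *\<^sub>R p) \<le> (1/2) * (x \<bullet> x) + (\<gamma>\<^sup>2 / 2) * (p \<bullet> p)"
      using inner_weighted_bound[of "1/2" x "- \<gamma> *\<^sub>R p"] by (simp add: power2_eq_square)
    from mult_left_mono[OF this, of \<epsilon>] show "- (\<epsilon> * \<gamma> * (x \<bullet> p)) \<le> \<epsilon> * ((1/2) * (x \<bullet> x) + (\<gamma>\<^sup>2 / 2) * (p \<bullet> p))"
      using \<epsilon>(1) by simp
    have "U \<bullet> (- \<gamma> *\<^sub>R K) \<le> (1/4) * (U \<bullet> U) + \<gamma>\<^sup>2 * (K \<bullet> K)"
      using inner_weighted_bound[of "1/4" U "- \<gamma> *\<^sub>R K"] by (simp add: power2_eq_square)
    from mult_left_mono[OF this, of \<epsilon>] show "- (\<epsilon> * \<gamma> * (U \<bullet> K)) \<le> \<epsilon> * ((1/4) * (U \<bullet> U) + \<gamma>\<^sup>2 * (K \<bullet> K))"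
      using \<epsilon>(1) by simp
    have "U \<bullet> D \<le> (1/4) * (U \<bullet> U) + D \<bullet> D"
      using inner_weighted_bound[of "1/4" U D] by simp
    from mult_left_mono[OF this, of \<epsilon>] show "\<epsilon> * (U \<bullet> D) \<le> \<epsilon> * ((1/4) * (U \<bullet> U) + D \<bullet> D)"
      using \<epsilon>(1) by simp
  qed
  have KK: "\<epsilon> * (K \<bullet> transpose K) \<le> \<epsilon> * (K \<bullet> K)"
    using inner_transpose_self_le \<epsilon>(1) by (intro mult_left_mono) auto
  have pos: "0 \<le> x \<bullet> x" "0 \<le> p \<bullet> p" "0 \<le> U \<bullet> U" "0 \<le> K \<bullet> K" "0 \<le> D \<bullet> D" by auto
  \<comment> \<open>The dissipation is at least \<open>\<epsilon> / 2\<close> times this sum and the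
    energy at most \<open>3\<close> times it, hence the rate
    \<open>\<epsilon> / 6 = 2 * (\<epsilon> / 12)\<close>.\<close>
  define \<Sigma> where "\<Sigma> = x \<bullet> x + p \<bullet> p + U \<bullet> U + K \<bullet> K + D \<bullet> D"
  have c1: "\<gamma> - \<epsilon> - \<epsilon> * \<gamma>\<^sup>2 / 2 \<ge> \<epsilon> / 2" "2 * \<gamma> - 2 * \<epsilon> - \<epsilon> * \<gamma>\<^sup>2 \<ge> \<epsilon> / 2" "\<gamma> - \<epsilon> \<ge> \<epsilon> / 2"
  proof -
    have "\<epsilon> * \<gamma>\<^sup>2 \<ge> 0" "4 * \<epsilon> + 4 * (\<epsilon> * \<gamma>\<^sup>2) = \<gamma>" using \<epsilon> by (auto simp: algebra_simps)
    then show "\<gamma> - \<epsilon> - \<epsilon> * \<gamma>\<^sup>2 / 2 \<ge> \<epsilon> / 2" "2 * \<gamma> - 2 * \<epsilon> - \<epsilon> * \<gamma>\<^sup>2 \<ge> \<epsilon> / 2" "\<gamma> - \<epsilon> \<ge> \<epsilon> / 2"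
      using \<epsilon>(1) \<gamma> by argo+
  qed
  have "energy \<epsilon> h (lin_field \<gamma> h) \<le> - (\<gamma> - \<epsilon> - \<epsilon> * \<gamma>\<^sup>2 / 2) * (p \<bullet> p) - (\<epsilon> / 2) * (x \<bullet> x)
      - (2 * \<gamma> - 2 * \<epsilon> - \<epsilon> * \<gamma>\<^sup>2) * (K \<bullet> K) - (\<gamma> - \<epsilon>) * (D \<bullet> D) - (\<epsilon> / 2) * (U \<bullet> U)"
    unfolding Q using xp UK UD KK by (simp add: algebra_simps)
  also have "\<dots> \<le> - (\<epsilon> / 2) * \<Sigma>"
    using mult_right_mono[OF c1(1) pos(2)] mult_right_mono[OF c1(2) pos(4)] mult_right_mono[OF c1(3) pos(5)]
    unfolding \<Sigma>_def by (simp add: algebra_simps)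
  also have "\<dots> \<le> - (\<epsilon> / 6) * energy \<epsilon> h h"
  proof -
    have b: "\<epsilon> * (a \<bullet> b + b \<bullet> a) \<le> (1/4) * (a \<bullet> a + b \<bullet> b)" for a b :: "'b::real_inner"
    proof -
      have "a \<bullet> b + b \<bullet> a \<le> a \<bullet> a + b \<bullet> b"
        using inner_ge_zero[of "a - b"] by (simp add: inner_diff_left inner_diff_right inner_commute)
      then have "\<epsilon> * (a \<bullet> b + b \<bullet> a) \<le> \<epsilon> * (a \<bullet> a + b \<bullet> b)" using \<epsilon>(1) by (intro mult_left_mono) auto
      also have "\<dots> \<le> (1/4) * (a \<bullet> a + b \<bullet> b)" using \<epsilon>(4) by (intro mult_right_mono) auto
      finally show ?thesis .
    qed
    have "energy \<epsilon> h h \<le> 3 * \<Sigma>"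
      unfolding h energy_def prod.case \<Sigma>_def D_def[symmetric] using b[of x p] b[of U K] pos by argo
    from mult_left_mono[OF this, of "\<epsilon> / 6"] show ?thesis using \<epsilon>(1) by simp
  qed
  finally show ?thesis by simp
qed

end

lemma linear_lin_field: "linear (lin_field \<gamma>)"
  by (intro linearI) (auto simp: lin_field_def transpose_add algebra_simps transpose_scalar)

lemma bounded_bilinear_quad_field: "bounded_bilinear (quad_field D)"
  unfolding bilinear_conv_bounded_bilinear[symmetric] bilinear_def
proof (intro conjI allI)
  fix h :: "'a state"
  show "linear (quad_field D h)" "linear (\<lambda>h'. quad_field D h' h)"
    by (intro linearI; auto simp: quad_field_def split_beta matrix_vector_right_distrib matrix_vector_mult_add_rdistrib
        matrix_add_ldistrib matrix_add_rdistrib transpose_add matrix_vector_mult_scaleR scaleR_matrix_vector_assoc[symmetric]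
        scalar_matrix_assoc[symmetric] matrix_scalar_ac transpose_scalar algebra_simps)+
qed

lemma bounded_bilinear_energy: "bounded_bilinear (energy \<epsilon>)"
  unfolding bilinear_conv_bounded_bilinear[symmetric] bilinear_def
proof (intro conjI allI)
  fix h :: "'a state"
  show "linear (energy \<epsilon> h)" "linear (\<lambda>h'. energy \<epsilon> h' h)"
    by (intro linearI; auto simp: energy_def split_beta inner_add_left inner_add_right inner_diff_left inner_diff_right algebra_simps
        add_divide_distrib diff_divide_distrib)+
qed

lemma energy_commute: "energy \<epsilon> x y = energy \<epsilon> y x"
  by (simp add: energy_def split_beta inner_commute add.commute)

lemma sym_states_subspace: "subspace (sym_states :: ('n::finite) state set)"
  unfolding subspace_def sym_states_def sym_cov_block unfolding sym_mat_def
  by (auto simp: transpose_add transpose_scalar zero_prod_def) (simp_all add: transpose_def vec_eq_iff)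

text \<open>\<open>B\<close> occurs only in the quadratic field, so it can shrink the region of
  guaranteed decay but not the rate.\<close>

lemma moment_field_stable:
  assumes \<gamma>: "\<gamma> > 0" and B: "pd_mat (B :: real^'n^'n)"
  shows "stable_quadratic_ode (lin_field \<gamma>) (quad_field (matrix_inv B)) sym_states
    (energy (\<gamma> / (4 + 4 * \<gamma>\<^sup>2))) (1/6) (\<gamma> / (4 + 4 * \<gamma>\<^sup>2) / 12)"
proof (intro stable_quadratic_ode.intro quadratic_ode.intro stable_quadratic_ode_axioms.intro)
  have sD: "transpose (matrix_inv B) = matrix_inv B" using pd_sym[OF pd_matrix_inv[OF B]] by (simp add: sym_mat_def)
  show "lin_field \<gamma> h + quad_field (matrix_inv B) h h \<in> sym_states" if "h \<in> sym_states" for h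
    using that unfolding sym_states_def sym_cov_block unfolding sym_mat_def
    by (auto simp: lin_field_def quad_field_def split_beta transpose_add transpose_diff transpose_uminus
        transpose_scalar algebra_simps)
  show "energy (\<gamma> / (4 + 4 * \<gamma>\<^sup>2)) x y = energy (\<gamma> / (4 + 4 * \<gamma>\<^sup>2)) y x" for x y :: "'n state"
    by (rule energy_commute)
  show "0 < \<gamma> / (4 + 4 * \<gamma>\<^sup>2) / 12" by (rule divide_pos_pos[OF \<epsilon>_bounds(1)[OF \<gamma> refl]]) simp
  show "energy (\<gamma> / (4 + 4 * \<gamma>\<^sup>2)) h (lin_field \<gamma> h)
      \<le> - 2 * (\<gamma> / (4 + 4 * \<gamma>\<^sup>2) / 12) * energy (\<gamma> / (4 + 4 * \<gamma>\<^sup>2)) h h" if "h \<in> sym_states" for h :: "'n state"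
    by (rule energy_decrease[OF \<gamma> refl that])
qed (rule linear_lin_field bounded_bilinear_quad_field bounded_bilinear_energy sym_states_subspace
    energy_lower[OF \<gamma> refl] | simp)+

section \<open>Steady states\<close>

lemma transpose_zero: "transpose 0 = (0 :: real^'n^'m)"
  by (simp add: transpose_def vec_eq_iff)

text \<open>The equation for \<open>Cq\<close> makes \<open>Cqp\<close> antisymmetric, whereas the
  one for \<open>Cqp\<close> writes it as a multiple of a symmetric matrix. So
  \<open>Cqp = 0\<close>, and the remaining identities can be read off.\<close>

lemma steady_state_equations:
  assumes \<gamma>: "\<gamma> > 0" and B: "pd_mat B" and sym: "sym_mat Cq" "sym_mat Cp"
    and st: "steady (moment_field \<gamma> B c) (mq, mp, Cq, Cp, Cqp)"
  shows "mp = 0" "Cqp = 0" "Cp = Cq" "Cq ** matrix_inv B ** Cq = Cq" "Cq *v (matrix_inv B *v mq - c) = 0"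
proof -
  let ?D = "matrix_inv B"
  have eqs: "mp = 0" "- (Cq *v (?D *v mq - c)) - \<gamma> *\<^sub>R mp = 0" "Cqp + transpose Cqp = 0"
    "- (Cq ** ?D ** Cqp) - transpose (Cq ** ?D ** Cqp) - (2 * \<gamma>) *\<^sub>R Cp + (2 * \<gamma>) *\<^sub>R Cq = 0"
    "- (\<gamma> *\<^sub>R Cqp) - Cq ** ?D ** Cq + Cp = 0"
    using st by (simp_all add: steady_def moment_field_def zero_prod_def)
  show "mp = 0" by fact
  show "Cq *v (matrix_inv B *v mq - c) = 0" using eqs(1,2) by simp
  have "transpose ?D = ?D" using pd_sym[OF pd_matrix_inv[OF B]] by (simp add: sym_mat_def)
  then have "transpose (Cp - Cq ** ?D ** Cq) = Cp - Cq ** ?D ** Cq"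
    using sym by (simp add: sym_mat_def transpose_diff matrix_transpose_mul matrix_mul_assoc)
  moreover have e: "\<gamma> *\<^sub>R Cqp = Cp - Cq ** ?D ** Cq" using eqs(5) by (simp add: algebra_simps)
  ultimately have "\<gamma> *\<^sub>R transpose Cqp = \<gamma> *\<^sub>R Cqp" by (simp add: transpose_scalar[symmetric])
  then have "transpose Cqp = Cqp" using \<gamma> by simp
  then have "2 *\<^sub>R Cqp = 0" using eqs(3) by (simp add: scaleR_2)
  then show K: "Cqp = 0" by simp
  have "(2 * \<gamma>) *\<^sub>R Cq = (2 * \<gamma>) *\<^sub>R Cp" using eqs(4) by (simp add: K transpose_zero)
  then show "Cp = Cq" using \<gamma> by simp
  then show "Cq ** matrix_inv B ** Cq = Cq" using e by (simp add: K)
qed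

text \<open>An invertible \<open>Cq\<close> can be cancelled from
  \<open>Cq ** matrix_inv B ** Cq = Cq\<close> and from the equation for the mean.\<close>

lemma steady_pd_unique:
  assumes \<gamma>: "\<gamma> > 0" and B: "pd_mat B" and pd: "(mq, mp, Cq, Cp, Cqp) \<in> pd_states"
    and st: "steady (moment_field \<gamma> B c) (mq, mp, Cq, Cp, Cqp)"
  shows "(mq, mp, Cq, Cp, Cqp) = equilibrium B c"
proof -
  have pdb: "pd_mat (cov_block Cq Cp Cqp)" using pd by (simp add: pd_states_def)
  then have C: "pd_mat Cq" and sym: "sym_mat Cq" "sym_mat Cp"
    using cov_block_component(2) pd_sym sym_cov_block by blast+
  note eqs = steady_state_equations[OF \<gamma> B sym st]
  have "Cq ** matrix_inv B = mat 1"
    using arg_cong[OF eqs(4), of "\<lambda>X. X ** matrix_inv Cq"] pd_inv[OF C] by (simp flip: matrix_mul_assoc)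
  then have "Cq ** matrix_inv B ** B = B" by simp
  then have "Cq = B" using pd_inv[OF B] by (simp flip: matrix_mul_assoc)
  moreover have "matrix_inv B *v mq - c = 0"
    using eqs(5) pd_inv_mult(2)[OF C] by (metis matrix_vector_mult_0_right)
  then have "mq = B *v c" using pd_inv_mult(1)[OF B, of mq] by simp
  ultimately show ?thesis using eqs by (simp add: equilibrium_def)
qed

lemma steady_equilibrium: "pd_mat B \<Longrightarrow> steady (moment_field \<gamma> B c) (equilibrium B c)"
  using moment_field_expand[of B \<gamma> c 0]
  by (simp add: steady_def linear_0[OF linear_lin_field] bounded_bilinear.zero_left[OF bounded_bilinear_quad_field])

lemma steady_projection_form:
  assumes \<gamma>: "\<gamma> > 0" and B: "pd_mat B" and sym: "sym_mat Cq" "sym_mat Cp"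
    and st: "steady (moment_field \<gamma> B c) (mq, mp, Cq, Cp, Cqp)"
  shows "\<exists>X m. X ** X = X \<and> sym_mat X \<and> Cq *v m = 0 \<and>
     mq = B *v (c + m) \<and> mp = 0 \<and> Cqp = 0 \<and>
     Cq = msqrt B ** X ** msqrt B \<and> Cp = msqrt B ** X ** msqrt B"
proof -
  note eqs = steady_state_equations[OF \<gamma> B sym st]
  let ?S = "msqrt B" and ?R = "matrix_inv (msqrt B)"
  note S = pd_msqrt[OF B] and SS = msqrt(2)[OF pd_imp_psd[OF B]]
  have RR: "matrix_inv B = ?R ** ?R"
    by (rule matrix_inv_unique) (metis pd_inv[OF S] SS matrix_mul_assoc matrix_mul_lid)+
  have tR: "transpose ?R = ?R" using pd_sym[OF pd_matrix_inv[OF S]] by (simp add: sym_mat_def)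
  define X where "X = ?R ** Cq ** ?R"
  have "X ** X = ?R ** (Cq ** (?R ** ?R) ** Cq) ** ?R" by (simp add: X_def matrix_mul_assoc)
  also have "\<dots> = X" using eqs(4) by (simp add: RR X_def)
  finally have "X ** X = X" .
  moreover have "sym_mat X" using sym(1) by (simp add: X_def sym_mat_def matrix_transpose_mul tR matrix_mul_assoc)
  moreover have "?S ** X ** ?S = (?S ** ?R) ** Cq ** (?R ** ?S)" by (simp add: X_def matrix_mul_assoc)
  then have "Cq = ?S ** X ** ?S" using pd_inv[OF S] by simp
  \<comment> \<open>The witness for \<open>m\<close> is the gradient of the potential at
    \<open>mq\<close>; the mean equation says that \<open>Cq\<close> annihilates it.\<close>
  moreover have "mq = B *v (c + (matrix_inv B *v mq - c))" by (simp add: pd_inv_mult[OF B])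
  ultimately show ?thesis using eqs by metis
qed

section \<open>Instability of the degenerate steady states\<close>

lemma norm_fst_le_norm: "norm (fst p) \<le> norm p" and norm_snd_le_norm: "norm (snd p) \<le> norm p"
  using norm_fst_le[of "fst p" "snd p"] norm_snd_le[of "snd p" "fst p"] by simp_all

text \<open>Let \<open>P = w w\<^sup>T\<close> with \<open>C\<^sub>q B\<^sup>-\<^sup>1 w = 0\<close> and \<open>w \<bullet> B\<^sup>-\<^sup>1 w = 1\<close>. Adding \<open>a P\<close>, \<open>b P\<close>, \<open>k P\<close>
  to \<open>C\<^sub>q\<close>, \<open>C\<^sub>p\<close>, \<open>C\<^sub>q\<^sub>p\<close> and \<open>\<xi> w\<close>, \<open>\<pi> w\<close> to the means of a steady state reduces the moment equations
  to this system for \<open>(a, b, k, \<xi>, \<pi>)\<close>, where \<open>\<mu> = w \<bullet> (B\<^sup>-\<^sup>1 m\<^sub>q - c)\<close>.\<close>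

definition escape_lin :: "real \<Rightarrow> real \<Rightarrow> real \<times> real \<times> real \<times> real \<times> real \<Rightarrow> real \<times> real \<times> real \<times> real \<times> real" where
  "escape_lin \<gamma> \<mu> = (\<lambda>(a, b, k, \<xi>, \<pi>). (2 * k, 2 * \<gamma> * a - 2 * \<gamma> * b, b - \<gamma> * k, \<pi>, - (\<mu> * a) - \<gamma> * \<pi>))"

definition escape_quad :: "real \<times> real \<times> real \<times> real \<times> real \<Rightarrow> real \<times> real \<times> real \<times> real \<times> real \<Rightarrow> real \<times> real \<times> real \<times> real \<times> real" where
  "escape_quad = (\<lambda>(a, b, k, \<xi>, \<pi>) (a', b', k', \<xi>', \<pi>'). (0, - (2 * a * k'), - (a * a'), 0, - (a * \<xi>')))"

lemma escape_quadratic_ode: "quadratic_ode (escape_lin \<gamma> \<mu>) escape_quad UNIV"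
proof (intro quadratic_ode.intro)
  show "linear (escape_lin \<gamma> \<mu>)"
    by (rule linearI) (auto simp: escape_lin_def split_beta algebra_simps)
  have "bilinear escape_quad"
    unfolding bilinear_def by (intro conjI allI linearI) (auto simp: escape_quad_def split_beta algebra_simps)
  then show "bounded_bilinear escape_quad" by (simp add: bilinear_conv_bounded_bilinear)
qed auto

text \<open>If the solution stayed in the ball of radius \<open>r\<close>, its components
  \<open>a\<close>, \<open>b\<close>, \<open>k\<close> would remain positive and a positive
  combination \<open>V\<close> of them would grow exponentially. The bounds \<open>1/4\<close>,
  \<open>\<gamma>/6\<close> and \<open>\<gamma>\<^sup>2\<close> on \<open>r\<close> let the linear
  terms dominate the quadratic ones. Leaving the ball through the mean components counts as
  well.\<close>

lemma escape:
  fixes \<gamma> \<mu> \<eta> r :: real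
  assumes \<gamma>: "\<gamma> > 0" and r: "r = min (1/4) (min (\<gamma>/6) (\<gamma>\<^sup>2))"
    and \<eta>: "0 < \<eta>" "\<eta> < 1" "norm (\<eta>, \<eta>, \<eta>, 0::real, 0::real) < r"
  shows "\<exists>T>0. \<exists>x. ode_solution (\<lambda>x. escape_lin \<gamma> \<mu> x + escape_quad x x) {0..T} x \<and>
    x 0 = (\<eta>, \<eta>, \<eta>, 0, 0) \<and> r \<le> norm (x T)"
proof (rule ccontr)
  assume no: "\<not> ?thesis"
  interpret quadratic_ode "escape_lin \<gamma> \<mu>" escape_quad UNIV by (rule escape_quadratic_ode)
  have F: "F = (\<lambda>x. escape_lin \<gamma> \<mu> x + escape_quad x x)" by (rule ext) (simp add: F_def)
  obtain z where z: "z 0 = (\<eta>, \<eta>, \<eta>, 0, 0)"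
    "\<And>T. \<lbrakk>\<And>t h. \<lbrakk>0 < t; t \<le> T; ode_solution F {0..t} h; h 0 = (\<eta>, \<eta>, \<eta>, 0, 0);
        \<And>s. 0 \<le> s \<Longrightarrow> s \<le> t \<Longrightarrow> h s \<in> UNIV \<and> norm (h s) \<le> r\<rbrakk> \<Longrightarrow> norm (h t) < r\<rbrakk>
      \<Longrightarrow> ode_solution F {0..T} z \<and> (\<forall>t\<in>{0..T}. z t \<in> UNIV \<and> norm (z t) < r)"
    using solution_in_ball[OF UNIV_I \<eta>(3)] by blast
  have no': "norm (x T) < r" if T: "T > 0" and x: "ode_solution F {0..T} x" "x 0 = (\<eta>, \<eta>, \<eta>, 0, 0)" for T x
  proof (rule ccontr)
    assume "\<not> norm (x T) < r"
    then have "r \<le> norm (x T)" by simp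
    with T x(2) x(1)[unfolded F] no show False by blast
  qed
  have sol: "ode_solution F {0..T} z \<and> (\<forall>t\<in>{0..T}. z t \<in> UNIV \<and> norm (z t) < r)" for T
    by (rule z(2)) (rule no')
  define a b k where "a t = fst (z t)" and "b t = fst (snd (z t))" and "k t = fst (snd (snd (z t)))" for t
  have bd: "\<bar>a t\<bar> < r" "\<bar>b t\<bar> < r" "\<bar>k t\<bar> < r" if "0 \<le> t" for t
  proof -
    have "norm (z t) < r" using sol[of t] that by auto
    moreover have "norm (fst (z t)) \<le> norm (z t)" by (rule norm_fst_le_norm)
    moreover have "norm (fst (snd (z t))) \<le> norm (z t)"
      by (rule order_trans[OF norm_fst_le_norm norm_snd_le_norm])
    moreover have "norm (fst (snd (snd (z t)))) \<le> norm (z t)"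
      by (rule order_trans[OF norm_fst_le_norm order_trans[OF norm_snd_le_norm norm_snd_le_norm]])
    ultimately show "\<bar>a t\<bar> < r" "\<bar>b t\<bar> < r" "\<bar>k t\<bar> < r" by (auto simp: a_def b_def k_def)
  qed
  have der: "(a has_real_derivative 2 * k t) (at t)"
    "(b has_real_derivative (2 * \<gamma> * a t - 2 * \<gamma> * b t - 2 * a t * k t)) (at t)"
    "(k has_real_derivative (b t - \<gamma> * k t - a t * a t)) (at t)" if "t > 0" for t
  proof -
    define G where "G = escape_lin \<gamma> \<mu> (z t) + escape_quad (z t) (z t)"
    have zd: "(z has_vector_derivative G) (at t)"
      using ode_solution_at[of F 0 "t + 1" z t] sol[of "t + 1"] that by (simp add: G_def F_def)
    have sn: "((\<lambda>t. snd (z t)) has_vector_derivative snd G) (at t)"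
      by (rule bounded_linear.has_vector_derivative[OF bounded_linear_snd zd])
    have sn2: "((\<lambda>t. snd (snd (z t))) has_vector_derivative snd (snd G)) (at t)"
      by (rule bounded_linear.has_vector_derivative[OF bounded_linear_snd sn])
    show "(a has_real_derivative 2 * k t) (at t)"
      using bounded_linear.has_vector_derivative[OF bounded_linear_fst zd]
      by (simp add: has_real_derivative_iff_has_vector_derivative a_def[abs_def] k_def G_def escape_lin_def escape_quad_def split_beta)
    show "(b has_real_derivative (2 * \<gamma> * a t - 2 * \<gamma> * b t - 2 * a t * k t)) (at t)"
      using bounded_linear.has_vector_derivative[OF bounded_linear_fst sn]
      by (simp add: has_real_derivative_iff_has_vector_derivative a_def b_def[abs_def] k_def G_def escape_lin_def escape_quad_def split_beta)
    show "(k has_real_derivative (b t - \<gamma> * k t - a t * a t)) (at t)"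
      using bounded_linear.has_vector_derivative[OF bounded_linear_fst sn2]
      by (simp add: has_real_derivative_iff_has_vector_derivative a_def b_def k_def[abs_def] G_def escape_lin_def escape_quad_def split_beta)
  qed
  have zc: "continuous_on {0..t} z" for t using ode_solution_continuous sol by blast
  have cont: "continuous_on {0..t} a" "continuous_on {0..t} b" "continuous_on {0..t} k" for t
    unfolding a_def[abs_def] b_def[abs_def] k_def[abs_def] by (intro continuous_intros zc)+
  \<comment> \<open>\<open>u\<close> drives \<open>k\<close>, since
    \<open>k' = u - \<gamma> * k\<close>, while \<open>a' = 2 * k\<close>. Positivity of
    \<open>a\<close>, \<open>k\<close> and \<open>u\<close> maintains itself, because
    \<open>u' + 2 * \<gamma> * u\<close> is \<open>a\<close> times a factor that is nonnegative in
    the ball.\<close>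
  define u where "u t = b t - a t * a t" for t
  have uder: "(u has_real_derivative (- (2 * \<gamma>) * u t + a t * (2 * \<gamma> - 2 * \<gamma> * a t - 6 * k t))) (at t)" if "t > 0" for t
    unfolding u_def[abs_def] using der[OF that]
    by (auto intro!: derivative_eq_intros simp: algebra_simps)
  have small: "0 \<le> 2 * \<gamma> - 2 * \<gamma> * a t - 6 * k t" "a t \<le> 1/4" "a t \<le> \<gamma>\<^sup>2" if "0 \<le> t" for t
  proof -
    have "a t \<le> 1/4" "k t \<le> \<gamma>/6" "a t \<le> \<gamma>\<^sup>2" using bd[OF that] by (auto simp: r)
    moreover from this(1) have "2 * \<gamma> * a t \<le> 2 * \<gamma> * (1/4)" using \<gamma> by (intro mult_left_mono) auto
    ultimately show "0 \<le> 2 * \<gamma> - 2 * \<gamma> * a t - 6 * k t" "a t \<le> 1/4" "a t \<le> \<gamma>\<^sup>2" using \<gamma> by linarith+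
  qed
  have init: "a 0 = \<eta>" "b 0 = \<eta>" "k 0 = \<eta>" by (simp_all add: a_def b_def k_def z(1))
  have u0: "u 0 > 0" using mult_strict_left_mono[OF \<eta>(2,1)] by (simp add: u_def init)
  have pos: "min (a t) (min (k t) (u t)) > 0" if "0 \<le> t" for t
  proof (rule positive_propagation[OF _ _ _ that order_refl])
    show "continuous_on {0..t} (\<lambda>t. min (a t) (min (k t) (u t)))"
      unfolding u_def by (intro continuous_intros cont)
    show "0 < min (a 0) (min (k 0) (u 0))" using u0 \<eta> by (simp add: init)
    fix s assume s: "0 < s" "s \<le> t" and p: "\<And>v. 0 \<le> v \<Longrightarrow> v < s \<Longrightarrow> 0 < min (a v) (min (k v) (u v))"
    have "- a s \<le> - a 0 * exp (0 * (s - 0))"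
    proof (rule gronwall)
      show "continuous_on {0..s} (\<lambda>t. - a t)" by (intro continuous_intros cont)
      show "((\<lambda>t. - a t) has_real_derivative - (2 * k v)) (at v)" if "0 < v" "v < s" for v
        by (intro DERIV_minus der that)
      show "- (2 * k v) \<le> 0 * - a v" if "0 < v" "v < s" for v using p[of v] that by simp
    qed (use s in auto)
    moreover have "- k s \<le> - k 0 * exp (- \<gamma> * (s - 0))"
    proof (rule gronwall)
      show "continuous_on {0..s} (\<lambda>t. - k t)" by (intro continuous_intros cont)
      show "((\<lambda>t. - k t) has_real_derivative - (b v - \<gamma> * k v - a v * a v)) (at v)" if "0 < v" "v < s" for v
        by (intro DERIV_minus der that)
      show "- (b v - \<gamma> * k v - a v * a v) \<le> - \<gamma> * - k v" if "0 < v" "v < s" for v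
        using p[of v] that by (simp add: u_def)
    qed (use s in auto)
    moreover have "- u s \<le> - u 0 * exp (- (2 * \<gamma>) * (s - 0))"
    proof (rule gronwall)
      show "continuous_on {0..s} (\<lambda>t. - u t)" unfolding u_def by (intro continuous_intros cont)
      show "((\<lambda>t. - u t) has_real_derivative - (- (2 * \<gamma>) * u v + a v * (2 * \<gamma> - 2 * \<gamma> * a v - 6 * k v))) (at v)" if "0 < v" "v < s" for v
        by (intro DERIV_minus uder that)
      show "- (- (2 * \<gamma>) * u v + a v * (2 * \<gamma> - 2 * \<gamma> * a v - 6 * k v)) \<le> - (2 * \<gamma>) * - u v" if "0 < v" "v < s" for v
        using p[of v] that mult_nonneg_nonneg[OF _ small(1)[of v], of "a v"] by simp
    qed (use s in auto)
    moreover have "- a 0 * exp (0 * (s - 0)) < 0" "- k 0 * exp (- \<gamma> * (s - 0)) < 0" "- u 0 * exp (- (2 * \<gamma>) * (s - 0)) < 0"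
      using \<eta> u0 by (auto simp: init)
    ultimately show "0 < min (a s) (min (k s) (u s))" by linarith
  qed
  \<comment> \<open>The derivative of \<open>V\<close> below is at least
    \<open>\<gamma> a + 2 \<gamma> b + 2 \<gamma>\<^sup>2 k\<close>. The three upper bounds on
    \<open>\<theta>\<close> say that \<open>\<theta> * V\<close> does not exceed this, component by
    component.\<close>
  define \<theta> where "\<theta> = min (\<gamma> / 2) (1 / (4 * \<gamma>))"
  have \<theta>: "\<theta> > 0" "\<theta> * (4 * \<gamma>) \<le> 2 * \<gamma>\<^sup>2" "\<theta> \<le> 2 * \<gamma>" "\<theta> * (4 * \<gamma>\<^sup>2) \<le> \<gamma>"
  proof -
    show "\<theta> > 0" using \<gamma> by (simp add: \<theta>_def)
    have "\<theta> * (4 * \<gamma>) \<le> \<gamma> / 2 * (4 * \<gamma>)" using \<gamma> by (intro mult_right_mono) (auto simp: \<theta>_def)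
    then show "\<theta> * (4 * \<gamma>) \<le> 2 * \<gamma>\<^sup>2" by (simp add: power2_eq_square)
    show "\<theta> \<le> 2 * \<gamma>" using \<gamma> by (simp add: \<theta>_def min_le_iff_disj)
    have "\<theta> * (4 * \<gamma>\<^sup>2) \<le> 1 / (4 * \<gamma>) * (4 * \<gamma>\<^sup>2)" using \<gamma> by (intro mult_right_mono) (auto simp: \<theta>_def)
    also have "\<dots> = \<gamma>" using \<gamma> by (simp add: power2_eq_square)
    finally show "\<theta> * (4 * \<gamma>\<^sup>2) \<le> \<gamma>" .
  qed
  \<comment> \<open>The weights overcompensate the damping: \<open>4 * \<gamma>\<close> on
    \<open>k\<close> beats the loss \<open>2 * \<gamma> * b\<close>, and
    \<open>4 * \<gamma>\<^sup>2\<close> on \<open>a\<close> beats the loss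
    \<open>4 * \<gamma>\<^sup>2 * k\<close> that this weight brings along.\<close>
  define V where "V t = 4 * \<gamma>\<^sup>2 * a t + b t + 4 * \<gamma> * k t" for t
  have growth: "V 0 * exp (\<theta> * T) \<le> V T" if "0 \<le> T" for T
  proof -
    have "- V T \<le> - V 0 * exp (\<theta> * (T - 0))"
    proof (rule gronwall[where V = "\<lambda>t. - V t", OF that])
      show "continuous_on {0..T} (\<lambda>t. - V t)" unfolding V_def by (intro continuous_intros cont)
      fix t assume t: "0 < t" "t < T"
      let ?V' = "4 * \<gamma>\<^sup>2 * (2 * k t) + (2 * \<gamma> * a t - 2 * \<gamma> * b t - 2 * a t * k t) + 4 * \<gamma> * (b t - \<gamma> * k t - a t * a t)"
      show "((\<lambda>t. - V t) has_real_derivative - ?V') (at t)"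
        unfolding V_def by (intro DERIV_minus DERIV_add DERIV_cmult der t)
      have p: "0 < a t" "0 < k t" "0 < b t"
      proof -
        show "0 < a t" "0 < k t" using pos[of t] t by auto
        moreover have "0 < u t" using pos[of t] t by auto
        ultimately show "0 < b t" using mult_pos_pos[of "a t" "a t"] unfolding u_def by linarith
      qed
      have "2 * a t * k t \<le> 2 * \<gamma>\<^sup>2 * k t" using small(3)[of t] t p by (intro mult_right_mono) auto
      moreover have "4 * \<gamma> * (a t * a t) \<le> \<gamma> * a t"
        using mult_right_mono[OF small(2)[of t], of "4 * \<gamma> * a t"] t p \<gamma> by (simp add: mult_ac)
      moreover have "\<theta> * (4 * \<gamma>\<^sup>2) * a t \<le> \<gamma> * a t" "\<theta> * b t \<le> 2 * \<gamma> * b t" "\<theta> * (4 * \<gamma>) * k t \<le> 2 * \<gamma>\<^sup>2 * k t"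
        using \<theta> p by (auto intro!: mult_right_mono)
      ultimately have "\<theta> * V t \<le> ?V'"
        by (simp add: V_def algebra_simps power2_eq_square)
      then show "- ?V' \<le> \<theta> * - V t" by simp
    qed
    then show ?thesis by simp
  qed
  have V0: "V 0 > 0" using \<eta> \<gamma> by (simp add: V_def init add_pos_pos)
  have r0: "r > 0" using \<gamma> by (simp add: r)
  define M where "M = (4 * \<gamma>\<^sup>2 + 1 + 4 * \<gamma>) * r"
  have M0: "M > 0" using r0 \<gamma> by (simp add: M_def add_pos_pos)
  have VM: "V T \<le> M" if "0 \<le> T" for T
  proof -
    have "4 * \<gamma>\<^sup>2 * a T \<le> 4 * \<gamma>\<^sup>2 * r" "4 * \<gamma> * k T \<le> 4 * \<gamma> * r" "b T \<le> r"
      using bd[OF that] \<gamma> by (auto intro!: mult_left_mono)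
    then show ?thesis by (simp add: V_def M_def algebra_simps)
  qed
  \<comment> \<open>Late enough for the lower bound \<open>V 0 * (1 + \<theta> * T)\<close> to
    exceed the bound \<open>M\<close> that holds in the ball.\<close>
  define T where "T = M / (V 0 * \<theta>)"
  have T0: "0 \<le> T" using M0 V0 \<theta>(1) by (simp add: T_def)
  have "M < V 0 * (1 + \<theta> * T)" using V0 \<theta>(1) by (simp add: T_def field_simps)
  also have "\<dots> \<le> V 0 * exp (\<theta> * T)" using V0 by (intro mult_left_mono exp_ge_add_one_self) auto
  also have "\<dots> \<le> M" using growth[OF T0] VM[OF T0] by simp
  finally show False by simp
qed

lemma outer_mult: "outer u v *v x = (v \<bullet> x) *\<^sub>R u" for u v x :: "real^'n"
  by (simp add: outer_def matrix_vector_mult_def vec_eq_iff inner_vec_def sum_distrib_left mult_ac)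

lemma matrix_mult_outer: "C ** outer u v = outer (C *v u) v"
  and outer_mult_matrix: "outer u v ** C = outer u (transpose C *v v)"
  and transpose_outer: "transpose (outer u v) = outer v u" for u v :: "real^'n" and C :: "real^'n^'n"
  by (simp_all add: outer_def matrix_matrix_mult_def matrix_vector_mult_def transpose_def vec_eq_iff
      sum_distrib_left sum_distrib_right mult_ac)

text \<open>The map \<open>\<iota>\<close> embeds the five-dimensional system into the states and
  conjugates the two fields. By injectivity an excursion of size \<open>r\<close> there is one of
  size at least \<open>\<kappa> * r\<close> here, from starting points arbitrarily close to the
  steady state.\<close>

lemma steady_unstable:
  fixes B :: "real^'n^'n"
  assumes \<gamma>: "\<gamma> > 0" and B: "pd_mat B" and psd: "(mq, mp, Cq, Cp, Cqp) \<in> psd_states"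
    and st: "steady (moment_field \<gamma> B c) (mq, mp, Cq, Cp, Cqp)"
    and ne: "(mq, mp, Cq, Cp, Cqp) \<noteq> equilibrium B c"
  shows "unstable (moment_field \<gamma> B c) psd_states (mq, mp, Cq, Cp, Cqp)"
  unfolding unstable_def
proof
  assume stable: "lyapunov_stable (moment_field \<gamma> B c) psd_states (mq, mp, Cq, Cp, Cqp)"
  let ?D = "matrix_inv B"
  have psdb: "psd_mat (cov_block Cq Cp Cqp)" using psd by (simp add: psd_states_def)
  then have C: "psd_mat Cq" and sym: "sym_mat Cq" "sym_mat Cp"
    using cov_block_component(1) psd_sym sym_cov_block by blast+
  note eqs = steady_state_equations[OF \<gamma> B sym st]
  define m where "m = ?D *v mq - c"
  have Cm: "Cq *v m = 0" using eqs(5) by (simp add: m_def)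
  have sD: "transpose ?D = ?D" using pd_sym[OF pd_matrix_inv[OF B]] by (simp add: sym_mat_def)
  have sC: "transpose Cq = Cq" using sym(1) by (simp add: sym_mat_def)
  \<comment> \<open>Otherwise \<open>Cq = B\<close>, so \<open>Cq\<close> is injective, the mean is
    \<open>B *v c\<close> as well, and the state is the equilibrium.\<close>
  have "Cq ** ?D \<noteq> mat 1"
  proof
    assume e: "Cq ** ?D = mat 1"
    then have "Cq ** ?D ** B = B" by simp
    then have "Cq = B" using pd_inv[OF B] by (simp flip: matrix_mul_assoc)
    moreover have "m = ?D *v (B *v m)" by (simp add: pd_inv_mult[OF B])
    then have "m = 0" using Cm calculation by simp
    then have "mq = B *v c" using pd_inv_mult(1)[OF B, of mq] by (simp add: m_def)
    ultimately show False using ne eqs by (simp add: equilibrium_def)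
  qed
  then obtain v where v: "(Cq ** ?D) *v v \<noteq> v" by (metis mat_eqI matrix_vector_mul_lid)
  \<comment> \<open>\<open>Cq ** ?D\<close> is a projection different from the identity, so the
    complementary projection maps some \<open>v\<close> to a nonzero vector of its kernel.\<close>
  define w0 where "w0 = v - Cq *v (?D *v v)"
  have w0: "w0 \<noteq> 0" using v by (simp add: w0_def matrix_vector_mul_assoc)
  have CDw0: "Cq *v (?D *v w0) = 0"
    using arg_cong[OF eqs(4), of "\<lambda>X. X *v (?D *v v)"]
    by (simp add: w0_def matrix_vector_mult_diff_distrib matrix_vector_mul_assoc matrix_mul_assoc)
  have q0: "w0 \<bullet> (?D *v w0) > 0" using pd_matrix_inv[OF B] w0 by (simp add: pd_mat_def)
  \<comment> \<open>Normalized so that \<open>P ** ?D ** P = P\<close> for the rank-one matrix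
    \<open>P\<close> below.\<close>
  define w where "w = (1 / sqrt (w0 \<bullet> (?D *v w0))) *\<^sub>R w0"
  have w: "w \<noteq> 0" "Cq *v (?D *v w) = 0" "w \<bullet> (?D *v w) = 1"
    using w0 q0 CDw0 by (simp_all add: w_def matrix_vector_mult_scaleR flip: power2_eq_square)
  define P where "P = outer w w"
  define \<mu> where "\<mu> = w \<bullet> m"
  have P: "Cq ** ?D ** P = 0" "P ** ?D ** Cq = 0" "P ** ?D ** P = P" "transpose P = P"
    "P *v m = \<mu> *\<^sub>R w" "P *v (?D *v w) = w"
    using w(2,3) inner_commute[of w "?D *v w"]
    by (simp_all add: P_def matrix_mult_outer outer_mult_matrix transpose_outer sD sC outer_mult \<mu>_def
        matrix_vector_mul_assoc flip: matrix_mul_assoc)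
      (simp_all add: matrix_vector_mul_assoc[symmetric] outer_def vec_eq_iff)
  define \<iota> :: "real \<times> real \<times> real \<times> real \<times> real \<Rightarrow> 'n state" where
    "\<iota> = (\<lambda>(a, b, k, \<xi>, \<pi>). (\<xi> *\<^sub>R w, \<pi> *\<^sub>R w, a *\<^sub>R P, b *\<^sub>R P, k *\<^sub>R P))"
  have lin: "linear \<iota>" by (rule linearI) (auto simp: \<iota>_def algebra_simps)
  have "P \<noteq> 0"
  proof
    assume "P = 0"
    then have "P *v (?D *v w) = 0" by simp
    then show False using P(6) w(1) by simp
  qed
  then have "inj \<iota>" using w(1) by (auto simp: inj_on_def \<iota>_def)
  then obtain \<kappa> where \<kappa>: "\<kappa> > 0" "\<And>x. \<kappa> * norm x \<le> norm (\<iota> x)"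
    using linear_inj_bounded_below_pos[OF lin] by (metis mult.commute)
  let ?s = "(mq, mp, Cq, Cp, Cqp)"
  \<comment> \<open>The mixed products of \<open>Cq\<close> and \<open>P\<close> through
    \<open>?D\<close> vanish, and each of the two reproduces itself. The perturbation therefore does
    not interact with the covariance of the steady state, and the mean enters through
    \<open>\<mu>\<close> alone.\<close>
  have field: "moment_field \<gamma> B c (?s + \<iota> x) = \<iota> (escape_lin \<gamma> \<mu> x + escape_quad x x)" for x
  proof -
    obtain a b k \<xi> \<pi> where x: "x = (a, b, k, \<xi>, \<pi>)" by (metis surj_pair)
    have m1: "?D *v (mq + \<xi> *\<^sub>R w) - c = m + \<xi> *\<^sub>R (?D *v w)"
      by (simp add: m_def matrix_vector_right_distrib matrix_vector_mult_scaleR)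
    have m2: "(Cq + a *\<^sub>R P) *v (m + \<xi> *\<^sub>R (?D *v w)) = (a * \<mu> + a * \<xi>) *\<^sub>R w"
      using Cm w(2) P(5,6)
      by (simp add: matrix_vector_mult_add_rdistrib matrix_vector_right_distrib matrix_vector_mult_scaleR
          scaleR_matrix_vector_assoc[symmetric] algebra_simps)
    have m3: "(Cq + a *\<^sub>R P) ** ?D ** (k *\<^sub>R P) = (a * k) *\<^sub>R P" for k
      using P(1,3) by (simp add: matrix_add_rdistrib matrix_add_ldistrib scalar_matrix_assoc[symmetric] matrix_scalar_ac)
    have m4: "(Cq + a *\<^sub>R P) ** ?D ** Cq = Cq"
      using P(2) eqs(4) by (simp add: matrix_add_rdistrib matrix_add_ldistrib scalar_matrix_assoc[symmetric] matrix_scalar_ac)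
    have m5: "(Cq + a *\<^sub>R P) ** ?D ** (Cq + a *\<^sub>R P) = Cq + (a * a) *\<^sub>R P"
      by (subst matrix_add_ldistrib) (simp only: m3 m4)
    have "moment_field \<gamma> B c (?s + \<iota> x) = (\<pi> *\<^sub>R w, - ((a * \<mu> + a * \<xi>) *\<^sub>R w) - \<gamma> *\<^sub>R \<pi> *\<^sub>R w, k *\<^sub>R P + k *\<^sub>R P,
        - ((a * k) *\<^sub>R P) - (a * k) *\<^sub>R P - (2 * \<gamma>) *\<^sub>R (Cq + b *\<^sub>R P) + (2 * \<gamma>) *\<^sub>R (Cq + a *\<^sub>R P),
        - (\<gamma> *\<^sub>R k *\<^sub>R P) - (Cq + (a * a) *\<^sub>R P) + (Cq + b *\<^sub>R P))"
      unfolding x \<iota>_def moment_field_def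
      by (simp only: prod.case add_Pair eqs(1-3) add_0 m1 m2 m3 m5 P(4) transpose_scalar)
    also have "\<dots> = \<iota> (escape_lin \<gamma> \<mu> x + escape_quad x x)"
      unfolding x \<iota>_def escape_lin_def escape_quad_def by (simp add: vec_eq_iff algebra_simps)
    finally show ?thesis .
  qed
  \<comment> \<open>The same \<open>\<eta>\<close> in all three blocks adds
    \<open>\<eta> * (w \<bullet> x + w \<bullet> y)\<^sup>2\<close> to the quadratic form, so the
    perturbed state is still a covariance.\<close>
  have psd_\<iota>: "?s + \<iota> (\<eta>, \<eta>, \<eta>, 0, 0) \<in> psd_states" if "\<eta> > 0" for \<eta>
  proof -
    have "0 \<le> z \<bullet> (cov_block (Cq + \<eta> *\<^sub>R P) (Cq + \<eta> *\<^sub>R P) (\<eta> *\<^sub>R P) *v z)" for z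
    proof -
      define x y :: "real^'n" where "x = (\<chi> i. z $ Inl i)" and "y = (\<chi> i. z $ Inr i)"
      have "z \<bullet> (cov_block (Cq + \<eta> *\<^sub>R P) (Cq + \<eta> *\<^sub>R P) (\<eta> *\<^sub>R P) *v z)
          = x \<bullet> (Cq *v x) + y \<bullet> (Cq *v y) + \<eta> * (w \<bullet> x + w \<bullet> y)\<^sup>2"
        unfolding cov_block_quadratic_form x_def[symmetric] y_def[symmetric] P_def
        by (simp add: matrix_vector_mult_add_rdistrib scaleR_matrix_vector_assoc[symmetric] outer_mult inner_add_right
            inner_commute power2_eq_square algebra_simps)
      then show ?thesis using C that by (simp add: psd_mat_def)
    qed
    moreover have "sym_mat (Cq + \<eta> *\<^sub>R P)" using P(4) sC by (simp add: sym_mat_def transpose_add transpose_scalar)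
    ultimately show ?thesis by (simp add: \<iota>_def psd_states_def psd_mat_def sym_cov_block eqs)
  qed
  define r where "r = min (1/4) (min (\<gamma>/6) (\<gamma>\<^sup>2))"
  have r0: "r > 0" using \<gamma> by (simp add: r_def)
  obtain \<delta> where \<delta>: "\<delta> > 0" "\<And>T \<phi>. T > 0 \<Longrightarrow> ode_solution (moment_field \<gamma> B c) {0..T} \<phi> \<Longrightarrow> \<phi> 0 \<in> psd_states \<Longrightarrow>
      dist (\<phi> 0) ?s < \<delta> \<Longrightarrow> \<forall>t\<in>{0..T}. dist (\<phi> t) ?s < \<kappa> * r"
    using stable r0 \<kappa>(1) unfolding lyapunov_stable_def by (metis mult_pos_pos)
  define v1 :: "real \<times> real \<times> real \<times> real \<times> real" where "v1 = (1, 1, 1, 0, 0)"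
  have v1: "(\<eta>, \<eta>, \<eta>, 0, 0) = \<eta> *\<^sub>R v1" for \<eta> by (simp add: v1_def)
  have pos: "1 + norm v1 > 0" "1 + norm (\<iota> v1) > 0" by (simp_all add: add_pos_nonneg)
  have half: "d / (2 * n) * n = d / 2" if "n > 0" for d n :: real using that by simp
  \<comment> \<open>Small enough to start within \<open>\<delta>\<close> of the steady state and
    within \<open>r\<close> in the coordinates of \<open>escape\<close>.\<close>
  define \<eta> where "\<eta> = min (1/2) (min (r / (2 * (1 + norm v1))) (\<delta> / (2 * (1 + norm (\<iota> v1)))))"
  have \<eta>: "0 < \<eta>" "\<eta> < 1" using r0 \<delta>(1) pos by (auto simp: \<eta>_def)
  have "\<eta> * (1 + norm v1) \<le> r / (2 * (1 + norm v1)) * (1 + norm v1)"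
    using pos by (intro mult_right_mono) (auto simp: \<eta>_def)
  also have "\<dots> = r / 2" by (rule half[OF pos(1)])
  finally have "\<eta> + \<eta> * norm v1 \<le> r / 2" by (simp add: distrib_left)
  then have \<eta>r: "norm (\<eta>, \<eta>, \<eta>, 0::real, 0::real) < r" using r0 \<eta>(1) by (simp add: v1)
  have "\<eta> * (1 + norm (\<iota> v1)) \<le> \<delta> / (2 * (1 + norm (\<iota> v1))) * (1 + norm (\<iota> v1))"
    using pos by (intro mult_right_mono) (auto simp: \<eta>_def)
  also have "\<dots> = \<delta> / 2" by (rule half[OF pos(2)])
  finally have "\<eta> + \<eta> * norm (\<iota> v1) \<le> \<delta> / 2" by (simp add: distrib_left)
  then have \<eta>\<delta>: "norm (\<iota> (\<eta>, \<eta>, \<eta>, 0, 0)) < \<delta>"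
    using \<delta>(1) \<eta>(1) by (simp add: v1 linear_scale[OF lin])
  obtain T x where T: "T > 0" and x: "ode_solution (\<lambda>x. escape_lin \<gamma> \<mu> x + escape_quad x x) {0..T} x"
    "x 0 = (\<eta>, \<eta>, \<eta>, 0, 0)" "r \<le> norm (x T)"
    using escape[OF \<gamma> r_def \<eta> \<eta>r] by blast
  have "bounded_linear \<iota>" using lin by (simp add: linear_conv_bounded_linear)
  from has_vector_derivative_add[OF has_vector_derivative_const[of ?s] bounded_linear.has_vector_derivative[OF this]]
  have "ode_solution (moment_field \<gamma> B c) {0..T} (\<lambda>t. ?s + \<iota> (x t))"
    using x(1) unfolding ode_solution_def field by (metis (no_types, lifting) add_0)
  then have "\<forall>t\<in>{0..T}. dist (?s + \<iota> (x t)) ?s < \<kappa> * r"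
    using \<delta>(2)[OF T, of "\<lambda>t. ?s + \<iota> (x t)"] psd_\<iota>[OF \<eta>(1)] \<eta>\<delta> x(2) by (simp add: dist_norm)
  then have "norm (\<iota> (x T)) < \<kappa> * r" using T by (simp add: dist_norm)
  moreover have "\<kappa> * r \<le> \<kappa> * norm (x T)" using x(3) \<kappa>(1) by simp
  ultimately show False using \<kappa>(2)[of "x T"] by simp
qed

section \<open>Square-integrable random variables\<close>

definition sq_int :: "'a measure \<Rightarrow> ('a \<Rightarrow> real) \<Rightarrow> bool" where
  "sq_int M X \<longleftrightarrow> X \<in> borel_measurable M \<and> integrable M (\<lambda>\<omega>. (X \<omega>)\<^sup>2)"

definition l2 :: "'a measure \<Rightarrow> ('a \<Rightarrow> real) \<Rightarrow> real" where
  "l2 M X = sqrt (\<integral>\<omega>. (X \<omega>)\<^sup>2 \<partial>M)"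

lemma sq_int_measurable: "sq_int M X \<Longrightarrow> X \<in> borel_measurable M"
  by (simp add: sq_int_def)

lemma l2_nonneg[simp]: "0 \<le> l2 M X"
  by (simp add: l2_def)

lemma l2_square: "(l2 M X)\<^sup>2 = (\<integral>\<omega>. (X \<omega>)\<^sup>2 \<partial>M)"
  by (simp add: l2_def)

lemma sq_int_mult:
  assumes "sq_int M X" "sq_int M Y"
  shows "integrable M (\<lambda>\<omega>. X \<omega> * Y \<omega>)"
proof (rule Bochner_Integration.integrable_bound)
  show "integrable M (\<lambda>\<omega>. (X \<omega>)\<^sup>2 + (Y \<omega>)\<^sup>2)" using assms by (simp add: sq_int_def)
  show "(\<lambda>\<omega>. X \<omega> * Y \<omega>) \<in> borel_measurable M"
    using assms by (intro borel_measurable_times sq_int_measurable)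
  have "\<bar>x * y\<bar> \<le> x\<^sup>2 + y\<^sup>2" for x y :: real
  proof -
    have "2 * (\<bar>x\<bar> * \<bar>y\<bar>) \<le> \<bar>x\<bar>\<^sup>2 + \<bar>y\<bar>\<^sup>2" using sum_squares_bound[of "\<bar>x\<bar>" "\<bar>y\<bar>"] by simp
    moreover have "0 \<le> \<bar>x\<bar> * \<bar>y\<bar>" by simp
    ultimately show ?thesis by (simp only: abs_mult power2_abs)
  qed
  then show "AE \<omega> in M. norm (X \<omega> * Y \<omega>) \<le> norm ((X \<omega>)\<^sup>2 + (Y \<omega>)\<^sup>2)" by (simp del: abs_mult)
qed

lemma sq_int_add: assumes "sq_int M X" "sq_int M Y" shows "sq_int M (\<lambda>\<omega>. X \<omega> + Y \<omega>)"
  using assms sq_int_mult[OF assms] unfolding sq_int_def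
  by (intro conjI borel_measurable_add) (simp_all add: power2_sum mult.assoc)

lemma sq_int_scale: "sq_int M X \<Longrightarrow> sq_int M (\<lambda>\<omega>. a * X \<omega>)"
  unfolding sq_int_def by (intro conjI borel_measurable_times borel_measurable_const) (simp_all add: power_mult_distrib)

lemma sq_int_diff: assumes "sq_int M X" "sq_int M Y" shows "sq_int M (\<lambda>\<omega>. X \<omega> - Y \<omega>)"
  using sq_int_add[OF assms(1) sq_int_scale[OF assms(2), of "- 1"]] by simp

lemma sq_int_zero: "sq_int M (\<lambda>_. 0)"
  by (simp add: sq_int_def)

lemma sq_int_sum: "(\<And>k. k \<in> I \<Longrightarrow> sq_int M (X k)) \<Longrightarrow> sq_int M (\<lambda>\<omega>. \<Sum>k\<in>I. X k \<omega>)"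
  by (induction I rule: infinite_finite_induct) (auto simp: sq_int_zero intro: sq_int_add)

text \<open>The second moment of \<open>X + t * Y\<close> is a nonnegative quadratic polynomial in
  \<open>t\<close>. Its value at \<open>t = - b / c\<close> gives the bound; for
  \<open>c = 0\<close> a suitable \<open>t\<close> forces \<open>b = 0\<close>.\<close>

lemma cauchy_schwarz_l2:
  assumes "sq_int M X" "sq_int M Y"
  shows "\<bar>\<integral>\<omega>. X \<omega> * Y \<omega> \<partial>M\<bar> \<le> l2 M X * l2 M Y"
proof -
  define a b c where "a = (\<integral>\<omega>. (X \<omega>)\<^sup>2 \<partial>M)" and "b = (\<integral>\<omega>. X \<omega> * Y \<omega> \<partial>M)" and "c = (\<integral>\<omega>. (Y \<omega>)\<^sup>2 \<partial>M)"
  have pos: "0 \<le> a + 2 * t * b + t\<^sup>2 * c" for t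
  proof -
    have "0 \<le> (\<integral>\<omega>. (X \<omega> + t * Y \<omega>)\<^sup>2 \<partial>M)" by simp
    also have "\<dots> = (\<integral>\<omega>. (X \<omega>)\<^sup>2 + 2 * t * (X \<omega> * Y \<omega>) + t\<^sup>2 * (Y \<omega>)\<^sup>2 \<partial>M)"
      by (simp add: power2_sum power_mult_distrib algebra_simps)
    also have "\<dots> = a + 2 * t * b + t\<^sup>2 * c"
      using assms sq_int_mult[OF assms] by (simp add: a_def b_def c_def sq_int_def)
    finally show ?thesis .
  qed
  have "a \<ge> 0" "c \<ge> 0" by (simp_all add: a_def c_def)
  have "b\<^sup>2 \<le> a * c"
  proof (cases "c = 0")
    case True
    have "b = 0"
    proof (rule ccontr)
      assume "b \<noteq> 0"
      have "0 \<le> a + 2 * (- (a + 1) / b) * b" using pos[of "- (a + 1) / b"] True by simp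
      also have "\<dots> = - a - 2" using \<open>b \<noteq> 0\<close> by simp
      finally show False using \<open>a \<ge> 0\<close> by simp
    qed
    then show ?thesis using True by simp
  next
    case False
    then have "c > 0" using \<open>c \<ge> 0\<close> by simp
    have "0 \<le> a + 2 * (- b / c) * b + (- b / c)\<^sup>2 * c" by (rule pos)
    also have "\<dots> = a - b\<^sup>2 / c" using \<open>c > 0\<close> by (simp add: power2_eq_square field_simps)
    finally show ?thesis using \<open>c > 0\<close> by (simp add: field_simps)
  qed
  then have "sqrt (b\<^sup>2) \<le> sqrt (a * c)" by (rule real_sqrt_le_mono)
  then show ?thesis by (simp add: l2_def a_def b_def c_def real_sqrt_mult)
qed

lemma l2_triangle:
  assumes "sq_int M X" "sq_int M Y"
  shows "l2 M (\<lambda>\<omega>. X \<omega> + Y \<omega>) \<le> l2 M X + l2 M Y"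
proof -
  have "(l2 M (\<lambda>\<omega>. X \<omega> + Y \<omega>))\<^sup>2 = (\<integral>\<omega>. (X \<omega>)\<^sup>2 + (Y \<omega>)\<^sup>2 + 2 * (X \<omega> * Y \<omega>) \<partial>M)"
    by (simp add: l2_square power2_sum mult.assoc)
  also have "\<dots> = (l2 M X)\<^sup>2 + (l2 M Y)\<^sup>2 + 2 * (\<integral>\<omega>. X \<omega> * Y \<omega> \<partial>M)"
    using assms sq_int_mult[OF assms] by (simp add: l2_square sq_int_def)
  also have "\<dots> \<le> (l2 M X + l2 M Y)\<^sup>2"
    using cauchy_schwarz_l2[OF assms] by (simp add: power2_sum)
  finally show ?thesis by (rule power2_le_imp_le) simp
qed

lemma l2_scale: "l2 M (\<lambda>\<omega>. a * X \<omega>) = \<bar>a\<bar> * l2 M X"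
  by (simp add: l2_def power_mult_distrib real_sqrt_mult)

lemma l2_zero[simp]: "l2 M (\<lambda>_. 0) = 0"
  by (simp add: l2_def)

lemma l2_diff_le:
  assumes "sq_int M X" "sq_int M Y"
  shows "l2 M (\<lambda>\<omega>. X \<omega> - Y \<omega>) \<le> l2 M X + l2 M Y"
  using l2_triangle[OF assms(1) sq_int_scale[OF assms(2), of "- 1"]] l2_scale[of M "- 1" Y] by simp

lemma l2_sum_le:
  assumes "\<And>k. k \<in> I \<Longrightarrow> sq_int M (X k)"
  shows "l2 M (\<lambda>\<omega>. \<Sum>k\<in>I. X k \<omega>) \<le> (\<Sum>k\<in>I. l2 M (X k))"
  using assms
proof (induction I rule: infinite_finite_induct)
  case (insert k I)
  have "l2 M (\<lambda>\<omega>. X k \<omega> + (\<Sum>k\<in>I. X k \<omega>)) \<le> l2 M (X k) + l2 M (\<lambda>\<omega>. \<Sum>k\<in>I. X k \<omega>)"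
    using insert.prems by (intro l2_triangle sq_int_sum) auto
  then show ?case using insert by simp
qed simp_all

text \<open>Continuity of the mean-square inner product; it carries the orthogonality and isometry
  of elementary integrals to the Wiener integral.\<close>

lemma product_integral_limit:
  assumes X: "sq_int M X" "\<And>n. sq_int M (Xn n)" "(\<lambda>n. l2 M (\<lambda>\<omega>. X \<omega> - Xn n \<omega>)) \<longlonglongrightarrow> 0"
    and Y: "sq_int M Y" "\<And>n. sq_int M (Yn n)" "(\<lambda>n. l2 M (\<lambda>\<omega>. Y \<omega> - Yn n \<omega>)) \<longlonglongrightarrow> 0"
  shows "(\<lambda>n. \<integral>\<omega>. Xn n \<omega> * Yn n \<omega> \<partial>M) \<longlonglongrightarrow> (\<integral>\<omega>. X \<omega> * Y \<omega> \<partial>M)"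
proof (rule Lim_null_comparison[THEN LIM_zero_cancel])
  let ?d = "\<lambda>n. l2 M (\<lambda>\<omega>. X \<omega> - Xn n \<omega>)" and ?e = "\<lambda>n. l2 M (\<lambda>\<omega>. Y \<omega> - Yn n \<omega>)"
  show "\<forall>\<^sub>F n in sequentially. norm ((\<integral>\<omega>. Xn n \<omega> * Yn n \<omega> \<partial>M) - (\<integral>\<omega>. X \<omega> * Y \<omega> \<partial>M))
      \<le> ?d n * ?e n + ?d n * l2 M Y + l2 M X * ?e n"
  proof (intro always_eventually allI)
    fix n
    note d = sq_int_diff[OF X(1,2), of n] and e = sq_int_diff[OF Y(1,2), of n]
    have "(\<integral>\<omega>. Xn n \<omega> * Yn n \<omega> \<partial>M) = (\<integral>\<omega>. (X \<omega> - Xn n \<omega>) * (Y \<omega> - Yn n \<omega>) - (X \<omega> - Xn n \<omega>) * Y \<omega> - X \<omega> * (Y \<omega> - Yn n \<omega>) + X \<omega> * Y \<omega> \<partial>M)"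
      by (intro Bochner_Integration.integral_cong) (auto simp: algebra_simps)
    also have "\<dots> = (\<integral>\<omega>. (X \<omega> - Xn n \<omega>) * (Y \<omega> - Yn n \<omega>) \<partial>M) - (\<integral>\<omega>. (X \<omega> - Xn n \<omega>) * Y \<omega> \<partial>M)
        - (\<integral>\<omega>. X \<omega> * (Y \<omega> - Yn n \<omega>) \<partial>M) + (\<integral>\<omega>. X \<omega> * Y \<omega> \<partial>M)"
      using sq_int_mult[OF d e] sq_int_mult[OF d Y(1)] sq_int_mult[OF X(1) e] sq_int_mult[OF X(1) Y(1)] by simp
    finally show "norm ((\<integral>\<omega>. Xn n \<omega> * Yn n \<omega> \<partial>M) - (\<integral>\<omega>. X \<omega> * Y \<omega> \<partial>M))
      \<le> ?d n * ?e n + ?d n * l2 M Y + l2 M X * ?e n"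
      using cauchy_schwarz_l2[OF d e] cauchy_schwarz_l2[OF d Y(1)] cauchy_schwarz_l2[OF X(1) e]
      unfolding real_norm_def by linarith
  qed
  have "(\<lambda>n. ?d n * ?e n + ?d n * l2 M Y + l2 M X * ?e n) \<longlonglongrightarrow> 0 * 0 + 0 * l2 M Y + l2 M X * 0"
    by (intro tendsto_intros X(3) Y(3))
  then show "(\<lambda>n. ?d n * ?e n + ?d n * l2 M Y + l2 M X * ?e n) \<longlonglongrightarrow> 0" by simp
qed

lemma sq_int_of_nn_integral:
  assumes [measurable]: "X \<in> borel_measurable M" and le: "(\<integral>\<^sup>+\<omega>. ennreal ((X \<omega>)\<^sup>2) \<partial>M) \<le> ennreal K" and "0 \<le> K"
  shows "sq_int M X" "l2 M X \<le> sqrt K"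
proof -
  have i: "integrable M (\<lambda>\<omega>. (X \<omega>)\<^sup>2)"
    using le by (intro integrableI_nonneg) (auto intro: le_less_trans)
  then show "sq_int M X" by (simp add: sq_int_def)
  have "ennreal (\<integral>\<omega>. (X \<omega>)\<^sup>2 \<partial>M) \<le> ennreal K"
    using nn_integral_eq_integral[OF i] le by simp
  then show "l2 M X \<le> sqrt K" using \<open>0 \<le> K\<close> by (simp add: l2_def)
qed

lemma sq_int_nn_integral:
  assumes "sq_int M X"
  shows "(\<integral>\<^sup>+\<omega>. ennreal ((X \<omega>)\<^sup>2) \<partial>M) = ennreal ((l2 M X)\<^sup>2)"
  using assms by (simp add: sq_int_def l2_square nn_integral_eq_integral)

section \<open>Riemann sums and path integrals in mean square\<close>

lemma grid_simps:
  "grid a b n 0 = a" "n > 0 \<Longrightarrow> grid a b n n = b" "grid a b n (Suc k) - grid a b n k = (b - a) / real n"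
  by (simp_all add: grid_def distrib_right add_divide_distrib)

lemma grid_mono: "a \<le> b \<Longrightarrow> j \<le> k \<Longrightarrow> grid a b n j \<le> grid a b n k"
  unfolding grid_def by (intro add_left_mono divide_right_mono mult_right_mono) auto

lemma grid_bounds: "a \<le> b \<Longrightarrow> k \<le> n \<Longrightarrow> n > 0 \<Longrightarrow> a \<le> grid a b n k \<and> grid a b n k \<le> b"
  using grid_mono[of a b 0 k n] grid_mono[of a b k n n] by (simp add: grid_simps)

lemma integral_grid_sum:
  fixes f :: "real \<Rightarrow> real"
  assumes f: "f integrable_on {a..b}" and ab: "a \<le> b" and n: "n > 0"
  shows "(\<Sum>k<n. integral {grid a b n k..grid a b n (Suc k)} f) = integral {a..b} f"
proof -
  have "m \<le> n \<Longrightarrow> (\<Sum>k<m. integral {grid a b n k..grid a b n (Suc k)} f) = integral {a..grid a b n m} f" for m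
  proof (induction m)
    case (Suc m)
    have "f integrable_on {a..grid a b n (Suc m)}"
      using grid_bounds[OF ab Suc.prems n] by (intro integrable_on_subinterval[OF f]) auto
    then show ?case
      using Suc grid_bounds[OF ab _ n, of m] grid_mono[OF ab, of m "Suc m" n]
      by (simp add: Henstock_Kurzweil_Integration.integral_combine)
  qed (simp add: grid_simps)
  from this[of n] show ?thesis using n by (simp add: grid_simps)
qed

lemma riemann_sum_tendsto:
  fixes f :: "real \<Rightarrow> real"
  assumes f: "continuous_on {a..b} f" and ab: "a \<le> b"
  shows "(\<lambda>n. \<Sum>k<n. (b - a) / real n * f (grid a b n k)) \<longlonglongrightarrow> integral {a..b} f"
proof (rule LIMSEQ_I)
  fix e :: real assume e: "e > 0"
  define e' where "e' = e / (b - a + 1)"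
  have e': "e' > 0" using e ab by (simp add: e'_def)
  have "uniformly_continuous_on {a..b} f" by (rule compact_uniformly_continuous[OF f]) simp
  then obtain d where d: "d > 0" "\<And>x y. x \<in> {a..b} \<Longrightarrow> y \<in> {a..b} \<Longrightarrow> dist y x < d \<Longrightarrow> dist (f y) (f x) < e'"
    using e' unfolding uniformly_continuous_on_def by metis
  obtain N where N: "(b - a) / d < real N" using reals_Archimedean2 by blast
  show "\<exists>N. \<forall>n\<ge>N. norm ((\<Sum>k<n. (b - a) / real n * f (grid a b n k)) - integral {a..b} f) < e"
  proof (intro exI[of _ "Suc N"] allI impI)
    fix n assume n: "n \<ge> Suc N"
    then have n0: "n > 0" and "(b - a) / d < real n" using N by auto
    then have h: "(b - a) / real n < d" using d(1) by (simp add: field_simps)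
    have fi: "f integrable_on {a..b}" by (rule integrable_continuous_real[OF f])
    have piece: "\<bar>(b - a) / real n * f (grid a b n k) - integral {grid a b n k..grid a b n (Suc k)} f\<bar> \<le> e' * ((b - a) / real n)"
      if "k < n" for k
    proof -
      let ?u = "grid a b n k" and ?v = "grid a b n (Suc k)"
      have uv: "?u \<le> ?v" "a \<le> ?u" "?v \<le> b" using that grid_bounds[OF ab _ n0, of k] grid_bounds[OF ab _ n0, of "Suc k"] grid_mono[OF ab, of k "Suc k" n] by auto
      have i: "f integrable_on {?u..?v}" using uv by (intro integrable_on_subinterval[OF fi]) auto
      have "integral {?u..?v} (\<lambda>x. f ?u - f x) = (?v - ?u) * f ?u - integral {?u..?v} f"
        using uv i by (subst Henstock_Kurzweil_Integration.integral_diff) (auto simp: content_real)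
      moreover have "norm (integral {?u..?v} (\<lambda>x. f ?u - f x)) \<le> integral {?u..?v} (\<lambda>x. e')"
      proof (rule Henstock_Kurzweil_Integration.integral_norm_bound_integral)
        show "norm (f ?u - f x) \<le> e'" if x: "x \<in> {?u..?v}" for x
        proof -
          have "?v - ?u = (b - a) / real n" by (rule grid_simps)
          then have "dist ?u x < d" using x h by (auto simp: dist_real_def)
          then show ?thesis using d(2)[of x ?u] x uv by (auto simp: dist_real_def)
        qed
      qed (use i in \<open>auto intro: integrable_diff\<close>)
      ultimately show ?thesis using uv by (simp add: grid_simps(3) content_real mult.commute)
    qed
    have "(\<Sum>k<n. (b - a) / real n * f (grid a b n k)) - integral {a..b} f
        = (\<Sum>k<n. (b - a) / real n * f (grid a b n k) - integral {grid a b n k..grid a b n (Suc k)} f)"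
      by (simp add: sum_subtractf integral_grid_sum[OF fi ab n0])
    also have "norm \<dots> \<le> (\<Sum>k<n. e' * ((b - a) / real n))"
      unfolding real_norm_def by (rule order_trans[OF sum_abs sum_mono]) (use piece in auto)
    also have "\<dots> = e' * (b - a)" using n0 by simp
    also have "\<dots> < e" using e ab by (simp add: e'_def field_simps)
    finally show "norm ((\<Sum>k<n. (b - a) / real n * f (grid a b n k)) - integral {a..b} f) < e" .
  qed
qed

text \<open>Minkowski's integral inequality, by Fatou's lemma for Riemann sums of the continuous paths,
  so that no joint measurability is needed.\<close>

lemma l2_path_integral_le:
  fixes Y :: "real \<Rightarrow> 'a \<Rightarrow> real"
  assumes ab: "a \<le> b" and Y: "\<And>r. a \<le> r \<Longrightarrow> r \<le> b \<Longrightarrow> sq_int M (Y r)" "\<And>r. a \<le> r \<Longrightarrow> r \<le> b \<Longrightarrow> l2 M (Y r) \<le> K"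
    and path: "AE \<omega> in M. continuous_on {a..b} (\<lambda>r. Y r \<omega>)"
    and int: "AE \<omega> in M. ((\<lambda>r. Y r \<omega>) has_integral I \<omega>) {a..b}" and [measurable]: "I \<in> borel_measurable M"
  shows "sq_int M I" "l2 M I \<le> (b - a) * K"
proof -
  define R where "R n \<omega> = (\<Sum>k<Suc n. (b - a) / real (Suc n) * Y (grid a b (Suc n) k) \<omega>)" for n \<omega>
  have g: "a \<le> grid a b (Suc n) k \<and> grid a b (Suc n) k \<le> b" if "k < Suc n" for n k
    using grid_bounds[OF ab, of k "Suc n"] that by simp
  have Rsq: "sq_int M (R n)" for n
    unfolding R_def[abs_def] by (intro sq_int_sum sq_int_scale Y(1)) (use g in auto)
  have [measurable]: "R n \<in> borel_measurable M" for n using Rsq by (simp add: sq_int_def)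
  have K0: "0 \<le> K" using order_trans[OF l2_nonneg Y(2)[of a]] ab by simp
  have Rl2: "l2 M (R n) \<le> (b - a) * K" for n
  proof -
    have "l2 M (R n) \<le> (\<Sum>k<Suc n. l2 M (\<lambda>\<omega>. (b - a) / real (Suc n) * Y (grid a b (Suc n) k) \<omega>))"
      unfolding R_def[abs_def] by (intro l2_sum_le sq_int_scale Y(1)) (use g in auto)
    also have "\<dots> \<le> (\<Sum>k<Suc n. (b - a) / real (Suc n) * K)"
      unfolding l2_scale using ab g by (intro sum_mono mult_mono Y(2)) auto
    also have "\<dots> = (b - a) * K" by (simp del: of_nat_Suc)
    finally show ?thesis .
  qed
  have lim: "AE \<omega> in M. ennreal ((I \<omega>)\<^sup>2) = liminf (\<lambda>n. ennreal ((R n \<omega>)\<^sup>2))"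
    using path int
  proof eventually_elim
    fix \<omega> assume c: "continuous_on {a..b} (\<lambda>r. Y r \<omega>)" and i: "((\<lambda>r. Y r \<omega>) has_integral I \<omega>) {a..b}"
    have "(\<lambda>n. R n \<omega>) \<longlonglongrightarrow> I \<omega>"
      using LIMSEQ_Suc[OF riemann_sum_tendsto[OF c ab]] integral_unique[OF i] by (simp add: R_def)
    then have "(\<lambda>n. ennreal ((R n \<omega>)\<^sup>2)) \<longlonglongrightarrow> ennreal ((I \<omega>)\<^sup>2)"
      by (intro tendsto_ennrealI tendsto_power)
    then show "ennreal ((I \<omega>)\<^sup>2) = liminf (\<lambda>n. ennreal ((R n \<omega>)\<^sup>2))"
      by (intro lim_imp_Liminf[symmetric]) simp
  qed
  have "(\<integral>\<^sup>+\<omega>. ennreal ((I \<omega>)\<^sup>2) \<partial>M) = (\<integral>\<^sup>+\<omega>. liminf (\<lambda>n. ennreal ((R n \<omega>)\<^sup>2)) \<partial>M)"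
    by (rule nn_integral_cong_AE[OF lim])
  also have "\<dots> \<le> liminf (\<lambda>n. \<integral>\<^sup>+\<omega>. ennreal ((R n \<omega>)\<^sup>2) \<partial>M)"
    by (rule nn_integral_liminf) simp
  also have "\<dots> \<le> liminf (\<lambda>n::nat. ennreal (((b - a) * K)\<^sup>2))"
    unfolding sq_int_nn_integral[OF Rsq] using Rl2
    by (intro Liminf_mono always_eventually allI ennreal_leI power_mono) auto
  also have "\<dots> = ennreal (((b - a) * K)\<^sup>2)" by (simp add: Liminf_const)
  finally have "(\<integral>\<^sup>+\<omega>. ennreal ((I \<omega>)\<^sup>2) \<partial>M) \<le> ennreal (((b - a) * K)\<^sup>2)" .
  from sq_int_of_nn_integral[OF _ this] show "sq_int M I" "l2 M I \<le> (b - a) * K"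
    using K0 ab by auto
qed

text \<open>An error of order \<open>3/2\<close> is negligible against the increment. The expansion
  is based at the left end of an interval; for \<open>y < x\<close> the base point is therefore
  \<open>y\<close>, and continuity of \<open>g\<close> replaces \<open>g y\<close> by
  \<open>g x\<close>.\<close>

lemma derivative_from_increments:
  fixes f g :: "real \<Rightarrow> real"
  assumes inc: "\<And>s t. 0 \<le> s \<Longrightarrow> s < t \<Longrightarrow> t \<le> T \<Longrightarrow> \<bar>f t - f s - (t - s) * g s\<bar> \<le> C * ((t - s) * sqrt (t - s))"
    and g: "continuous_on {0..T} g" and x: "x \<in> {0..T}"
  shows "(f has_vector_derivative g x) (at x within {0..T})"
proof -
  have C: "0 \<le> C" if "0 < T"
  proof (rule ccontr)
    assume "\<not> 0 \<le> C"
    then have "C * (T * sqrt T) < 0" using that by (simp add: mult_neg_pos)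
    then show False using order_trans[OF abs_ge_zero inc[of 0 T]] that by simp
  qed
  have "((\<lambda>y. (f y - f x) / (y - x)) \<longlongrightarrow> g x) (at x within {0..T})"
  proof (rule Lim_null_comparison[THEN LIM_zero_cancel])
    show "\<forall>\<^sub>F y in at x within {0..T}. norm ((f y - f x) / (y - x) - g x) \<le> C * sqrt \<bar>y - x\<bar> + \<bar>g y - g x\<bar>"
      unfolding eventually_at_filter
    proof (intro always_eventually allI impI)
      fix y assume y: "y \<noteq> x" "y \<in> {0..T}"
      have quot: "\<bar>(f t - f s) / (t - s) - g s\<bar> \<le> C * sqrt (t - s)" if "0 \<le> s" "s < t" "t \<le> T" for s t
      proof -
        have "(f t - f s) / (t - s) - g s = (f t - f s - (t - s) * g s) / (t - s)"
          using that by (simp add: diff_divide_distrib)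
        then have "\<bar>(f t - f s) / (t - s) - g s\<bar> = \<bar>f t - f s - (t - s) * g s\<bar> / (t - s)"
          using that by (simp add: abs_divide)
        also have "\<dots> \<le> (C * ((t - s) * sqrt (t - s))) / (t - s)"
          using that by (intro divide_right_mono inc) auto
        also have "\<dots> = C * sqrt (t - s)" using that by simp
        finally show ?thesis .
      qed
      show "norm ((f y - f x) / (y - x) - g x) \<le> C * sqrt \<bar>y - x\<bar> + \<bar>g y - g x\<bar>"
      proof (cases "x < y")
        case True
        then show ?thesis using quot[of x y] x y by auto
      next
        case False
        then have "(f y - f x) / (y - x) = (f x - f y) / (x - y)" using y by (simp add: field_simps)
        then show ?thesis using quot[of y x] x y False by auto
      qed
    qed
    have "(g \<longlongrightarrow> g x) (at x within {0..T})" using g x by (simp add: continuous_on)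
    then have "((\<lambda>y. C * sqrt \<bar>y - x\<bar> + \<bar>g y - g x\<bar>) \<longlongrightarrow> C * sqrt \<bar>x - x\<bar> + \<bar>g x - g x\<bar>) (at x within {0..T})"
      by (intro tendsto_intros)
    then show "((\<lambda>y. C * sqrt \<bar>y - x\<bar> + \<bar>g y - g x\<bar>) \<longlongrightarrow> 0) (at x within {0..T})" by simp
  qed
  then show ?thesis
    by (simp add: has_real_derivative_iff_has_vector_derivative[symmetric] has_field_derivative_iff)
qed

lemma (in prob_space) sq_int_const: "sq_int M (\<lambda>_. a)"
  by (simp add: sq_int_def)

lemma (in prob_space) sq_int_integrable: "sq_int M X \<Longrightarrow> integrable M X"
  using sq_int_mult[of M X "\<lambda>_. 1"] sq_int_const by simp

section \<open>Wiener integrals\<close>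

lemma measurable_vec_component[measurable (raw)]:
  fixes f :: "'a \<Rightarrow> real^'n"
  assumes "f \<in> borel_measurable M"
  shows "(\<lambda>x. f x $ i) \<in> borel_measurable M"
  using measurable_compose[OF assms, of "\<lambda>v. v $ i" borel]
  by (simp add: borel_measurable_continuous_onI continuous_intros)

lemma pd_scaled_identity: "h > 0 \<Longrightarrow> pd_mat (h *\<^sub>R mat 1)"
  by (auto simp: pd_mat_def sym_mat_def transpose_scalar transpose_mat scaleR_matrix_vector_assoc[symmetric])

locale brownian = prob_space M for M :: "'w measure" +
  fixes F :: "real \<Rightarrow> 'w measure" and W :: "real \<Rightarrow> 'w \<Rightarrow> real^'n"
  assumes bm: "brownian_motion M F W"
begin

lemma filtration: "0 \<le> t \<Longrightarrow> subalgebra M (F t)"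
  using bm unfolding brownian_motion_def by auto

lemma adapted_measurable: "0 \<le> s \<Longrightarrow> X \<in> borel_measurable (F s) \<Longrightarrow> X \<in> borel_measurable M"
  by (rule measurable_from_subalg[OF filtration])

lemma adapted_mono:
  assumes "0 \<le> s" "s \<le> t" "X \<in> borel_measurable (F s)"
  shows "X \<in> borel_measurable (F t)"
proof (rule measurable_from_subalg[OF _ assms(3)])
  have "subalgebra M (F s)" "subalgebra M (F t)" "sets (F s) \<subseteq> sets (F t)"
    using bm assms(1,2) unfolding brownian_motion_def by auto
  then show "subalgebra (F t) (F s)" by (simp add: subalgebra_def)
qed

lemma W_adapted: "0 \<le> t \<Longrightarrow> W t \<in> borel_measurable (F t)"
  using bm unfolding brownian_motion_def by auto

lemma W_measurable[measurable]: "0 \<le> t \<Longrightarrow> W t \<in> borel_measurable M"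
  using W_adapted adapted_measurable by blast

lemma increment_adapted:
  assumes "0 \<le> s" "s \<le> t"
  shows "(\<lambda>\<omega>. (W t \<omega> - W s \<omega>) $ i) \<in> borel_measurable (F t)"
proof -
  have "W t \<in> borel_measurable (F t)" "W s \<in> borel_measurable (F t)"
    using W_adapted[of t] adapted_mono[OF assms W_adapted] assms by auto
  then have "(\<lambda>\<omega>. W t \<omega> - W s \<omega>) \<in> borel_measurable (F t)" by (rule borel_measurable_diff)
  then show ?thesis by (rule measurable_vec_component)
qed

lemma increment_moments:
  assumes st: "0 \<le> s" "s < t"
  shows "sq_int M (\<lambda>\<omega>. (W t \<omega> - W s \<omega>) $ i)"
    "(\<integral>\<omega>. (W t \<omega> - W s \<omega>) $ i \<partial>M) = 0"
    "(\<integral>\<omega>. (W t \<omega> - W s \<omega>) $ i * (W t \<omega> - W s \<omega>) $ j \<partial>M) = (if i = j then t - s else 0)"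
proof -
  let ?D = "\<lambda>\<omega>. W t \<omega> - W s \<omega>" and ?C = "(t - s) *\<^sub>R mat 1 :: real^'n^'n"
  have pd: "pd_mat ?C" using st by (intro pd_scaled_identity) simp
  have [measurable]: "?D \<in> borel_measurable M"
    using st by (intro borel_measurable_diff W_measurable) auto
  have law: "distr M borel ?D = gaussian 0 ?C" using bm st unfolding brownian_motion_def by auto
  have "has_bochner_integral (distr M borel ?D) (\<lambda>x. x $ i) (0 $ i)"
    unfolding law by (rule has_bochner_integral_bounded_linear[OF bounded_linear_vec_nth gaussian_moments(2)[OF pd]])
  then show "(\<integral>\<omega>. ?D \<omega> $ i \<partial>M) = 0"
    by (subst (asm) has_bochner_integral_iff) (simp add: integral_distr)
  have m: "has_bochner_integral (distr M borel ?D) (\<lambda>x. x $ i * x $ j) (?C $ i $ j)" for i j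
    using has_bochner_integral_bounded_linear[OF bounded_linear_vec_nth[of j]
        has_bochner_integral_bounded_linear[OF bounded_linear_vec_nth[of i] gaussian_moments(3)[OF pd, of 0]]]
    unfolding law by (simp add: outer_def)
  have Dm: "(\<lambda>\<omega>. ?D \<omega> $ i) \<in> borel_measurable M" by measurable
  from m[of i i] show "sq_int M (\<lambda>\<omega>. ?D \<omega> $ i)"
    unfolding sq_int_def using Dm
    by (subst (asm) has_bochner_integral_iff) (simp add: integrable_distr_eq power2_eq_square)
  from m[of i j] show "(\<integral>\<omega>. ?D \<omega> $ i * ?D \<omega> $ j \<partial>M) = (if i = j then t - s else 0)"
    by (subst (asm) has_bochner_integral_iff) (simp add: integral_distr mat_def)
qed

text \<open>Independence of the past makes the expectation factor, and the increment has mean zero.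
  \<open>brownian_motion\<close> states independence for sigma-algebras; it is restricted to those
  generated by \<open>X\<close> and by one component of the increment.\<close>

lemma increment_orthogonal:
  assumes st: "0 \<le> s" "s < t" and X: "X \<in> borel_measurable (F s)" "sq_int M X"
  shows "(\<integral>\<omega>. X \<omega> * (W t \<omega> - W s \<omega>) $ i \<partial>M) = 0"
proof -
  let ?D = "\<lambda>\<omega>. W t \<omega> - W s \<omega>"
  have [measurable]: "?D \<in> borel_measurable M"
    using st by (intro borel_measurable_diff W_measurable) auto
  have [measurable]: "X \<in> borel_measurable M" using X(2) by (rule sq_int_measurable)
  have sub: "subalgebra M (F s)" by (rule filtration[OF st(1)])
  have ind: "indep_set (sets (F s)) (sets (vimage_algebra (space M) ?D borel))"
    using bm st unfolding brownian_motion_def by auto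
  have A: "sigma_sets (space M) {X -` A \<inter> space M | A. A \<in> sets borel} \<subseteq> sets (F s)"
  proof -
    have "space (F s) = space M" using sub by (simp add: subalgebra_def)
    moreover have "sigma_sets (space (F s)) {X -` A \<inter> space (F s) | A. A \<in> sets borel} \<subseteq> sets (F s)"
      using X(1) by (intro sets.sigma_sets_subset) (auto intro: measurable_sets)
    ultimately show ?thesis by simp
  qed
  have B: "sigma_sets (space M) {(\<lambda>\<omega>. ?D \<omega> $ i) -` A \<inter> space M | A. A \<in> sets borel}
      \<subseteq> sets (vimage_algebra (space M) ?D borel)"
  proof -
    have "{(\<lambda>\<omega>. ?D \<omega> $ i) -` A \<inter> space M | A. A \<in> sets borel} \<subseteq> {?D -` A \<inter> space M | A. A \<in> sets borel}"
    proof clarify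
      fix A :: "real set" assume "A \<in> sets borel"
      then have "(\<lambda>v::real^'n. v $ i) -` A \<in> sets borel"
        using measurable_sets[of "\<lambda>v::real^'n. v $ i" borel borel A] by simp
      then show "\<exists>Aa. (\<lambda>\<omega>. ?D \<omega> $ i) -` A \<inter> space M = ?D -` Aa \<inter> space M \<and> Aa \<in> sets borel"
        by (intro exI[of _ "(\<lambda>v::real^'n. v $ i) -` A"]) auto
    qed
    then show ?thesis unfolding sets_vimage_algebra by (rule sigma_sets_mono')
  qed
  have "indep_var borel X borel (\<lambda>\<omega>. ?D \<omega> $ i)"
    unfolding indep_var_eq
  proof (intro conjI)
    show "indep_set (sigma_sets (space M) {X -` A \<inter> space M | A. A \<in> sets borel})
       (sigma_sets (space M) {(\<lambda>\<omega>. ?D \<omega> $ i) -` A \<inter> space M | A. A \<in> sets borel})"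
      using ind unfolding indep_set_def
      by (rule indep_sets_mono_sets) (use A B in \<open>auto split: bool.splits\<close>)
  qed measurable
  then have "(\<integral>\<omega>. X \<omega> * ?D \<omega> $ i \<partial>M) = (\<integral>\<omega>. X \<omega> \<partial>M) * (\<integral>\<omega>. ?D \<omega> $ i \<partial>M)"
    using sq_int_integrable[OF X(2)] sq_int_integrable[OF increment_moments(1)[OF st]]
    by (intro indep_var_lebesgue_integral)
  then show ?thesis using increment_moments(2)[OF st] by simp
qed

context
  fixes a b :: real and n :: nat and H :: "nat \<Rightarrow> real^'n^'n"
  assumes ab: "0 \<le> a" "a < b"
begin

abbreviation (input) incr :: "nat \<Rightarrow> 'n \<Rightarrow> 'w \<Rightarrow> real" where
  "incr k l \<omega> \<equiv> (W (grid a b n (Suc k)) \<omega> - W (grid a b n k) \<omega>) $ l"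

definition elem :: "'w \<Rightarrow> real^'n" where
  "elem \<omega> = (\<Sum>k<n. H k *v (W (grid a b n (Suc k)) \<omega> - W (grid a b n k) \<omega>))"

lemma elem_component: "elem \<omega> $ i = (\<Sum>k<n. \<Sum>l\<in>UNIV. H k $ i $ l * incr k l \<omega>)"
  by (simp add: elem_def matrix_vector_mult_def)

lemma grid_step: "k < n \<Longrightarrow> 0 \<le> grid a b n k" "k < n \<Longrightarrow> grid a b n k < grid a b n (Suc k)"
proof -
  assume "k < n"
  then show "0 \<le> grid a b n k" using ab grid_bounds[of a b k n] by auto
  have "(b - a) / real n > 0" using \<open>k < n\<close> ab by simp
  then show "grid a b n k < grid a b n (Suc k)" using grid_simps(3)[of a b n k] by linarith
qed

lemma incr_sq: "k < n \<Longrightarrow> sq_int M (incr k l)"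
  by (intro increment_moments grid_step)

lemma elem_sq: "sq_int M (\<lambda>\<omega>. elem \<omega> $ i)"
  unfolding elem_component by (intro sq_int_sum sq_int_scale incr_sq) simp

lemma elem_orthogonal:
  assumes X: "X \<in> borel_measurable (F a)" "sq_int M X"
  shows "(\<integral>\<omega>. X \<omega> * elem \<omega> $ i \<partial>M) = 0"
proof -
  have z: "(\<integral>\<omega>. X \<omega> * incr k l \<omega> \<partial>M) = 0" if k: "k < n" for k l
  proof (rule increment_orthogonal[OF grid_step(1)[OF k] grid_step(2)[OF k] _ X(2)])
    show "X \<in> borel_measurable (F (grid a b n k))"
      using grid_bounds[of a b k n] k ab by (intro adapted_mono[OF _ _ X(1)]) auto
  qed
  have "(\<integral>\<omega>. X \<omega> * elem \<omega> $ i \<partial>M) = (\<integral>\<omega>. (\<Sum>k<n. \<Sum>l\<in>UNIV. H k $ i $ l * (X \<omega> * incr k l \<omega>)) \<partial>M)"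
    unfolding elem_component by (simp add: sum_distrib_left mult_ac)
  also have "\<dots> = (\<Sum>k<n. \<Sum>l\<in>UNIV. H k $ i $ l * (\<integral>\<omega>. X \<omega> * incr k l \<omega> \<partial>M))"
    using sq_int_mult[OF X(2) incr_sq]
    by (subst Bochner_Integration.integral_sum, force, intro sum.cong refl)
      (subst Bochner_Integration.integral_sum, auto)
  also have "\<dots> = 0" using z by simp
  finally show ?thesis .
qed

text \<open>Of two different increments the earlier one is known when the later one begins.\<close>

lemma incr_product:
  assumes k: "k < n" "k' < n"
  shows "(\<integral>\<omega>. incr k l \<omega> * incr k' l' \<omega> \<partial>M) = (if k = k' \<and> l = l' then (b - a) / real n else 0)"
proof -
  have lt: "(\<integral>\<omega>. incr k l \<omega> * incr k' l' \<omega> \<partial>M) = 0" if "k < k'" "k' < n" for k k' l l'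
  proof (rule increment_orthogonal[OF grid_step[OF that(2)]])
    have "k < n" using that by simp
    show "incr k l \<in> borel_measurable (F (grid a b n k'))"
      using that ab grid_step[OF \<open>k < n\<close>]
      by (intro adapted_mono[OF _ _ increment_adapted] grid_mono) auto
    show "sq_int M (incr k l)" using \<open>k < n\<close> by (rule incr_sq)
  qed
  show ?thesis
  proof (cases k k' rule: linorder_cases)
    case less
    then show ?thesis using lt[OF less k(2)] by simp
  next
    case equal
    then show ?thesis using increment_moments(3)[OF grid_step[OF k(2)], of l l'] by (simp only: grid_simps) simp
  next
    case greater
    then show ?thesis using lt[OF greater k(1), of l' l] by (simp add: mult.commute)
  qed
qed

text \<open>Ito's isometry for step integrands: only the terms with \<open>k = k'\<close> and
  \<open>l = l'\<close> survive.\<close>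

lemma elem_covariance:
  "(\<integral>\<omega>. elem \<omega> $ i * elem \<omega> $ j \<partial>M) = (\<Sum>k<n. (b - a) / real n * (H k $ i \<bullet> H k $ j))"
proof -
  have "(\<integral>\<omega>. elem \<omega> $ i * elem \<omega> $ j \<partial>M)
      = (\<integral>\<omega>. (\<Sum>k<n. \<Sum>k'<n. \<Sum>l\<in>UNIV. \<Sum>l'\<in>UNIV. (H k $ i $ l * H k' $ j $ l') * (incr k l \<omega> * incr k' l' \<omega>)) \<partial>M)"
    unfolding elem_component by (simp add: sum_product mult_ac)
  also have "\<dots> = (\<Sum>k<n. \<Sum>k'<n. \<Sum>l\<in>UNIV. \<Sum>l'\<in>UNIV. (H k $ i $ l * H k' $ j $ l') * (\<integral>\<omega>. incr k l \<omega> * incr k' l' \<omega> \<partial>M))"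
  proof -
    have int: "integrable M (\<lambda>\<omega>. (H k $ i $ l * H k' $ j $ l') * (incr k l \<omega> * incr k' l' \<omega>))" if "k < n" "k' < n" for k k' l l'
      by (intro integrable_mult_right sq_int_mult incr_sq that)
    show ?thesis
      by (subst Bochner_Integration.integral_sum, (intro Bochner_Integration.integrable_sum int; simp), rule sum.cong[OF refl])+
        (simp only: integral_mult_right_zero)
  qed
  also have "\<dots> = (\<Sum>k<n. \<Sum>k'<n. \<Sum>l\<in>UNIV. \<Sum>l'\<in>UNIV. if k' = k then (if l' = l then (H k $ i $ l * H k $ j $ l) * ((b - a) / real n) else 0) else 0)"
    by (intro sum.cong refl, subst incr_product) auto
  also have "\<dots> = (\<Sum>k<n. \<Sum>k'<n. if k' = k then (\<Sum>l\<in>UNIV. (H k $ i $ l * H k $ j $ l) * ((b - a) / real n)) else 0)"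
    by (intro sum.cong refl) simp
  also have "\<dots> = (\<Sum>k<n. (\<Sum>l\<in>UNIV. (H k $ i $ l * H k $ j $ l) * ((b - a) / real n)))"
    by simp
  also have "\<dots> = (\<Sum>k<n. (b - a) / real n * (H k $ i \<bullet> H k $ j))"
    by (simp add: inner_vec_def sum_distrib_left mult_ac)
  finally show ?thesis .
qed

end

end

text \<open>The approximations in \<open>wiener_integral\<close> are controlled through squared
  errors, so the error linear in \<open>d\<close> is split by Young's inequality;
  \<open>\<eta>\<close> is chosen at the end.\<close>

lemma inner_perturbation:
  fixes x y s t :: "'a::real_inner"
  assumes "\<eta> > 0" "norm (s - x) \<le> d" "norm (t - y) \<le> d" "norm s \<le> m" "norm t \<le> m"
  shows "\<bar>x \<bullet> y - s \<bullet> t\<bar> \<le> (1 + 1 / \<eta>) * d\<^sup>2 + \<eta> * m\<^sup>2"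
proof -
  have d0: "0 \<le> d" "0 \<le> m" using norm_ge_zero order_trans assms by blast+
  have "x \<bullet> y - s \<bullet> t = (s - x) \<bullet> (t - y) - (s - x) \<bullet> t - s \<bullet> (t - y)"
    by (simp add: inner_diff_left inner_diff_right)
  moreover have "\<bar>(s - x) \<bullet> (t - y)\<bar> \<le> d * d" "\<bar>(s - x) \<bullet> t\<bar> \<le> d * m" "\<bar>s \<bullet> (t - y)\<bar> \<le> m * d"
    using assms d0 by (auto intro!: order_trans[OF Cauchy_Schwarz_ineq2] mult_mono)
  moreover have "2 * (d * m) \<le> d\<^sup>2 / \<eta> + \<eta> * m\<^sup>2"
  proof -
    have "0 \<le> (d - \<eta> * m)\<^sup>2 / \<eta>" using assms(1) by simp
    also have "\<dots> = d\<^sup>2 / \<eta> + \<eta> * m\<^sup>2 - 2 * (d * m)"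
      using assms(1) by (simp add: power2_eq_square field_simps)
    finally show ?thesis by simp
  qed
  ultimately show ?thesis by (simp add: algebra_simps power2_eq_square add_divide_distrib)
qed

text \<open>The limit involves only inner products of rows of the integrand. For a symmetric matrix
  square root these are entries of the matrix itself, so continuity of the covariance takes the
  place of continuity of its root.\<close>

lemma step_covariance_limit:
  fixes \<sigma> :: "real \<Rightarrow> real^'n^'n" and H :: "nat \<Rightarrow> nat \<Rightarrow> real^'n^'n"
  assumes ab: "a < b" and \<sigma>: "set_borel_measurable lborel {a..b} \<sigma>"
    and c: "\<And>i j r. a \<le> r \<Longrightarrow> r \<le> b \<Longrightarrow> \<sigma> r $ i \<bullet> \<sigma> r $ j = c i j r"
    and cont: "\<And>i j. continuous_on {a..b} (c i j)"
    and lim: "(\<lambda>n. \<Sum>k<n. \<integral>\<^sup>+ r. ennreal ((norm (\<sigma> r - H n k))\<^sup>2)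
               * indicator {grid a b n k..grid a b n (Suc k)} r \<partial>lborel) \<longlonglongrightarrow> 0"
  shows "(\<lambda>n. \<Sum>k<n. (b - a) / real n * (H n k $ i \<bullet> H n k $ j)) \<longlonglongrightarrow> integral {a..b} (c i j)"
proof -
  define E where "E n = (\<Sum>k<n. \<integral>\<^sup>+ r. ennreal ((norm (\<sigma> r - H n k))\<^sup>2)
               * indicator {grid a b n k..grid a b n (Suc k)} r \<partial>lborel)" for n
  have "continuous_on {a..b} (\<lambda>r. \<Sum>i\<in>UNIV. c i i r)" by (intro continuous_intros cont)
  then have "bounded ((\<lambda>r. \<Sum>i\<in>UNIV. c i i r) ` {a..b})"
    by (intro compact_imp_bounded compact_continuous_image) auto
  then obtain V0 where V0: "\<And>r. r \<in> {a..b} \<Longrightarrow> norm (\<Sum>i\<in>UNIV. c i i r) \<le> V0"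
    unfolding bounded_iff by blast
  define V where "V = \<bar>V0\<bar> + 1"
  have V: "V > 0" by (simp add: V_def)
  have \<sigma>V: "(norm (\<sigma> r))\<^sup>2 \<le> V" if "r \<in> {a..b}" for r
  proof -
    have "(norm (\<sigma> r))\<^sup>2 = (\<Sum>i\<in>UNIV. c i i r)"
      using that c by (simp add: power2_norm_eq_inner inner_vec_def[of "\<sigma> r"])
    then show ?thesis using V0[OF that] by (simp add: V_def)
  qed
  have [measurable]: "(\<lambda>r. indicator {a..b} r *\<^sub>R \<sigma> r) \<in> borel_measurable lborel"
    using \<sigma> by (simp add: set_borel_measurable_def)
  have piece: "ennreal \<bar>(b - a) / real n * (H n k $ i \<bullet> H n k $ j) - integral {grid a b n k..grid a b n (Suc k)} (c i j)\<bar>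
      \<le> ennreal (1 + 1 / \<eta>) * (\<integral>\<^sup>+ r. ennreal ((norm (\<sigma> r - H n k))\<^sup>2) * indicator {grid a b n k..grid a b n (Suc k)} r \<partial>lborel)
        + ennreal (\<eta> * V * ((b - a) / real n))" if k: "k < n" and \<eta>: "\<eta> > 0" for n k \<eta>
  proof -
    let ?I = "{grid a b n k..grid a b n (Suc k)}" and ?u = "grid a b n k" and ?v = "grid a b n (Suc k)"
    let ?\<alpha> = "H n k $ i \<bullet> H n k $ j"
    have uv: "?u \<le> ?v" "a \<le> ?u" "?v \<le> b"
      using k ab grid_bounds[of a b k n] grid_bounds[of a b "Suc k" n] grid_mono[of a b k "Suc k" n] by auto
    have sub: "?I \<subseteq> {a..b}" using uv by auto
    have cc: "continuous_on ?I (\<lambda>r. ?\<alpha> - c i j r)" by (intro continuous_intros continuous_on_subset[OF cont sub])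
    have si: "set_integrable lborel ?I (\<lambda>r. ?\<alpha> - c i j r)" by (rule borel_integrable_atLeastAtMost'[OF cc])
    have "integral ?I (\<lambda>r. ?\<alpha> - c i j r) = (b - a) / real n * ?\<alpha> - integral ?I (c i j)"
      using uv integrable_continuous_real[OF continuous_on_subset[OF cont sub]]
      by (subst Henstock_Kurzweil_Integration.integral_diff) (auto simp: content_real grid_simps(3))
    then have "ennreal \<bar>(b - a) / real n * ?\<alpha> - integral ?I (c i j)\<bar> = ennreal (norm (\<integral>r. indicator ?I r *\<^sub>R (?\<alpha> - c i j r) \<partial>lborel))"
      using set_borel_integral_eq_integral(2)[OF si] by (simp add: set_lebesgue_integral_def)
    also have "\<dots> \<le> (\<integral>\<^sup>+ r. ennreal (norm (indicator ?I r *\<^sub>R (?\<alpha> - c i j r))) \<partial>lborel)"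
      using si unfolding set_integrable_def by (rule integral_norm_bound_ennreal)
    also have "\<dots> \<le> (\<integral>\<^sup>+ r. ennreal (1 + 1 / \<eta>) * (ennreal ((norm (\<sigma> r - H n k))\<^sup>2) * indicator ?I r) + ennreal (\<eta> * V) * indicator ?I r \<partial>lborel)"
    proof (rule nn_integral_mono)
      fix r
      show "ennreal (norm (indicator ?I r *\<^sub>R (?\<alpha> - c i j r)))
        \<le> ennreal (1 + 1 / \<eta>) * (ennreal ((norm (\<sigma> r - H n k))\<^sup>2) * indicator ?I r) + ennreal (\<eta> * V) * indicator ?I r"
      proof (cases "r \<in> ?I")
        case True
        then have r: "r \<in> {a..b}" using sub by auto
        have "\<bar>?\<alpha> - \<sigma> r $ i \<bullet> \<sigma> r $ j\<bar> \<le> (1 + 1 / \<eta>) * (norm (\<sigma> r - H n k))\<^sup>2 + \<eta> * (norm (\<sigma> r))\<^sup>2"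
          by (rule inner_perturbation[OF \<eta>])
            (use Finite_Cartesian_Product.norm_nth_le[of "\<sigma> r - H n k"] Finite_Cartesian_Product.norm_nth_le[of "\<sigma> r"] in auto)
        also have "\<dots> \<le> (1 + 1 / \<eta>) * (norm (\<sigma> r - H n k))\<^sup>2 + \<eta> * V"
          using \<eta> \<sigma>V[OF r] by simp
        finally have "ennreal \<bar>?\<alpha> - c i j r\<bar> \<le> ennreal ((1 + 1 / \<eta>) * (norm (\<sigma> r - H n k))\<^sup>2 + \<eta> * V)"
          using r c by (intro ennreal_leI) auto
        also have "\<dots> = ennreal (1 + 1 / \<eta>) * ennreal ((norm (\<sigma> r - H n k))\<^sup>2) + ennreal (\<eta> * V)"
          using \<eta> V by (simp add: ennreal_plus ennreal_mult)
        finally show ?thesis using True by simp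
      qed simp
    qed
    also have "\<dots> = ennreal (1 + 1 / \<eta>) * (\<integral>\<^sup>+ r. ennreal ((norm (\<sigma> r - H n k))\<^sup>2) * indicator ?I r \<partial>lborel)
        + ennreal (\<eta> * V * ((b - a) / real n))"
    proof -
      have "(\<lambda>r. ennreal ((norm (\<sigma> r - H n k))\<^sup>2) * indicator ?I r)
          = (\<lambda>r. ennreal ((norm (indicator {a..b} r *\<^sub>R \<sigma> r - H n k))\<^sup>2) * indicator ?I r)"
        using sub by (auto simp: indicator_def fun_eq_iff)
      then have [measurable]: "(\<lambda>r. ennreal ((norm (\<sigma> r - H n k))\<^sup>2) * indicator ?I r) \<in> borel_measurable lborel"
        by simp
      have "(\<integral>\<^sup>+ r. ennreal (\<eta> * V) * indicator ?I r \<partial>lborel) = ennreal (\<eta> * V * ((b - a) / real n))"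
        using uv \<eta> V by (simp add: nn_integral_cmult grid_simps(3) ennreal_mult[symmetric])
      then show ?thesis by (subst nn_integral_add) (auto simp: nn_integral_cmult)
    qed
    finally show ?thesis .
  qed
  have total: "ennreal \<bar>(\<Sum>k<n. (b - a) / real n * (H n k $ i \<bullet> H n k $ j)) - integral {a..b} (c i j)\<bar>
      \<le> ennreal (1 + 1 / \<eta>) * E n + ennreal (\<eta> * V * (b - a))" if n: "n > 0" and \<eta>: "\<eta> > 0" for n \<eta>
  proof -
    let ?x = "\<lambda>k. (b - a) / real n * (H n k $ i \<bullet> H n k $ j) - integral {grid a b n k..grid a b n (Suc k)} (c i j)"
    have "(\<Sum>k<n. (b - a) / real n * (H n k $ i \<bullet> H n k $ j)) - integral {a..b} (c i j) = (\<Sum>k<n. ?x k)"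
      using integral_grid_sum[OF integrable_continuous_real[OF cont] _ n] ab by (simp add: sum_subtractf)
    then have "ennreal \<bar>(\<Sum>k<n. (b - a) / real n * (H n k $ i \<bullet> H n k $ j)) - integral {a..b} (c i j)\<bar>
        \<le> ennreal (\<Sum>k<n. \<bar>?x k\<bar>)" by (simp add: ennreal_leI)
    also have "\<dots> = (\<Sum>k<n. ennreal \<bar>?x k\<bar>)" by (rule sum_ennreal[symmetric]) simp
    also have "\<dots> \<le> (\<Sum>k<n. ennreal (1 + 1 / \<eta>) * (\<integral>\<^sup>+ r. ennreal ((norm (\<sigma> r - H n k))\<^sup>2) * indicator {grid a b n k..grid a b n (Suc k)} r \<partial>lborel)
        + ennreal (\<eta> * V * ((b - a) / real n)))"
      by (intro sum_mono piece \<eta>) simp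
    also have "\<dots> = ennreal (1 + 1 / \<eta>) * E n + ennreal (\<eta> * V * (b - a))"
    proof -
      have "(\<Sum>k<n. ennreal (\<eta> * V * ((b - a) / real n))) = ennreal (\<Sum>k<n. \<eta> * V * ((b - a) / real n))"
        using \<eta> V ab by (intro sum_ennreal) simp
      also have "(\<Sum>k<n. \<eta> * V * ((b - a) / real n)) = \<eta> * V * (b - a)" using n by simp
      finally show ?thesis by (simp add: sum.distrib E_def sum_distrib_left)
    qed
    finally show ?thesis .
  qed
  show ?thesis
  proof (rule LIMSEQ_I)
    fix e :: real assume e: "e > 0"
    \<comment> \<open>Makes the term \<open>\<eta> * V * (b - a)\<close> equal to
      \<open>e / 2\<close>; the other term then tends to zero with the approximation error.\<close>
    define \<eta> where "\<eta> = e / (2 * V * (b - a))"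
    have \<eta>: "\<eta> > 0" using e V ab by (simp add: \<eta>_def)
    have "e / (2 * V * w) * V * w = e / 2" if "w > 0" for w using V that by simp
    then have \<eta>e: "\<eta> * V * (b - a) = e / 2" unfolding \<eta>_def using ab by simp
    have "(\<lambda>n. ennreal (1 + 1 / \<eta>) * E n) \<longlonglongrightarrow> ennreal (1 + 1 / \<eta>) * 0"
      using lim unfolding E_def[symmetric] by (intro ennreal_tendsto_cmult) auto
    then have "\<forall>\<^sub>F n in sequentially. ennreal (1 + 1 / \<eta>) * E n < ennreal (e / 2)"
      using e by (intro order_tendstoD(2)) auto
    then obtain N where N: "\<And>n. n \<ge> N \<Longrightarrow> ennreal (1 + 1 / \<eta>) * E n < ennreal (e / 2)"
      unfolding eventually_sequentially by blast
    show "\<exists>N. \<forall>n\<ge>N. norm ((\<Sum>k<n. (b - a) / real n * (H n k $ i \<bullet> H n k $ j)) - integral {a..b} (c i j)) < e"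
    proof (intro exI[of _ "Suc N"] allI impI)
      fix n assume n: "n \<ge> Suc N"
      have "ennreal \<bar>(\<Sum>k<n. (b - a) / real n * (H n k $ i \<bullet> H n k $ j)) - integral {a..b} (c i j)\<bar>
          \<le> ennreal (1 + 1 / \<eta>) * E n + ennreal (e / 2)"
        using total[of n, OF _ \<eta>] n \<eta>e by simp
      also have "\<dots> < ennreal (e / 2) + ennreal (e / 2)"
        using N[of n] n by (simp add: ennreal_add_left_cancel_less add.commute)
      also have "\<dots> = ennreal e" using e by (simp flip: ennreal_plus)
      finally show "norm ((\<Sum>k<n. (b - a) / real n * (H n k $ i \<bullet> H n k $ j)) - integral {a..b} (c i j)) < e"
        using e by (simp add: ennreal_less_iff)
    qed
  qed
qed

text \<open>\<open>J\<close> is square integrable because it is at finite mean-square distance from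
  an elementary integral. Orthogonality and isometry then pass to the limit.\<close>

lemma (in brownian) wiener_integral_moments:
  assumes ab: "0 \<le> a" "a < b" and J: "wiener_integral M W \<sigma> a b J"
    and c: "\<And>i j r. a \<le> r \<Longrightarrow> r \<le> b \<Longrightarrow> \<sigma> r $ i \<bullet> \<sigma> r $ j = c i j r"
    and cont: "\<And>i j. continuous_on {a..b} (c i j)"
  shows "sq_int M (\<lambda>\<omega>. J \<omega> $ i)"
    "\<And>X. X \<in> borel_measurable (F a) \<Longrightarrow> sq_int M X \<Longrightarrow> (\<integral>\<omega>. X \<omega> * J \<omega> $ i \<partial>M) = 0"
    "(\<integral>\<omega>. J \<omega> $ i * J \<omega> $ j \<partial>M) = integral {a..b} (c i j)"
proof -
  obtain H where [measurable]: "J \<in> borel_measurable M" and \<sigma>: "set_borel_measurable lborel {a..b} \<sigma>"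
    and H: "(\<lambda>n. \<Sum>k<n. \<integral>\<^sup>+ r. ennreal ((norm (\<sigma> r - H n k))\<^sup>2)
               * indicator {grid a b n k..grid a b n (Suc k)} r \<partial>lborel) \<longlonglongrightarrow> 0"
    "(\<lambda>n. \<integral>\<^sup>+ \<omega>. ennreal ((norm (J \<omega> - elem a b n (H n) \<omega>))\<^sup>2) \<partial>M) \<longlonglongrightarrow> 0"
    using J unfolding wiener_integral_def elem_def[OF ab] by blast
  let ?S = "\<lambda>n \<omega>. elem a b n (H n) \<omega>"
  note Ssq = elem_sq[OF ab]
  have [measurable]: "(\<lambda>\<omega>. ?S n \<omega> $ i) \<in> borel_measurable M" for n i using Ssq by (rule sq_int_measurable)
  have comp: "(\<integral>\<^sup>+ \<omega>. ennreal ((J \<omega> $ i - ?S n \<omega> $ i)\<^sup>2) \<partial>M) \<le> (\<integral>\<^sup>+ \<omega>. ennreal ((norm (J \<omega> - ?S n \<omega>))\<^sup>2) \<partial>M)" for n i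
  proof (rule nn_integral_mono, rule ennreal_leI)
    fix \<omega>
    have "\<bar>(J \<omega> - ?S n \<omega>) $ i\<bar> \<le> norm (J \<omega> - ?S n \<omega>)" by (rule component_le_norm_cart)
    then have "\<bar>(J \<omega> - ?S n \<omega>) $ i\<bar>\<^sup>2 \<le> (norm (J \<omega> - ?S n \<omega>))\<^sup>2" by (rule power_mono) simp
    then show "(J \<omega> $ i - ?S n \<omega> $ i)\<^sup>2 \<le> (norm (J \<omega> - ?S n \<omega>))\<^sup>2" by simp
  qed
  show sq: "sq_int M (\<lambda>\<omega>. J \<omega> $ i)" for i
  proof -
    have "\<forall>\<^sub>F n in sequentially. (\<integral>\<^sup>+ \<omega>. ennreal ((norm (J \<omega> - ?S n \<omega>))\<^sup>2) \<partial>M) < 1"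
      using order_tendstoD(2)[OF H(2), of 1] by simp
    then obtain n where "(\<integral>\<^sup>+ \<omega>. ennreal ((norm (J \<omega> - ?S n \<omega>))\<^sup>2) \<partial>M) < 1"
      using eventually_happens' sequentially_bot by blast
    then have "(\<integral>\<^sup>+ \<omega>. ennreal ((J \<omega> $ i - ?S n \<omega> $ i)\<^sup>2) \<partial>M) \<le> ennreal 1"
      using comp[of i n] by (simp add: less_imp_le order_trans)
    then have "sq_int M (\<lambda>\<omega>. J \<omega> $ i - ?S n \<omega> $ i)"
      by (rule sq_int_of_nn_integral(1)[where K = 1, rotated]) (simp, measurable)
    from sq_int_add[OF this Ssq[of n "H n" i]] show ?thesis by simp
  qed
  have lim: "(\<lambda>n. l2 M (\<lambda>\<omega>. J \<omega> $ i - ?S n \<omega> $ i)) \<longlonglongrightarrow> 0" for i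
  proof -
    have e: "ennreal ((l2 M (\<lambda>\<omega>. J \<omega> $ i - ?S n \<omega> $ i))\<^sup>2) \<le> (\<integral>\<^sup>+ \<omega>. ennreal ((norm (J \<omega> - ?S n \<omega>))\<^sup>2) \<partial>M)" for n
      using comp[of i n] sq_int_nn_integral[OF sq_int_diff[OF sq Ssq]] by simp
    have "(\<lambda>n. ennreal ((l2 M (\<lambda>\<omega>. J \<omega> $ i - ?S n \<omega> $ i))\<^sup>2)) \<longlonglongrightarrow> 0"
      by (rule tendsto_sandwich[OF _ _ tendsto_const H(2)]) (use e in auto)
    then have "(\<lambda>n. (l2 M (\<lambda>\<omega>. J \<omega> $ i - ?S n \<omega> $ i))\<^sup>2) \<longlonglongrightarrow> 0"
      by (subst (asm) ennreal_tendsto_0_iff) auto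
    from tendsto_real_sqrt[OF this] show ?thesis by simp
  qed
  show "(\<integral>\<omega>. X \<omega> * J \<omega> $ i \<partial>M) = 0" if X: "X \<in> borel_measurable (F a)" "sq_int M X" for X
  proof -
    have "(\<lambda>n. \<integral>\<omega>. X \<omega> * ?S n \<omega> $ i \<partial>M) \<longlonglongrightarrow> (\<integral>\<omega>. X \<omega> * J \<omega> $ i \<partial>M)"
      by (rule product_integral_limit[OF X(2) X(2) _ sq Ssq lim]) simp
    then show ?thesis by (simp add: elem_orthogonal[OF ab X] LIMSEQ_const_iff)
  qed
  have "(\<lambda>n. \<integral>\<omega>. ?S n \<omega> $ i * ?S n \<omega> $ j \<partial>M) \<longlonglongrightarrow> (\<integral>\<omega>. J \<omega> $ i * J \<omega> $ j \<partial>M)"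
    by (rule product_integral_limit[OF sq Ssq lim sq Ssq lim])
  then show "(\<integral>\<omega>. J \<omega> $ i * J \<omega> $ j \<partial>M) = integral {a..b} (c i j)"
    unfolding elem_covariance[OF ab]
    using step_covariance_limit[OF ab(2) \<sigma> c cont H(1), of i j] LIMSEQ_unique by blast
qed

section \<open>Covariances of continuous processes\<close>

definition cv :: "'a measure \<Rightarrow> ('a \<Rightarrow> real) \<Rightarrow> ('a \<Rightarrow> real) \<Rightarrow> real" where
  "cv M X Y = (\<integral>\<omega>. X \<omega> * Y \<omega> \<partial>M) - (\<integral>\<omega>. X \<omega> \<partial>M) * (\<integral>\<omega>. Y \<omega> \<partial>M)"

lemma cv_commute: "cv M X Y = cv M Y X"
  by (simp add: cv_def mult.commute)

context prob_space
begin

lemma l2_const: "l2 M (\<lambda>_. a) = \<bar>a\<bar>"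
  by (simp add: l2_def prob_space)

lemma mean_le_l2: "sq_int M X \<Longrightarrow> \<bar>\<integral>\<omega>. X \<omega> \<partial>M\<bar> \<le> l2 M X"
  using cauchy_schwarz_l2[of M X "\<lambda>_. 1"] sq_int_const[of 1] l2_const[of 1] by simp

lemma cv_bound: "sq_int M X \<Longrightarrow> sq_int M Y \<Longrightarrow> \<bar>cv M X Y\<bar> \<le> 2 * (l2 M X * l2 M Y)"
proof -
  assume X: "sq_int M X" and Y: "sq_int M Y"
  have "\<bar>(\<integral>\<omega>. X \<omega> \<partial>M) * (\<integral>\<omega>. Y \<omega> \<partial>M)\<bar> \<le> l2 M X * l2 M Y"
    unfolding abs_mult by (intro mult_mono mean_le_l2 X Y) auto
  then show ?thesis using cauchy_schwarz_l2[OF X Y] unfolding cv_def by linarith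
qed

lemma cv_bound_mono: "sq_int M X \<Longrightarrow> sq_int M Y \<Longrightarrow> l2 M X \<le> a \<Longrightarrow> l2 M Y \<le> b \<Longrightarrow> \<bar>cv M X Y\<bar> \<le> 2 * (a * b)"
  by (rule order_trans[OF cv_bound]) (auto intro!: mult_mono order_trans[OF l2_nonneg])

lemma cv_add_left:
  "sq_int M X \<Longrightarrow> sq_int M Y \<Longrightarrow> sq_int M Z \<Longrightarrow> cv M (\<lambda>\<omega>. X \<omega> + Y \<omega>) Z = cv M X Z + cv M Y Z"
  by (simp add: cv_def distrib_right sq_int_mult sq_int_integrable)

lemma cv_add_right:
  "sq_int M X \<Longrightarrow> sq_int M Y \<Longrightarrow> sq_int M Z \<Longrightarrow> cv M Z (\<lambda>\<omega>. X \<omega> + Y \<omega>) = cv M Z X + cv M Z Y"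
  by (simp only: cv_commute[of M Z] cv_add_left)

lemma cv_scale_left: "cv M (\<lambda>\<omega>. a * X \<omega>) Z = a * cv M X Z"
  by (simp add: cv_def mult.assoc algebra_simps)

lemma cv_scale_right: "cv M Z (\<lambda>\<omega>. a * X \<omega>) = a * cv M Z X"
  by (simp only: cv_commute[of M Z] cv_scale_left)

lemma cv_diff_left:
  "sq_int M X \<Longrightarrow> sq_int M Y \<Longrightarrow> sq_int M Z \<Longrightarrow> cv M (\<lambda>\<omega>. X \<omega> - Y \<omega>) Z = cv M X Z - cv M Y Z"
  using cv_add_left[of X "\<lambda>\<omega>. - 1 * Y \<omega>" Z] sq_int_scale[of M Y "- 1"] cv_scale_left[of "- 1" Y Z] by simp

lemma cv_const_left: "cv M (\<lambda>_. a) Z = 0"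
  by (simp add: cv_def prob_space)

lemma cv_sum_left:
  "(\<And>k. k \<in> I \<Longrightarrow> sq_int M (X k)) \<Longrightarrow> sq_int M Z \<Longrightarrow> cv M (\<lambda>\<omega>. \<Sum>k\<in>I. X k \<omega>) Z = (\<Sum>k\<in>I. cv M (X k) Z)"
  by (induction I rule: infinite_finite_induct) (auto simp: cv_const_left cv_add_left sq_int_sum)

lemma cv_centered:
  assumes "sq_int M X" "sq_int M Y"
  shows "cv M X Y = (\<integral>\<omega>. (X \<omega> - (\<integral>\<omega>. X \<omega> \<partial>M)) * (Y \<omega> - (\<integral>\<omega>. Y \<omega> \<partial>M)) \<partial>M)"
    "integrable M (\<lambda>\<omega>. (X \<omega> - (\<integral>\<omega>. X \<omega> \<partial>M)) * (Y \<omega> - (\<integral>\<omega>. Y \<omega> \<partial>M)))"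
proof -
  have "(\<integral>\<omega>. (X \<omega> - a) * (Y \<omega> - b) \<partial>M) = (\<integral>\<omega>. X \<omega> * Y \<omega> - b * X \<omega> - a * Y \<omega> + a * b \<partial>M)" for a b
    by (intro Bochner_Integration.integral_cong) (auto simp: algebra_simps)
  also have "\<dots> a b = (\<integral>\<omega>. X \<omega> * Y \<omega> \<partial>M) - b * (\<integral>\<omega>. X \<omega> \<partial>M) - a * (\<integral>\<omega>. Y \<omega> \<partial>M) + a * b" for a b
    using sq_int_mult[OF assms] assms[THEN sq_int_integrable] by (simp add: prob_space)
  finally show "cv M X Y = (\<integral>\<omega>. (X \<omega> - (\<integral>\<omega>. X \<omega> \<partial>M)) * (Y \<omega> - (\<integral>\<omega>. Y \<omega> \<partial>M)) \<partial>M)"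
    by (simp add: cv_def)
  show "integrable M (\<lambda>\<omega>. (X \<omega> - (\<integral>\<omega>. X \<omega> \<partial>M)) * (Y \<omega> - (\<integral>\<omega>. Y \<omega> \<partial>M)))"
    by (intro sq_int_mult sq_int_diff assms sq_int_const)
qed

text \<open>\<open>x\<close>, \<open>y\<close> are the drifts, \<open>N\<close>, \<open>N'\<close>
  the noises and \<open>R\<close>, \<open>S\<close> the remainders over a step \<open>h\<close>. The
  first factor is expanded throughout, the second only where its size alone does not suffice.
  Orthogonality removes the products of noise with past values, and what is left beyond first order
  is of order \<open>h * sqrt h\<close>.\<close>

lemma cov_increment:
  assumes sq: "sq_int M X" "sq_int M x" "sq_int M R" "sq_int M N" "sq_int M Y" "sq_int M y" "sq_int M S" "sq_int M N'"
    and h: "0 < h" "h \<le> T" and K: "0 \<le> K"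
    and orth: "cv M X N' = 0" "cv M x N' = 0" "cv M N Y = 0" "cv M N y = 0"
    and bd: "l2 M X \<le> K" "l2 M x \<le> K" "l2 M y \<le> K" "l2 M R \<le> K * (h * sqrt h)" "l2 M S \<le> K * (h * sqrt h)" "l2 M N \<le> K * sqrt h"
    and Y': "Y' = (\<lambda>\<omega>. (Y \<omega> + h * y \<omega>) + (S \<omega> + N' \<omega>))" "l2 M Y' \<le> K"
    and X': "X' = (\<lambda>\<omega>. (X \<omega> + h * x \<omega>) + (R \<omega> + N \<omega>))"
    and nn: "\<bar>cv M N N' - h * n\<bar> \<le> K * (h * sqrt h)"
  shows "\<bar>cv M X' Y' - cv M X Y - h * (cv M x Y + cv M X y + n)\<bar> \<le> (K + (4 + 2 * T + 4 * sqrt T) * K\<^sup>2) * (h * sqrt h)"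
proof -
  note sqs = sq sq_int_add sq_int_scale
  have Y'sq: "sq_int M Y'" unfolding Y' by (intro sqs)
  have "cv M X' Y' = cv M X Y' + h * cv M x Y' + (cv M R Y' + cv M N Y')"
    unfolding X' using Y'sq by (simp add: cv_add_left cv_scale_left sqs)
  also have "cv M X Y' = cv M X Y + h * cv M X y + cv M X S"
    unfolding Y' by (simp add: cv_add_right cv_scale_right sqs orth)
  also have "cv M x Y' = cv M x Y + h * cv M x y + cv M x S"
    unfolding Y' by (simp add: cv_add_right cv_scale_right sqs orth)
  also have "cv M N Y' = cv M N S + cv M N N'"
    unfolding Y' by (simp add: cv_add_right cv_scale_right sqs orth)
  finally have eq: "cv M X' Y' - cv M X Y - h * (cv M x Y + cv M X y + n)
      = cv M X S + h * (h * cv M x y) + h * cv M x S + cv M R Y' + cv M N S + (cv M N N' - h * n)"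
    by (simp add: algebra_simps)
  let ?g = "h * sqrt h"
  have g: "0 \<le> ?g" "sqrt h \<le> sqrt T" using h by auto
  have 1: "\<bar>cv M X S\<bar> \<le> 2 * K\<^sup>2 * ?g"
    using cv_bound_mono[OF sq(1,7) bd(1,5)] by (simp add: power2_eq_square mult_ac)
  have 2: "\<bar>h * (h * cv M x y)\<bar> \<le> 2 * sqrt T * K\<^sup>2 * ?g"
  proof -
    have "h * h = sqrt h * ?g" using h by simp
    then have "\<bar>h * (h * cv M x y)\<bar> = sqrt h * ?g * \<bar>cv M x y\<bar>" using h by (simp add: abs_mult flip: mult.assoc)
    also have "\<dots> \<le> sqrt T * ?g * (2 * (K * K))"
      using g h by (intro mult_mono cv_bound_mono[OF sq(2,6) bd(2,3)]) auto
    finally show ?thesis by (simp add: power2_eq_square mult_ac)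
  qed
  have 3: "\<bar>h * cv M x S\<bar> \<le> 2 * T * K\<^sup>2 * ?g"
  proof -
    have "\<bar>h * cv M x S\<bar> = h * \<bar>cv M x S\<bar>" using h by (simp add: abs_mult)
    also have "\<dots> \<le> T * (2 * (K * (K * ?g)))"
      using h by (intro mult_mono cv_bound_mono[OF sq(2,7) bd(2,5)]) auto
    finally show ?thesis by (simp add: power2_eq_square mult_ac)
  qed
  have 4: "\<bar>cv M R Y'\<bar> \<le> 2 * K\<^sup>2 * ?g"
    using cv_bound_mono[OF sq(3) Y'sq bd(4) Y'(2)] by (simp add: power2_eq_square mult_ac)
  have 5: "\<bar>cv M N S\<bar> \<le> 2 * sqrt T * K\<^sup>2 * ?g"
  proof -
    have "\<bar>cv M N S\<bar> \<le> 2 * (K * sqrt h * (K * ?g))" by (rule cv_bound_mono[OF sq(4,7) bd(6,5)])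
    also have "\<dots> = sqrt h * (2 * K\<^sup>2 * ?g)" by (simp add: power2_eq_square mult_ac)
    also have "\<dots> \<le> sqrt T * (2 * K\<^sup>2 * ?g)" using g by (intro mult_right_mono) auto
    finally show ?thesis by (simp add: mult_ac)
  qed
  have tri: "\<bar>a1 + a2 + a3 + a4 + a5 + a6\<bar> \<le> b1 + b2 + b3 + b4 + b5 + b6"
    if "\<bar>a1\<bar> \<le> b1" "\<bar>a2\<bar> \<le> b2" "\<bar>a3\<bar> \<le> b3" "\<bar>a4\<bar> \<le> b4" "\<bar>a5\<bar> \<le> b5" "\<bar>a6\<bar> \<le> b6"
    for a1 a2 a3 a4 a5 a6 b1 b2 b3 b4 b5 b6 :: real
    using that by linarith
  have "\<bar>cv M X' Y' - cv M X Y - h * (cv M x Y + cv M X y + n)\<bar>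
      \<le> 2 * K\<^sup>2 * ?g + 2 * sqrt T * K\<^sup>2 * ?g + 2 * T * K\<^sup>2 * ?g + 2 * K\<^sup>2 * ?g + 2 * sqrt T * K\<^sup>2 * ?g + K * ?g"
    unfolding eq by (rule tri[OF 1 2 3 4 5 nn])
  also have "\<dots> = (K + (4 + 2 * T + 4 * sqrt T) * K\<^sup>2) * ?g" by (simp add: algebra_simps)
  finally show ?thesis .
qed

text \<open>\<open>w = sqrt\<close> is Hoelder continuity of exponent \<open>1/2\<close>, and \<open>w = (\<lambda>_. 1)\<close> is mere boundedness.\<close>

definition hol :: "real \<Rightarrow> (real \<Rightarrow> real) \<Rightarrow> (real \<Rightarrow> 'a \<Rightarrow> real) \<Rightarrow> bool" where
  "hol T w Y \<longleftrightarrow> (\<forall>r\<in>{0..T}. sq_int M (Y r)) \<and> (\<exists>K\<ge>0. (\<forall>r\<in>{0..T}. l2 M (Y r) \<le> K) \<and>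
     (\<forall>r\<in>{0..T}. \<forall>s\<in>{0..T}. l2 M (\<lambda>\<omega>. Y r \<omega> - Y s \<omega>) \<le> K * w \<bar>r - s\<bar>))"

definition dhol :: "real \<Rightarrow> (real \<Rightarrow> real) \<Rightarrow> (real \<Rightarrow> real) \<Rightarrow> bool" where
  "dhol T w a \<longleftrightarrow> (\<exists>K\<ge>0. (\<forall>r\<in>{0..T}. \<bar>a r\<bar> \<le> K) \<and>
     (\<forall>r\<in>{0..T}. \<forall>s\<in>{0..T}. \<bar>a r - a s\<bar> \<le> K * w \<bar>r - s\<bar>))"

lemma hol_sq: "hol T w Y \<Longrightarrow> 0 \<le> r \<Longrightarrow> r \<le> T \<Longrightarrow> sq_int M (Y r)"
  by (simp add: hol_def)

text \<open>A deterministic function is a constant random variable at each time, so closure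
  properties proved for \<open>hol\<close> transfer to \<open>dhol\<close>.\<close>

lemma hol_of_dhol: "dhol T w a \<Longrightarrow> hol T w (\<lambda>r \<omega>. a r)"
  by (simp add: hol_def dhol_def sq_int_const l2_const)

lemma dhol_of_hol: "hol T w (\<lambda>r \<omega>. a r) \<Longrightarrow> dhol T w a"
  by (simp add: hol_def dhol_def sq_int_const l2_const)

lemma hol_add:
  assumes X: "hol T w X" and Y: "hol T w Y"
  shows "hol T w (\<lambda>r \<omega>. X r \<omega> + Y r \<omega>)"
proof -
  obtain K where K: "K \<ge> 0" "\<And>r. r \<in> {0..T} \<Longrightarrow> l2 M (X r) \<le> K"
    "\<And>r s. r \<in> {0..T} \<Longrightarrow> s \<in> {0..T} \<Longrightarrow> l2 M (\<lambda>\<omega>. X r \<omega> - X s \<omega>) \<le> K * w \<bar>r - s\<bar>"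
    using X unfolding hol_def by blast
  obtain L where L: "L \<ge> 0" "\<And>r. r \<in> {0..T} \<Longrightarrow> l2 M (Y r) \<le> L"
    "\<And>r s. r \<in> {0..T} \<Longrightarrow> s \<in> {0..T} \<Longrightarrow> l2 M (\<lambda>\<omega>. Y r \<omega> - Y s \<omega>) \<le> L * w \<bar>r - s\<bar>"
    using Y unfolding hol_def by blast
  have sq: "sq_int M (X r)" "sq_int M (Y r)" if "r \<in> {0..T}" for r using X Y that by (auto simp: hol_def)
  show ?thesis
    unfolding hol_def
  proof (intro conjI ballI exI[of _ "K + L"])
    fix r assume r: "r \<in> {0..T}"
    show "sq_int M (\<lambda>\<omega>. X r \<omega> + Y r \<omega>)" using sq[OF r] by (rule sq_int_add)
    show "l2 M (\<lambda>\<omega>. X r \<omega> + Y r \<omega>) \<le> K + L" using l2_triangle[OF sq[OF r]] K(2)[OF r] L(2)[OF r] by linarith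
    fix s assume s: "s \<in> {0..T}"
    have "l2 M (\<lambda>\<omega>. (X r \<omega> - X s \<omega>) + (Y r \<omega> - Y s \<omega>)) \<le> K * w \<bar>r - s\<bar> + L * w \<bar>r - s\<bar>"
      by (rule order_trans[OF l2_triangle add_mono]) (intro sq_int_diff sq r s K L)+
    then show "l2 M (\<lambda>\<omega>. X r \<omega> + Y r \<omega> - (X s \<omega> + Y s \<omega>)) \<le> (K + L) * w \<bar>r - s\<bar>"
      by (simp add: algebra_simps)
  qed (use K L in simp)
qed

lemma hol_mult:
  assumes w: "\<And>x. 0 \<le> x \<Longrightarrow> 0 \<le> w x" and a: "dhol T w a" and Y: "hol T w Y"
  shows "hol T w (\<lambda>r \<omega>. a r * Y r \<omega>)"
proof -
  obtain K where K: "K \<ge> 0" "\<And>r. r \<in> {0..T} \<Longrightarrow> \<bar>a r\<bar> \<le> K"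
    "\<And>r s. r \<in> {0..T} \<Longrightarrow> s \<in> {0..T} \<Longrightarrow> \<bar>a r - a s\<bar> \<le> K * w \<bar>r - s\<bar>"
    using a unfolding dhol_def by blast
  obtain L where L: "L \<ge> 0" "\<And>r. r \<in> {0..T} \<Longrightarrow> l2 M (Y r) \<le> L"
    "\<And>r s. r \<in> {0..T} \<Longrightarrow> s \<in> {0..T} \<Longrightarrow> l2 M (\<lambda>\<omega>. Y r \<omega> - Y s \<omega>) \<le> L * w \<bar>r - s\<bar>"
    using Y unfolding hol_def by blast
  have sq: "sq_int M (Y r)" if "r \<in> {0..T}" for r using Y that by (auto simp: hol_def)
  have KL: "K * L \<le> 2 * K * L" using K(1) L(1) by simp
  show ?thesis
    unfolding hol_def
  proof (intro conjI ballI exI[of _ "2 * K * L"])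
    fix r assume r: "r \<in> {0..T}"
    show "sq_int M (\<lambda>\<omega>. a r * Y r \<omega>)" using sq[OF r] by (rule sq_int_scale)
    have "\<bar>a r\<bar> * l2 M (Y r) \<le> K * L" using K L r by (intro mult_mono) auto
    then show "l2 M (\<lambda>\<omega>. a r * Y r \<omega>) \<le> 2 * K * L" using KL by (simp add: l2_scale)
    fix s assume s: "s \<in> {0..T}"
    have "l2 M (\<lambda>\<omega>. a r * (Y r \<omega> - Y s \<omega>) + (a r - a s) * Y s \<omega>)
        \<le> \<bar>a r\<bar> * l2 M (\<lambda>\<omega>. Y r \<omega> - Y s \<omega>) + \<bar>a r - a s\<bar> * l2 M (Y s)"
      by (rule order_trans[OF l2_triangle]) (auto simp: l2_scale intro!: sq_int_scale sq_int_diff sq r s)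
    also have "\<dots> \<le> K * (L * w \<bar>r - s\<bar>) + (K * w \<bar>r - s\<bar>) * L"
      using K L r s w by (intro add_mono mult_mono) auto
    finally show "l2 M (\<lambda>\<omega>. a r * Y r \<omega> - a s * Y s \<omega>) \<le> 2 * K * L * w \<bar>r - s\<bar>"
      by (simp add: algebra_simps)
  qed (use K L in simp)
qed

lemma dhol_const: "(\<And>x. 0 \<le> x \<Longrightarrow> 0 \<le> w x) \<Longrightarrow> dhol T w (\<lambda>_. a)"
  unfolding dhol_def by (intro exI[of _ "\<bar>a\<bar>"]) auto

lemma dhol_add: "dhol T w a \<Longrightarrow> dhol T w b \<Longrightarrow> dhol T w (\<lambda>r. a r + b r)"
  by (rule dhol_of_hol, rule hol_add) (rule hol_of_dhol, assumption)+

lemma dhol_mult: "(\<And>x. 0 \<le> x \<Longrightarrow> 0 \<le> w x) \<Longrightarrow> dhol T w a \<Longrightarrow> dhol T w b \<Longrightarrow> dhol T w (\<lambda>r. a r * b r)"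
  by (rule dhol_of_hol, rule hol_mult) (auto intro: hol_of_dhol)

lemma dhol_sum: "(\<And>x. 0 \<le> x \<Longrightarrow> 0 \<le> w x) \<Longrightarrow> (\<And>k. k \<in> I \<Longrightarrow> dhol T w (a k)) \<Longrightarrow> dhol T w (\<lambda>r. \<Sum>k\<in>I. a k r)"
  by (induction I rule: infinite_finite_induct) (auto intro: dhol_const dhol_add)

lemma hol_sum: "(\<And>x. 0 \<le> x \<Longrightarrow> 0 \<le> w x) \<Longrightarrow> (\<And>k. k \<in> I \<Longrightarrow> hol T w (Y k)) \<Longrightarrow> hol T w (\<lambda>r \<omega>. \<Sum>k\<in>I. Y k r \<omega>)"
  by (induction I rule: infinite_finite_induct) (auto intro: hol_add hol_of_dhol[OF dhol_const])

lemma hol_bounded: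
  assumes "\<And>r. r \<in> {0..T} \<Longrightarrow> sq_int M (Y r)" "\<And>r. r \<in> {0..T} \<Longrightarrow> l2 M (Y r) \<le> K" "0 \<le> K"
  shows "hol T (\<lambda>_. 1) Y"
  unfolding hol_def
proof (intro conjI ballI exI[of _ "2 * K"])
  fix r s assume rs: "r \<in> {0..T}" "s \<in> {0..T}"
  show "l2 M (\<lambda>\<omega>. Y r \<omega> - Y s \<omega>) \<le> 2 * K * 1"
    using l2_diff_le[OF assms(1)[OF rs(1)] assms(1)[OF rs(2)]] assms(2)[OF rs(1)] assms(2)[OF rs(2)] by linarith
next
  fix r assume r: "r \<in> {0..T}"
  show "sq_int M (Y r)" by (rule assms(1)[OF r])
  show "l2 M (Y r) \<le> 2 * K" using assms(2)[OF r] assms(3) by linarith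
qed (use assms(3) in simp)

lemma dhol_cv:
  assumes X: "hol T w X" and Y: "hol T w Y"
  shows "dhol T w (\<lambda>r. cv M (X r) (Y r))"
proof -
  obtain K where K: "K \<ge> 0" "\<And>r. r \<in> {0..T} \<Longrightarrow> l2 M (X r) \<le> K"
    "\<And>r s. r \<in> {0..T} \<Longrightarrow> s \<in> {0..T} \<Longrightarrow> l2 M (\<lambda>\<omega>. X r \<omega> - X s \<omega>) \<le> K * w \<bar>r - s\<bar>"
    using X unfolding hol_def by blast
  obtain L where L: "L \<ge> 0" "\<And>r. r \<in> {0..T} \<Longrightarrow> l2 M (Y r) \<le> L"
    "\<And>r s. r \<in> {0..T} \<Longrightarrow> s \<in> {0..T} \<Longrightarrow> l2 M (\<lambda>\<omega>. Y r \<omega> - Y s \<omega>) \<le> L * w \<bar>r - s\<bar>"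
    using Y unfolding hol_def by blast
  have sq: "sq_int M (X r)" "sq_int M (Y r)" if "r \<in> {0..T}" for r using X Y that by (auto simp: hol_def)
  have KL: "0 \<le> K * L" using K(1) L(1) by simp
  show ?thesis
    unfolding dhol_def
  proof (intro conjI ballI exI[of _ "4 * (K * L)"])
    fix r assume r: "r \<in> {0..T}"
    show "\<bar>cv M (X r) (Y r)\<bar> \<le> 4 * (K * L)"
      using cv_bound_mono[OF sq[OF r] K(2)[OF r] L(2)[OF r]] KL by linarith
    fix s assume s: "s \<in> {0..T}"
    have "cv M (X r) (Y r) - cv M (X s) (Y s) = cv M (\<lambda>\<omega>. X r \<omega> - X s \<omega>) (Y r) + cv M (\<lambda>\<omega>. Y r \<omega> - Y s \<omega>) (X s)"
      using sq[OF r] sq[OF s] by (simp add: cv_diff_left cv_commute[of M "Y r"] cv_commute[of M "Y s"])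
    moreover have "\<bar>cv M (\<lambda>\<omega>. X r \<omega> - X s \<omega>) (Y r)\<bar> \<le> 2 * (K * w \<bar>r - s\<bar> * L)"
      by (intro cv_bound_mono sq_int_diff sq r s K L)
    moreover have "\<bar>cv M (\<lambda>\<omega>. Y r \<omega> - Y s \<omega>) (X s)\<bar> \<le> 2 * (L * w \<bar>r - s\<bar> * K)"
      by (intro cv_bound_mono sq_int_diff sq r s K L)
    ultimately have "\<bar>cv M (X r) (Y r) - cv M (X s) (Y s)\<bar> \<le> 2 * (K * w \<bar>r - s\<bar> * L) + 2 * (L * w \<bar>r - s\<bar> * K)"
      by linarith
    also have "\<dots> = 4 * (K * L) * w \<bar>r - s\<bar>" by (simp add: algebra_simps)
    finally show "\<bar>cv M (X r) (Y r) - cv M (X s) (Y s)\<bar> \<le> 4 * (K * L) * w \<bar>r - s\<bar>" .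
  qed (use KL in simp)
qed

lemma dhol_mean:
  assumes X: "hol T w X"
  shows "dhol T w (\<lambda>r. \<integral>\<omega>. X r \<omega> \<partial>M)"
proof -
  obtain K where K: "K \<ge> 0" "\<And>r. r \<in> {0..T} \<Longrightarrow> l2 M (X r) \<le> K"
    "\<And>r s. r \<in> {0..T} \<Longrightarrow> s \<in> {0..T} \<Longrightarrow> l2 M (\<lambda>\<omega>. X r \<omega> - X s \<omega>) \<le> K * w \<bar>r - s\<bar>"
    using X unfolding hol_def by blast
  have sq: "sq_int M (X r)" if "r \<in> {0..T}" for r using X that by (auto simp: hol_def)
  show ?thesis
    unfolding dhol_def
  proof (intro conjI ballI exI[of _ K])
    fix r s assume rs: "r \<in> {0..T}" "s \<in> {0..T}"
    have "(\<integral>\<omega>. X r \<omega> \<partial>M) - (\<integral>\<omega>. X s \<omega> \<partial>M) = (\<integral>\<omega>. X r \<omega> - X s \<omega> \<partial>M)"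
      using sq rs by (simp add: sq_int_integrable)
    then show "\<bar>(\<integral>\<omega>. X r \<omega> \<partial>M) - (\<integral>\<omega>. X s \<omega> \<partial>M)\<bar> \<le> K * w \<bar>r - s\<bar>"
      using mean_le_l2[OF sq_int_diff[OF sq[OF rs(1)] sq[OF rs(2)]]] K(3)[OF rs] by simp
  next
    fix r assume r: "r \<in> {0..T}"
    show "\<bar>\<integral>\<omega>. X r \<omega> \<partial>M\<bar> \<le> K" using mean_le_l2[OF sq[OF r]] K(2)[OF r] by linarith
  qed (rule K(1))
qed

lemma dhol_continuous:
  assumes "dhol T sqrt a"
  shows "continuous_on {0..T} a"
proof -
  obtain K where K: "\<And>r s. r \<in> {0..T} \<Longrightarrow> s \<in> {0..T} \<Longrightarrow> \<bar>a r - a s\<bar> \<le> K * sqrt \<bar>r - s\<bar>"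
    using assms unfolding dhol_def by blast
  show ?thesis
    unfolding continuous_on_def
  proof
    fix x assume x: "x \<in> {0..T}"
    show "(a \<longlongrightarrow> a x) (at x within {0..T})"
    proof (rule Lim_null_comparison[THEN LIM_zero_cancel])
      show "\<forall>\<^sub>F r in at x within {0..T}. norm (a r - a x) \<le> K * sqrt \<bar>r - x\<bar>"
        unfolding eventually_at_filter using K x by (intro always_eventually) auto
      have "((\<lambda>r. K * sqrt \<bar>r - x\<bar>) \<longlongrightarrow> K * sqrt \<bar>x - x\<bar>) (at x within {0..T})" by (intro tendsto_intros)
      then show "((\<lambda>r. K * sqrt \<bar>r - x\<bar>) \<longlongrightarrow> 0) (at x within {0..T})" by simp
    qed
  qed
qed

end

section \<open>Moments of mean-field solutions\<close>

lemma has_vector_derivative_vec: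
  fixes f :: "real \<Rightarrow> ('b::euclidean_space)^'n"
  assumes "\<And>i. ((\<lambda>t. f t $ i) has_vector_derivative g $ i) F"
  shows "(f has_vector_derivative g) F"
proof -
  have ax: "v = (\<Sum>i\<in>UNIV. axis i (v $ i))" for v :: "'b^'n"
    by (simp add: vec_eq_iff axis_def if_distrib if_distribR cong: if_cong)
  have "linear (axis i :: 'b \<Rightarrow> 'b^'n)" for i :: 'n
    by (rule linearI) (auto simp: axis_def vec_eq_iff)
  then have "bounded_linear (axis i :: 'b \<Rightarrow> 'b^'n)" for i :: 'n
    by (simp add: linear_conv_bounded_linear)
  then have "((\<lambda>t. \<Sum>i\<in>UNIV. axis i (f t $ i)) has_vector_derivative (\<Sum>i\<in>UNIV. axis i (g $ i))) F"
    by (intro has_vector_derivative_sum) (rule bounded_linear.has_vector_derivative[OF _ assms])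
  then show ?thesis using ax by simp
qed

locale mean_field = brownian M F W for M :: "'w measure" and F :: "real \<Rightarrow> 'w measure" and W :: "real \<Rightarrow> 'w \<Rightarrow> real^'n" +
  fixes \<gamma> :: real and B :: "real^'n^'n" and c :: "real^'n" and T :: real and q p :: "real \<Rightarrow> 'w \<Rightarrow> real^'n"
  assumes sol: "mean_field_solution \<gamma> B c T M F W q p" and \<gamma>: "\<gamma> > 0" and B: "pd_mat B"
begin

abbreviation (input) Q :: "'n \<Rightarrow> real \<Rightarrow> 'w \<Rightarrow> real" where "Q i r \<omega> \<equiv> q r \<omega> $ i"
abbreviation (input) P :: "'n \<Rightarrow> real \<Rightarrow> 'w \<Rightarrow> real" where "P i r \<omega> \<equiv> p r \<omega> $ i"

definition C :: "real \<Rightarrow> real^'n^'n" where "C r = cov_q (law M q p r)"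

lemma bounded_moments:
  "\<exists>K::real. \<forall>t\<in>{0..T}. (\<integral>\<^sup>+ \<omega>. ennreal ((norm (q t \<omega>))\<^sup>2 + (norm (p t \<omega>))\<^sup>2) \<partial>M) \<le> ennreal K"
  using sol unfolding mean_field_solution_def by (elim conjE)

lemma integrated_equation:
  assumes "0 \<le> s" "s < t" "t \<le> T"
  shows "AE \<omega> in M. ((\<lambda>r. p r \<omega>) has_integral (q t \<omega> - q s \<omega>)) {s..t}"
    "\<exists>J. wiener_integral M W (\<lambda>r. msqrt ((2 * \<gamma>) *\<^sub>R C r)) s t J \<and>
       (AE \<omega> in M. ((\<lambda>r. - (C r *v (matrix_inv B *v q r \<omega> - c)) - \<gamma> *\<^sub>R p r \<omega>)
                 has_integral (p t \<omega> - p s \<omega> - J \<omega>)) {s..t})"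
proof -
  have "\<forall>s t. 0 \<le> s \<and> s < t \<and> t \<le> T \<longrightarrow>
        (AE \<omega> in M. ((\<lambda>r. p r \<omega>) has_integral (q t \<omega> - q s \<omega>)) {s..t}) \<and>
        (\<exists>J. wiener_integral M W (\<lambda>r. msqrt ((2 * \<gamma>) *\<^sub>R C r)) s t J \<and>
           (AE \<omega> in M.
              ((\<lambda>r. - (C r *v (matrix_inv B *v q r \<omega> - c)) - \<gamma> *\<^sub>R p r \<omega>)
                 has_integral (p t \<omega> - p s \<omega> - J \<omega>)) {s..t}))"
    using sol unfolding mean_field_solution_def C_def by (elim conjE)
  with assms show "AE \<omega> in M. ((\<lambda>r. p r \<omega>) has_integral (q t \<omega> - q s \<omega>)) {s..t}"
    "\<exists>J. wiener_integral M W (\<lambda>r. msqrt ((2 * \<gamma>) *\<^sub>R C r)) s t J \<and>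
       (AE \<omega> in M. ((\<lambda>r. - (C r *v (matrix_inv B *v q r \<omega> - c)) - \<gamma> *\<^sub>R p r \<omega>)
                 has_integral (p t \<omega> - p s \<omega> - J \<omega>)) {s..t})"
    by simp_all
qed

lemma T0: "T > 0" using sol by (simp add: mean_field_solution_def)

lemma adapted: "r \<in> {0..T} \<Longrightarrow> q r \<in> borel_measurable (F r)" "r \<in> {0..T} \<Longrightarrow> p r \<in> borel_measurable (F r)"
  using sol by (simp_all add: mean_field_solution_def)

lemma measurable_qp: "r \<in> {0..T} \<Longrightarrow> q r \<in> borel_measurable M" "r \<in> {0..T} \<Longrightarrow> p r \<in> borel_measurable M"
  using adapted adapted_measurable by auto

lemma paths: "AE \<omega> in M. continuous_on {0..T} (\<lambda>t. q t \<omega>) \<and> continuous_on {0..T} (\<lambda>t. p t \<omega>)"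
  using sol by (simp add: mean_field_solution_def)

lemma second_moments:
  "\<exists>K\<ge>0. (\<forall>r\<in>{0..T}. \<forall>i. sq_int M (Q i r) \<and> l2 M (Q i r) \<le> K) \<and>
     (\<forall>r\<in>{0..T}. \<forall>i. sq_int M (P i r) \<and> l2 M (P i r) \<le> K)"
proof -
  obtain K where K: "\<And>t. t \<in> {0..T} \<Longrightarrow> (\<integral>\<^sup>+ \<omega>. ennreal ((norm (q t \<omega>))\<^sup>2 + (norm (p t \<omega>))\<^sup>2) \<partial>M) \<le> ennreal K"
    using bounded_moments by blast
  have le: "ennreal K \<le> ennreal \<bar>K\<bar>" by (simp add: ennreal_leI)
  have comp: "(v $ i)\<^sup>2 \<le> (norm v)\<^sup>2" for v :: "real^'n" and i
    using power_mono[OF component_le_norm_cart[of v i] abs_ge_zero, of 2] by simp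
  have b: "sq_int M (Q i r) \<and> l2 M (Q i r) \<le> sqrt \<bar>K\<bar>" "sq_int M (P i r) \<and> l2 M (P i r) \<le> sqrt \<bar>K\<bar>"
    if r: "r \<in> {0..T}" for r i
  proof -
    have "(\<integral>\<^sup>+ \<omega>. ennreal ((Q i r \<omega>)\<^sup>2) \<partial>M) \<le> (\<integral>\<^sup>+ \<omega>. ennreal ((norm (q r \<omega>))\<^sup>2 + (norm (p r \<omega>))\<^sup>2) \<partial>M)"
      by (intro nn_integral_mono ennreal_leI) (use comp in \<open>simp add: add_increasing2\<close>)
    then have 1: "(\<integral>\<^sup>+ \<omega>. ennreal ((Q i r \<omega>)\<^sup>2) \<partial>M) \<le> ennreal \<bar>K\<bar>" using K[OF r] le by order
    have "(\<integral>\<^sup>+ \<omega>. ennreal ((P i r \<omega>)\<^sup>2) \<partial>M) \<le> (\<integral>\<^sup>+ \<omega>. ennreal ((norm (q r \<omega>))\<^sup>2 + (norm (p r \<omega>))\<^sup>2) \<partial>M)"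
      by (intro nn_integral_mono ennreal_leI) (use comp in \<open>simp add: add_increasing\<close>)
    then have 2: "(\<integral>\<^sup>+ \<omega>. ennreal ((P i r \<omega>)\<^sup>2) \<partial>M) \<le> ennreal \<bar>K\<bar>" using K[OF r] le by order
    show "sq_int M (Q i r) \<and> l2 M (Q i r) \<le> sqrt \<bar>K\<bar>" "sq_int M (P i r) \<and> l2 M (P i r) \<le> sqrt \<bar>K\<bar>"
      using sq_int_of_nn_integral[OF measurable_vec_component[OF measurable_qp(1)[OF r]] 1]
        sq_int_of_nn_integral[OF measurable_vec_component[OF measurable_qp(2)[OF r]] 2] by auto
  qed
  then show ?thesis by (intro exI[of _ "sqrt \<bar>K\<bar>"]) auto
qed

lemma sq: "r \<in> {0..T} \<Longrightarrow> sq_int M (Q i r)" "r \<in> {0..T} \<Longrightarrow> sq_int M (P i r)"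
  using second_moments by auto

lemma law_moments:
  assumes r: "r \<in> {0..T}"
  shows "mean_q (law M q p r) $ i = (\<integral>\<omega>. Q i r \<omega> \<partial>M)" "mean_p (law M q p r) $ i = (\<integral>\<omega>. P i r \<omega> \<partial>M)"
    "cov_q (law M q p r) $ i $ j = cv M (Q i r) (Q j r)" "cov_p (law M q p r) $ i $ j = cv M (P i r) (P j r)"
    "cov_qp (law M q p r) $ i $ j = cv M (Q i r) (P j r)"
proof -
  note [measurable] = measurable_qp[OF r]
  have pm: "(\<lambda>\<omega>. (q r \<omega>, p r \<omega>)) \<in> M \<rightarrow>\<^sub>M borel" by measurable
  have I: "integral\<^sup>L (law M q p r) f = (\<integral>\<omega>. f (q r \<omega>, p r \<omega>) \<partial>M)" if "f \<in> borel_measurable borel"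
    for f :: "_ \<Rightarrow> 'b::{banach, second_countable_topology}"
    unfolding law_def by (rule integral_distr[OF pm that])
  have "has_bochner_integral M (q r) (\<chi> i. \<integral>\<omega>. Q i r \<omega> \<partial>M)" "has_bochner_integral M (p r) (\<chi> i. \<integral>\<omega>. P i r \<omega> \<partial>M)"
    by (rule has_bochner_integral_vec, simp add: has_bochner_integral_iff sq_int_integrable sq[OF r])+
  then have m: "mean_q (law M q p r) = (\<chi> i. \<integral>\<omega>. Q i r \<omega> \<partial>M)" "mean_p (law M q p r) = (\<chi> i. \<integral>\<omega>. P i r \<omega> \<partial>M)"
    unfolding mean_q_def mean_p_def by (auto simp: I borel_measurable_continuous_onI continuous_intros has_bochner_integral_iff)
  then show "mean_q (law M q p r) $ i = (\<integral>\<omega>. Q i r \<omega> \<partial>M)" "mean_p (law M q p r) $ i = (\<integral>\<omega>. P i r \<omega> \<partial>M)"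
    by simp_all
  have O: "(\<integral>\<omega>. outer (f \<omega> - (\<chi> i. \<integral>\<omega>. f \<omega> $ i \<partial>M)) (g \<omega> - (\<chi> i. \<integral>\<omega>. g \<omega> $ i \<partial>M)) \<partial>M) $ i $ j = cv M (\<lambda>\<omega>. f \<omega> $ i) (\<lambda>\<omega>. g \<omega> $ j)"
    if "\<And>i. sq_int M (\<lambda>\<omega>. f \<omega> $ i)" "\<And>i. sq_int M (\<lambda>\<omega>. g \<omega> $ i)" for f g :: "'w \<Rightarrow> real^'n"
  proof -
    have "has_bochner_integral M (\<lambda>\<omega>. outer (f \<omega> - (\<chi> i. \<integral>\<omega>. f \<omega> $ i \<partial>M)) (g \<omega> - (\<chi> i. \<integral>\<omega>. g \<omega> $ i \<partial>M)))
        (\<chi> i j. cv M (\<lambda>\<omega>. f \<omega> $ i) (\<lambda>\<omega>. g \<omega> $ j))"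
      using cv_centered[OF that] by (intro has_bochner_integral_vec) (simp add: outer_def has_bochner_integral_iff)
    then show ?thesis by (simp add: has_bochner_integral_iff)
  qed
  have om: "(\<lambda>z. outer (f z) (g z)) \<in> borel_measurable borel" if "continuous_on UNIV f" "continuous_on UNIV g"
    for f g :: "(real^'n) \<times> (real^'n) \<Rightarrow> real^'n"
    unfolding outer_def by (intro borel_measurable_continuous_onI continuous_intros that)
  show "cov_q (law M q p r) $ i $ j = cv M (Q i r) (Q j r)" "cov_p (law M q p r) $ i $ j = cv M (P i r) (P j r)"
    "cov_qp (law M q p r) $ i $ j = cv M (Q i r) (P j r)"
    unfolding cov_q_def cov_p_def cov_qp_def m
    by (subst I, rule om, (intro continuous_intros)+, simp only: fst_conv snd_conv, rule O; rule sq[OF r])+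
qed

lemma C_component: "r \<in> {0..T} \<Longrightarrow> C r $ i $ j = cv M (Q i r) (Q j r)"
  by (simp add: C_def law_moments)

text \<open>The form at \<open>x\<close> is the variance of the combination of the coordinates of
  \<open>q\<close> with coefficients \<open>x\<close>. Semidefiniteness gives \<open>msqrt\<close>
  its meaning in the diffusion coefficient.\<close>

lemma C_psd: "r \<in> {0..T} \<Longrightarrow> psd_mat (C r)"
proof -
  assume r: "r \<in> {0..T}"
  have "0 \<le> x \<bullet> (C r *v x)" for x
  proof -
    let ?X = "\<lambda>\<omega>. \<Sum>i\<in>UNIV. x $ i * Q i r \<omega>"
    have sX: "sq_int M ?X" by (intro sq_int_sum sq_int_scale sq r)
    have lin: "cv M ?X Z = (\<Sum>i\<in>UNIV. x $ i * cv M (Q i r) Z)" if "sq_int M Z" for Z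
      by (subst cv_sum_left) (auto simp: cv_scale_left intro!: sq_int_scale sq r that)
    have Cc: "C r $ i $ j = cv M (Q j r) (Q i r)" for i j
      by (rule trans[OF C_component[OF r] cv_commute])
    have "x \<bullet> (C r *v x) = (\<Sum>i\<in>UNIV. x $ i * (\<Sum>j\<in>UNIV. x $ j * cv M (Q j r) (Q i r)))"
      by (simp add: inner_vec_def matrix_vector_mult_def Cc mult.commute)
    also have "\<dots> = (\<Sum>i\<in>UNIV. x $ i * cv M ?X (Q i r))"
      by (simp only: lin[OF sq(1)[OF r]])
    also have "\<dots> = (\<Sum>i\<in>UNIV. x $ i * cv M (Q i r) ?X)"
      by (rule sum.cong[OF refl]) (rule arg_cong[OF cv_commute])
    also have "\<dots> = cv M ?X ?X" by (rule lin[OF sX, symmetric])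
    also have "\<dots> \<ge> 0" unfolding cv_centered(1)[OF sX sX] by simp
    finally show ?thesis .
  qed
  moreover have "sym_mat (C r)"
    by (simp add: sym_mat_def transpose_def vec_eq_iff C_component[OF r] cv_commute)
  ultimately show "psd_mat (C r)" by (simp add: psd_mat_def)
qed

text \<open>The root is symmetric, so the inner products of its rows are the entries of its square;
  the root thereby disappears from the second moments of the noise.\<close>

lemma diffusion_square:
  assumes r: "r \<in> {0..T}"
  shows "msqrt ((2 * \<gamma>) *\<^sub>R C r) $ i \<bullet> msqrt ((2 * \<gamma>) *\<^sub>R C r) $ j = 2 * \<gamma> * cv M (Q i r) (Q j r)"
proof -
  let ?S = "msqrt ((2 * \<gamma>) *\<^sub>R C r)"
  have "psd_mat ((2 * \<gamma>) *\<^sub>R C r)"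
    using C_psd[OF r] \<gamma> by (simp add: psd_mat_def sym_mat_def transpose_scalar scaleR_matrix_vector_assoc[symmetric])
  note S = msqrt[OF this]
  have "?S $ i \<bullet> ?S $ j = (?S ** transpose ?S) $ i $ j"
    by (simp add: inner_vec_def matrix_matrix_mult_def transpose_def)
  also have "transpose ?S = ?S" using psd_sym[OF S(1)] by (simp add: sym_mat_def)
  finally show ?thesis by (simp add: S(2) C_component[OF r])
qed

lemma q_increment:
  assumes st: "0 \<le> s" "s < t" "t \<le> T"
  shows "AE \<omega> in M. ((\<lambda>r. P i r \<omega>) has_integral (Q i t \<omega> - Q i s \<omega>)) {s..t}"
proof -
  from integrated_equation(1)[OF st] show ?thesis
    by eventually_elim (use has_integral_linear[OF _ bounded_linear_vec_nth[of i]] in \<open>force simp: o_def\<close>)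
qed

lemma hol_from_increments:
  assumes Y: "\<And>r. r \<in> {0..T} \<Longrightarrow> sq_int M (Y r) \<and> l2 M (Y r) \<le> K" and K: "0 \<le> K" "0 \<le> L"
    and inc: "\<And>s t. 0 \<le> s \<Longrightarrow> s < t \<Longrightarrow> t \<le> T \<Longrightarrow> l2 M (\<lambda>\<omega>. Y t \<omega> - Y s \<omega>) \<le> L * sqrt (t - s)"
  shows "hol T sqrt Y"
  unfolding hol_def
proof (intro conjI ballI exI[of _ "K + L"])
  have comm: "l2 M (\<lambda>\<omega>. X \<omega> - Z \<omega>) = l2 M (\<lambda>\<omega>. Z \<omega> - X \<omega>)" for X Z
    by (simp add: l2_def power2_commute)
  fix r assume r: "r \<in> {0..T}"
  show "sq_int M (Y r)" using Y[OF r] by blast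
  show "l2 M (Y r) \<le> K + L" using Y[OF r] K by linarith
  fix s assume s: "s \<in> {0..T}"
  have "l2 M (\<lambda>\<omega>. Y r \<omega> - Y s \<omega>) \<le> L * sqrt \<bar>r - s\<bar>"
    using inc[of r s] inc[of s r] r s comm[of "Y r" "Y s"] by (cases r s rule: linorder_cases) auto
  also have "\<dots> \<le> (K + L) * sqrt \<bar>r - s\<bar>" using K by (intro mult_right_mono) auto
  finally show "l2 M (\<lambda>\<omega>. Y r \<omega> - Y s \<omega>) \<le> (K + L) * sqrt \<bar>r - s\<bar>" .
qed (use K in simp)

text \<open>Start of a bootstrap. Bounded moments of \<open>p\<close> give regularity of
  \<open>q\<close>, hence of its covariance; this bounds the drift and sizes the noise, which gives
  regularity of \<open>p\<close> and finally of the drift. The increments are even of order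
  \<open>t - s\<close> and are weakened to the exponent \<open>1/2\<close> that the noise
  permits.\<close>

lemma Q_hol: "hol T sqrt (Q i)"
proof -
  obtain K where K: "K \<ge> 0" "\<And>r i. r \<in> {0..T} \<Longrightarrow> sq_int M (Q i r) \<and> l2 M (Q i r) \<le> K"
    "\<And>r i. r \<in> {0..T} \<Longrightarrow> sq_int M (P i r) \<and> l2 M (P i r) \<le> K"
    using second_moments by auto
  show ?thesis
  proof (rule hol_from_increments[OF K(2,1), where L = "sqrt T * K"])
    show "0 \<le> sqrt T * K" using K(1) T0 by simp
    fix s t assume st: "0 \<le> s" "s < t" "t \<le> T"
    have "l2 M (\<lambda>\<omega>. Q i t \<omega> - Q i s \<omega>) \<le> (t - s) * K"
    proof (rule l2_path_integral_le(2)[where Y = "P i"])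
      show "AE \<omega> in M. continuous_on {s..t} (\<lambda>r. P i r \<omega>)"
        using paths by eventually_elim (use st in \<open>auto intro!: continuous_intros elim: continuous_on_subset\<close>)
      show "AE \<omega> in M. ((\<lambda>r. P i r \<omega>) has_integral (Q i t \<omega> - Q i s \<omega>)) {s..t}" by (rule q_increment[OF st])
      show "(\<lambda>\<omega>. Q i t \<omega> - Q i s \<omega>) \<in> borel_measurable M"
        using st by (intro borel_measurable_diff measurable_vec_component measurable_qp) auto
    qed (use st K in auto)
    also have "(t - s) * K = sqrt (t - s) * (sqrt (t - s) * K)" using st by simp
    also have "\<dots> \<le> sqrt (t - s) * (sqrt T * K)" using st K by (intro mult_left_mono mult_right_mono) auto
    finally show "l2 M (\<lambda>\<omega>. Q i t \<omega> - Q i s \<omega>) \<le> sqrt T * K * sqrt (t - s)" by (simp add: mult_ac)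
  qed
qed

lemma C_dhol: "dhol T sqrt (\<lambda>r. C r $ i $ j)"
proof -
  have "dhol T sqrt (\<lambda>r. cv M (Q i r) (Q j r))" by (intro dhol_cv Q_hol)
  then show ?thesis by (simp add: dhol_def C_component)
qed

section \<open>Drift and noise of the momentum\<close>

definition G :: "'n \<Rightarrow> real \<Rightarrow> 'w \<Rightarrow> real" where
  "G i r \<omega> = (- (C r *v (matrix_inv B *v q r \<omega> - c)) - \<gamma> *\<^sub>R p r \<omega>) $ i"

definition CD :: "'n \<Rightarrow> 'n \<Rightarrow> real \<Rightarrow> real" where
  "CD i j r = (C r ** matrix_inv B) $ i $ j"

text \<open>A linear combination of the coordinates with deterministic coefficients, the shape to
  which the closure rules of \<open>hol\<close> and the bilinearity of \<open>cv\<close>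
  apply.\<close>

lemma G_expand:
  "G i r = (\<lambda>\<omega>. (\<Sum>j\<in>UNIV. (- 1 * CD i j r) * Q j r \<omega>) + ((- \<gamma>) * P i r \<omega> + (\<Sum>j\<in>UNIV. C r $ i $ j * c $ j)))"
proof
  fix \<omega>
  have "C r *v (matrix_inv B *v q r \<omega> - c) = (C r ** matrix_inv B) *v q r \<omega> - C r *v c"
    by (simp add: matrix_vector_mult_diff_distrib matrix_vector_mul_assoc)
  then show "G i r \<omega> = (\<Sum>j\<in>UNIV. (- 1 * CD i j r) * Q j r \<omega>) + ((- \<gamma>) * P i r \<omega> + (\<Sum>j\<in>UNIV. C r $ i $ j * c $ j))"
    by (simp add: G_def CD_def matrix_vector_mult_def[of "C r"] matrix_vector_mult_def[of "C r ** matrix_inv B"] sum_negf)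
qed

lemma dhol_weaken: "dhol T sqrt a \<Longrightarrow> dhol T (\<lambda>_. 1) a"
  using hol_bounded[of T "\<lambda>r \<omega>. a r"] unfolding dhol_def
  by (intro dhol_of_hol[unfolded dhol_def]) (metis abs_ge_zero l2_const order_trans sq_int_const)

lemma CD_dhol: "dhol T sqrt (CD i j)"
  unfolding CD_def matrix_matrix_mult_def
  by (simp, intro dhol_sum dhol_mult C_dhol dhol_const) auto

text \<open>Stated for a general modulus because it is used twice: with mere boundedness, on the way
  to the regularity of \<open>p\<close>, and afterwards with \<open>sqrt\<close>.\<close>

lemma G_hol:
  assumes w: "\<And>x. 0 \<le> x \<Longrightarrow> 0 \<le> w x" and a: "\<And>a. dhol T sqrt a \<Longrightarrow> dhol T w a"
    and QP: "\<And>i. hol T w (Q i)" "\<And>i. hol T w (P i)"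
  shows "hol T w (G i)"
  unfolding G_expand[abs_def]
  by (intro hol_add hol_sum hol_mult hol_of_dhol dhol_sum dhol_mult dhol_const w a QP CD_dhol C_dhol)

lemma G_paths: "AE \<omega> in M. continuous_on {0..T} (\<lambda>r. G i r \<omega>)"
  using paths
proof eventually_elim
  fix \<omega> assume c: "continuous_on {0..T} (\<lambda>t. q t \<omega>) \<and> continuous_on {0..T} (\<lambda>t. p t \<omega>)"
  then have qc: "continuous_on {0..T} (\<lambda>t. q t \<omega> $ j)" and pc: "continuous_on {0..T} (\<lambda>t. p t \<omega> $ j)" for j
    by (auto intro: continuous_intros)
  show "continuous_on {0..T} (\<lambda>r. G i r \<omega>)"
    unfolding G_expand by (intro continuous_on_add continuous_on_sum continuous_on_mult continuous_on_const
        qc pc dhol_continuous CD_dhol C_dhol)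
qed

text \<open>Splits the vector equation into components and keeps of the Wiener integral only its
  second moments and its orthogonality to the past.\<close>

lemma noise_exists:
  assumes st: "0 \<le> s" "s < t" "t \<le> T"
  shows "\<exists>J. (\<forall>i. sq_int M (J i)) \<and> (\<forall>i Z. Z \<in> borel_measurable (F s) \<longrightarrow> sq_int M Z \<longrightarrow> (\<integral>\<omega>. Z \<omega> * J i \<omega> \<partial>M) = 0) \<and>
     (\<forall>i j. (\<integral>\<omega>. J i \<omega> * J j \<omega> \<partial>M) = integral {s..t} (\<lambda>r. 2 * \<gamma> * C r $ i $ j)) \<and>
     (\<forall>i. AE \<omega> in M. ((\<lambda>r. G i r \<omega>) has_integral (P i t \<omega> - P i s \<omega> - J i \<omega>)) {s..t})"
proof -
  obtain J where J: "wiener_integral M W (\<lambda>r. msqrt ((2 * \<gamma>) *\<^sub>R C r)) s t J"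
    and ae: "AE \<omega> in M. ((\<lambda>r. - (C r *v (matrix_inv B *v q r \<omega> - c)) - \<gamma> *\<^sub>R p r \<omega>)
                 has_integral (p t \<omega> - p s \<omega> - J \<omega>)) {s..t}"
    using integrated_equation(2)[OF st] by blast
  have sub: "{s..t} \<subseteq> {0..T}" using st by auto
  have c: "msqrt ((2 * \<gamma>) *\<^sub>R C r) $ i \<bullet> msqrt ((2 * \<gamma>) *\<^sub>R C r) $ j = 2 * \<gamma> * C r $ i $ j" if "s \<le> r" "r \<le> t" for i j r
    using diffusion_square[of r i j] C_component[of r i j] that st by simp
  have cont: "continuous_on {s..t} (\<lambda>r. 2 * \<gamma> * C r $ i $ j)" for i j
    by (intro continuous_intros continuous_on_subset[OF dhol_continuous[OF C_dhol] sub])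
  note W = wiener_integral_moments[OF st(1,2) J, of "\<lambda>i j r. 2 * \<gamma> * C r $ i $ j", OF c cont]
  have "AE \<omega> in M. ((\<lambda>r. G i r \<omega>) has_integral (P i t \<omega> - P i s \<omega> - J \<omega> $ i)) {s..t}" for i
    using ae
  proof eventually_elim
    fix \<omega> assume "((\<lambda>r. - (C r *v (matrix_inv B *v q r \<omega> - c)) - \<gamma> *\<^sub>R p r \<omega>) has_integral (p t \<omega> - p s \<omega> - J \<omega>)) {s..t}"
    from has_integral_linear[OF this bounded_linear_vec_nth[of i]]
    show "((\<lambda>r. G i r \<omega>) has_integral (P i t \<omega> - P i s \<omega> - J \<omega> $ i)) {s..t}"
      by (simp add: o_def G_def)
  qed
  then show ?thesis using W by (intro exI[of _ "\<lambda>i \<omega>. J \<omega> $ i"]) auto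
qed

text \<open>A choice for each interval separately; the expansions never compare the noises of
  different intervals.\<close>

definition noise :: "real \<Rightarrow> real \<Rightarrow> 'n \<Rightarrow> 'w \<Rightarrow> real" where
  "noise s t = (SOME J. (\<forall>i. sq_int M (J i)) \<and> (\<forall>i Z. Z \<in> borel_measurable (F s) \<longrightarrow> sq_int M Z \<longrightarrow> (\<integral>\<omega>. Z \<omega> * J i \<omega> \<partial>M) = 0) \<and>
     (\<forall>i j. (\<integral>\<omega>. J i \<omega> * J j \<omega> \<partial>M) = integral {s..t} (\<lambda>r. 2 * \<gamma> * C r $ i $ j)) \<and>
     (\<forall>i. AE \<omega> in M. ((\<lambda>r. G i r \<omega>) has_integral (P i t \<omega> - P i s \<omega> - J i \<omega>)) {s..t}))"

lemma noise:
  assumes st: "0 \<le> s" "s < t" "t \<le> T"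
  shows "sq_int M (noise s t i)"
    "Z \<in> borel_measurable (F s) \<Longrightarrow> sq_int M Z \<Longrightarrow> (\<integral>\<omega>. Z \<omega> * noise s t i \<omega> \<partial>M) = 0"
    "(\<integral>\<omega>. noise s t i \<omega> * noise s t j \<omega> \<partial>M) = integral {s..t} (\<lambda>r. 2 * \<gamma> * C r $ i $ j)"
    "AE \<omega> in M. ((\<lambda>r. G i r \<omega>) has_integral (P i t \<omega> - P i s \<omega> - noise s t i \<omega>)) {s..t}"
  using someI_ex[OF noise_exists[OF st], folded noise_def] by auto

text \<open>The first bound measures the variance of the noise. The second freezes the covariance at
  the left end, where Hoelder continuity makes the error of order \<open>3/2\<close>.\<close>

lemma C_integral_bounds:
  obtains K where "K \<ge> 0" "\<And>s t. 0 \<le> s \<Longrightarrow> s < t \<Longrightarrow> t \<le> T \<Longrightarrow>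
     \<bar>integral {s..t} (\<lambda>r. 2 * \<gamma> * C r $ i $ j)\<bar> \<le> K * (t - s) \<and>
     \<bar>integral {s..t} (\<lambda>r. 2 * \<gamma> * C r $ i $ j) - (t - s) * (2 * \<gamma> * C s $ i $ j)\<bar> \<le> K * ((t - s) * sqrt (t - s))"
proof -
  have d: "dhol T sqrt (\<lambda>r. 2 * \<gamma> * C r $ i $ j)"
    using dhol_mult[OF _ dhol_const[of sqrt T "2 * \<gamma>"] C_dhol] by simp
  then obtain K where K: "K \<ge> 0" "\<And>r. r \<in> {0..T} \<Longrightarrow> \<bar>2 * \<gamma> * C r $ i $ j\<bar> \<le> K"
    "\<And>r s. r \<in> {0..T} \<Longrightarrow> s \<in> {0..T} \<Longrightarrow> \<bar>2 * \<gamma> * C r $ i $ j - 2 * \<gamma> * C s $ i $ j\<bar> \<le> K * sqrt \<bar>r - s\<bar>"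
    unfolding dhol_def by auto
  have "\<bar>integral {s..t} (\<lambda>r. 2 * \<gamma> * C r $ i $ j)\<bar> \<le> K * (t - s) \<and>
     \<bar>integral {s..t} (\<lambda>r. 2 * \<gamma> * C r $ i $ j) - (t - s) * (2 * \<gamma> * C s $ i $ j)\<bar> \<le> K * ((t - s) * sqrt (t - s))"
    if st: "0 \<le> s" "s < t" "t \<le> T" for s t
  proof
    have "{s..t} \<subseteq> {0..T}" using st by auto
    then have cont: "continuous_on {s..t} (\<lambda>r. 2 * \<gamma> * C r $ i $ j)"
      by (rule continuous_on_subset[OF dhol_continuous[OF d]])
    have "norm (integral {s..t} (\<lambda>r. 2 * \<gamma> * C r $ i $ j)) \<le> integral {s..t} (\<lambda>r. K)"
      using K(2) st by (intro Henstock_Kurzweil_Integration.integral_norm_bound_integral integrable_continuous_real cont) auto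
    then show "\<bar>integral {s..t} (\<lambda>r. 2 * \<gamma> * C r $ i $ j)\<bar> \<le> K * (t - s)"
      using st by (simp add: content_real mult.commute)
    have "integral {s..t} (\<lambda>r. 2 * \<gamma> * C r $ i $ j - 2 * \<gamma> * C s $ i $ j) = integral {s..t} (\<lambda>r. 2 * \<gamma> * C r $ i $ j) - (t - s) * (2 * \<gamma> * C s $ i $ j)"
      using st by (subst Henstock_Kurzweil_Integration.integral_diff) (auto intro!: integrable_continuous_real cont simp: content_real)
    moreover have "norm (integral {s..t} (\<lambda>r. 2 * \<gamma> * C r $ i $ j - 2 * \<gamma> * C s $ i $ j)) \<le> integral {s..t} (\<lambda>r. K * sqrt (t - s))"
    proof (rule Henstock_Kurzweil_Integration.integral_norm_bound_integral)
      fix r assume r: "r \<in> {s..t}"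
      have "\<bar>2 * \<gamma> * C r $ i $ j - 2 * \<gamma> * C s $ i $ j\<bar> \<le> K * sqrt \<bar>r - s\<bar>" using r st by (intro K(3)) auto
      also have "\<dots> \<le> K * sqrt (t - s)" using r K(1) by (intro mult_left_mono) auto
      finally show "norm (2 * \<gamma> * C r $ i $ j - 2 * \<gamma> * C s $ i $ j) \<le> K * sqrt (t - s)" by simp
    qed (auto intro!: integrable_continuous_real continuous_intros cont)
    ultimately show "\<bar>integral {s..t} (\<lambda>r. 2 * \<gamma> * C r $ i $ j) - (t - s) * (2 * \<gamma> * C s $ i $ j)\<bar> \<le> K * ((t - s) * sqrt (t - s))"
      using st by (simp add: content_real mult_ac)
  qed
  with K(1) that show thesis by blast
qed

lemma noise_l2: "\<exists>K\<ge>0. \<forall>s t. 0 \<le> s \<and> s < t \<and> t \<le> T \<longrightarrow> l2 M (noise s t i) \<le> K * sqrt (t - s)"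
proof -
  obtain K where K: "K \<ge> 0" "\<And>s t. 0 \<le> s \<Longrightarrow> s < t \<Longrightarrow> t \<le> T \<Longrightarrow>
     \<bar>integral {s..t} (\<lambda>r. 2 * \<gamma> * C r $ i $ i)\<bar> \<le> K * (t - s) \<and>
     \<bar>integral {s..t} (\<lambda>r. 2 * \<gamma> * C r $ i $ i) - (t - s) * (2 * \<gamma> * C s $ i $ i)\<bar> \<le> K * ((t - s) * sqrt (t - s))"
    using C_integral_bounds by blast
  have "l2 M (noise s t i) \<le> sqrt K * sqrt (t - s)" if st: "0 \<le> s" "s < t" "t \<le> T" for s t
  proof -
    have "(\<integral>\<omega>. (noise s t i \<omega>)\<^sup>2 \<partial>M) = integral {s..t} (\<lambda>r. 2 * \<gamma> * C r $ i $ i)"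
      by (simp only: power2_eq_square noise(3)[OF st])
    then have "(\<integral>\<omega>. (noise s t i \<omega>)\<^sup>2 \<partial>M) \<le> K * (t - s)" using K(2)[OF st] by linarith
    then show ?thesis unfolding l2_def by (simp add: real_sqrt_mult[symmetric])
  qed
  then show ?thesis using K(1) by (intro exI[of _ "sqrt K"]) auto
qed

lemma G_hol_bounded: "hol T (\<lambda>_. 1) (G i)"
proof (rule G_hol)
  obtain K where "K \<ge> 0" "\<And>r i. r \<in> {0..T} \<Longrightarrow> sq_int M (Q i r) \<and> l2 M (Q i r) \<le> K"
    "\<And>r i. r \<in> {0..T} \<Longrightarrow> sq_int M (P i r) \<and> l2 M (P i r) \<le> K"
    using second_moments by auto
  then show "hol T (\<lambda>_. 1) (Q i)" "hol T (\<lambda>_. 1) (P i)" for i by (auto intro!: hol_bounded[where K = K])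
qed (auto intro: dhol_weaken)

lemma measurable_increment:
  assumes "0 \<le> s" "s < t" "t \<le> T"
  shows "(\<lambda>\<omega>. Q i t \<omega> - Q i s \<omega>) \<in> borel_measurable M"
    "(\<lambda>\<omega>. P i t \<omega> - P i s \<omega> - noise s t i \<omega>) \<in> borel_measurable M"
proof -
  have "s \<in> {0..T}" "t \<in> {0..T}" using assms by auto
  then show "(\<lambda>\<omega>. Q i t \<omega> - Q i s \<omega>) \<in> borel_measurable M"
    by (intro borel_measurable_diff measurable_vec_component measurable_qp)
  from \<open>s \<in> {0..T}\<close> \<open>t \<in> {0..T}\<close> show "(\<lambda>\<omega>. P i t \<omega> - P i s \<omega> - noise s t i \<omega>) \<in> borel_measurable M"
    by (intro borel_measurable_diff measurable_vec_component measurable_qp sq_int_measurable[OF noise(1)[OF assms]])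
qed

text \<open>The drift contributes order \<open>t - s\<close> and the noise order
  \<open>sqrt (t - s)\<close>, which is where the exponent \<open>1/2\<close> comes from.\<close>

lemma P_hol: "hol T sqrt (P i)"
proof -
  obtain K where K: "K \<ge> 0" "\<And>r i. r \<in> {0..T} \<Longrightarrow> sq_int M (P i r) \<and> l2 M (P i r) \<le> K"
    using second_moments by auto
  obtain N where N: "N \<ge> 0" "\<And>s t. 0 \<le> s \<Longrightarrow> s < t \<Longrightarrow> t \<le> T \<Longrightarrow> l2 M (noise s t i) \<le> N * sqrt (t - s)"
    using noise_l2[of i] by auto
  obtain L where L: "L \<ge> 0" "\<And>r. r \<in> {0..T} \<Longrightarrow> l2 M (G i r) \<le> L" "\<And>r. r \<in> {0..T} \<Longrightarrow> sq_int M (G i r)"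
    using G_hol_bounded[of i] unfolding hol_def by auto
  show ?thesis
  proof (rule hol_from_increments[OF K(2,1), where L = "sqrt T * L + N"])
    show "0 \<le> sqrt T * L + N" using L N T0 by simp
    fix s t assume st: "0 \<le> s" "s < t" "t \<le> T"
    let ?I = "\<lambda>\<omega>. P i t \<omega> - P i s \<omega> - noise s t i \<omega>"
    have "AE \<omega> in M. continuous_on {s..t} (\<lambda>r. G i r \<omega>)"
      using G_paths by eventually_elim (use st in \<open>auto elim: continuous_on_subset\<close>)
    note I = l2_path_integral_le[OF _ _ _ this noise(4)[OF st] measurable_increment(2)[OF st], of L]
    have "l2 M (\<lambda>\<omega>. ?I \<omega> + noise s t i \<omega>) \<le> (t - s) * L + N * sqrt (t - s)"
      using I L st by (intro order_trans[OF l2_triangle add_mono] noise N) auto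
    also have "(t - s) * L = sqrt (t - s) * (sqrt (t - s) * L)" using st by simp
    also have "\<dots> \<le> sqrt (t - s) * (sqrt T * L)" using st L by (intro mult_left_mono mult_right_mono) auto
    finally show "l2 M (\<lambda>\<omega>. P i t \<omega> - P i s \<omega>) \<le> (sqrt T * L + N) * sqrt (t - s)" by (simp add: algebra_simps)
  qed
qed

lemma G_hol_sqrt: "hol T sqrt (G i)"
  by (rule G_hol) (auto intro: Q_hol P_hol)

text \<open>Freezing a Hoelder continuous integrand at \<open>s\<close> costs at most
  \<open>K * sqrt (t - s)\<close> at each time of the interval, and integration adds a factor
  \<open>t - s\<close>.\<close>

lemma drift_remainder:
  assumes Y: "hol T sqrt Y" and path: "AE \<omega> in M. continuous_on {0..T} (\<lambda>r. Y r \<omega>)"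
  obtains K where "K \<ge> 0" "\<And>s t D. \<lbrakk>0 \<le> s; s < t; t \<le> T; D \<in> borel_measurable M;
      AE \<omega> in M. ((\<lambda>r. Y r \<omega>) has_integral D \<omega>) {s..t}\<rbrakk>
      \<Longrightarrow> l2 M (\<lambda>\<omega>. D \<omega> - (t - s) * Y s \<omega>) \<le> K * ((t - s) * sqrt (t - s))"
proof -
  obtain K where K: "K \<ge> 0" "\<And>r s. r \<in> {0..T} \<Longrightarrow> s \<in> {0..T} \<Longrightarrow> l2 M (\<lambda>\<omega>. Y r \<omega> - Y s \<omega>) \<le> K * sqrt \<bar>r - s\<bar>"
    using Y unfolding hol_def by auto
  have "l2 M (\<lambda>\<omega>. D \<omega> - (t - s) * Y s \<omega>) \<le> K * ((t - s) * sqrt (t - s))"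
    if st: "0 \<le> s" "s < t" "t \<le> T" and D: "D \<in> borel_measurable M"
      and ae: "AE \<omega> in M. ((\<lambda>r. Y r \<omega>) has_integral D \<omega>) {s..t}" for s t D
  proof -
    have sqY: "sq_int M (Y r)" if "s \<le> r" "r \<le> t" for r using hol_sq[OF Y] that st by simp
    have "l2 M (\<lambda>\<omega>. D \<omega> - (t - s) * Y s \<omega>) \<le> (t - s) * (K * sqrt (t - s))"
    proof (rule l2_path_integral_le(2)[where Y = "\<lambda>r \<omega>. Y r \<omega> - Y s \<omega>"])
      show "AE \<omega> in M. continuous_on {s..t} (\<lambda>r. Y r \<omega> - Y s \<omega>)"
        using path by eventually_elim (use st in \<open>auto intro!: continuous_intros elim: continuous_on_subset\<close>)
      show "AE \<omega> in M. ((\<lambda>r. Y r \<omega> - Y s \<omega>) has_integral (D \<omega> - (t - s) * Y s \<omega>)) {s..t}"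
        using ae
      proof eventually_elim
        fix \<omega> assume "((\<lambda>r. Y r \<omega>) has_integral D \<omega>) {s..t}"
        from has_integral_diff[OF this has_integral_const_real[of "Y s \<omega>" s t]]
        show "((\<lambda>r. Y r \<omega> - Y s \<omega>) has_integral (D \<omega> - (t - s) * Y s \<omega>)) {s..t}"
          using st by (simp add: content_real)
      qed
      show "(\<lambda>\<omega>. D \<omega> - (t - s) * Y s \<omega>) \<in> borel_measurable M"
        using D sq_int_measurable[OF sqY[of s]] st
        by (intro borel_measurable_diff borel_measurable_times borel_measurable_const) auto
      fix r assume r: "s \<le> r" "r \<le> t"
      show "sq_int M (\<lambda>\<omega>. Y r \<omega> - Y s \<omega>)" using r st by (intro sq_int_diff sqY) auto
      have "l2 M (\<lambda>\<omega>. Y r \<omega> - Y s \<omega>) \<le> K * sqrt \<bar>r - s\<bar>" using r st by (intro K(2)) auto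
      also have "\<dots> \<le> K * sqrt (t - s)" using r K(1) by (intro mult_left_mono) auto
      finally show "l2 M (\<lambda>\<omega>. Y r \<omega> - Y s \<omega>) \<le> K * sqrt (t - s)" .
    qed (use st in auto)
    then show ?thesis by (simp add: mult_ac)
  qed
  with K(1) that show thesis by blast
qed

text \<open>First-order expansion of the increments in mean square, with a noise orthogonal to the past. It is
  all of the stochastic calculus that the derivatives of means and covariances need.\<close>

definition ito :: "(real \<Rightarrow> 'w \<Rightarrow> real) \<Rightarrow> (real \<Rightarrow> 'w \<Rightarrow> real) \<Rightarrow> (real \<Rightarrow> real \<Rightarrow> 'w \<Rightarrow> real) \<Rightarrow> bool" where
  "ito X x N \<longleftrightarrow> hol T sqrt X \<and> hol T sqrt x \<and>
     (\<forall>s\<in>{0..T}. X s \<in> borel_measurable (F s) \<and> x s \<in> borel_measurable (F s)) \<and>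
     (\<forall>s t. 0 \<le> s \<and> s < t \<and> t \<le> T \<longrightarrow> sq_int M (N s t) \<and>
        (\<forall>Z. Z \<in> borel_measurable (F s) \<longrightarrow> sq_int M Z \<longrightarrow> (\<integral>\<omega>. Z \<omega> * N s t \<omega> \<partial>M) = 0)) \<and>
     (\<exists>K\<ge>0. \<forall>s t. 0 \<le> s \<and> s < t \<and> t \<le> T \<longrightarrow> l2 M (N s t) \<le> K * sqrt (t - s) \<and>
        l2 M (\<lambda>\<omega>. X t \<omega> - X s \<omega> - (t - s) * x s \<omega> - N s t \<omega>) \<le> K * ((t - s) * sqrt (t - s)))"

lemma ito_bounds:
  assumes "ito X x N"
  shows "\<exists>K\<ge>0. \<forall>s t. 0 \<le> s \<and> s < t \<and> t \<le> T \<longrightarrow> l2 M (N s t) \<le> K * sqrt (t - s) \<and>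
        l2 M (\<lambda>\<omega>. X t \<omega> - X s \<omega> - (t - s) * x s \<omega> - N s t \<omega>) \<le> K * ((t - s) * sqrt (t - s))"
  using assms unfolding ito_def by (elim conjE)

lemma ito_noise:
  assumes I: "ito X x N" and st: "0 \<le> s" "s < t" "t \<le> T"
  shows "sq_int M (N s t)"
    "Z \<in> borel_measurable (F s) \<Longrightarrow> sq_int M Z \<Longrightarrow> (\<integral>\<omega>. Z \<omega> * N s t \<omega> \<partial>M) = 0"
    "(\<integral>\<omega>. N s t \<omega> \<partial>M) = 0"
proof -
  have "\<forall>s t. 0 \<le> s \<and> s < t \<and> t \<le> T \<longrightarrow> sq_int M (N s t) \<and>
        (\<forall>Z. Z \<in> borel_measurable (F s) \<longrightarrow> sq_int M Z \<longrightarrow> (\<integral>\<omega>. Z \<omega> * N s t \<omega> \<partial>M) = 0)"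
    using I unfolding ito_def by (elim conjE)
  with st have N: "sq_int M (N s t)" "\<And>Z. Z \<in> borel_measurable (F s) \<Longrightarrow> sq_int M Z \<Longrightarrow> (\<integral>\<omega>. Z \<omega> * N s t \<omega> \<partial>M) = 0"
    by simp_all
  show "sq_int M (N s t)" by (rule N(1))
  show "Z \<in> borel_measurable (F s) \<Longrightarrow> sq_int M Z \<Longrightarrow> (\<integral>\<omega>. Z \<omega> * N s t \<omega> \<partial>M) = 0" by (rule N(2))
  show "(\<integral>\<omega>. N s t \<omega> \<partial>M) = 0" using N(2)[of "\<lambda>_. 1"] sq_int_const[of 1] by simp
qed

lemma G_adapted: "r \<in> {0..T} \<Longrightarrow> G i r \<in> borel_measurable (F r)"
  unfolding G_expand
  by (intro borel_measurable_add borel_measurable_sum borel_measurable_times borel_measurable_const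
      measurable_vec_component adapted)

lemma ito_Q: "ito (Q i) (P i) (\<lambda>s t \<omega>. 0)"
proof -
  have "AE \<omega> in M. continuous_on {0..T} (\<lambda>r. P i r \<omega>)"
    using paths by eventually_elim (auto intro: continuous_intros)
  from drift_remainder[OF P_hol this]
  obtain K where K: "K \<ge> 0" "\<And>s t D. \<lbrakk>0 \<le> s; s < t; t \<le> T; D \<in> borel_measurable M;
      AE \<omega> in M. ((\<lambda>r. P i r \<omega>) has_integral D \<omega>) {s..t}\<rbrakk>
      \<Longrightarrow> l2 M (\<lambda>\<omega>. D \<omega> - (t - s) * P i s \<omega>) \<le> K * ((t - s) * sqrt (t - s))" by blast
  have "l2 M (\<lambda>\<omega>. Q i t \<omega> - Q i s \<omega> - (t - s) * P i s \<omega>) \<le> K * ((t - s) * sqrt (t - s))"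
    if "0 \<le> s" "s < t" "t \<le> T" for s t
    by (rule K(2)[OF that measurable_increment(1)[OF that] q_increment[OF that]])
  then show ?thesis
    unfolding ito_def using Q_hol P_hol K(1)
    by (auto intro!: measurable_vec_component adapted sq_int_zero exI[of _ K])
qed

lemma ito_P: "ito (P i) (G i) (\<lambda>s t. noise s t i)"
proof -
  obtain K where K: "K \<ge> 0" "\<And>s t D. \<lbrakk>0 \<le> s; s < t; t \<le> T; D \<in> borel_measurable M;
      AE \<omega> in M. ((\<lambda>r. G i r \<omega>) has_integral D \<omega>) {s..t}\<rbrakk>
      \<Longrightarrow> l2 M (\<lambda>\<omega>. D \<omega> - (t - s) * G i s \<omega>) \<le> K * ((t - s) * sqrt (t - s))"
    using drift_remainder[OF G_hol_sqrt[of i] G_paths[of i]] by blast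
  obtain N where N: "N \<ge> 0" "\<And>s t. 0 \<le> s \<Longrightarrow> s < t \<Longrightarrow> t \<le> T \<Longrightarrow> l2 M (noise s t i) \<le> N * sqrt (t - s)"
    using noise_l2[of i] by auto
  have b: "l2 M (noise s t i) \<le> (K + N) * sqrt (t - s) \<and>
      l2 M (\<lambda>\<omega>. P i t \<omega> - P i s \<omega> - (t - s) * G i s \<omega> - noise s t i \<omega>) \<le> (K + N) * ((t - s) * sqrt (t - s))"
    if st: "0 \<le> s" "s < t" "t \<le> T" for s t
  proof
    have "l2 M (noise s t i) \<le> N * sqrt (t - s)" using N(2) st by simp
    also have "\<dots> \<le> (K + N) * sqrt (t - s)" using K(1) st by (intro mult_right_mono) auto
    finally show "l2 M (noise s t i) \<le> (K + N) * sqrt (t - s)" .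
    have "l2 M (\<lambda>\<omega>. P i t \<omega> - P i s \<omega> - noise s t i \<omega> - (t - s) * G i s \<omega>) \<le> K * ((t - s) * sqrt (t - s))"
      by (rule K(2)[OF st measurable_increment(2)[OF st] noise(4)[OF st]])
    also have "\<dots> \<le> (K + N) * ((t - s) * sqrt (t - s))" using N(1) st by (intro mult_right_mono) auto
    finally show "l2 M (\<lambda>\<omega>. P i t \<omega> - P i s \<omega> - (t - s) * G i s \<omega> - noise s t i \<omega>) \<le> (K + N) * ((t - s) * sqrt (t - s))"
      by (simp add: algebra_simps)
  qed
  then show ?thesis
    unfolding ito_def using P_hol G_hol_sqrt K(1) N(1)
    by (auto intro!: measurable_vec_component adapted G_adapted noise exI[of _ "K + N"])
qed

text \<open>The noise has mean zero, so the mean moves with the drift alone.\<close>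

lemma ito_mean:
  assumes I: "ito X x N" and t: "t \<in> {0..T}"
  shows "((\<lambda>t. \<integral>\<omega>. X t \<omega> \<partial>M) has_vector_derivative (\<integral>\<omega>. x t \<omega> \<partial>M)) (at t within {0..T})"
proof -
  obtain K where "K \<ge> 0" and K: "\<And>s t. 0 \<le> s \<Longrightarrow> s < t \<Longrightarrow> t \<le> T \<Longrightarrow> l2 M (N s t) \<le> K * sqrt (t - s) \<and>
        l2 M (\<lambda>\<omega>. X t \<omega> - X s \<omega> - (t - s) * x s \<omega> - N s t \<omega>) \<le> K * ((t - s) * sqrt (t - s))"
    using ito_bounds[OF I] by auto
  have hol: "hol T sqrt X" "hol T sqrt x" using I by (auto simp: ito_def)
  show ?thesis
  proof (rule derivative_from_increments[OF _ dhol_continuous[OF dhol_mean[OF hol(2)]] t])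
    fix s t assume st: "0 \<le> s" "s < t" "t \<le> T"
    note N = ito_noise(1,3)[OF I st]
    have sq: "sq_int M (X s)" "sq_int M (X t)" "sq_int M (x s)"
      using hol_sq[OF hol(1)] hol_sq[OF hol(2)] st by auto
    let ?R = "\<lambda>\<omega>. X t \<omega> - X s \<omega> - (t - s) * x s \<omega> - N s t \<omega>"
    have "(\<integral>\<omega>. ?R \<omega> \<partial>M) = (\<integral>\<omega>. X t \<omega> \<partial>M) - (\<integral>\<omega>. X s \<omega> \<partial>M) - (t - s) * (\<integral>\<omega>. x s \<omega> \<partial>M)"
      using N sq by (simp add: sq_int_integrable)
    then show "\<bar>(\<integral>\<omega>. X t \<omega> \<partial>M) - (\<integral>\<omega>. X s \<omega> \<partial>M) - (t - s) * (\<integral>\<omega>. x s \<omega> \<partial>M)\<bar> \<le> K * ((t - s) * sqrt (t - s))"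
      using mean_le_l2[of ?R, OF sq_int_diff[OF sq_int_diff[OF sq_int_diff[OF sq(2,1)] sq_int_scale[OF sq(3)]] N(1)]] K[OF st]
      by simp
  qed
qed

text \<open>Ito's product rule in expectation: besides the two drift terms there is the rate
  \<open>n\<close> at which the noises covary.\<close>

lemma ito_covariance:
  assumes X: "ito X x N" and Y: "ito Y y N'" and t: "t \<in> {0..T}"
    and n: "continuous_on {0..T} n" and NN: "\<exists>K\<ge>0. \<forall>s t. 0 \<le> s \<and> s < t \<and> t \<le> T \<longrightarrow>
      \<bar>(\<integral>\<omega>. N s t \<omega> * N' s t \<omega> \<partial>M) - (t - s) * n s\<bar> \<le> K * ((t - s) * sqrt (t - s))"
  shows "((\<lambda>t. cv M (X t) (Y t)) has_vector_derivative (cv M (x t) (Y t) + cv M (X t) (y t) + n t)) (at t within {0..T})"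
proof -
  have hol: "hol T sqrt X" "hol T sqrt x" "hol T sqrt Y" "hol T sqrt y" using X Y by (auto simp: ito_def)
  obtain K1 where K1: "K1 \<ge> 0" "\<And>r. r \<in> {0..T} \<Longrightarrow> l2 M (X r) \<le> K1" using hol(1) unfolding hol_def by auto
  obtain K2 where K2: "K2 \<ge> 0" "\<And>r. r \<in> {0..T} \<Longrightarrow> l2 M (x r) \<le> K2" using hol(2) unfolding hol_def by auto
  obtain K3 where K3: "K3 \<ge> 0" "\<And>r. r \<in> {0..T} \<Longrightarrow> l2 M (Y r) \<le> K3" using hol(3) unfolding hol_def by auto
  obtain K4 where K4: "K4 \<ge> 0" "\<And>r. r \<in> {0..T} \<Longrightarrow> l2 M (y r) \<le> K4" using hol(4) unfolding hol_def by auto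
  obtain K5 where K5: "K5 \<ge> 0" "\<And>s t. 0 \<le> s \<Longrightarrow> s < t \<Longrightarrow> t \<le> T \<Longrightarrow> l2 M (N s t) \<le> K5 * sqrt (t - s) \<and>
        l2 M (\<lambda>\<omega>. X t \<omega> - X s \<omega> - (t - s) * x s \<omega> - N s t \<omega>) \<le> K5 * ((t - s) * sqrt (t - s))"
    using ito_bounds[OF X] by auto
  obtain K6 where K6: "K6 \<ge> 0" "\<And>s t. 0 \<le> s \<Longrightarrow> s < t \<Longrightarrow> t \<le> T \<Longrightarrow> l2 M (N' s t) \<le> K6 * sqrt (t - s) \<and>
        l2 M (\<lambda>\<omega>. Y t \<omega> - Y s \<omega> - (t - s) * y s \<omega> - N' s t \<omega>) \<le> K6 * ((t - s) * sqrt (t - s))"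
    using ito_bounds[OF Y] by auto
  obtain K7 where K7: "K7 \<ge> 0" "\<And>s t. 0 \<le> s \<Longrightarrow> s < t \<Longrightarrow> t \<le> T \<Longrightarrow>
      \<bar>(\<integral>\<omega>. N s t \<omega> * N' s t \<omega> \<partial>M) - (t - s) * n s\<bar> \<le> K7 * ((t - s) * sqrt (t - s))"
    using NN by auto
  define K where "K = K1 + K2 + K3 + K4 + K5 + K6 + K7"
  have K: "K \<ge> 0" "K1 \<le> K" "K2 \<le> K" "K3 \<le> K" "K4 \<le> K" "K5 \<le> K" "K6 \<le> K" "K7 \<le> K"
    using K1(1) K2(1) K3(1) K4(1) K5(1) K6(1) K7(1) by (auto simp: K_def)
  show ?thesis
  proof (rule derivative_from_increments[OF _ _ t])
    show "continuous_on {0..T} (\<lambda>t. cv M (x t) (Y t) + cv M (X t) (y t) + n t)"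
      by (intro continuous_intros dhol_continuous dhol_cv hol n)
    fix s t assume st: "0 \<le> s" "s < t" "t \<le> T"
    then have s: "s \<in> {0..T}" and t: "t \<in> {0..T}" by auto
    let ?h = "t - s"
    let ?R = "\<lambda>\<omega>. X t \<omega> - X s \<omega> - ?h * x s \<omega> - N s t \<omega>" and ?S = "\<lambda>\<omega>. Y t \<omega> - Y s \<omega> - ?h * y s \<omega> - N' s t \<omega>"
    note N = ito_noise[OF X st] and N' = ito_noise[OF Y st]
    note mean0 = N(3) N'(3)
    have meas: "X s \<in> borel_measurable (F s)" "x s \<in> borel_measurable (F s)" "Y s \<in> borel_measurable (F s)" "y s \<in> borel_measurable (F s)"
      using X Y s unfolding ito_def by auto
    have sq: "sq_int M (X s)" "sq_int M (x s)" "sq_int M (Y s)" "sq_int M (y s)" "sq_int M (X t)" "sq_int M (Y t)"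
      using hol s t unfolding hol_def by auto
    have orth: "cv M Z (N' s t) = 0" "cv M (N s t) Z = 0" if "Z \<in> borel_measurable (F s)" "sq_int M Z" for Z
      using N(2)[OF that] N'(2)[OF that] mean0 by (simp_all add: cv_def mult.commute)
    have g: "0 \<le> ?h * sqrt ?h" "0 \<le> sqrt ?h" using st by auto
    show "\<bar>cv M (X t) (Y t) - cv M (X s) (Y s) - ?h * (cv M (x s) (Y s) + cv M (X s) (y s) + n s)\<bar>
        \<le> (K + (4 + 2 * T + 4 * sqrt T) * K\<^sup>2) * (?h * sqrt ?h)"
    proof (rule cov_increment[where R = ?R and S = ?S and N = "N s t" and N' = "N' s t"])
      show "l2 M (X s) \<le> K" "l2 M (x s) \<le> K" "l2 M (y s) \<le> K" "l2 M (Y t) \<le> K"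
        using K1(2)[OF s] K2(2)[OF s] K4(2)[OF s] K3(2)[OF t] K by auto
      show "l2 M ?R \<le> K * (?h * sqrt ?h)" "l2 M (N s t) \<le> K * sqrt ?h"
        using K5(2)[OF st] mult_right_mono[OF K(6) g(1)] mult_right_mono[OF K(6) g(2)] by auto
      show "l2 M ?S \<le> K * (?h * sqrt ?h)" using K6(2)[OF st] mult_right_mono[OF K(7) g(1)] by auto
      show "\<bar>cv M (N s t) (N' s t) - ?h * n s\<bar> \<le> K * (?h * sqrt ?h)"
        using K7(2)[OF st] mult_right_mono[OF K(8) g(1)] mean0 by (auto simp: cv_def)
      show "cv M (X s) (N' s t) = 0" "cv M (x s) (N' s t) = 0" "cv M (N s t) (Y s) = 0" "cv M (N s t) (y s) = 0"
        by (intro orth meas sq)+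
      show "sq_int M ?R" "sq_int M ?S" by (intro sq_int_diff sq_int_scale sq N N')+
    qed (use sq N N' st K in \<open>auto simp: algebra_simps\<close>)
  qed
qed

lemma G_covariance:
  assumes t: "t \<in> {0..T}" and Z: "sq_int M Z"
  shows "cv M (G i t) Z = - (\<Sum>k\<in>UNIV. CD i k t * cv M (Q k t) Z) - \<gamma> * cv M (P i t) Z"
proof -
  have "sq_int M (\<lambda>\<omega>. \<Sum>j\<in>UNIV. (- 1 * CD i j t) * Q j t \<omega>)" "sq_int M (\<lambda>\<omega>. (- \<gamma>) * P i t \<omega>)"
    by (intro sq_int_sum sq_int_scale sq t)+
  then show ?thesis
    unfolding G_expand using sq[OF t] Z
    by (simp only: cv_add_left cv_sum_left cv_scale_left sq_int_scale sq_int_sum sq_int_add sq_int_const cv_const_left)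
      (simp add: sum_negf)
qed

lemma G_mean:
  assumes t: "t \<in> {0..T}"
  shows "(\<integral>\<omega>. G i t \<omega> \<partial>M) = (- (C t *v (matrix_inv B *v mean_q (law M q p t) - c)) - \<gamma> *\<^sub>R mean_p (law M q p t)) $ i"
proof -
  have "(C t *v (matrix_inv B *v mean_q (law M q p t) - c)) $ i
      = (\<Sum>j\<in>UNIV. CD i j t * (\<integral>\<omega>. Q j t \<omega> \<partial>M)) - (\<Sum>j\<in>UNIV. C t $ i $ j * c $ j)"
  proof -
    have "C t *v (matrix_inv B *v m - c) = (C t ** matrix_inv B) *v m - C t *v c" for m
      by (simp add: matrix_vector_mult_diff_distrib matrix_vector_mul_assoc)
    then show ?thesis
      by (simp add: CD_def matrix_vector_mult_def[of "C t"] matrix_vector_mult_def[of "C t ** matrix_inv B"] law_moments(1)[OF t])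
  qed
  then show ?thesis
    unfolding G_expand using sq[OF t]
    by (simp add: sq_int_integrable law_moments(2)[OF t] prob_space sum_negf)
qed

theorem moments_ode: "ode_solution (moment_field \<gamma> B c) {0..T} (\<lambda>t. moments (law M q p t))"
  unfolding ode_solution_def
proof
  fix t assume t: "t \<in> {0..T}"
  let ?at = "at t within {0..T}" and ?\<rho> = "\<lambda>t. law M q p t" and ?D = "matrix_inv B"
  have ext: "(f has_vector_derivative d) ?at" if "(g has_vector_derivative d) ?at" "\<And>s. s \<in> {0..T} \<Longrightarrow> f s = g s"
    for f g :: "real \<Rightarrow> real" and d
    by (rule has_vector_derivative_transform[OF t that(2) that(1)])
  have sC: "transpose (C t) = C t" using C_psd[OF t] by (simp add: psd_mat_def sym_mat_def)
  have sD: "transpose ?D = ?D" using pd_sym[OF pd_matrix_inv[OF B]] by (simp add: sym_mat_def)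
  have CC: "cv M (Q i t) (Q j t) = C t $ i $ j" for i j by (simp add: C_component[OF t])
  have Cp: "cv M (P i t) (P j t) = cov_p (?\<rho> t) $ i $ j" for i j by (simp add: law_moments[OF t])
  have Cqp: "cv M (Q i t) (P j t) = cov_qp (?\<rho> t) $ i $ j" "cv M (P j t) (Q i t) = cov_qp (?\<rho> t) $ i $ j" for i j
    using law_moments(5)[OF t] cv_commute by metis+
  have mq: "((\<lambda>t. mean_q (?\<rho> t)) has_vector_derivative mean_p (?\<rho> t)) ?at"
    by (rule has_vector_derivative_vec, rule ext[OF ito_mean[OF ito_Q t, folded law_moments(2)[OF t]]])
      (rule law_moments(1))
  have mp: "((\<lambda>t. mean_p (?\<rho> t)) has_vector_derivative - (C t *v (?D *v mean_q (?\<rho> t) - c)) - \<gamma> *\<^sub>R mean_p (?\<rho> t)) ?at"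
    by (rule has_vector_derivative_vec, rule ext[OF ito_mean[OF ito_P t, unfolded G_mean[OF t]]])
      (rule law_moments(2))
  \<comment> \<open>\<open>q\<close> has no noise of its own, so no covariation enters the equations
    for \<open>cov_q\<close> and \<open>cov_qp\<close>.\<close>
  have zero: "continuous_on {0..T} (\<lambda>_. 0::real)"
    "\<exists>K\<ge>0. \<forall>s t. 0 \<le> s \<and> s < t \<and> t \<le> T \<longrightarrow> \<bar>(\<integral>\<omega>. 0 * Y s t \<omega> \<partial>M) - (t - s) * 0\<bar> \<le> K * ((t - s) * sqrt (t - s))" for Y
    by (simp, intro exI[of _ 0], simp)
  have GP: "cv M (G i t) (P j t) = - ((C t ** ?D ** cov_qp (?\<rho> t)) $ i $ j) - \<gamma> * cov_p (?\<rho> t) $ i $ j" for i j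
    unfolding G_covariance[OF t sq(2)[OF t]] Cqp Cp by (simp add: CD_def matrix_matrix_mult_def[of "C t ** ?D"])
  \<comment> \<open>The sum arises with the indices exchanged; \<open>C t ** ?D ** C t\<close> is
    symmetric.\<close>
  have GQ: "cv M (G j t) (Q i t) = - ((C t ** ?D ** C t) $ i $ j) - \<gamma> * cov_qp (?\<rho> t) $ i $ j" for i j
  proof -
    have "(\<Sum>k\<in>UNIV. CD j k t * C t $ k $ i) = (C t ** ?D ** C t) $ j $ i"
      by (simp add: CD_def matrix_matrix_mult_def[of "C t ** ?D"])
    also have "\<dots> = transpose (C t ** ?D ** C t) $ i $ j" by (simp add: transpose_def)
    also have "transpose (C t ** ?D ** C t) = C t ** ?D ** C t"
      by (simp add: matrix_transpose_mul sC sD matrix_mul_assoc)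
    finally show ?thesis unfolding G_covariance[OF t sq(1)[OF t]] Cqp CC by simp
  qed
  have cq: "((\<lambda>t. cov_q (?\<rho> t)) has_vector_derivative cov_qp (?\<rho> t) + transpose (cov_qp (?\<rho> t))) ?at"
  proof (intro has_vector_derivative_vec)
    fix i j
    have "((\<lambda>t. cv M (Q i t) (Q j t)) has_vector_derivative cv M (P i t) (Q j t) + cv M (Q i t) (P j t) + 0) ?at"
      by (rule ito_covariance[OF ito_Q ito_Q t zero])
    moreover have "cv M (P i t) (Q j t) + cv M (Q i t) (P j t) + 0 = (cov_qp (?\<rho> t) + transpose (cov_qp (?\<rho> t))) $ i $ j"
      by (simp add: Cqp transpose_def)
    ultimately have "((\<lambda>t. cv M (Q i t) (Q j t)) has_vector_derivative (cov_qp (?\<rho> t) + transpose (cov_qp (?\<rho> t))) $ i $ j) ?at"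
      by simp
    then show "((\<lambda>t. cov_q (?\<rho> t) $ i $ j) has_vector_derivative (cov_qp (?\<rho> t) + transpose (cov_qp (?\<rho> t))) $ i $ j) ?at"
      by (rule ext) (rule law_moments(3))
  qed
  have cqp: "((\<lambda>t. cov_qp (?\<rho> t)) has_vector_derivative - (\<gamma> *\<^sub>R cov_qp (?\<rho> t)) - C t ** ?D ** C t + cov_p (?\<rho> t)) ?at"
  proof (intro has_vector_derivative_vec)
    fix i j
    have "((\<lambda>t. cv M (Q i t) (P j t)) has_vector_derivative cv M (P i t) (P j t) + cv M (Q i t) (G j t) + 0) ?at"
      by (rule ito_covariance[OF ito_Q ito_P t zero])
    moreover have "cv M (P i t) (P j t) + cv M (Q i t) (G j t) + 0 = (- (\<gamma> *\<^sub>R cov_qp (?\<rho> t)) - C t ** ?D ** C t + cov_p (?\<rho> t)) $ i $ j"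
      unfolding Cp cv_commute[of M "Q i t" "G j t"] GQ by simp
    ultimately have "((\<lambda>t. cv M (Q i t) (P j t)) has_vector_derivative (- (\<gamma> *\<^sub>R cov_qp (?\<rho> t)) - C t ** ?D ** C t + cov_p (?\<rho> t)) $ i $ j) ?at"
      by simp
    then show "((\<lambda>t. cov_qp (?\<rho> t) $ i $ j) has_vector_derivative (- (\<gamma> *\<^sub>R cov_qp (?\<rho> t)) - C t ** ?D ** C t + cov_p (?\<rho> t)) $ i $ j) ?at"
      by (rule ext) (rule law_moments(5))
  qed
  have cp: "((\<lambda>t. cov_p (?\<rho> t)) has_vector_derivative - (C t ** ?D ** cov_qp (?\<rho> t)) - transpose (C t ** ?D ** cov_qp (?\<rho> t))
      - (2 * \<gamma>) *\<^sub>R cov_p (?\<rho> t) + (2 * \<gamma>) *\<^sub>R C t) ?at"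
  proof (intro has_vector_derivative_vec)
    fix i j
    obtain K where K: "K \<ge> 0" "\<And>s t. 0 \<le> s \<Longrightarrow> s < t \<Longrightarrow> t \<le> T \<Longrightarrow>
       \<bar>integral {s..t} (\<lambda>r. 2 * \<gamma> * C r $ i $ j)\<bar> \<le> K * (t - s) \<and>
       \<bar>integral {s..t} (\<lambda>r. 2 * \<gamma> * C r $ i $ j) - (t - s) * (2 * \<gamma> * C s $ i $ j)\<bar> \<le> K * ((t - s) * sqrt (t - s))"
      using C_integral_bounds by blast
    \<comment> \<open>The momentum noise covaries at the rate \<open>2 * \<gamma> * C t\<close>, the
      source of the last term in the equation for \<open>cov_p\<close>.\<close>
    have "((\<lambda>t. cv M (P i t) (P j t)) has_vector_derivative cv M (G i t) (P j t) + cv M (P i t) (G j t) + 2 * \<gamma> * C t $ i $ j) ?at"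
    proof (rule ito_covariance[OF ito_P ito_P t])
      show "continuous_on {0..T} (\<lambda>t. 2 * \<gamma> * C t $ i $ j)"
        by (intro continuous_on_mult continuous_on_const dhol_continuous C_dhol)
      show "\<exists>K\<ge>0. \<forall>s t. 0 \<le> s \<and> s < t \<and> t \<le> T \<longrightarrow>
          \<bar>(\<integral>\<omega>. noise s t i \<omega> * noise s t j \<omega> \<partial>M) - (t - s) * (2 * \<gamma> * C s $ i $ j)\<bar> \<le> K * ((t - s) * sqrt (t - s))"
      proof (intro exI[of _ K] conjI allI impI K(1))
        fix s t assume st: "0 \<le> s \<and> s < t \<and> t \<le> T"
        then have "(\<integral>\<omega>. noise s t i \<omega> * noise s t j \<omega> \<partial>M) = integral {s..t} (\<lambda>r. 2 * \<gamma> * C r $ i $ j)"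
          by (intro noise(3)) auto
        with K(2)[of s t] st show "\<bar>(\<integral>\<omega>. noise s t i \<omega> * noise s t j \<omega> \<partial>M) - (t - s) * (2 * \<gamma> * C s $ i $ j)\<bar> \<le> K * ((t - s) * sqrt (t - s))"
          by presburger
      qed
    qed
    moreover have "cov_p (?\<rho> t) $ j $ i = cov_p (?\<rho> t) $ i $ j"
      unfolding Cp[symmetric] by (rule cv_commute)
    then have "cv M (G i t) (P j t) + cv M (P i t) (G j t) + 2 * \<gamma> * C t $ i $ j = (- (C t ** ?D ** cov_qp (?\<rho> t)) - transpose (C t ** ?D ** cov_qp (?\<rho> t))
        - (2 * \<gamma>) *\<^sub>R cov_p (?\<rho> t) + (2 * \<gamma>) *\<^sub>R C t) $ i $ j"
      unfolding cv_commute[of M "P i t" "G j t"] GP by (simp add: transpose_def)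
    ultimately have "((\<lambda>t. cv M (P i t) (P j t)) has_vector_derivative (- (C t ** ?D ** cov_qp (?\<rho> t)) - transpose (C t ** ?D ** cov_qp (?\<rho> t))
        - (2 * \<gamma>) *\<^sub>R cov_p (?\<rho> t) + (2 * \<gamma>) *\<^sub>R C t) $ i $ j) ?at"
      by (simp only:)
    then show "((\<lambda>t. cov_p (?\<rho> t) $ i $ j) has_vector_derivative (- (C t ** ?D ** cov_qp (?\<rho> t)) - transpose (C t ** ?D ** cov_qp (?\<rho> t))
      - (2 * \<gamma>) *\<^sub>R cov_p (?\<rho> t) + (2 * \<gamma>) *\<^sub>R C t) $ i $ j) ?at"
      by (rule ext) (rule law_moments(4))
  qed
  show "((\<lambda>t. moments (?\<rho> t)) has_vector_derivative moment_field \<gamma> B c (moments (?\<rho> t))) ?at"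
    unfolding moments_def moment_field_def prod.case C_def[symmetric]
    using has_vector_derivative_Pair[OF mq has_vector_derivative_Pair[OF mp has_vector_derivative_Pair[OF cq[folded C_def] has_vector_derivative_Pair[OF cp cqp]]]]
    by (simp add: C_def)
qed

end

lemma mean_field_solution_moments:
  assumes "\<gamma> > 0" "pd_mat B" and sol: "mean_field_solution \<gamma> B c T M F W q p"
  shows "ode_solution (moment_field \<gamma> B c) {0..T} (\<lambda>t. moments (law M q p t))"
proof -
  have bm: "brownian_motion M F W"
    using sol unfolding mean_field_solution_def by (elim conjE)
  then have "prob_space M" unfolding brownian_motion_def by (elim conjE)
  with bm have "brownian M F W" by (intro brownian.intro brownian_axioms.intro)
  then interpret mean_field M F W \<gamma> B c T q p
    using assms by (intro mean_field.intro mean_field_axioms.intro)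
  show ?thesis by (rule moments_ode)
qed

lemma equilibrium_pd_states: "pd_mat B \<Longrightarrow> equilibrium B c \<in> pd_states"
  by (simp add: equilibrium_def pd_states_def pd_cov_block_diagonal)

lemma pd_states_diff_equilibrium:
  assumes "pd_mat B" "x \<in> pd_states"
  shows "x - equilibrium B c \<in> sym_states"
proof -
  obtain mq mp Cq Cp Cqp where x: "x = (mq, mp, Cq, Cp, Cqp)" by (metis surj_pair)
  have "sym_mat Cq \<and> sym_mat Cp"
    using assms(2) unfolding sym_cov_block[symmetric, of _ _ Cqp] by (simp add: x pd_states_def pd_sym)
  then show ?thesis using pd_sym[OF assms(1)]
    by (simp add: x equilibrium_def sym_states_def sym_cov_block) (simp add: sym_mat_def transpose_diff)
qed

lemma moment_field_equilibrium_stability: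
  fixes c :: "real^'n"
  assumes \<gamma>: "\<gamma> > 0" and B: "pd_mat B"
  defines "f \<equiv> moment_field \<gamma> B c" and "e \<equiv> equilibrium B c"
  shows "f differentiable (at e)"
    and "eigenvalue_on sym_states (frechet_derivative f (at e)) z \<Longrightarrow> Re z < 0"
    and "e \<in> basin f pd_states e"
    and "openin (top_of_set pd_states) (basin f pd_states e)"
    and "\<lbrakk>x \<in> basin f pd_states e; ode_solution f {0..} \<phi>; \<phi> 0 = x\<rbrakk>
      \<Longrightarrow> \<exists>K. \<forall>t\<ge>0. dist (\<phi> t) e \<le> K * exp (- (\<gamma> / (4 + 4 * \<gamma>\<^sup>2) / 12) * t)"
proof -
  interpret stable_quadratic_ode "lin_field \<gamma>" "quad_field (matrix_inv B)" sym_states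
    "energy (\<gamma> / (4 + 4 * \<gamma>\<^sup>2))" "1/6" "\<gamma> / (4 + 4 * \<gamma>\<^sup>2) / 12"
    by (rule moment_field_stable[OF \<gamma> B])
  have f: "f (e + h) = F h" for h
    unfolding f_def e_def F_def by (rule moment_field_expand[OF B])
  have P: "x - e \<in> sym_states" if "x \<in> pd_states" for x
    unfolding e_def by (rule pd_states_diff_equilibrium[OF B that])
  have D: "(f has_derivative lin_field \<gamma>) (at e)" by (rule linearization[OF f])
  show "f differentiable (at e)" using D by (rule differentiableI)
  show "Re z < 0" if "eigenvalue_on sym_states (frechet_derivative f (at e)) z"
    using that eigenvalue_neg unfolding frechet_derivative_at[OF D, symmetric] by blast
  show "e \<in> basin f pd_states e"
    unfolding e_def by (rule equilibrium_in_basin[OF f P, unfolded e_def]) (auto simp: equilibrium_pd_states B)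
  show "openin (top_of_set pd_states) (basin f pd_states e)"
    by (rule basin_open[OF f P])
  show "\<exists>K. \<forall>t\<ge>0. dist (\<phi> t) e \<le> K * exp (- (\<gamma> / (4 + 4 * \<gamma>\<^sup>2) / 12) * t)"
    if "x \<in> basin f pd_states e" "ode_solution f {0..} \<phi>" "\<phi> 0 = x"
    by (rule basin_rate[OF f P that])
qed

theorem proposition5p1:
  fixes \<gamma> :: real
    and A :: "real^'n^'j" and \<Gamma> :: "real^'j^'j" and \<Gamma>0 :: "real^'n^'n" and y :: "real^'j"
    and B :: "real^'n^'n" and c :: "real^'n"
  assumes "\<gamma> > 0" and "pd_mat \<Gamma>" and "pd_mat \<Gamma>0"
    and "B = post_cov A \<Gamma> \<Gamma>0" and "c = data_vec A \<Gamma> y"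
  shows
    \<comment> \<open>(i)\<close>
    "(\<forall>(M :: 'w measure) F W q p T. mean_field_solution \<gamma> B c T M F W q p \<longrightarrow>
        ode_solution (moment_field \<gamma> B c) {0..T} (\<lambda>t. moments (law M q p t)))
   \<and>
    \<comment> \<open>(ii)\<close>
     ((\<forall>s \<in> pd_states. steady (moment_field \<gamma> B c) s \<longleftrightarrow> s = (B *v c, 0, B, B, 0)) \<and>
      (B *v c, 0, B, B, 0) \<in> pd_states \<and>
      prob_space (gibbs A \<Gamma> \<Gamma>0 y B) \<and>
      gibbs A \<Gamma> \<Gamma>0 y B = gaussian (B *v c) B \<Otimes>\<^sub>M gaussian 0 B \<and>
      moments (gibbs A \<Gamma> \<Gamma>0 y B) = (B *v c, 0, B, B, 0) \<and>
      distr (gibbs A \<Gamma> \<Gamma>0 y B) borel fst = gaussian (B *v c) B \<and>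
      distr (gibbs A \<Gamma> \<Gamma>0 y B) borel fst
        = normalized_density (\<lambda>q. exp (- potential A \<Gamma> \<Gamma>0 y q)) \<and>
      conditional_law (bayes_joint A \<Gamma> \<Gamma>0) (\<lambda>y'. distr (gibbs A \<Gamma> \<Gamma>0 y' B) borel fst))
   \<and>
    \<comment> \<open>(iii)\<close>
     (\<forall>mq mp Cq Cp Cqp.
        (mq, mp, Cq, Cp, Cqp) \<in> psd_states \<and>
        steady (moment_field \<gamma> B c) (mq, mp, Cq, Cp, Cqp) \<and>
        (mq, mp, Cq, Cp, Cqp) \<noteq> equilibrium B c \<longrightarrow>
          (mq, mp, Cq, Cp, Cqp) \<notin> pd_states \<and>
          unstable (moment_field \<gamma> B c) psd_states (mq, mp, Cq, Cp, Cqp) \<and>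
          (\<exists>X m. X ** X = X \<and> sym_mat X \<and> Cq *v m = 0 \<and>
             mq = B *v (c + m) \<and> mp = 0 \<and> Cqp = 0 \<and>
             Cq = msqrt B ** X ** msqrt B \<and> Cp = msqrt B ** X ** msqrt B))
   \<and>
    \<comment> \<open>(iv)\<close>
     (hyperbolic_on sym_states (moment_field \<gamma> B c) (equilibrium B c) \<and>
      linearly_stable_on sym_states (moment_field \<gamma> B c) (equilibrium B c) \<and>
      equilibrium B c \<in> basin (moment_field \<gamma> B c) pd_states (equilibrium B c) \<and>
      openin (top_of_set pd_states) (basin (moment_field \<gamma> B c) pd_states (equilibrium B c)))
   \<and>
    \<comment> \<open>(v)\<close>
     (\<exists>\<omega>>0. \<forall>(A' :: real^'n^'j) \<Gamma>' \<Gamma>0' y' B' c'.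
        pd_mat \<Gamma>' \<and> pd_mat \<Gamma>0' \<and> B' = post_cov A' \<Gamma>' \<Gamma>0' \<and> c' = data_vec A' \<Gamma>' y' \<longrightarrow>
        (\<forall>x \<in> basin (moment_field \<gamma> B' c') pd_states (equilibrium B' c').
           \<forall>\<phi>. ode_solution (moment_field \<gamma> B' c') {0..} \<phi> \<and> \<phi> 0 = x \<longrightarrow>
             (\<exists>K. \<forall>t\<ge>0. dist (\<phi> t) (equilibrium B' c') \<le> K * exp (- \<omega> * t))))"
proof -
  let ?f = "moment_field \<gamma> B c" and ?e = "equilibrium B c"
  have B: "pd_mat B" unfolding assms(4) by (rule post_cov_pd(1)[OF assms(2,3)])
  note stability = moment_field_equilibrium_stability[OF assms(1) B, where c = c]
  note G = gibbs_eq_gaussian[OF assms(2-5)] and P = gaussian_pair_moments[OF B B, of "B *v c" 0]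
  have steady_iff: "steady ?f s \<longleftrightarrow> s = ?e" if "s \<in> pd_states" for s
  proof -
    obtain mq mp Cq Cp Cqp where s: "s = (mq, mp, Cq, Cp, Cqp)" by (metis surj_pair)
    show ?thesis
    proof
      assume "steady ?f s"
      then show "s = ?e" unfolding s by (rule steady_pd_unique[OF assms(1) B that[unfolded s]])
    next
      assume "s = ?e"
      then show "steady ?f s" by (simp only: steady_equilibrium[OF B])
    qed
  qed
  \<comment> \<open>\<open>B\<close> does not depend on the data, so one mass matrix serves all
    observations \<open>y'\<close>.\<close>
  have marginal: "distr (gibbs A \<Gamma> \<Gamma>0 y' B) borel fst = gaussian (B *v data_vec A \<Gamma> y') B" for y'
    unfolding gibbs_eq_gaussian(1)[OF assms(2-4) refl] by (rule gaussian_pair_moments(2)[OF B B])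
  have law: "conditional_law (bayes_joint A \<Gamma> \<Gamma>0) (\<lambda>y'. distr (gibbs A \<Gamma> \<Gamma>0 y' B) borel fst)"
    unfolding marginal by (rule bayes_conditional_law[OF assms(2-4)])
  have ii: "(\<forall>s \<in> pd_states. steady ?f s \<longleftrightarrow> s = (B *v c, 0, B, B, 0)) \<and>
      (B *v c, 0, B, B, 0) \<in> pd_states \<and>
      prob_space (gibbs A \<Gamma> \<Gamma>0 y B) \<and>
      gibbs A \<Gamma> \<Gamma>0 y B = gaussian (B *v c) B \<Otimes>\<^sub>M gaussian 0 B \<and>
      moments (gibbs A \<Gamma> \<Gamma>0 y B) = (B *v c, 0, B, B, 0) \<and>
      distr (gibbs A \<Gamma> \<Gamma>0 y B) borel fst = gaussian (B *v c) B \<and>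
      distr (gibbs A \<Gamma> \<Gamma>0 y B) borel fst
        = normalized_density (\<lambda>q. exp (- potential A \<Gamma> \<Gamma>0 y q)) \<and>
      conditional_law (bayes_joint A \<Gamma> \<Gamma>0) (\<lambda>y'. distr (gibbs A \<Gamma> \<Gamma>0 y' B) borel fst)"
    using steady_iff equilibrium_pd_states[OF B, of c] law P unfolding G equilibrium_def by simp
  have iii: "(mq, mp, Cq, Cp, Cqp) \<notin> pd_states \<and>
          unstable ?f psd_states (mq, mp, Cq, Cp, Cqp) \<and>
          (\<exists>X m. X ** X = X \<and> sym_mat X \<and> Cq *v m = 0 \<and>
             mq = B *v (c + m) \<and> mp = 0 \<and> Cqp = 0 \<and>
             Cq = msqrt B ** X ** msqrt B \<and> Cp = msqrt B ** X ** msqrt B)"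
    if s: "(mq, mp, Cq, Cp, Cqp) \<in> psd_states" and st: "steady ?f (mq, mp, Cq, Cp, Cqp)"
      and ne: "(mq, mp, Cq, Cp, Cqp) \<noteq> ?e" for mq mp Cq Cp Cqp
  proof (intro conjI)
    show "(mq, mp, Cq, Cp, Cqp) \<notin> pd_states" using steady_iff st ne by blast
    show "unstable ?f psd_states (mq, mp, Cq, Cp, Cqp)"
      by (rule steady_unstable[OF assms(1) B s st ne])
    have "psd_mat (cov_block Cq Cp Cqp)" using s by (simp add: psd_states_def)
    from psd_sym[OF this] have "sym_mat Cq" "sym_mat Cp" by (simp_all add: sym_cov_block)
    then show "\<exists>X m. X ** X = X \<and> sym_mat X \<and> Cq *v m = 0 \<and>
             mq = B *v (c + m) \<and> mp = 0 \<and> Cqp = 0 \<and>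
             Cq = msqrt B ** X ** msqrt B \<and> Cp = msqrt B ** X ** msqrt B"
      by (rule steady_projection_form[OF assms(1) B _ _ st])
  qed
  have iv: "hyperbolic_on sym_states ?f ?e" "linearly_stable_on sym_states ?f ?e"
    using stability(1,2) unfolding hyperbolic_on_def linearly_stable_on_def by force+
  have v: "\<exists>\<omega>>0. \<forall>(A' :: real^'n^'j) \<Gamma>' \<Gamma>0' y' B' c'.
        pd_mat \<Gamma>' \<and> pd_mat \<Gamma>0' \<and> B' = post_cov A' \<Gamma>' \<Gamma>0' \<and> c' = data_vec A' \<Gamma>' y' \<longrightarrow>
        (\<forall>x \<in> basin (moment_field \<gamma> B' c') pd_states (equilibrium B' c').
           \<forall>\<phi>. ode_solution (moment_field \<gamma> B' c') {0..} \<phi> \<and> \<phi> 0 = x \<longrightarrow>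
             (\<exists>K. \<forall>t\<ge>0. dist (\<phi> t) (equilibrium B' c') \<le> K * exp (- \<omega> * t)))"
  \<comment> \<open>The rate of \<open>moment_field_stable\<close>, a function of
    \<open>\<gamma>\<close> alone, is chosen before the inverse problem is fixed.\<close>
  proof (rule exI[of _ "\<gamma> / (4 + 4 * \<gamma>\<^sup>2) / 12"], intro conjI allI impI ballI)
    show "0 < \<gamma> / (4 + 4 * \<gamma>\<^sup>2) / 12"
      by (rule divide_pos_pos[OF \<epsilon>_bounds(1)[OF assms(1) refl]]) simp
    fix A' :: "real^'n^'j" and \<Gamma>' \<Gamma>0' y' B' c' x \<phi>
    assume "pd_mat \<Gamma>' \<and> pd_mat \<Gamma>0' \<and> B' = post_cov A' \<Gamma>' \<Gamma>0' \<and> c' = data_vec A' \<Gamma>' y'"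
    then have B': "pd_mat B'" by (simp add: post_cov_pd(1))
    assume x: "x \<in> basin (moment_field \<gamma> B' c') pd_states (equilibrium B' c')"
      and \<phi>: "ode_solution (moment_field \<gamma> B' c') {0..} \<phi> \<and> \<phi> 0 = x"
    show "\<exists>K. \<forall>t\<ge>0. dist (\<phi> t) (equilibrium B' c') \<le> K * exp (- (\<gamma> / (4 + 4 * \<gamma>\<^sup>2) / 12) * t)"
      by (rule moment_field_equilibrium_stability(5)[OF assms(1) B' x conjunct1[OF \<phi>] conjunct2[OF \<phi>]])
  qed
  have i: "\<forall>(M :: 'w measure) F W q p T. mean_field_solution \<gamma> B c T M F W q p \<longrightarrow>
      ode_solution ?f {0..T} (\<lambda>t. moments (law M q p t))"
    by (intro allI impI mean_field_solution_moments[OF assms(1) B])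
  have iii': "\<forall>mq mp Cq Cp Cqp.
        (mq, mp, Cq, Cp, Cqp) \<in> psd_states \<and> steady ?f (mq, mp, Cq, Cp, Cqp) \<and>
        (mq, mp, Cq, Cp, Cqp) \<noteq> ?e \<longrightarrow>
          (mq, mp, Cq, Cp, Cqp) \<notin> pd_states \<and>
          unstable ?f psd_states (mq, mp, Cq, Cp, Cqp) \<and>
          (\<exists>X m. X ** X = X \<and> sym_mat X \<and> Cq *v m = 0 \<and>
             mq = B *v (c + m) \<and> mp = 0 \<and> Cqp = 0 \<and>
             Cq = msqrt B ** X ** msqrt B \<and> Cp = msqrt B ** X ** msqrt B)"
    by (intro allI impI, elim conjE) (rule iii)
  show ?thesis
    by (rule conjI[OF i conjI[OF ii conjI[OF iii' conjI[OF conjI[OF iv(1) conjI[OF iv(2)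
          conjI[OF stability(3,4)]]] v]]]])
qed

end
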